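(* Let $\overline{\rho}\in L^1(\mathbb{R})\cap L^\infty(\mathbb{R})$ be non-negative with compact support and $\|\overline{\rho}\|_{L^1(\mathbb{R})}=1$. Let $v(\rho)=A-\rho^\gamma$, $\rho\in[0,+\infty)$, with $A,\gamma>0$, let $f(\rho)=\rho v(\rho)$, and let $\rho^n$ be the follow-the-leader approximated density with $n+1$ particles associated with $\overline{\rho}$ and $v$. Then $\{\rho^n\}_{n\in\mathbb{N}}$ converges, up to a subsequence, almost everywhere and in $L^1_{loc}$ on $\mathbb{R}\times[0,+\infty)$ to the unique classical entropy solution of the Cauchy problem $$\rho_t+f(\rho)_x=0\ \text{ in }\mathbb{R}\times(0,+\infty),\qquad \rho(x,0)=\overline{\rho}(x),\ x\in\mathbb{R}.$$
   Context: Follow-the-leader scheme. Let $[\overline{x}_{\min},\overline{x}_{\max}]$ be the convex hull of $\mathrm{supp}(\overline{\rho})$, $\ell_n:=1/n$, $v_{\max}:=v(0)=A$. Set $\overline{x}_0:=\overline{x}_{\min}$, $\overline{x}_n:=\overline{x}_{\max}$ and recursively $\overline{x}_i:=\sup\{x\in\mathbb{R}:\int_{\overline{x}_{i-1}}^x\overline{\rho}(y)\,dy<\ell_n\}$ for $i\in\{1,\dots,n-1\}$. The particles $x_0(t),\dots,x_n(t)$ (depending on $n$) solve $$\dot{x}_i(t)=v(R_i(t)),\ i\in\{0,\dots,n-1\},\qquad \dot{x}_n(t)=v_{\max},\qquad x_i(0)=\overline{x}_i,\ i\in\{0,\dots,n\},$$ where $R_i(t):=\frac{\ell_n}{x_{i+1}(t)-x_i(t)}$.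 It is known (discrete maximum principle) that the particles never collide and that the solution exists for all $t\ge0$. The approximated density is $$\rho^n(x,t):=\sum_{i=0}^{n-1}R_i(t)\mathbf{1}_{[x_i(t),x_{i+1}(t))}(x).$$ Classical entropy solution. A function $\rho\in L^\infty([0,+\infty);L^1\cap L^\infty(\mathbb{R}))$ is a classical entropy solution of the Cauchy problem if: (1) $\rho_t+f(\rho)_x=0$ in the sense of distributions on $\mathbb{R}\times(0,+\infty)$; (2) $\rho(\cdot,t)\to\overline{\rho}$ in the weak-star sense of measures as $t\searrow 0$; (3) $f'(\rho)_x\le 1/t$ in the sense of distributions, i.e. $\int_0^{+\infty}\int_{\mathbb{R}} f'(\rho)\varphi_x\,dx\,dt\ge -\int_0^{+\infty}\int_{\mathbb{R}}\frac{1}{t}\varphi\,dx\,dt$ for all non-negative $\varphi\in C_c^\infty(\mathbb{R}\times(0,+\infty))$. *)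

theory Defs
  imports "HOL-Analysis.Analysis"
begin

text \<open>
  Elements of the spaces \<open>L\<^sup>p\<close> are represented by Borel functions (every class has one),
  and none of the notions depends on the choice of the representative.  Points of the \<open>(x,t)\<close> half-plane are pairs, space first.
\<close>

definition ess_support :: "(real \<Rightarrow> real) \<Rightarrow> real set" where
  "ess_support g = {x. \<forall>U. open U \<and> x \<in> U \<longrightarrow> \<not> (AE y in lborel. y \<in> U \<longrightarrow> g y = 0)}"

definition x_min :: "(real \<Rightarrow> real) \<Rightarrow> real" where
  "x_min g = Inf (convex hull (ess_support g))"

definition x_max :: "(real \<Rightarrow> real) \<Rightarrow> real" where
  "x_max g = Sup (convex hull (ess_support g))"

definition velocity :: "real \<Rightarrow> real \<Rightarrow> real \<Rightarrow> real" where
  "velocity A \<gamma> r = A - r powr \<gamma>"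

definition flux :: "(real \<Rightarrow> real) \<Rightarrow> real \<Rightarrow> real" where
  "flux v r = r * v r"

text \<open>The velocity, hence the flux, lives on \<open>[0,\<infinity>)\<close>, so at 0 its derivative is one-sided.\<close>

definition flux_deriv :: "(real \<Rightarrow> real) \<Rightarrow> real \<Rightarrow> real" where
  "flux_deriv v r = vector_derivative (flux v) (at r within {0..})"


subsection \<open>The follow-the-leader scheme\<close>

text \<open>The interval integral is oriented: it is negative for \<open>x\<close> to the left of the base point.\<close>

primrec quantile_pos :: "(real \<Rightarrow> real) \<Rightarrow> nat \<Rightarrow> nat \<Rightarrow> real" where
  "quantile_pos g n 0 = x_min g"
| "quantile_pos g n (Suc i) =
     Sup {x. (LBINT y=ereal (quantile_pos g n i)..ereal x. g y) < 1 / real n}"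

definition init_pos :: "(real \<Rightarrow> real) \<Rightarrow> nat \<Rightarrow> nat \<Rightarrow> real" where
  "init_pos g n i = (if i = n then x_max g else quantile_pos g n i)"

definition discrete_density :: "nat \<Rightarrow> (nat \<Rightarrow> real \<Rightarrow> real) \<Rightarrow> nat \<Rightarrow> real \<Rightarrow> real" where
  "discrete_density n x i t = (1 / real n) / (x (Suc i) t - x i t)"

text \<open>
  The strict ordering of the particles is not part of the definition: it holds initially and is
  preserved by the equations.
\<close>

definition ftl_solution ::
  "(real \<Rightarrow> real) \<Rightarrow> (real \<Rightarrow> real) \<Rightarrow> nat \<Rightarrow> (nat \<Rightarrow> real \<Rightarrow> real) \<Rightarrow> bool" where
  "ftl_solution v g n x \<longleftrightarrow>
     (\<forall>i\<le>n. x i 0 = init_pos g n i) \<and>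
     (\<forall>i<n. \<forall>t\<ge>0. (x i has_real_derivative v (discrete_density n x i t)) (at t within {0..})) \<and>
     (\<forall>t\<ge>0. (x n has_real_derivative v 0) (at t within {0..}))"

definition ftl_density :: "nat \<Rightarrow> (nat \<Rightarrow> real \<Rightarrow> real) \<Rightarrow> real \<times> real \<Rightarrow> real" where
  "ftl_density n x =
     (\<lambda>(y, t). \<Sum>i<n. discrete_density n x i t * indicator {x i t..<x (Suc i) t} y)"


subsection \<open>Test functions\<close>

definition partial_x :: "(real \<times> real \<Rightarrow> real) \<Rightarrow> real \<times> real \<Rightarrow> real" where
  "partial_x \<phi> = (\<lambda>(x, t). deriv (\<lambda>y. \<phi> (y, t)) x)"

definition partial_t :: "(real \<times> real \<Rightarrow> real) \<Rightarrow> real \<times> real \<Rightarrow> real" where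
  "partial_t \<phi> = (\<lambda>(x, t). deriv (\<lambda>s. \<phi> (x, s)) t)"

primrec C_k :: "nat \<Rightarrow> (real \<times> real \<Rightarrow> real) \<Rightarrow> bool" where
  "C_k 0 \<phi> \<longleftrightarrow> continuous_on UNIV \<phi>"
| "C_k (Suc k) \<phi> \<longleftrightarrow>
     continuous_on UNIV \<phi> \<and>
     (\<forall>x t. (\<lambda>y. \<phi> (y, t)) differentiable at x \<and> (\<lambda>s. \<phi> (x, s)) differentiable at t) \<and>
     C_k k (partial_x \<phi>) \<and> C_k k (partial_t \<phi>)"

text \<open>Functions in \<open>C\<^sub>c\<^sup>\<infinity>(\<real> \<times> (0,\<infinity>))\<close>, extended by 0 to the plane.\<close>

definition test_function :: "(real \<times> real \<Rightarrow> real) \<Rightarrow> bool" where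
  "test_function \<phi> \<longleftrightarrow>
     (\<forall>k. C_k k \<phi>) \<and> compact (closure {z. \<phi> z \<noteq> 0}) \<and> closure {z. \<phi> z \<noteq> 0} \<subseteq> UNIV \<times> {0<..}"


subsection \<open>Classical entropy solutions\<close>

definition Linfty_L1_Linfty :: "(real \<times> real \<Rightarrow> real) \<Rightarrow> bool" where
  "Linfty_L1_Linfty \<rho> \<longleftrightarrow>
     set_borel_measurable lborel (UNIV \<times> {0..}) \<rho> \<and>
     (\<exists>C. AE t in lborel. t \<ge> 0 \<longrightarrow>
        integrable lborel (\<lambda>x. \<rho> (x, t)) \<and>
        (LINT x|lborel. \<bar>\<rho> (x, t)\<bar>) \<le> C \<and>
        (AE x in lborel. \<bar>\<rho> (x, t)\<bar> \<le> C))"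

text \<open>
  As \<open>\<rho>(\<cdot>,t)\<close> is only determined for almost every \<open>t\<close>, the initial trace is taken along times
  outside of a null set.
\<close>

definition weak_star_trace :: "(real \<times> real \<Rightarrow> real) \<Rightarrow> (real \<Rightarrow> real) \<Rightarrow> bool" where
  "weak_star_trace \<rho> g \<longleftrightarrow>
     (\<exists>N\<in>null_sets lborel. \<forall>\<psi>. continuous_on UNIV \<psi> \<and> compact (closure {x. \<psi> x \<noteq> 0}) \<longrightarrow>
        ((\<lambda>t. LINT x|lborel. \<psi> x * \<rho> (x, t)) \<longlongrightarrow> (LINT x|lborel. \<psi> x * g x))
          (at 0 within ({0<..} - N)))"

text \<open>
  Non-negativity is required for \<open>v \<circ> \<rho>\<close> to make sense, \<open>v\<close> being a function on \<open>[0,\<infinity>)\<close>.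
\<close>

definition classical_entropy_solution ::
  "(real \<Rightarrow> real) \<Rightarrow> (real \<Rightarrow> real) \<Rightarrow> (real \<times> real \<Rightarrow> real) \<Rightarrow> bool" where
  "classical_entropy_solution v g \<rho> \<longleftrightarrow>
     Linfty_L1_Linfty \<rho> \<and>
     (AE z in lborel. z \<in> UNIV \<times> {0..} \<longrightarrow> \<rho> z \<ge> 0) \<and>
     (\<forall>\<phi>. test_function \<phi> \<longrightarrow>
        (LINT z:UNIV \<times> {0<..}|lborel. \<rho> z * partial_t \<phi> z + flux v (\<rho> z) * partial_x \<phi> z) = 0) \<and>
     weak_star_trace \<rho> g \<and>
     (\<forall>\<phi>. test_function \<phi> \<and> (\<forall>z. \<phi> z \<ge> 0) \<longrightarrow>
        (LINT z:UNIV \<times> {0<..}|lborel. flux_deriv v (\<rho> z) * partial_x \<phi> z)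
          \<ge> - (LINT z:UNIV \<times> {0<..}|lborel. 1 / snd z * \<phi> z))"


subsection \<open>Modes of convergence on the closed half-plane\<close>

definition converges_ae :: "(nat \<Rightarrow> real \<times> real \<Rightarrow> real) \<Rightarrow> (real \<times> real \<Rightarrow> real) \<Rightarrow> bool" where
  "converges_ae u \<rho> \<longleftrightarrow>
     (AE z in lborel. z \<in> UNIV \<times> {0..} \<longrightarrow> (\<lambda>k. u k z) \<longlonglongrightarrow> \<rho> z)"

definition converges_L1_loc :: "(nat \<Rightarrow> real \<times> real \<Rightarrow> real) \<Rightarrow> (real \<times> real \<Rightarrow> real) \<Rightarrow> bool" where
  "converges_L1_loc u \<rho> \<longleftrightarrow>
     (\<forall>K. compact K \<and> K \<subseteq> UNIV \<times> {0..} \<longrightarrow>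
        (\<forall>k. set_integrable lborel K (u k)) \<and> set_integrable lborel K \<rho> \<and>
        (\<lambda>k. LINT z:K|lborel. \<bar>u k z - \<rho> z\<bar>) \<longlonglongrightarrow> 0)"

end

theory Submission
  imports Defs "HOL-Probability.Probability" "HOL-Complex_Analysis.Great_Picard"
begin

text \<open>
  Existence.  Let \<open>z\<^sub>i = R\<^sub>i\<^sup>\<gamma>\<close> and let \<open>d\<^sub>i\<close> be the gap ahead of particle \<open>i\<close>.  The quotients
  \<open>E\<^sub>i = (z\<^sub>i - z\<^sub>i\<^sub>+\<^sub>1)/d\<^sub>i\<close> satisfy \<open>E\<^sub>i' = -(1+\<gamma>) E\<^sub>i\<^sup>2 - \<gamma> (z\<^sub>i\<^sub>+\<^sub>1/d\<^sub>i) (E\<^sub>i - E\<^sub>i\<^sub>+\<^sub>1)\<close>, whence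
  \<open>(1+\<gamma>) t E\<^sub>i \<le> 1\<close>, the discrete Oleinik estimate.  The distribution functions of the discrete densities
  are Lipschitz in space and, up to \<open>1/n\<close>, in time, so a subsequence of them converges everywhere.  By the
  Oleinik estimate the \<open>\<gamma>\<close>-th powers of the densities are monotone up to a linear term and a vanishing error;
  hence at each time \<open>t > 0\<close> convergence of the primitives forces convergence of the densities themselves
  outside a countable set.  The limit inherits the Oleinik estimate, and it is a weak solution because
  \<open>\<Sum>i. \<phi>(x\<^sub>i(t),t)/n\<close> approximates \<open>\<integral> \<phi> \<rho>\<^sup>n dx\<close> with an error \<open>O(1/n)\<close>.

  Uniqueness.  The tail integral \<open>T\<close> of the difference of two solutions solves \<open>T\<^sub>t = H\<close>, where \<open>H\<close> is the
  difference of the fluxes.  Since the flux is concave, \<open>H \<le> - a T\<^sub>x\<close> with the characteristic speed \<open>a\<close> of one of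
  the solutions, and \<open>a\<^sub>x \<le> 1/t\<close>.  As \<open>T = O(t)\<close>, a Gronwall argument for a weighted integral of
  \<open>(T\<^sup>+)\<^sup>2\<close> gives \<open>T \<le> 0\<close>, and \<open>T = 0\<close> by symmetry.
\<close>

subsection \<open>The discrete Oleinik estimate\<close>

text \<open>The \<gamma>-th powers are chosen because they close the discrete estimate. Each
  particle moves with speed \<open>A - z i\<close>, so the gap has derivative
  \<open>z i - z (Suc i)\<close>; thus \<open>E i\<close> is the logarithmic derivative of the gap
  and \<open>- E i\<close> that of the density. This yields a Riccati equation coupled only to the
  particle ahead, hence an induction from the leader backwards. The characteristic speed of the
  limit is affine in the same power. The datum is merely bounded, so the variation of the densities
  is not controlled up to time 0. All regularity stems from the Oleinik estimate at positive times;
  the initial trace comes from the distribution functions, which vary at bounded speed. Vacuum is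
  the other obstacle: a nearly empty cell may be long, and an estimate per cell then says nothing at
  smaller scales. But a cell longer than 1/sqrt n has density below 1/sqrt n, which is the source of
  the vanishing error. In the uniqueness part the rate 1/t is not integrable at 0. It only makes
  \<open>M t / t\<close> nonincreasing up to an exponential factor, so everything rests on this
  quotient tending to 0 with t.\<close>

lemma barrier_le:
  fixes f f' :: "real \<Rightarrow> real"
  assumes deriv: "\<And>t. t \<ge> 0 \<Longrightarrow> (f has_real_derivative f' t) (at t within {0..})"
    and "f 0 \<le> c" "c < c'"
    and decr: "\<And>t. t \<ge> 0 \<Longrightarrow> c < f t \<Longrightarrow> f t < c' \<Longrightarrow> f' t \<le> 0"
    and "t \<ge> 0"
  shows "f t \<le> c"
proof (rule ccontr)
  assume "\<not> f t \<le> c"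
  have cont: "continuous_on {0..} f"
    using deriv by (auto intro!: DERIV_continuous_on)
  \<comment> \<open>The sign of \<open>f'\<close> is known only strictly between c and c', so the
    path is stopped at a level m inside that band. Between the last time \<open>s0\<close> at or
    below c and the first time \<open>t2\<close> at level m the function stays in the band, and the
    mean value theorem contradicts its rise.\<close>
  define m where "m = min (f t) ((c + c') / 2)"
  have m: "c < m" "m < c'" "m \<le> f t"
    using \<open>\<not> f t \<le> c\<close> \<open>c < c'\<close> by (auto simp: m_def min_def)
  define S where "S = {s \<in> {0..t}. m \<le> f s}"
  have contS: "continuous_on {0..u} f" for u
    using cont by (rule continuous_on_subset) auto
  have "compact S"
    unfolding S_def using continuous_closed_preimage[OF contS, of t "{m..}"]
    by (intro compact_eq_bounded_closed[THEN iffD2] conjI)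
       (auto simp: vimage_def Int_def intro: bounded_subset[OF bounded_closed_interval[of 0 t]])
  moreover have "t \<in> S" using m \<open>t \<ge> 0\<close> by (auto simp: S_def)
  ultimately obtain t2 where t2: "t2 \<in> S" "\<And>s. s \<in> S \<Longrightarrow> t2 \<le> s"
    using compact_attains_inf[of S] by blast
  define S2 where "S2 = {s \<in> {0..t2}. f s \<le> c}"
  have "compact S2"
    unfolding S2_def using continuous_closed_preimage[OF contS, of t2 "{..c}"]
    by (intro compact_eq_bounded_closed[THEN iffD2] conjI)
       (auto simp: vimage_def Int_def intro: bounded_subset[OF bounded_closed_interval[of 0 t2]])
  moreover have "0 \<in> S2" using t2 \<open>f 0 \<le> c\<close> by (auto simp: S2_def S_def)
  ultimately obtain s0 where s0: "s0 \<in> S2" "\<And>s. s \<in> S2 \<Longrightarrow> s \<le> s0"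
    using compact_attains_sup[of S2] by blast
  have "s0 \<noteq> t2" using s0 t2 m by (auto simp: S_def S2_def)
  then have less: "0 \<le> s0" "s0 < t2" "t2 \<le> t" using s0 t2 by (auto simp: S2_def S_def)
  have "(f has_derivative (\<lambda>y. f' u * y)) (at u within {s0..t2})" if "s0 \<le> u" "u \<le> t2" for u
    using deriv[of u] less that unfolding has_field_derivative_def
    by (auto intro: has_derivative_subset)
  from mvt_simple[OF less(2) this]
  obtain z where z: "s0 < z" "z < t2" "f t2 - f s0 = f' z * (t2 - s0)"
    by (metis greaterThanLessThan_iff)
  have "\<not> z \<in> S2" using z s0 by force
  moreover have "\<not> z \<in> S" using z t2 by force
  ultimately have "c < f z" "f z < m" using z less by (auto simp: S_def S2_def)
  then have "f' z \<le> 0" using decr[of z] z less m by auto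
  then have "f' z * (t2 - s0) \<le> 0" using less by (intro mult_nonpos_nonneg) auto
  then have "f t2 \<le> f s0" using z by linarith
  then show False using s0 t2 m by (auto simp: S_def S2_def)
qed

text \<open>The datum enters only through \<open>initial_gap\<close>, which bounds the densities at
  time 0 by C. The order of the particles at later times is not assumed; it results from
  \<open>gap_ge\<close>.\<close>

locale ftl_scheme =
  fixes A \<gamma> C :: real and n :: nat and x :: "nat \<Rightarrow> real \<Rightarrow> real"
  assumes \<gamma>_pos: "\<gamma> > 0" and n_pos: "n > 0" and C_pos: "C > 0"
    and ode: "\<And>i t. i < n \<Longrightarrow> t \<ge> 0 \<Longrightarrow>
      (x i has_real_derivative velocity A \<gamma> (discrete_density n x i t)) (at t within {0..})"
    and ode_last: "\<And>t. t \<ge> 0 \<Longrightarrow> (x n has_real_derivative A) (at t within {0..})"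
    and initial_gap: "\<And>i. i < n \<Longrightarrow> 1 / (real n * C) \<le> x (Suc i) 0 - x i 0"
begin

abbreviation R :: "nat \<Rightarrow> real \<Rightarrow> real" where
  "R i t \<equiv> discrete_density n x i t"

definition gap :: "nat \<Rightarrow> real \<Rightarrow> real" where
  "gap i t = x (Suc i) t - x i t"

text \<open>The value 0 from index n on lets the leader obey the law of the others: every particle
  has velocity \<open>A - z i t\<close>.\<close>

definition z :: "nat \<Rightarrow> real \<Rightarrow> real" where
  "z i t = (if i < n then R i t powr \<gamma> else 0)"

lemma z_nonneg: "0 \<le> z i t" by (simp add: z_def)

lemma deriv_gap:
  assumes "i < n" "t \<ge> 0"
  shows "(gap i has_real_derivative z i t - z (Suc i) t) (at t within {0..})"
proof (cases "Suc i < n")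
  case True
  have "((\<lambda>t. x (Suc i) t - x i t) has_real_derivative
     velocity A \<gamma> (R (Suc i) t) - velocity A \<gamma> (R i t)) (at t within {0..})"
    using ode[OF True assms(2)] ode[OF assms] by (rule DERIV_diff)
  then show ?thesis using True assms by (simp add: gap_def[abs_def] z_def velocity_def)
next
  case False
  then have "Suc i = n" using assms by auto
  have "((\<lambda>t. x (Suc i) t - x i t) has_real_derivative
     A - velocity A \<gamma> (R i t)) (at t within {0..})"
    using ode_last[OF assms(2)] ode[OF assms] unfolding \<open>Suc i = n\<close> by (rule DERIV_diff)
  then show ?thesis using False assms by (simp add: gap_def[abs_def] z_def velocity_def)
qed

lemma R_eq: "R i t = 1 / (real n * gap i t)"
  by (simp add: discrete_density_def gap_def)

lemma R_le_of_gap_ge: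
  assumes "1 / (real n * C) \<le> gap i t"
  shows "0 < gap i t" "0 < R i t" "R i t \<le> C"
proof -
  have "0 < 1 / (real n * C)" using n_pos C_pos by simp
  then show g: "0 < gap i t" using assms by linarith
  then show "0 < R i t" using n_pos by (simp add: R_eq)
  show "R i t \<le> C"
    using assms g n_pos C_pos by (simp add: R_eq field_simps)
qed

text \<open>Discrete maximum principle, by induction from the leader backwards. If the particle
  ahead has \<open>z\<close> at most \<open>C powr \<gamma>\<close>, then a gap below the threshold
  means density above C behind, so the rear particle is the slower one and the gap cannot shrink.
  The barrier is applied to the negative gap, with upper level 0: that is the collision, where the
  density formula loses its meaning.\<close>

lemma gap_ge:
  assumes "i < n" "t \<ge> 0"
  shows "1 / (real n * C) \<le> gap i t"
proof -
  let ?b = "1 / (real n * C)"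
  have b: "?b > 0" using n_pos C_pos by simp
  have step: "\<forall>t\<ge>0. ?b \<le> gap i t"
    if "i < n" "\<And>t. t \<ge> 0 \<Longrightarrow> z (Suc i) t \<le> C powr \<gamma>" for i
  proof (intro allI impI)
    fix t :: real assume "t \<ge> 0"
    have "- gap i t \<le> - ?b"
    proof (rule barrier_le[where c' = 0 and f = "\<lambda>t. - gap i t" and f' = "\<lambda>t. - (z i t - z (Suc i) t)" and t = t])
      show "\<And>t. t \<ge> 0 \<Longrightarrow> ((\<lambda>t. - gap i t) has_real_derivative - (z i t - z (Suc i) t)) (at t within {0..})"
        using deriv_gap[OF that(1)] by (rule DERIV_minus)
      show "- gap i 0 \<le> - ?b" using initial_gap[OF that(1)] by (simp add: gap_def)
      fix t :: real assume t: "t \<ge> 0" "- ?b < - gap i t" "- gap i t < 0"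
      have "C < R i t"
        using t n_pos C_pos by (simp add: R_eq field_simps)
      then have "C powr \<gamma> \<le> z i t"
        using that(1) C_pos \<gamma>_pos by (auto simp: z_def intro!: powr_mono2)
      then show "- (z i t - z (Suc i) t) \<le> 0" using that(2)[OF t(1)] by simp
    qed (use b \<open>t \<ge> 0\<close> in auto)
    then show "?b \<le> gap i t" by simp
  qed
  have "\<forall>t\<ge>0. ?b \<le> gap (n - Suc k) t" if "k < n" for k
    using that
  proof (induction k)
    case 0
    then have "z (Suc (n - Suc 0)) t = 0" for t by (simp add: z_def)
    then show ?case using 0 by (intro step) auto
  next
    case (Suc k)
    then have eq: "Suc (n - Suc (Suc k)) = n - Suc k" by simp
    show ?case
    proof (rule step)
      fix t :: real assume "t \<ge> 0"
      then have "0 < R (n - Suc k) t" "R (n - Suc k) t \<le> C"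
        using R_le_of_gap_ge Suc by auto
      then show "z (Suc (n - Suc (Suc k))) t \<le> C powr \<gamma>"
        unfolding eq using \<gamma>_pos by (auto simp: z_def intro!: powr_mono2)
    qed (use Suc in auto)
  qed
  from this[of "n - Suc i"] assms show ?thesis by auto
qed

lemma gap_pos: "i < n \<Longrightarrow> t \<ge> 0 \<Longrightarrow> 0 < gap i t"
  and R_pos: "i < n \<Longrightarrow> t \<ge> 0 \<Longrightarrow> 0 < R i t"
  and R_le: "i < n \<Longrightarrow> t \<ge> 0 \<Longrightarrow> R i t \<le> C"
  using R_le_of_gap_ge gap_ge by auto

text \<open>For i < n this is the logarithmic derivative of the gap, and \<open>- E i\<close> is
  that of the density \<open>R i\<close>.\<close>

definition E :: "nat \<Rightarrow> real \<Rightarrow> real" where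
  "E i t = (z i t - z (Suc i) t) / gap i t"

lemma deriv_z:
  assumes "t \<ge> 0"
  shows "(z i has_real_derivative - \<gamma> * z i t * E i t) (at t within {0..})"
proof (cases "i < n")
  case True
  note g = gap_pos[OF True assms] and r = R_pos[OF True assms]
  have "((\<lambda>t. 1 / (real n * gap i t)) has_real_derivative
      - (real n * (z i t - z (Suc i) t)) / (real n * gap i t)\<^sup>2) (at t within {0..})"
    using deriv_gap[OF True assms] g n_pos
    by (auto intro!: derivative_eq_intros simp: power2_eq_square)
  then have "(R i has_real_derivative
      - (real n * (z i t - z (Suc i) t)) / (real n * gap i t)\<^sup>2) (at t within {0..})"
    by (simp add: R_eq[abs_def])
  moreover have "- (real n * (z i t - z (Suc i) t)) / (real n * gap i t)\<^sup>2 = - R i t * E i t"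
    using g n_pos by (simp add: R_eq E_def field_simps power2_eq_square)
  ultimately have "(R i has_real_derivative - R i t * E i t) (at t within {0..})" by simp
  then have "((\<lambda>t. R i t powr \<gamma>) has_real_derivative
      \<gamma> * R i t powr (\<gamma> - 1) * (- R i t * E i t)) (at t within {0..})"
    by (rule DERIV_chain2[where f = "\<lambda>u. u powr \<gamma>" and g = "R i" and x = t, OF has_real_derivative_powr[OF r]])
  moreover have "\<gamma> * R i t powr (\<gamma> - 1) * (- R i t * E i t) = - \<gamma> * z i t * E i t"
    using r True by (simp add: powr_diff z_def)
  moreover have "(\<lambda>t. R i t powr \<gamma>) = z i"
    using True by (simp add: z_def[abs_def])
  ultimately show ?thesis by metis
qed (simp add: z_def[abs_def])

lemma deriv_E:
  assumes "i < n" "t \<ge> 0"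
  shows "(E i has_real_derivative
    - (1 + \<gamma>) * (E i t)\<^sup>2 - \<gamma> * (z (Suc i) t / gap i t) * (E i t - E (Suc i) t)) (at t within {0..})"
proof -
  note g = gap_pos[OF assms]
  have "((\<lambda>t. (z i t - z (Suc i) t) / gap i t) has_real_derivative
     ((- \<gamma> * z i t * E i t - - \<gamma> * z (Suc i) t * E (Suc i) t) * gap i t
       - (z i t - z (Suc i) t) * (z i t - z (Suc i) t)) / (gap i t * gap i t)) (at t within {0..})"
    using g deriv_z[OF assms(2)] deriv_gap[OF assms] by (intro DERIV_divide DERIV_diff) auto
  \<comment> \<open>Eliminating \<open>z i\<close> in favour of \<open>E i\<close> turns the
    quotient rule into a Riccati term plus a relaxation towards \<open>E (Suc i)\<close>.\<close>
  moreover have "z i t = E i t * gap i t + z (Suc i) t" using g by (simp add: E_def)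
  then have "((- \<gamma> * z i t * E i t - - \<gamma> * z (Suc i) t * E (Suc i) t) * gap i t
       - (z i t - z (Suc i) t) * (z i t - z (Suc i) t)) / (gap i t * gap i t) =
    - (1 + \<gamma>) * (E i t)\<^sup>2 - \<gamma> * (z (Suc i) t / gap i t) * (E i t - E (Suc i) t)"
    using g by (simp add: field_simps power2_eq_square)
  ultimately show ?thesis by (simp add: E_def[abs_def])
qed

text \<open>The constant \<open>1/(1+\<gamma>)\<close> is sharp: it turns into the constant 1 in the Oleinik condition of the limit.\<close>

lemma discrete_Oleinik:
  assumes "t \<ge> 0"
  shows "(1 + \<gamma>) * t * (z i t - z (Suc i) t) \<le> gap i t \<or> n \<le> i"
proof (cases "i < n")
  case True
  \<comment> \<open>Induction from the leader, where \<open>E n\<close> vanishes. The upper barrier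
    level 2 is arbitrary: the derivative is nonpositive wherever the quantity exceeds 1.\<close>
  have "\<forall>t\<ge>0. (1 + \<gamma>) * t * E (n - k) t \<le> 1" if "k \<le> n" for k
    using that
  proof (induction k)
    case 0
    then show ?case by (simp add: E_def z_def)
  next
    case (Suc k)
    let ?i = "n - Suc k"
    have i: "?i < n" "Suc ?i = n - k" using Suc by auto
    show ?case
    proof (intro allI impI)
      fix t :: real assume "t \<ge> 0"
      show "(1 + \<gamma>) * t * E ?i t \<le> 1"
      proof (rule barrier_le[where c' = 2 and t = t and f = "\<lambda>t. (1 + \<gamma>) * t * E ?i t"
            and f' = "\<lambda>t. (1 + \<gamma>) * E ?i t + (1 + \<gamma>) * t * (- (1 + \<gamma>) * (E ?i t)\<^sup>2
              - \<gamma> * (z (Suc ?i) t / gap ?i t) * (E ?i t - E (Suc ?i) t))"])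
        show "((\<lambda>t. (1 + \<gamma>) * t * E ?i t) has_real_derivative
            (1 + \<gamma>) * E ?i t + (1 + \<gamma>) * t * (- (1 + \<gamma>) * (E ?i t)\<^sup>2
              - \<gamma> * (z (Suc ?i) t / gap ?i t) * (E ?i t - E (Suc ?i) t))) (at t within {0..})"
          if "t \<ge> 0" for t
          using deriv_E[OF i(1) that] by (auto intro!: derivative_eq_intros)
        fix t :: real assume t: "t \<ge> 0" "1 < (1 + \<gamma>) * t * E ?i t"
        have ih: "(1 + \<gamma>) * t * E (Suc ?i) t \<le> 1" using Suc t i by auto
        have pos: "t > 0" using t by (cases "t = 0") auto
        have Epos: "E ?i t > 0"
          using t pos \<gamma>_pos by (smt (verit) mult_nonneg_nonpos mult_nonneg_nonneg)
        \<comment> \<open>The derivative splits into two parts: the growth of the factor t against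
          the Riccati damping, and the relaxation term, whose sign is known because the bound
          already holds for the particle ahead.\<close>
        have 1: "(1 + \<gamma>) * E ?i t * (1 - (1 + \<gamma>) * t * E ?i t) \<le> 0"
          using Epos \<gamma>_pos t by (intro mult_nonneg_nonpos) auto
        have 2: "0 \<le> \<gamma> * (z (Suc ?i) t / gap ?i t) * ((1 + \<gamma>) * t * E ?i t - (1 + \<gamma>) * t * E (Suc ?i) t)"
          using \<gamma>_pos z_nonneg[of "Suc ?i" t] gap_pos[OF i(1) t(1)] t ih
          by (intro mult_nonneg_nonneg divide_nonneg_pos) linarith+
        show "(1 + \<gamma>) * E ?i t + (1 + \<gamma>) * t * (- (1 + \<gamma>) * (E ?i t)\<^sup>2
              - \<gamma> * (z (Suc ?i) t / gap ?i t) * (E ?i t - E (Suc ?i) t)) \<le> 0"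
        proof -
          define q e e' where "q = z (Suc ?i) t / gap ?i t" and "e = E ?i t" and "e' = E (Suc ?i) t"
          show ?thesis using 1 2 unfolding q_def[symmetric] e_def[symmetric] e'_def[symmetric]
            by (simp add: algebra_simps power2_eq_square)
        qed
      qed (use \<open>t \<ge> 0\<close> in auto)
    qed
  qed
  from this[of "n - i"] True assms have "(1 + \<gamma>) * t * E i t \<le> 1" by auto
  then show ?thesis using gap_pos[OF True assms] by (simp add: E_def field_simps)
qed simp

end

subsection \<open>Smooth approximations of trapezoids\<close>

text \<open>The counterpart of \<open>C_k\<close> in one variable; smoothness of a product test
  function is reduced to that of its two factors.\<close>

primrec Ck :: "nat \<Rightarrow> (real \<Rightarrow> real) \<Rightarrow> bool" where
  "Ck 0 g \<longleftrightarrow> continuous_on UNIV g"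
| "Ck (Suc k) g \<longleftrightarrow> continuous_on UNIV g \<and> (\<forall>x. g differentiable at x) \<and> Ck k (deriv g)"

lemma Ck_continuous: "Ck k g \<Longrightarrow> continuous_on UNIV g"
  by (cases k) auto

lemma Ck_SucI:
  assumes "\<And>x. (g has_real_derivative g' x) (at x)" "Ck k g'"
  shows "Ck (Suc k) g"
proof -
  have "deriv g = g'" using assms(1) by (auto intro: DERIV_imp_deriv)
  then show ?thesis
    using assms by (auto simp: real_differentiable_def intro!: DERIV_continuous_on[where D = g'])
qed

lemma Ck_SucD:
  assumes "Ck (Suc k) g"
  shows "(g has_real_derivative deriv g x) (at x)" "Ck k (deriv g)"
  using assms by (auto simp: DERIV_deriv_iff_real_differentiable)

lemma Ck_Suc_imp: "Ck (Suc k) g \<Longrightarrow> Ck k g"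
  by (induction k arbitrary: g) auto

lemma Ck_const: "Ck k (\<lambda>x. c)"
proof (induction k arbitrary: c)
  case (Suc k)
  show ?case by (rule Ck_SucI[OF _ Suc[of 0]]) auto
qed auto

lemma Ck_id: "Ck k (\<lambda>x. x)"
proof (cases k)
  case (Suc k)
  show ?thesis unfolding Suc by (rule Ck_SucI[OF _ Ck_const[of _ 1]]) auto
qed auto

lemma Ck_add: "Ck k f \<Longrightarrow> Ck k g \<Longrightarrow> Ck k (\<lambda>x. f x + g x)"
proof (induction k arbitrary: f g)
  case (Suc k)
  show ?case
    using Suc.IH[OF Ck_SucD(2)[OF Suc.prems(1)] Ck_SucD(2)[OF Suc.prems(2)]]
    by (rule Ck_SucI[rotated]) (intro DERIV_add Ck_SucD[OF Suc.prems(1)] Ck_SucD[OF Suc.prems(2)])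
qed (auto intro: continuous_intros)

lemma Ck_mult: "Ck k f \<Longrightarrow> Ck k g \<Longrightarrow> Ck k (\<lambda>x. f x * g x)"
proof (induction k arbitrary: f g)
  case (Suc k)
  show ?case
    by (rule Ck_SucI[OF DERIV_mult[OF Ck_SucD(1)[OF Suc.prems(1)] Ck_SucD(1)[OF Suc.prems(2)]]
        Ck_add[OF Suc.IH Suc.IH]])
       (use Suc.prems in \<open>auto intro: Ck_SucD(2) Ck_Suc_imp simp del: Ck.simps\<close>)
qed (auto intro: continuous_intros)

lemma Ck_diff:
  assumes "Ck k f" "Ck k g" shows "Ck k (\<lambda>x. f x - g x)"
  using Ck_add[OF assms(1) Ck_mult[OF Ck_const[of k "-1"] assms(2)]] by simp

lemma Ck_affine: "Ck k f \<Longrightarrow> Ck k (\<lambda>x. f (a * x + b))"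
proof (induction k arbitrary: f)
  case 0
  then show ?case by (auto intro!: continuous_on_compose2[of UNIV f] continuous_intros)
next
  case (Suc k)
  have "((\<lambda>x. f (a * x + b)) has_real_derivative deriv f (a * x + b) * a) (at x)" for x
    by (rule DERIV_chain2[OF Ck_SucD(1)[OF Suc.prems]]) (auto intro!: derivative_eq_intros)
  moreover have "Ck k (\<lambda>x. deriv f (a * x + b) * a)"
    by (intro Ck_mult Ck_const Suc.IH Ck_SucD(2) Suc.prems)
  ultimately show ?case by (rule Ck_SucI)
qed

section \<open>Products g(x) h(t) as test functions\<close>

lemma continuous_tensor:
  fixes g h :: "real \<Rightarrow> real"
  assumes "continuous_on UNIV g" "continuous_on UNIV h"
  shows "continuous_on UNIV (\<lambda>(x, t). g x * h t)"
  unfolding split_beta'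
  by (intro continuous_on_mult continuous_on_compose2[OF assms(1) continuous_on_fst]
      continuous_on_compose2[OF assms(2) continuous_on_snd] continuous_on_id) auto

lemma C_k_tensor: "Ck k g \<Longrightarrow> Ck k h \<Longrightarrow> C_k k (\<lambda>(x, t). g x * h t)"
proof (induction k arbitrary: g h)
  case 0
  then show ?case
    by (simp add: continuous_tensor)
next
  case (Suc k)
  note dg = Ck_SucD(1)[OF Suc.prems(1)] and dh = Ck_SucD(1)[OF Suc.prems(2)]
  have gx: "((\<lambda>y. g y * h t) has_real_derivative deriv g x * h t) (at x)" for x t
    by (auto intro!: derivative_eq_intros dg)
  have ht: "((\<lambda>s. g x * h s) has_real_derivative g x * deriv h t) (at t)" for x t
    by (auto intro!: derivative_eq_intros dh)
  have "partial_x (\<lambda>(x, t). g x * h t) = (\<lambda>(x, t). deriv g x * h t)"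
    "partial_t (\<lambda>(x, t). g x * h t) = (\<lambda>(x, t). g x * deriv h t)"
    using gx ht by (auto simp: partial_x_def partial_t_def fun_eq_iff intro!: DERIV_imp_deriv)
  moreover have "continuous_on UNIV (\<lambda>(x, t). g x * h t)"
    by (intro continuous_tensor Ck_continuous[OF Suc.prems(1)] Ck_continuous[OF Suc.prems(2)])
  moreover have "C_k k (\<lambda>(x, t). deriv g x * h t)" "C_k k (\<lambda>(x, t). g x * deriv h t)"
    by (intro Suc.IH Ck_SucD(2)[OF Suc.prems(1)] Ck_SucD(2)[OF Suc.prems(2)]
        Ck_Suc_imp[OF Suc.prems(1)] Ck_Suc_imp[OF Suc.prems(2)])+
  moreover have "(\<lambda>y. g y * h t) differentiable at x" "(\<lambda>s. g x * h s) differentiable at t" for x t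
    using gx ht unfolding real_differentiable_def by blast+
  ultimately show ?case by simp
qed

lemma partial_tensor:
  assumes "\<And>x. (g has_real_derivative g' x) (at x)" "\<And>x. (h has_real_derivative h' x) (at x)"
  shows "partial_x (\<lambda>(x, t). g x * h t) = (\<lambda>(x, t). g' x * h t)"
    "partial_t (\<lambda>(x, t). g x * h t) = (\<lambda>(x, t). g x * h' t)"
proof -
  have "((\<lambda>y. g y * h t) has_real_derivative g' x * h t) (at x)"
    "((\<lambda>s. g x * h s) has_real_derivative g x * h' t) (at t)" for x t
    using DERIV_cmult_right[OF assms(1)] DERIV_cmult[OF assms(2)] by auto
  from DERIV_imp_deriv[OF this(1)] DERIV_imp_deriv[OF this(2)]
  show "partial_x (\<lambda>(x, t). g x * h t) = (\<lambda>(x, t). g' x * h t)"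
    "partial_t (\<lambda>(x, t). g x * h t) = (\<lambda>(x, t). g x * h' t)"
    by (auto simp: partial_x_def partial_t_def fun_eq_iff)
qed

lemma test_function_tensor:
  assumes g: "\<And>k. Ck k g" "\<And>x. x \<notin> {a..b} \<Longrightarrow> g x = 0"
    and h: "\<And>k. Ck k h" "\<And>t. t \<notin> {c..d} \<Longrightarrow> h t = 0" and "0 < c"
  shows "test_function (\<lambda>(x, t). g x * h t)"
proof -
  have "{z. (case z of (x, t) \<Rightarrow> g x * h t) \<noteq> 0} \<subseteq> cbox (a, c) (b, d)"
    using g(2) h(2) by (auto simp: mem_box cbox_Pair_eq) (meson atLeastAtMost_iff)+
  then have sub: "closure {z. (case z of (x, t) \<Rightarrow> g x * h t) \<noteq> 0} \<subseteq> cbox (a, c) (b, d)"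
    by (intro closure_minimal closed_cbox)
  moreover have "cbox (a, c) (b, d) \<subseteq> UNIV \<times> {0<..}"
    using \<open>0 < c\<close> by (auto simp: cbox_Pair_eq)
  moreover have "compact (closure {z. (case z of (x, t) \<Rightarrow> g x * h t) \<noteq> 0})"
    using sub by (auto simp: compact_eq_bounded_closed intro: bounded_subset[OF bounded_cbox])
  ultimately show ?thesis
    unfolding test_function_def using C_k_tensor g h by auto
qed

section \<open>The flat function exp(-1/x) and bumps made from it\<close>

definition expinv :: "real poly \<Rightarrow> real \<Rightarrow> real" where
  "expinv p x = (if x > 0 then poly p (1 / x) * exp (- (1 / x)) else 0)"

lemma poly_exp_tendsto_0: "((\<lambda>y. poly p y * exp (- y)) \<longlongrightarrow> (0::real)) at_top"
proof -
  have "((\<lambda>y. \<Sum>i\<le>degree p. coeff p i * (y ^ i / exp y)) \<longlongrightarrow> (\<Sum>i\<le>degree p. coeff p i * 0)) at_top"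
    by (intro tendsto_intros tendsto_power_div_exp_0)
  then show ?thesis
    by (simp add: poly_altdef sum_distrib_right exp_minus divide_inverse mult.assoc)
qed

lemma expinv_tendsto_0: "(expinv p \<longlongrightarrow> 0) (at 0)"
proof -
  have "((\<lambda>x. poly p (1 / x) * exp (- (1 / x))) \<longlongrightarrow> 0) (at_right (0::real))"
    using filterlim_compose[OF poly_exp_tendsto_0[of p] filterlim_inverse_at_top_right]
    by (simp add: inverse_eq_divide)
  then have "(expinv p \<longlongrightarrow> 0) (at_right 0)"
    by (rule Lim_transform_eventually)
       (auto simp: expinv_def eventually_at_filter)
  moreover have "(expinv p \<longlongrightarrow> 0) (at_left 0)"
    by (rule Lim_transform_eventually[OF tendsto_const])
       (auto simp: expinv_def eventually_at_filter)
  ultimately show ?thesis by (simp add: filterlim_split_at)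
qed

text \<open>The functions p(1/x) exp(-1/x), continued by 0, form a family closed under
  differentiation: with y = 1/x the derivative has the polynomial y^2 (p - p'). Carrying p along is
  what makes the induction on the order of smoothness work.\<close>

lemma deriv_expinv:
  "(expinv p has_real_derivative expinv ([:0, 0, 1:] * (p - pderiv p)) x) (at x)"
proof -
  consider "x > 0" | "x < 0" | "x = 0" by linarith
  then show ?thesis
  proof cases
    case 1
    have "((\<lambda>x. poly p (1 / x) * exp (- (1 / x))) has_real_derivative
        poly (pderiv p) (1 / x) * (- 1 / x\<^sup>2) * exp (- (1 / x))
          + exp (- (1 / x)) * (1 / x\<^sup>2) * poly p (1 / x)) (at x)"
      using 1 by (auto intro!: derivative_eq_intros DERIV_chain2[OF poly_DERIV] simp: power2_eq_square)
    moreover have "poly (pderiv p) (1 / x) * (- 1 / x\<^sup>2) * exp (- (1 / x))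
          + exp (- (1 / x)) * (1 / x\<^sup>2) * poly p (1 / x)
        = expinv ([:0, 0, 1:] * (p - pderiv p)) x"
      using 1 by (simp add: expinv_def field_simps power2_eq_square)
    ultimately have "((\<lambda>x. poly p (1 / x) * exp (- (1 / x))) has_real_derivative
      expinv ([:0, 0, 1:] * (p - pderiv p)) x) (at x)" by simp
    moreover have "eventually (\<lambda>x::real. x > 0) (nhds x)" using 1 by (intro eventually_nhds_in_open[of "{0<..}", simplified]) auto
    then have "eventually (\<lambda>x. poly p (1 / x) * exp (- (1 / x)) = expinv p x) (nhds x)"
      by eventually_elim (simp add: expinv_def)
    ultimately show ?thesis by (subst (asm) DERIV_cong_ev) auto
  next
    case 2
    have "eventually (\<lambda>x::real. x < 0) (nhds x)" using 2 by (intro eventually_nhds_in_open[of "{..<0}", simplified]) auto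
    then have "eventually (\<lambda>x. 0 = expinv p x) (nhds x)"
      by eventually_elim (simp add: expinv_def)
    moreover have "((\<lambda>x. 0) has_real_derivative expinv ([:0, 0, 1:] * (p - pderiv p)) x) (at x)"
      using 2 by (simp add: expinv_def)
    ultimately show ?thesis by (subst (asm) DERIV_cong_ev) auto
  next
    case 3
    \<comment> \<open>The difference quotient at 0 is again in the family, with the polynomial
      multiplied by its variable, so \<open>expinv_tendsto_0\<close> applies to it.\<close>
    have "((\<lambda>h. (expinv p h - expinv p 0) / (h - 0)) \<longlongrightarrow> 0) (at 0)"
      by (rule Lim_transform_eventually[OF expinv_tendsto_0[of "[:0, 1:] * p"]])
         (auto simp: expinv_def eventually_at_filter)
    then show ?thesis using 3 by (simp add: has_field_derivative_iff expinv_def)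
  qed
qed

lemma Ck_expinv: "Ck k (expinv p)"
proof (induction k arbitrary: p)
  case 0
  then show ?case by (auto intro!: DERIV_continuous_on[OF DERIV_subset[OF deriv_expinv]])
next
  case (Suc k)
  show ?case by (rule Ck_SucI[OF deriv_expinv Suc])
qed

text \<open>The rescaling drives the exponential to 1 at each positive point while the function
  stays 0 on the nonpositive half-line. The approximating test functions therefore keep their
  supports inside that of the limit.\<close>

definition smooth_step :: "nat \<Rightarrow> real \<Rightarrow> real" where
  "smooth_step m x = expinv 1 (real (Suc m) * x)"

lemma smooth_step_eq: "smooth_step m x = (if x > 0 then exp (- (1 / (real (Suc m) * x))) else 0)"
  by (simp add: smooth_step_def expinv_def zero_less_mult_iff)

lemma smooth_step_bounds: "0 \<le> smooth_step m x" "smooth_step m x \<le> 1"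
  by (auto simp: smooth_step_eq)

lemma smooth_step_tendsto: "(\<lambda>m. smooth_step m x) \<longlonglongrightarrow> indicator {0<..} x"
proof (cases "x > 0")
  case True
  have "(\<lambda>m. exp (- ((1 / x) * (1 / real (Suc m))))) \<longlonglongrightarrow> exp (- ((1 / x) * 0))"
    by (intro tendsto_intros LIMSEQ_Suc[OF lim_1_over_n])
  then show ?thesis using True by (simp add: smooth_step_eq mult.commute)
qed (simp add: smooth_step_eq)

definition bump :: "nat \<Rightarrow> real \<Rightarrow> real \<Rightarrow> real \<Rightarrow> real" where
  "bump m a b x = smooth_step m (x - a) * smooth_step m (b - x)"

lemma Ck_bump: "Ck k (bump m a b)"
proof -
  have "Ck k (smooth_step m)" using Ck_affine[OF Ck_expinv[of k 1], of "real (Suc m)" 0]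
    by (simp add: smooth_step_def[abs_def])
  from Ck_mult[OF Ck_affine[OF this, of 1 "- a"] Ck_affine[OF this, of "- 1" b]]
  show ?thesis by (simp add: bump_def[abs_def])
qed

lemma continuous_bump: "continuous_on UNIV (bump m a b)"
  by (rule Ck_continuous[OF Ck_bump[of 0]])

lemma bump_bounds: "0 \<le> bump m a b x" "bump m a b x \<le> 1"
  using smooth_step_bounds by (auto simp: bump_def intro: mult_le_one)

lemma bump_eq_0: "x \<notin> {a<..<b} \<Longrightarrow> bump m a b x = 0"
  by (auto simp: bump_def smooth_step_eq)

lemma bump_translate: "bump m 0 d (x - a) = bump m a (a + d) x"
  by (simp add: bump_def algebra_simps)

lemma bump_tendsto: "(\<lambda>m. bump m a b x) \<longlonglongrightarrow> indicator {a<..<b} x"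
proof -
  have "(\<lambda>m. bump m a b x) \<longlonglongrightarrow> indicator {0<..} (x - a) * indicator {0<..} (b - x)"
    unfolding bump_def by (intro tendsto_mult smooth_step_tendsto)
  also have "indicator {0<..} (x - a) * indicator {0<..} (b - x) = (indicator {a<..<b} x :: real)"
    by (auto simp: indicator_def)
  finally show ?thesis .
qed

text \<open>For negative x the interval is empty and the value is 0, which is the correct primitive
  there because the bump vanishes on that side. Since the bump approximates the indicator of (0,d),
  its primitive approximates \<open>ramp d\<close>.\<close>

definition smooth_ramp :: "nat \<Rightarrow> real \<Rightarrow> real \<Rightarrow> real" where
  "smooth_ramp m d x = (LINT y:{0..x}|lborel. bump m 0 d y)"

lemma deriv_smooth_ramp: "(smooth_ramp m d has_real_derivative bump m 0 d x) (at x)"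
proof -
  have "isCont (bump m 0 d) y" for y
    using continuous_bump by (simp add: continuous_on_eq_continuous_at)
  then obtain G where G: "\<And>y. (G has_real_derivative bump m 0 d y) (at y)"
    using einterval_antiderivative[of "-\<infinity>" "\<infinity>" "bump m 0 d"]
    by (auto simp: has_real_derivative_iff_has_vector_derivative)
  have "smooth_ramp m d y = G y - G 0" for y
  proof (cases "0 \<le> y")
    case True
    then show ?thesis
      using integral_FTC_Icc_real[OF True, of G "bump m 0 d"] G \<open>\<And>y. isCont (bump m 0 d) y\<close>
      by (simp add: smooth_ramp_def set_lebesgue_integral_def mult.commute)
  next
    case False
    have "\<exists>z>y. z < 0 \<and> G 0 - G y = (0 - y) * bump m 0 d z"
      using False by (intro MVT2 G) auto
    then show ?thesis using False by (auto simp: smooth_ramp_def set_lebesgue_integral_def bump_eq_0)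
  qed
  then have "smooth_ramp m d = (\<lambda>y. G y - G 0)" by auto
  then show ?thesis using G by (auto intro!: derivative_eq_intros)
qed

definition ramp :: "real \<Rightarrow> real \<Rightarrow> real" where
  "ramp d x = max 0 (min x d)"

lemma smooth_ramp_tendsto:
  assumes "d > 0" shows "(\<lambda>m. smooth_ramp m d x) \<longlonglongrightarrow> ramp d x"
proof -
  have "(\<lambda>m. LINT y|lborel. indicator {0..x} y *\<^sub>R bump m 0 d y)
      \<longlonglongrightarrow> (LINT y|lborel. indicator {0..x} y *\<^sub>R indicator {0<..<d} y)"
  proof (rule integral_dominated_convergence[where w = "indicator {0..x}"])
    show "AE y in lborel. (\<lambda>m. indicator {0..x} y *\<^sub>R bump m 0 d y) \<longlonglongrightarrow> indicator {0..x} y *\<^sub>R indicator {0<..<d} y"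
      by (intro AE_I2 tendsto_intros bump_tendsto)
    show "(\<lambda>y. indicator {0..x} y *\<^sub>R bump m 0 d y) \<in> borel_measurable lborel" for m
      using borel_measurable_continuous_onI[OF continuous_bump] by measurable
    have "emeasure lborel {0..x} < \<infinity>" by (cases "0 \<le> x") auto
    then show "integrable lborel (indicator {0..x} :: real \<Rightarrow> real)"
      by (simp add: integrable_indicator_iff)
  qed (auto simp: indicator_def bump_bounds)
  moreover have "(LINT y|lborel. indicator {0..x} y *\<^sub>R indicator {0<..<d} y) = ramp d x"
  proof -
    have "(LINT y|lborel. indicator {0..x} y *\<^sub>R indicator {0<..<d} y :: real)
      = (LINT y|lborel. indicator ({0..x} \<inter> {0<..<d}) y)"
      by (intro Bochner_Integration.integral_cong) (auto simp: indicator_def)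
    also have "\<dots> = measure lborel ({0..x} \<inter> {0<..<d})" by simp
    also have "\<dots> = ramp d x"
    proof (cases "0 < x")
      case True
      show ?thesis
      proof (cases "x < d")
        case True
        then have "{0..x} \<inter> {0<..<d} = {0<..x}" by auto
        then show ?thesis using True \<open>0 < x\<close> by (simp add: ramp_def)
      next
        case False
        then have "{0..x} \<inter> {0<..<d} = {0<..<d}" by auto
        then show ?thesis using False \<open>0 < x\<close> \<open>d > 0\<close> by (simp add: ramp_def)
      qed
    next
      case False
      then have "{0..x} \<inter> {0<..<d} = {}" by auto
      then show ?thesis using False by (simp add: ramp_def)
    qed
    finally show ?thesis .
  qed
  ultimately show ?thesis by (simp add: smooth_ramp_def set_lebesgue_integral_def)
qed

lemma smooth_ramp_mono: "x \<le> y \<Longrightarrow> smooth_ramp m d x \<le> smooth_ramp m d y"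
  by (erule DERIV_nonneg_imp_nondecreasing) (rule exI, rule conjI, rule deriv_smooth_ramp, rule bump_bounds)

lemma smooth_ramp_neg: "x \<le> 0 \<Longrightarrow> smooth_ramp m d x = 0"
proof -
  assume "x \<le> 0"
  then have "(\<lambda>y. indicator {0..x} y *\<^sub>R bump m 0 d y) = (\<lambda>y. 0)"
    by (auto simp: fun_eq_iff indicator_def bump_eq_0)
  then show ?thesis by (simp add: smooth_ramp_def set_lebesgue_integral_def)
qed

lemma smooth_ramp_const:
  assumes "d \<le> x" shows "smooth_ramp m d x = smooth_ramp m d d"
proof (cases "d < x")
  case True
  have "\<exists>z>d. z < x \<and> smooth_ramp m d x - smooth_ramp m d d = (x - d) * bump m 0 d z"
    using True by (intro MVT2 deriv_smooth_ramp) auto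
  then show ?thesis by (auto simp: bump_eq_0)
qed (use assms in auto)

lemma smooth_ramp_le:
  assumes "d \<ge> 0" shows "smooth_ramp m d x \<le> d"
proof -
  have *: "smooth_ramp m d y \<le> y" if "0 \<le> y" for y
  proof (cases "0 < y")
    case True
    have "\<exists>z>0. z < y \<and> smooth_ramp m d y - smooth_ramp m d 0 = (y - 0) * bump m 0 d z"
      using True by (intro MVT2 deriv_smooth_ramp) auto
    then show ?thesis using bump_bounds True mult_left_le[of "bump m 0 d _" y] by (auto simp: smooth_ramp_neg)
  qed (use that in \<open>auto simp: smooth_ramp_neg\<close>)
  show ?thesis
  proof (cases "d \<le> x")
    case True
    then show ?thesis using *[OF assms] smooth_ramp_const[OF True, of m] by simp
  next
    case False
    then show ?thesis using smooth_ramp_mono[of x d m d] *[of d] assms by auto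
  qed
qed

lemma smooth_ramp_nonneg: "0 \<le> smooth_ramp m d x"
  using smooth_ramp_mono[of 0 x m d] by (cases "x \<le> 0") (auto simp: smooth_ramp_neg)

definition smooth_trap :: "nat \<Rightarrow> real \<Rightarrow> real \<Rightarrow> real \<Rightarrow> real \<Rightarrow> real" where
  "smooth_trap m d a c x = smooth_ramp m d (x - a) - smooth_ramp m d (x - c)"

definition smooth_trap' :: "nat \<Rightarrow> real \<Rightarrow> real \<Rightarrow> real \<Rightarrow> real \<Rightarrow> real" where
  "smooth_trap' m d a c x = bump m a (a + d) x - bump m c (c + d) x"

text \<open>Slopes 1 and -1 over intervals of length d. Divided by d it tends to the indicator of an
  interval as d tends to 0; for c = a + d it is a tent, whose derivative produces second differences
  of a primitive. These two uses are why trapezoids are the test functions of the whole uniqueness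
  proof.\<close>

definition trap :: "real \<Rightarrow> real \<Rightarrow> real \<Rightarrow> real \<Rightarrow> real" where
  "trap d a c x = ramp d (x - a) - ramp d (x - c)"

definition trap' :: "real \<Rightarrow> real \<Rightarrow> real \<Rightarrow> real \<Rightarrow> real" where
  "trap' d a c x = indicator {a<..<a + d} x - indicator {c<..<c + d} x"

lemma deriv_smooth_trap: "(smooth_trap m d a c has_real_derivative smooth_trap' m d a c x) (at x)"
proof -
  have "((\<lambda>x. smooth_ramp m d (x - b)) has_real_derivative bump m b (b + d) x) (at x)" for b
    using DERIV_chain2[where f = "smooth_ramp m d" and g = "\<lambda>x. x - b" and x = x and Db = 1 and s = UNIV,
        OF deriv_smooth_ramp]
    by (simp add: bump_translate DERIV_diff[where E = 0, simplified])
  then show ?thesis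
    unfolding smooth_trap_def[abs_def] smooth_trap'_def by (intro DERIV_diff)
qed

lemma Ck_smooth_trap': "Ck k (smooth_trap' m d a c)"
  unfolding smooth_trap'_def[abs_def] by (intro Ck_diff Ck_bump)

lemma Ck_smooth_trap: "Ck k (smooth_trap m d a c)"
  by (rule Ck_Suc_imp[OF Ck_SucI[OF deriv_smooth_trap Ck_smooth_trap']])

lemma smooth_trap_eq_0: 
  assumes "a \<le> c" "0 \<le> d" "x \<notin> {a..c + d}" shows "smooth_trap m d a c x = 0"
proof (cases "x < a")
  case False
  then have "d \<le> x - a" "d \<le> x - c" using assms by auto
  then show ?thesis unfolding smooth_trap_def
    using smooth_ramp_const[of d "x - a" m] smooth_ramp_const[of d "x - c" m] by linarith
qed (use assms in \<open>auto simp: smooth_trap_def smooth_ramp_neg\<close>)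

lemma trap_eq_0: 
  assumes "a \<le> c" "0 \<le> d" "x \<notin> {a..c + d}" shows "trap d a c x = 0"
  using assms by (auto simp: trap_def ramp_def)

lemma smooth_trap'_eq_0: 
  assumes "a \<le> c" "0 \<le> d" "x \<notin> {a..c + d}" shows "smooth_trap' m d a c x = 0"
  using assms by (auto simp: smooth_trap'_def bump_eq_0)

lemma smooth_trap_bounds:
  assumes "a \<le> c" "0 \<le> d" shows "0 \<le> smooth_trap m d a c x" "smooth_trap m d a c x \<le> d"
  using smooth_ramp_mono[of "x - c" "x - a" m d] smooth_ramp_le[of d m "x - a"]
    smooth_ramp_nonneg[of m d "x - c"] assms by (auto simp: smooth_trap_def)

lemma trap_bounds:
  assumes "a \<le> c" "0 \<le> d" shows "0 \<le> trap d a c x" "trap d a c x \<le> d"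
  using assms by (auto simp: trap_def ramp_def)

lemma smooth_trap'_bound: "\<bar>smooth_trap' m d a c x\<bar> \<le> 1"
  using bump_bounds[of m a "a + d" x] bump_bounds[of m c "c + d" x]
  by (auto simp: smooth_trap'_def)

lemma smooth_trap_tendsto: "d > 0 \<Longrightarrow> (\<lambda>m. smooth_trap m d a c x) \<longlonglongrightarrow> trap d a c x"
  unfolding smooth_trap_def trap_def by (intro tendsto_diff smooth_ramp_tendsto)

lemma smooth_trap'_tendsto: "(\<lambda>m. smooth_trap' m d a c x) \<longlonglongrightarrow> trap' d a c x"
  unfolding smooth_trap'_def trap'_def by (intro tendsto_diff bump_tendsto)

subsection \<open>Primitives of locally integrable functions\<close>

definition locally_integrable :: "(real \<Rightarrow> real) \<Rightarrow> bool" where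
  "locally_integrable f \<longleftrightarrow> (\<forall>a b. set_integrable lborel {a..b} f)"

lemma locally_integrable_bounded:
  fixes f :: "real \<Rightarrow> real"
  assumes "f \<in> borel_measurable borel" "\<And>y. \<bar>f y\<bar> \<le> B"
  shows "locally_integrable f"
  unfolding locally_integrable_def set_integrable_def
proof (intro allI)
  show "integrable lborel (\<lambda>x. indicator {a..b} x *\<^sub>R f x)" for a b :: real
    using assms by (intro integrableI_bounded_set_indicator[where B = B]) (auto simp: emeasure_lborel_Icc_eq)
qed

lemma locally_integrable_subset:
  assumes "locally_integrable f" "S \<in> sets borel" "S \<subseteq> {a..b}"
  shows "set_integrable lborel S f"
  by (rule set_integrable_subset[of _ "{a..b}"])
     (use assms in \<open>auto simp: locally_integrable_def\<close>)

lemma interval_integrable_locally: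
  fixes a b :: real
  assumes "locally_integrable f"
  shows "interval_lebesgue_integrable lborel a b f"
  unfolding interval_lebesgue_integrable_def
  using locally_integrable_subset[OF assms, of "{a<..<b}" a b]
    locally_integrable_subset[OF assms, of "{b<..<a}" b a] by (auto simp: subset_eq)

definition prim :: "(real \<Rightarrow> real) \<Rightarrow> real \<Rightarrow> real" where
  "prim f x = (LBINT y=ereal 0..ereal x. f y)"

lemma prim_0 [simp]: "prim f 0 = 0"
  unfolding prim_def by (rule interval_integral_endpoints_same)

lemma prim_diff:
  assumes "locally_integrable f"
  shows "prim f b - prim f a = (LBINT y=ereal a..ereal b. f y)"
proof -
  have "interval_lebesgue_integrable lborel (min (ereal 0) (min (ereal a) (ereal b))) (max (ereal 0) (max (ereal a) (ereal b))) f"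
    using interval_integrable_locally[OF assms, of "min 0 (min a b)" "max 0 (max a b)"]
    by (simp only: ereal_min ereal_max)
  from interval_integral_sum[OF this] show ?thesis by (simp add: prim_def)
qed

lemma prim_diff_set:
  assumes "locally_integrable f" "a \<le> b"
  shows "prim f b - prim f a = (LINT y:{a<..<b}|lborel. f y)"
  using interval_integral_Ioo[of "ereal a" "ereal b" f] assms
  by (simp add: prim_diff)

lemma prim_diff_Icc:
  assumes "locally_integrable f" "a \<le> b"
  shows "prim f b - prim f a = (LINT y:{a..b}|lborel. f y)"
  using interval_integral_Icc[of a b f] assms by (simp add: prim_diff)

lemma prim_lipschitz:
  assumes "f \<in> borel_measurable borel" "\<And>y. \<bar>f y\<bar> \<le> B"
  shows "\<bar>prim f b - prim f a\<bar> \<le> B * \<bar>b - a\<bar>"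
proof -
  have li: "locally_integrable f" using assms by (rule locally_integrable_bounded)
  have *: "\<bar>prim f b - prim f a\<bar> \<le> B * (b - a)" if "a \<le> b" for a b
  proof -
    have "norm (LINT y:{a..b}|lborel. f y) \<le> (LINT y:{a..b}|lborel. norm (f y))"
      using li by (intro set_integral_norm_bound) (auto simp: locally_integrable_def)
    also have "\<dots> \<le> (LINT y:{a..b}|lborel. B)"
      using li assms that
      by (intro set_integral_mono set_integrable_norm) (auto simp: locally_integrable_def set_integrable_def)
    also have "\<dots> = B * (b - a)" using that by (simp add: set_lebesgue_integral_def)
    finally show ?thesis using that by (simp add: prim_diff_Icc[OF li])
  qed
  show ?thesis using *[of a b] *[of b a] by (cases "a \<le> b") (auto simp: abs_minus_commute)
qed

text \<open>Lebesgue differentiation. \<open>integrable_ccontinuous_explicit\<close> states it for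
  cubes having x as their lower corner, which in one dimension are exactly the right difference
  quotients of the primitive.\<close>

lemma tendsto_prim_right:
  assumes "locally_integrable f"
  shows "AE x in lborel. ((\<lambda>d. (prim f (x + d) - prim f x) / d) \<longlongrightarrow> f x) (at_right 0)"
proof -
  have int: "f integrable_on cbox a b" for a b
    using set_borel_integral_eq_integral(1)[of "{a..b}" f] assms by (auto simp: locally_integrable_def)
  obtain N where N: "negligible N" and
    lim: "\<And>x e. x \<notin> N \<Longrightarrow> 0 < e \<Longrightarrow> \<exists>d>0. \<forall>h. 0 < h \<and> h < d \<longrightarrow>
        norm (integral (cbox x (x + h *\<^sub>R One)) f /\<^sub>R h ^ DIM(real) - f x) < e"
    using integrable_ccontinuous_explicit[OF int] by blast
  have eq: "integral (cbox x (x + h *\<^sub>R One)) f /\<^sub>R h ^ DIM(real) = (prim f (x + h) - prim f x) / h" if "h > 0" for x h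
    using that set_borel_integral_eq_integral(2)[of "{x..x+h}" f] assms
    by (simp add: prim_diff_Icc divide_inverse_commute locally_integrable_def)
  have "((\<lambda>d. (prim f (x + d) - prim f x) / d) \<longlongrightarrow> f x) (at_right 0)" if "x \<notin> N" for x
    unfolding tendsto_iff
  proof (intro allI impI)
    fix e :: real assume "e > 0"
    from lim[OF that this] obtain d where "d > 0" "\<forall>h. 0 < h \<and> h < d \<longrightarrow>
        norm (integral (cbox x (x + h *\<^sub>R One)) f /\<^sub>R h ^ DIM(real) - f x) < e" by blast
    then show "\<forall>\<^sub>F h in at_right 0. dist ((prim f (x + h) - prim f x) / h) (f x) < e"
      unfolding eventually_at_right_field dist_real_def
      by (intro exI[of _ d]) (use eq[of _ x] in \<open>auto simp del: inverse_eq_divide\<close>)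
  qed
  moreover have "AE x in lborel. x \<notin> N"
    using AE_not_in[of N lebesgue] N by (simp add: negligible_iff_null_sets AE_completion_iff)
  ultimately show ?thesis by (auto elim: eventually_mono)
qed

text \<open>The widths \<open>1 / real (Suc k)\<close> make the quotients a sequence, as dominated
  convergence requires.\<close>

lemma tendsto_prim_seq:
  assumes "locally_integrable f"
  shows "AE x in lborel. (\<lambda>k. real (Suc k) * (prim f (x + 1 / real (Suc k)) - prim f x)) \<longlonglongrightarrow> f x"
proof -
  have "filterlim (\<lambda>k. 1 / real (Suc k)) (at_right 0) sequentially"
    unfolding filterlim_at using LIMSEQ_Suc[OF lim_1_over_n] by auto
  from tendsto_prim_right[OF assms] show ?thesis
    by eventually_elim
       (drule filterlim_compose[OF _ \<open>filterlim (\<lambda>k. 1 / real (Suc k)) (at_right 0) sequentially\<close>],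
        simp add: mult.commute)
qed

text \<open>The primitive is Lipschitz, so its values at rational points determine it. Rational
  points are what remains available when each point carries its own exceptional null set of
  times.\<close>

lemma AE_eq_0_of_prim_const:
  assumes "f \<in> borel_measurable borel" "\<And>y. \<bar>f y\<bar> \<le> B" "\<And>x. x \<in> \<rat> \<Longrightarrow> prim f x = c"
  shows "AE x in lborel. f x = 0"
proof -
  have "prim f x = c" for x
  proof -
    have "B-lipschitz_on UNIV (prim f)"
      using prim_lipschitz[OF assms(1,2)] assms(2)[of 0]
      by (auto simp: lipschitz_on_def dist_real_def abs_minus_commute)
    then have cont: "continuous_on UNIV (prim f)" by (rule lipschitz_on_continuous_on)
    have "closed {x. prim f x = c}"
      using closed_Collect_eq[OF cont continuous_on_const] .
    moreover have "\<rat> \<subseteq> {x. prim f x = c}" using assms(3) by auto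
    ultimately have "closure \<rat> \<subseteq> {x. prim f x = c}" by (rule closure_minimal[rotated])
    then show ?thesis by (auto simp: Rats_closure_real)
  qed
  then show ?thesis
    using tendsto_prim_seq[OF locally_integrable_bounded[OF assms(1,2)]]
    by (auto simp: LIMSEQ_const_iff)
qed

lemma AE_nonneg_of_integrals:
  assumes "locally_integrable p"
    and "\<And>s t. 0 < s \<Longrightarrow> s < t \<Longrightarrow> 0 \<le> (LINT y:{s<..<t}|lborel. p y)"
  shows "AE t in lborel. 0 < t \<longrightarrow> 0 \<le> p t"
  using tendsto_prim_seq[OF assms(1)]
proof eventually_elim
  case (elim t)
  show ?case
  proof
    assume "0 < t"
    show "0 \<le> p t"
    proof (rule LIMSEQ_le_const[OF elim], intro exI allI impI)
      fix k :: nat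
      show "0 \<le> real (Suc k) * (prim p (t + 1 / real (Suc k)) - prim p t)"
        using assms(2)[OF \<open>0 < t\<close>, of "t + 1 / real (Suc k)"]
        by (simp add: prim_diff_set[OF assms(1)])
    qed
  qed
qed

section \<open>Testing with trapezoids in one variable\<close>

lemma borel_measurable_trap [measurable]: "trap d a c \<in> borel_measurable borel"
  unfolding trap_def ramp_def by measurable

lemma borel_measurable_trap' [measurable]: "trap' d a c \<in> borel_measurable borel"
  unfolding trap'_def by measurable

lemma trap_div_tendsto:
  assumes "s \<le> s'"
  shows "(\<lambda>k. real (Suc k) * trap (1 / real (Suc k)) s s' t) \<longlonglongrightarrow> indicator {s<..s'} t"
proof -
  have *: "(\<lambda>k. real (Suc k) * ramp (1 / real (Suc k)) y) \<longlonglongrightarrow> indicator {0<..} y" for y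
  proof (cases "y > 0")
    case True
    have "eventually (\<lambda>k. 1 / real (Suc k) < y) sequentially"
      using order_tendstoD(2)[OF LIMSEQ_Suc[OF lim_1_over_n] True] by simp
    then have "eventually (\<lambda>k. 1 = real (Suc k) * ramp (1 / real (Suc k)) y) sequentially"
      by eventually_elim (auto simp: ramp_def)
    then show ?thesis using True by (intro Lim_transform_eventually[OF tendsto_const]) auto
  qed (auto simp: ramp_def)
  have "(\<lambda>k. real (Suc k) * trap (1 / real (Suc k)) s s' t) \<longlonglongrightarrow>
      indicator {0<..} (t - s) - indicator {0<..} (t - s')"
    unfolding trap_def right_diff_distrib by (intro tendsto_diff *)
  also have "indicator {0<..} (t - s) - indicator {0<..} (t - s') = (indicator {s<..s'} t :: real)"
    using assms by (auto simp: indicator_def)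
  finally show ?thesis .
qed

lemma integral_trap':
  assumes "locally_integrable p" "0 \<le> d"
  shows "(LINT t|lborel. p t * trap' d s s' t)
    = (prim p (s + d) - prim p s) - (prim p (s' + d) - prim p s')"
proof -
  have i: "integrable lborel (\<lambda>t. indicator {r<..<r + d} t *\<^sub>R p t)" for r
    using locally_integrable_subset[OF assms(1), of "{r<..<r + d}" r "r + d"]
    by (auto simp: set_integrable_def subset_eq)
  have "(LINT t|lborel. p t * trap' d s s' t)
    = (LINT t|lborel. indicator {s<..<s + d} t *\<^sub>R p t - indicator {s'<..<s' + d} t *\<^sub>R p t)"
    by (simp add: trap'_def algebra_simps)
  also have "\<dots> = (LINT t:{s<..<s + d}|lborel. p t) - (LINT t:{s'<..<s' + d}|lborel. p t)"
    using i by (simp add: set_lebesgue_integral_def)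
  finally show ?thesis using assms by (simp add: prim_diff_set)
qed

text \<open>A distributional identity \<open>p' = q\<close> on \<open>(0,\<infinity>)\<close>, tested with trapezoids only.\<close>

lemma AE_primitive_of_trapezoids:
  assumes p: "p \<in> borel_measurable borel" "\<And>t. \<bar>p t\<bar> \<le> B"
    and q: "q \<in> borel_measurable borel" "\<And>t. \<bar>q t\<bar> \<le> B"
    and eq: "\<And>d s s'. 0 < d \<Longrightarrow> 0 < s \<Longrightarrow> s < s' \<Longrightarrow>
      (LINT t|lborel. p t * trap' d s s' t) + (LINT t|lborel. q t * trap d s s' t) = 0"
  shows "\<exists>N\<in>null_sets lborel. \<forall>s s'. 0 < s \<and> s < s' \<and> s \<notin> N \<and> s' \<notin> N \<longrightarrow>
    p s' - p s = prim q s' - prim q s"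
proof -
  note lp = locally_integrable_bounded[OF p] and lq = locally_integrable_bounded[OF q]
  obtain N where N: "N \<in> null_sets lborel" and lim:
    "\<And>s. s \<notin> N \<Longrightarrow> (\<lambda>k. real (Suc k) * (prim p (s + 1 / real (Suc k)) - prim p s)) \<longlonglongrightarrow> p s"
    using tendsto_prim_seq[OF lp] unfolding eventually_ae_filter by auto
  show ?thesis
  proof (intro bexI[OF _ N] allI impI, elim conjE)
    fix s s' assume s: "0 < s" "s < s'" "s \<notin> N" "s' \<notin> N"
    \<comment> \<open>As the width shrinks, the rescaled \<open>trap'\<close> produces difference
      quotients of \<open>prim p\<close> at s and s', which converge off N, while the rescaled
      \<open>trap\<close> tends to the indicator of the interval between them.\<close>
    let ?d = "\<lambda>k. 1 / real (Suc k)"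
    have "(\<lambda>k. real (Suc k) * (LINT t|lborel. p t * trap' (?d k) s s' t)) \<longlonglongrightarrow> p s - p s'"
      using tendsto_diff[OF lim[OF s(3)] lim[OF s(4)]]
      by (simp add: integral_trap'[OF lp] right_diff_distrib del: of_nat_Suc)
    moreover have "(\<lambda>k. LINT t|lborel. q t * (real (Suc k) * trap (?d k) s s' t))
        \<longlonglongrightarrow> (LINT t|lborel. q t * indicator {s<..s'} t)"
    proof (rule integral_dominated_convergence[where w = "\<lambda>t. B * indicator {s..s' + 1} t"])
      show "AE t in lborel. (\<lambda>k. q t * (real (Suc k) * trap (?d k) s s' t)) \<longlonglongrightarrow> q t * indicator {s<..s'} t"
        using s by (intro AE_I2 tendsto_mult tendsto_const trap_div_tendsto) auto
      fix k
      show "AE t in lborel. norm (q t * (real (Suc k) * trap (?d k) s s' t)) \<le> B * indicator {s..s' + 1} t"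
      proof (rule AE_I2)
        fix t
        show "norm (q t * (real (Suc k) * trap (?d k) s s' t)) \<le> B * indicator {s..s' + 1} t"
        proof (cases "t \<in> {s..s' + 1}")
          case True
          have "\<bar>real (Suc k) * trap (?d k) s s' t\<bar> \<le> 1"
            using trap_bounds[of s s' "?d k" t] s by (auto simp: abs_mult field_simps)
          then have "\<bar>q t\<bar> * \<bar>real (Suc k) * trap (?d k) s s' t\<bar> \<le> B * 1"
            using q(2)[of t] by (intro mult_mono) auto
          then show ?thesis using True by (simp add: abs_mult)
        next
          case False
          have "?d k \<le> 1" by simp
          then have "t \<notin> {s..s' + ?d k}" using False unfolding atLeastAtMost_iff by linarith
          then have "trap (?d k) s s' t = 0" using s by (intro trap_eq_0) auto
          then show ?thesis using False by simp
        qed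
      qed
    qed (use q s in \<open>auto simp: emeasure_lborel_Icc_eq\<close>)
    moreover have "(LINT t|lborel. q t * (real (Suc k) * trap (?d k) s s' t)) =
      - (real (Suc k) * (LINT t|lborel. p t * trap' (?d k) s s' t))" for k
    proof -
      have "(LINT t|lborel. q t * (real (Suc k) * trap (?d k) s s' t)) =
         real (Suc k) * (LINT t|lborel. q t * trap (?d k) s s' t)"
        by (subst Bochner_Integration.integral_mult_right_zero[symmetric]) (simp add: mult.left_commute)
      moreover have "(LINT t|lborel. p t * trap' (?d k) s s' t) + (LINT t|lborel. q t * trap (?d k) s s' t) = 0"
        using s by (intro eq) auto
      ultimately show ?thesis by (simp add: eq_neg_iff_add_eq_0 distrib_left[symmetric] add.commute del: of_nat_Suc)
    qed
    ultimately have "(\<lambda>k. real (Suc k) * (LINT t|lborel. p t * trap' (?d k) s s' t)) \<longlonglongrightarrow>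
       - (LINT t|lborel. q t * indicator {s<..s'} t)"
      by (simp add: tendsto_minus_cancel_left del: of_nat_Suc)
    with \<open>_ \<longlonglongrightarrow> p s - p s'\<close> have "p s - p s' = - (LINT t|lborel. q t * indicator {s<..s'} t)"
      using LIMSEQ_unique by blast
    moreover have "prim q s' - prim q s = (LINT t|lborel. q t * indicator {s<..s'} t)"
      using interval_integral_Ioc[of "s" s' q] s prim_diff[OF lq, of s' s]
      by (simp add: set_lebesgue_integral_def mult.commute)
    ultimately show "p s' - p s = prim q s' - prim q s" by simp
  qed
qed

lemma not_null_open_interval:
  assumes "N \<in> null_sets lborel" "a < b"
  obtains m :: real where "a < m" "m < b" "m \<notin> N"
proof -
  have "\<not> {a<..<b} \<subseteq> N"
  proof
    assume "{a<..<b} \<subseteq> N"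
    then have "{a<..<b} \<in> null_sets lborel" using assms(1) by (rule null_sets_subset[rotated 2]) auto
    then show False using \<open>a < b\<close> by (auto simp: null_sets_def)
  qed
  then obtain m where "m \<in> {a<..<b}" "m \<notin> N" by blast
  then show ?thesis by (intro that[of m]) auto
qed

text \<open>Splitting an interval near its middle gains a factor \<open>5/9\<close> in a quadratic bound on the increment.\<close>

lemma le_of_quadratic_increments:
  fixes M :: "real \<Rightarrow> real"
  assumes N: "N \<in> null_sets lborel" and "C \<ge> 0"
    and incr: "\<And>s t. a \<le> s \<Longrightarrow> s < t \<Longrightarrow> t \<le> b \<Longrightarrow> s \<notin> N \<Longrightarrow> t \<notin> N \<Longrightarrow> M t - M s \<le> C * (t - s)\<^sup>2"
    and ab: "a < b" "a \<notin> N" "b \<notin> N"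
  shows "M b \<le> M a"
proof -
  have *: "\<forall>s t. a \<le> s \<and> s < t \<and> t \<le> b \<and> s \<notin> N \<and> t \<notin> N \<longrightarrow> M t - M s \<le> C * (5/9) ^ k * (t - s)\<^sup>2" for k
  proof (induction k)
    case 0
    then show ?case using incr by auto
  next
    case (Suc k)
    show ?case
    proof (intro allI impI)
      fix s t assume st: "a \<le> s \<and> s < t \<and> t \<le> b \<and> s \<notin> N \<and> t \<notin> N"
      \<comment> \<open>The exact midpoint may be exceptional, so only some point of the middle
        third is available. The worst case is a cut at one third: 1/9 + 4/9 = 5/9.\<close>
      obtain m where m: "s + (t - s) / 3 < m" "m < t - (t - s) / 3" "m \<notin> N"
        using not_null_open_interval[OF N, of "s + (t - s) / 3" "t - (t - s) / 3"] st by (auto simp: field_simps)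
      have "M t - M s \<le> C * (5/9) ^ k * (m - s)\<^sup>2 + C * (5/9) ^ k * (t - m)\<^sup>2"
        using Suc.IH[rule_format, of s m] Suc.IH[rule_format, of m t] m st by (auto simp: field_simps)
      also have "\<dots> = C * (5/9) ^ k * ((m - s)\<^sup>2 + (t - m)\<^sup>2)" by (simp add: algebra_simps)
      also have "\<dots> \<le> C * (5/9) ^ k * (5/9 * (t - s)\<^sup>2)"
      proof (intro mult_left_mono)
        have "0 \<le> (m - s - (t - s) / 3) * (t - m - (t - s) / 3)" using m by (intro mult_nonneg_nonneg) linarith+
        then show "(m - s)\<^sup>2 + (t - m)\<^sup>2 \<le> 5/9 * (t - s)\<^sup>2"
          by (simp add: power2_eq_square field_simps)
      qed (use \<open>C \<ge> 0\<close> in auto)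
      finally show "M t - M s \<le> C * (5/9) ^ Suc k * (t - s)\<^sup>2" by (simp add: mult.assoc)
    qed
  qed
  have "(\<lambda>k. C * (5/9) ^ k * (b - a)\<^sup>2) \<longlonglongrightarrow> C * 0 * (b - a)\<^sup>2"
    by (intro tendsto_intros LIMSEQ_realpow_zero) auto
  then have "M b - M a \<le> C * 0 * (b - a)\<^sup>2"
    by (rule LIMSEQ_le_const) (use *[rule_format, of a b] ab in auto)
  then show ?thesis by simp
qed

subsection \<open>Comparison for transport inequalities with a one-sided Lipschitz coefficient\<close>

text \<open>Tail integrals are bounded, but their integrability over the line is not known, hence an
  integrable weight. Its derivative is dominated by the weight itself
  (\<open>weight'_bound\<close>), so it costs only a Gronwall term.\<close>

definition weight :: "real \<Rightarrow> real" where
  "weight x = inverse (1 + x\<^sup>2)"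

lemma one_plus_square_pos: "0 < 1 + (x::real)\<^sup>2"
  by (simp add: add_pos_nonneg)

lemma weight_pos: "0 < weight x"
  using one_plus_square_pos by (simp add: weight_def)

lemma borel_measurable_weight [measurable]: "weight \<in> borel_measurable borel"
  unfolding weight_def by measurable

lemma integrable_weight: "integrable lborel weight"
  using integrable_inverse_1_plus_square by (simp add: set_integrable_def weight_def[abs_def])

lemma integrable_weight_mult:
  assumes "f \<in> borel_measurable borel" "\<And>x. \<bar>f x\<bar> \<le> W"
  shows "integrable lborel (\<lambda>x. weight x * f x)"
proof (rule Bochner_Integration.integrable_bound)
  show "integrable lborel (\<lambda>x. W * weight x)" using integrable_weight by simp
  show "(\<lambda>x. weight x * f x) \<in> borel_measurable lborel" using assms by measurable
  show "AE x in lborel. norm (weight x * f x) \<le> norm (W * weight x)"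
  proof (rule AE_I2)
    fix x
    have "weight x * \<bar>f x\<bar> \<le> weight x * \<bar>W\<bar>"
      using assms(2)[of x] weight_pos[of x] by (intro mult_left_mono) auto
    then show "norm (weight x * f x) \<le> norm (W * weight x)"
      using weight_pos[of x] by (simp add: abs_mult mult.commute)
  qed
qed

lemma weight_shift:
  assumes "\<bar>x - y\<bar> \<le> 1"
  shows "weight y \<le> 3 * weight x"
proof -
  \<comment> \<open>The unequal split 2 x y \<le> x^2/2 + 2 y^2 lets half of x^2 be absorbed, so
    that x^2 \<le> 2 + 2 y^2.\<close>
  have "0 \<le> (x - 2 * y)\<^sup>2" by simp
  then have "4 * (x * y) \<le> x * x + 4 * (y * y)" by (simp add: power2_eq_square algebra_simps)
  moreover have "\<bar>x - y\<bar>\<^sup>2 \<le> 1\<^sup>2" using assms by (intro power_mono) auto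
  then have "(x - y)\<^sup>2 \<le> 1" by simp
  then have "x * x + y * y \<le> 1 + 2 * (x * y)" by (simp add: power2_eq_square algebra_simps)
  moreover have "0 \<le> y * y" by simp
  moreover have "1 + q \<le> 3 * (1 + r)" if "4 * p \<le> q + 4 * r" "q + r \<le> 1 + 2 * p" "0 \<le> r" for p q r :: real
    using that by (simp add: algebra_simps)
  ultimately have "1 + x * x \<le> 3 * (1 + y * y)" by blast
  then have "1 + x\<^sup>2 \<le> 3 * (1 + y\<^sup>2)" by (simp add: power2_eq_square)
  then show ?thesis
    using one_plus_square_pos[of x] one_plus_square_pos[of y] by (simp add: weight_def field_simps)
qed

lemma abs_mult_weight_le: "2 * \<bar>x\<bar> * weight x \<le> 1"
proof -
  have "0 \<le> (\<bar>x\<bar> - 1)\<^sup>2" by simp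
  then have "2 * \<bar>x\<bar> \<le> 1 + x\<^sup>2" by (simp add: power2_eq_square algebra_simps flip: abs_mult)
  then show ?thesis using one_plus_square_pos[of x] by (simp add: weight_def field_simps)
qed

lemma weight_lipschitz:
  assumes "\<bar>x - y\<bar> \<le> 1"
  shows "\<bar>weight y - weight x\<bar> \<le> 2 * weight x * \<bar>y - x\<bar>"
proof -
  have eq: "weight y - weight x = (x - y) * (x + y) * (weight x * weight y)"
    using one_plus_square_pos[of x] one_plus_square_pos[of y]
    by (simp add: weight_def field_simps power2_eq_square)
  have "\<bar>x + y\<bar> * (weight x * weight y) \<le> (\<bar>x\<bar> + \<bar>y\<bar>) * (weight x * weight y)"
    using weight_pos[of x] weight_pos[of y] by (intro mult_right_mono) auto
  also have "\<dots> = (\<bar>x\<bar> * weight x) * weight y + (\<bar>y\<bar> * weight y) * weight x"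
    by (simp add: algebra_simps)
  also have "\<dots> \<le> (1/2) * weight y + (1/2) * weight x"
    using abs_mult_weight_le[of x] abs_mult_weight_le[of y] weight_pos[of x] weight_pos[of y]
    by (intro add_mono mult_right_mono) auto
  also have "\<dots> \<le> 2 * weight x" using weight_shift[OF assms] by simp
  finally have "\<bar>x + y\<bar> * (weight x * weight y) * \<bar>y - x\<bar> \<le> 2 * weight x * \<bar>y - x\<bar>"
    by (rule mult_right_mono) auto
  then show ?thesis
    unfolding eq using weight_pos[of x] weight_pos[of y]
    by (simp add: abs_mult abs_minus_commute mult_ac)
qed

definition weight' :: "real \<Rightarrow> real" where
  "weight' x = - (2 * x) * (weight x)\<^sup>2"

lemma deriv_weight: "(weight has_real_derivative weight' x) (at x)"
proof -
  have "((\<lambda>x. inverse (1 + x\<^sup>2)) has_real_derivative - (inverse (1 + x\<^sup>2) * (2 * x) * inverse (1 + x\<^sup>2))) (at x)"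
    using one_plus_square_pos[of x] by (auto intro!: derivative_eq_intros)
  then show ?thesis by (simp add: weight_def[abs_def] weight'_def power2_eq_square mult_ac)
qed

lemma borel_measurable_weight' [measurable]: "weight' \<in> borel_measurable borel"
  unfolding weight'_def by measurable

lemma weight'_bound: "\<bar>weight' x\<bar> \<le> weight x"
proof -
  have "\<bar>weight' x\<bar> = (2 * \<bar>x\<bar> * weight x) * weight x"
    using weight_pos[of x] by (simp add: weight'_def abs_mult power2_eq_square)
  also have "\<dots> \<le> 1 * weight x" using abs_mult_weight_le weight_pos[of x] by (intro mult_right_mono) auto
  finally show ?thesis by simp
qed

definition pos_sq :: "real \<Rightarrow> real" where
  "pos_sq u = (max 0 u)\<^sup>2 / 2"

lemma pos_sq_nonneg: "0 \<le> pos_sq u" by (simp add: pos_sq_def)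

text \<open>Convexity, \<open>max 0 v\<close> being the derivative at v. With the arguments
  exchanged it becomes a lower bound, and the two together squeeze difference quotients of the
  square along a Lipschitz function: a chain rule at almost every point.\<close>

lemma pos_sq_diff_le: "pos_sq v - pos_sq u \<le> max 0 v * (v - u)"
proof -
  have "0 \<le> (max 0 v - max 0 u)\<^sup>2" by simp
  then have "pos_sq v - pos_sq u \<le> max 0 v * (max 0 v - max 0 u)"
    by (simp add: pos_sq_def power2_eq_square algebra_simps)
  also have "\<dots> \<le> max 0 v * (v - u)" by (cases "v \<ge> 0") (auto intro!: mult_left_mono)
  finally show ?thesis .
qed

lemma pos_sq_diff_ge: "max 0 u * (v - u) \<le> pos_sq v - pos_sq u"
  using pos_sq_diff_le[of u v] by (simp add: algebra_simps)

lemma borel_measurable_pos_sq [measurable]: "pos_sq \<in> borel_measurable borel"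
  unfolding pos_sq_def by measurable

lemma pos_sq_bound: "\<bar>u\<bar> \<le> W \<Longrightarrow> pos_sq u \<le> W\<^sup>2 / 2"
  by (auto simp: pos_sq_def max_def intro!: power_mono)

lemma pos_sq_lipschitz:
  assumes "\<bar>u\<bar> \<le> W" "\<bar>v\<bar> \<le> W"
  shows "\<bar>pos_sq v - pos_sq u\<bar> \<le> W * \<bar>v - u\<bar>"
proof -
  have "max 0 v * (v - u) \<le> W * \<bar>v - u\<bar>" 
    using assms by (intro order_trans[OF mult_left_mono[OF abs_ge_self] mult_right_mono]) auto
  moreover have "- (max 0 u * (v - u)) \<le> W * \<bar>v - u\<bar>" 
    unfolding mult_minus_right[symmetric] using assms
    by (intro order_trans[OF mult_left_mono[OF abs_ge_minus_self] mult_right_mono]) auto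
  ultimately show ?thesis using pos_sq_diff_le[of v u] pos_sq_diff_ge[of u v] by linarith
qed

text \<open>
  Integration by parts against a one-sided Lipschitz coefficient \<open>a\<close>: \<open>a\<close> is replaced by its difference
  quotients \<open>(P (x+d) - P x)/d\<close>, and the second differences of the primitive \<open>P\<close> are controlled.
\<close>

lemma weighted_transport_estimate:
  assumes D[measurable]: "D \<in> borel_measurable borel" and D_bd: "\<And>x. \<bar>D x\<bar> \<le> B"
    and a[measurable]: "a \<in> borel_measurable borel" and a_bd: "\<And>x. \<bar>a x\<bar> \<le> B"
    and w: "\<And>x y. w y - w x = - (prim D y - prim D x)" "\<And>x. \<bar>w x\<bar> \<le> W"
    and Oleinik: "\<And>d y. 0 < d \<Longrightarrow> (prim a (y + d) - prim a y) - (prim a y - prim a (y - d)) \<le> l * d\<^sup>2"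
  shows "(LINT x|lborel. weight x * (max 0 (w x) * (a x * D x)))
    \<le> (l + B) * (LINT x|lborel. weight x * pos_sq (w x))"
proof -
  let ?h = "\<lambda>k. 1 / real (Suc k)"
  have h: "0 < ?h k" "?h k \<le> 1" for k by auto
  have B: "0 \<le> B" using D_bd[of 0] by auto
  have W: "0 \<le> W" using w(2)[of 0] by auto
  have w_lip: "\<bar>w y - w x\<bar> \<le> B * \<bar>y - x\<bar>" for x y
    using prim_lipschitz[OF D D_bd, of y x] by (simp add: w(1))
  have "B-lipschitz_on UNIV w"
    using w_lip B by (auto simp: lipschitz_on_def dist_real_def abs_minus_commute)
  then have w_cont: "continuous_on UNIV w" by (rule lipschitz_on_continuous_on)
  have [measurable]: "w \<in> borel_measurable borel"
    by (rule borel_measurable_continuous_onI[OF w_cont])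
  have "B-lipschitz_on UNIV (prim a)"
    using prim_lipschitz[OF a a_bd] B by (auto simp: lipschitz_on_def dist_real_def abs_minus_commute)
  then have [measurable]: "prim a \<in> borel_measurable borel"
    by (intro borel_measurable_continuous_onI lipschitz_on_continuous_on)
  \<comment> \<open>G is the quantity to be estimated. \<open>Q k\<close> and \<open>F k\<close> are
    difference quotients, tending almost everywhere to the coefficient a and to the derivative of
    G.\<close>
  define G where "G x = weight x * pos_sq (w x)" for x
  define Q where "Q k x = real (Suc k) * (prim a (x + ?h k) - prim a x)" for k x
  define F where "F k x = real (Suc k) * (G (x + ?h k) - G x)" for k x
  have [measurable]: "G \<in> borel_measurable borel" "Q k \<in> borel_measurable borel" "F k \<in> borel_measurable borel" for k
    unfolding G_def Q_def F_def by measurable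
  have ps_bd: "\<bar>pos_sq (w x)\<bar> \<le> W\<^sup>2 / 2" for x
    using pos_sq_nonneg pos_sq_bound[OF w(2)] by simp
  have G_int: "integrable lborel G"
    unfolding G_def by (rule integrable_weight_mult[OF _ ps_bd]) measurable
  have G_nonneg: "0 \<le> G x" for x using weight_pos[of x] pos_sq_nonneg by (simp add: G_def)
  have Q_bd: "\<bar>Q k x\<bar> \<le> B" for k x
  proof -
    have "\<bar>Q k x\<bar> = real (Suc k) * \<bar>prim a (x + ?h k) - prim a x\<bar>"
      by (simp add: Q_def abs_mult)
    also have "\<dots> \<le> real (Suc k) * (B * \<bar>(x + ?h k) - x\<bar>)"
      by (intro mult_left_mono prim_lipschitz[OF a a_bd]) auto
    also have "\<dots> = B" by simp
    finally show ?thesis .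
  qed
  have F_bd: "\<bar>F k x\<bar> \<le> (3 * W * B + W\<^sup>2) * weight x" for k x
  proof -
    let ?y = "x + ?h k"
    have "G ?y - G x = weight ?y * (pos_sq (w ?y) - pos_sq (w x)) + pos_sq (w x) * (weight ?y - weight x)"
      by (simp add: G_def algebra_simps)
    also have "\<bar>\<dots>\<bar> \<le> weight ?y * \<bar>pos_sq (w ?y) - pos_sq (w x)\<bar> + \<bar>pos_sq (w x)\<bar> * \<bar>weight ?y - weight x\<bar>"
      using weight_pos[of ?y] by (intro order_trans[OF abs_triangle_ineq]) (simp add: abs_mult)
    also have "\<dots> \<le> 3 * weight x * (W * (B * ?h k)) + W\<^sup>2 / 2 * (2 * weight x * ?h k)"
    proof (intro add_mono mult_mono)
      show "weight ?y \<le> 3 * weight x" using h[of k] by (intro weight_shift) auto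
      have "\<bar>pos_sq (w ?y) - pos_sq (w x)\<bar> \<le> W * \<bar>w ?y - w x\<bar>" by (intro pos_sq_lipschitz w(2))
      also have "\<dots> \<le> W * (B * ?h k)" using w_lip[of ?y x] W by (intro mult_left_mono) auto
      finally show "\<bar>pos_sq (w ?y) - pos_sq (w x)\<bar> \<le> W * (B * ?h k)" .
      show "\<bar>weight ?y - weight x\<bar> \<le> 2 * weight x * ?h k"
        using weight_lipschitz[of x ?y] h[of k] by simp
    qed (use weight_pos[of x] weight_pos[of ?y] ps_bd in \<open>auto simp: less_imp_le\<close>)
    also have "\<dots> = ?h k * ((3 * W * B + W\<^sup>2) * weight x)" by (simp add: algebra_simps)
    finally have "real (Suc k) * \<bar>G ?y - G x\<bar> \<le> real (Suc k) * (?h k * ((3 * W * B + W\<^sup>2) * weight x))"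
      by (rule mult_left_mono) auto
    also have "\<dots> = (3 * W * B + W\<^sup>2) * weight x" by simp
    finally show ?thesis by (simp add: F_def abs_mult)
  qed
  have w_int: "integrable lborel (\<lambda>x. (3 * W * B + W\<^sup>2) * weight x)" using integrable_weight by simp
  have F_int: "integrable lborel (F k)" for k
    using G_int lborel_integrable_real_affine[OF G_int, of 1 "?h k"]
    unfolding F_def by (simp add: add.commute)
  have GQ_int: "integrable lborel (\<lambda>x. G x * Q k (x + c))" for k c
  proof (rule Bochner_Integration.integrable_bound)
    show "integrable lborel (\<lambda>x. G x * B)" using G_int by simp
    show "AE x in lborel. norm (G x * Q k (x + c)) \<le> norm (G x * B)"
      using Q_bd[of k] B by (auto simp: abs_mult intro!: mult_left_mono)
  qed measurable
  \<comment> \<open>Discrete integration by parts: a shift of the variable moves the difference from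
    G onto \<open>Q k\<close>, where it becomes a second difference of \<open>prim a\<close>.
    Because G is nonnegative, the one-sided bound on that difference suffices.\<close>
  have key: "- (LINT x|lborel. Q k x * F k x) \<le> l * (LINT x|lborel. G x)" for k
  proof -
    have G': "integrable lborel (\<lambda>x. G (x + ?h k) * Q k x)"
      using lborel_integrable_real_affine[OF GQ_int[of k "- ?h k"], of 1 "?h k"]
      by (simp add: add.commute)
    have shift: "(LINT x|lborel. G (x + ?h k) * Q k x) = (LINT x|lborel. G x * Q k (x - ?h k))"
      using lborel_integral_real_affine[of 1 "\<lambda>x. G x * Q k (x - ?h k)" "?h k"]
      by (simp add: add.commute)
    have "Q k x * F k x = real (Suc k) * (G (x + ?h k) * Q k x - G x * Q k x)" for x
      by (simp add: F_def algebra_simps)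
    then have "(LINT x|lborel. Q k x * F k x)
      = real (Suc k) * ((LINT x|lborel. G (x + ?h k) * Q k x) - (LINT x|lborel. G x * Q k x))"
      using G' GQ_int[of k 0] by simp
    also have "\<dots> = - (LINT x|lborel. G x * (real (Suc k) * (Q k x - Q k (x - ?h k))))"
    proof -
      have "(LINT x|lborel. G x * (real (Suc k) * (Q k x - Q k (x - ?h k)))) =
        (LINT x|lborel. real (Suc k) * (G x * Q k x - G x * Q k (x - ?h k)))"
        by (intro Bochner_Integration.integral_cong) (simp_all add: algebra_simps)
      also have "\<dots> = real (Suc k) * ((LINT x|lborel. G x * Q k x) - (LINT x|lborel. G x * Q k (x - ?h k)))"
        using GQ_int[of k 0] GQ_int[of k "- ?h k"] by simp
      finally show ?thesis unfolding shift by (simp add: algebra_simps)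
    qed
    finally have "- (LINT x|lborel. Q k x * F k x)
      = (LINT x|lborel. G x * (real (Suc k) * (Q k x - Q k (x - ?h k))))" by simp
    also have "\<dots> \<le> (LINT x|lborel. G x * l)"
    proof (rule integral_mono)
      show "integrable lborel (\<lambda>x. G x * (real (Suc k) * (Q k x - Q k (x - ?h k))))"
      proof -
        have "(\<lambda>x. G x * (real (Suc k) * (Q k x - Q k (x - ?h k)))) =
          (\<lambda>x. real (Suc k) * (G x * Q k x - G x * Q k (x - ?h k)))"
          by (simp add: fun_eq_iff algebra_simps)
        then show ?thesis using GQ_int[of k 0] GQ_int[of k "- ?h k"] by simp
      qed
      fix x
      have "real (Suc k) * (Q k x - Q k (x - ?h k)) = (real (Suc k))\<^sup>2 *
        ((prim a (x + ?h k) - prim a x) - (prim a x - prim a (x - ?h k)))"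
        by (simp add: Q_def power2_eq_square algebra_simps)
      also have "\<dots> \<le> (real (Suc k))\<^sup>2 * (l * (?h k)\<^sup>2)"
        by (intro mult_left_mono Oleinik h) auto
      also have "\<dots> = l" by (simp add: power_divide)
      finally show "G x * (real (Suc k) * (Q k x - Q k (x - ?h k))) \<le> G x * l"
        using G_nonneg by (intro mult_left_mono) auto
    qed (use G_int in auto)
    finally show ?thesis by (simp add: mult.commute)
  qed
  \<comment> \<open>The coefficient times the derivative of G by the product rule, with
    \<open>- D\<close> as the derivative of w almost everywhere.\<close>
  let ?L = "\<lambda>x. a x * (weight' x * pos_sq (w x) + weight x * (max 0 (w x) * - D x))"
  have hlim: "(\<lambda>k. ?h k) \<longlonglongrightarrow> 0" by (rule LIMSEQ_Suc[OF lim_1_over_n])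
  have "(\<lambda>k. LINT x|lborel. Q k x * F k x) \<longlonglongrightarrow> (LINT x|lborel. ?L x)"
  proof (rule integral_dominated_convergence[where w = "\<lambda>x. B * ((3 * W * B + W\<^sup>2) * weight x)"])
    show "integrable lborel (\<lambda>x. B * ((3 * W * B + W\<^sup>2) * weight x))" using w_int by simp
    show "AE x in lborel. norm (Q k x * F k x) \<le> B * ((3 * W * B + W\<^sup>2) * weight x)" for k
      using Q_bd F_bd B by (auto simp: abs_mult intro!: mult_mono)
    show "AE x in lborel. (\<lambda>k. Q k x * F k x) \<longlonglongrightarrow> ?L x"
      using tendsto_prim_seq[OF locally_integrable_bounded[OF a a_bd]]
        tendsto_prim_seq[OF locally_integrable_bounded[OF D D_bd]]
    proof eventually_elim
      case (elim x)
      have ylim: "(\<lambda>k. x + ?h k) \<longlonglongrightarrow> x" using tendsto_add[OF tendsto_const hlim, of x] by simp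
      have wlim: "(\<lambda>k. w (x + ?h k)) \<longlonglongrightarrow> w x"
        by (rule isCont_tendsto_compose[OF _ ylim])
           (use w_cont in \<open>simp add: continuous_on_eq_continuous_at\<close>)
      have philim: "(\<lambda>k. weight (x + ?h k)) \<longlonglongrightarrow> weight x"
        by (rule isCont_tendsto_compose[OF _ ylim]) (rule DERIV_isCont[OF deriv_weight])
      have w': "(\<lambda>k. real (Suc k) * (w (x + ?h k) - w x)) \<longlonglongrightarrow> - D x"
        using tendsto_minus[OF elim(2)] by (simp only: w(1) mult_minus_right)
      have ps': "(\<lambda>k. real (Suc k) * (pos_sq (w (x + ?h k)) - pos_sq (w x))) \<longlonglongrightarrow> max 0 (w x) * - D x"
      proof (rule tendsto_sandwich)
        show "(\<lambda>k. max 0 (w x) * (real (Suc k) * (w (x + ?h k) - w x))) \<longlonglongrightarrow> max 0 (w x) * - D x"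
          by (intro tendsto_mult tendsto_const w')
        show "(\<lambda>k. max 0 (w (x + ?h k)) * (real (Suc k) * (w (x + ?h k) - w x))) \<longlonglongrightarrow> max 0 (w x) * - D x"
          by (intro tendsto_mult tendsto_max tendsto_const wlim w')
        show "\<forall>\<^sub>F k in sequentially. max 0 (w x) * (real (Suc k) * (w (x + ?h k) - w x))
            \<le> real (Suc k) * (pos_sq (w (x + ?h k)) - pos_sq (w x))"
          using mult_left_mono[OF pos_sq_diff_ge, of "real (Suc _)"]
          by (intro always_eventually allI) (simp add: mult.left_commute del: of_nat_Suc)
        show "\<forall>\<^sub>F k in sequentially. real (Suc k) * (pos_sq (w (x + ?h k)) - pos_sq (w x))
            \<le> max 0 (w (x + ?h k)) * (real (Suc k) * (w (x + ?h k) - w x))"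
          using mult_left_mono[OF pos_sq_diff_le, of "real (Suc _)"]
          by (intro always_eventually allI) (simp add: mult.left_commute del: of_nat_Suc)
      qed
      have phi': "(\<lambda>k. real (Suc k) * (weight (x + ?h k) - weight x)) \<longlonglongrightarrow> weight' x"
      proof -
        have "((\<lambda>h. (weight (x + h) - weight x) / h) \<longlongrightarrow> weight' x) (at 0)"
          using deriv_weight by (simp add: DERIV_def)
        moreover have "filterlim ?h (at 0) sequentially"
          using hlim by (simp add: filterlim_at)
        ultimately have "(\<lambda>k. (weight (x + ?h k) - weight x) / ?h k) \<longlonglongrightarrow> weight' x"
          by (rule filterlim_compose)
        then show ?thesis by (simp add: mult.commute)
      qed
      have "F k x = (real (Suc k) * (weight (x + ?h k) - weight x)) * pos_sq (w x)
          + weight (x + ?h k) * (real (Suc k) * (pos_sq (w (x + ?h k)) - pos_sq (w x)))" for k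
        by (simp add: F_def G_def algebra_simps)
      then have "(\<lambda>k. F k x) \<longlonglongrightarrow> weight' x * pos_sq (w x) + weight x * (max 0 (w x) * - D x)"
        using tendsto_add[OF tendsto_mult[OF phi' tendsto_const] tendsto_mult[OF philim ps']] by simp
      then show ?case using elim(1) unfolding Q_def by (intro tendsto_mult)
    qed
  qed measurable
  from LIMSEQ_le_const2[OF tendsto_minus[OF this], of "l * (LINT x|lborel. G x)"] key
  have "- (LINT x|lborel. ?L x) \<le> l * (LINT x|lborel. G x)" by blast
  moreover have "(LINT x|lborel. ?L x) =
     (LINT x|lborel. a x * (weight' x * pos_sq (w x))) - (LINT x|lborel. weight x * (max 0 (w x) * (a x * D x)))"
  proof -
    have "integrable lborel (\<lambda>x. a x * (weight' x * pos_sq (w x)))"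
    proof (rule Bochner_Integration.integrable_bound)
      show "integrable lborel (\<lambda>x. B * G x)" using G_int by simp
      show "AE x in lborel. norm (a x * (weight' x * pos_sq (w x))) \<le> norm (B * G x)"
        using a_bd weight'_bound pos_sq_nonneg B weight_pos
        by (auto simp: abs_mult G_def less_imp_le intro!: mult_mono)
    qed measurable
    moreover have "\<bar>max 0 (w x) * (a x * D x)\<bar> \<le> W * (B * B)" for x
      unfolding abs_mult using w(2)[of x] a_bd[of x] D_bd[of x] W B by (intro mult_mono) auto
    then have "integrable lborel (\<lambda>x. weight x * (max 0 (w x) * (a x * D x)))"
      by (intro integrable_weight_mult) measurable
    ultimately show ?thesis
      by (subst Bochner_Integration.integral_diff[symmetric]) (auto simp: algebra_simps)
  qed
  moreover have "(LINT x|lborel. a x * (weight' x * pos_sq (w x))) \<le> (LINT x|lborel. B * G x)"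
  proof (rule integral_mono')
    show "integrable lborel (\<lambda>x. B * G x)" using G_int by simp
    fix x
    have "a x * (weight' x * pos_sq (w x)) \<le> \<bar>a x\<bar> * (\<bar>weight' x\<bar> * pos_sq (w x))"
      using abs_ge_self[of "a x * (weight' x * pos_sq (w x))"] pos_sq_nonneg[of "w x"] by (simp add: abs_mult)
    also have "\<dots> \<le> B * G x"
      unfolding G_def using a_bd weight'_bound pos_sq_nonneg B weight_pos
      by (intro mult_mono) (auto simp: less_imp_le)
    finally show "a x * (weight' x * pos_sq (w x)) \<le> B * G x" .
    show "0 \<le> B * G x" using B G_nonneg by simp
  qed
  ultimately show ?thesis unfolding G_def by (simp add: algebra_simps)
qed

lemma AE_le_imp_le_continuous:
  fixes f :: "real \<Rightarrow> real"
  assumes "continuous_on UNIV f" "AE x in lborel. f x \<le> c"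
  shows "f x \<le> c"
proof (rule ccontr)
  assume "\<not> f x \<le> c"
  have "open {x. c < f x}"
    using open_Collect_less[OF continuous_on_const assms(1)] .
  then obtain e where "e > 0" and e: "ball x e \<subseteq> {x. c < f x}"
    using \<open>\<not> f x \<le> c\<close> unfolding open_contains_ball by (metis mem_Collect_eq not_le)
  obtain N where N: "N \<in> null_sets lborel" "\<And>x. x \<notin> N \<Longrightarrow> f x \<le> c"
    using assms(2) unfolding eventually_ae_filter by auto
  obtain m where m: "x < m" "m < x + e" "m \<notin> N"
    using not_null_open_interval[OF N(1), of x "x + e"] \<open>e > 0\<close> by auto
  then have "m \<in> ball x e" by (simp add: dist_real_def)
  then show False using e N(2)[OF m(3)] by force
qed

section \<open>Integrability on the plane and tail integrals\<close>

lemma integrable_product_bound: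
  fixes f :: "real \<times> real \<Rightarrow> real"
  assumes "f \<in> borel_measurable borel" "integrable lborel g" "integrable lborel h"
    and "\<And>x t. \<bar>f (x, t)\<bar> \<le> g x * h t"
  shows "integrable (lborel \<Otimes>\<^sub>M lborel) f"
proof (rule Bochner_Integration.integrable_bound)
  note [measurable] = borel_measurable_integrable[OF assms(2)] borel_measurable_integrable[OF assms(3)]
  show "integrable (lborel \<Otimes>\<^sub>M lborel) (\<lambda>(x, t). g x * h t)"
  proof (rule lborel_pair.Fubini_integrable)
    show "integrable lborel (\<lambda>x. LINT y|lborel. norm (case (x, y) of (x, t) \<Rightarrow> g x * h t))"
      using assms(2) by (simp add: abs_mult)
    show "AE x in lborel. integrable lborel (\<lambda>y. case (x, y) of (x, t) \<Rightarrow> g x * h t)"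
      using assms(3) by simp
  qed measurable
  show "f \<in> borel_measurable (lborel \<Otimes>\<^sub>M lborel)"
    using assms(1) by (simp add: lborel_prod)
  show "AE z in lborel \<Otimes>\<^sub>M lborel. norm (f z) \<le> norm (case z of (x, t) \<Rightarrow> g x * h t)"
    by (intro AE_I2) (auto intro: order_trans[OF assms(4)])
qed

definition tail :: "(real \<Rightarrow> real) \<Rightarrow> real \<Rightarrow> real" where
  "tail f y = (LINT x:{y<..}|lborel. f x)"

lemma integrable_imp_locally_integrable: "integrable lborel f \<Longrightarrow> locally_integrable f"
  unfolding locally_integrable_def set_integrable_def
  by (intro allI integrable_mult_indicator) auto

lemma tail_diff:
  assumes "integrable lborel f"
  shows "tail f y - tail f x = - (prim f y - prim f x)"
proof -
  have *: "tail f y - tail f x = - (prim f y - prim f x)" if "x \<le> y" for x y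
  proof -
    have "(LINT z:{x<..y} \<union> {y<..}|lborel. f z) = (LINT z:{x<..y}|lborel. f z) + (LINT z:{y<..}|lborel. f z)"
      using assms
      by (intro set_integral_Un) (auto simp: set_integrable_def simp del: real_scaleR_def intro!: integrable_mult_indicator)
    moreover have "{x<..y} \<union> {y<..} = {x<..}" using that by auto
    moreover have "prim f y - prim f x = (LINT z:{x<..y}|lborel. f z)"
      using interval_integral_Ioc[of x y f] that
      by (simp add: prim_diff[OF integrable_imp_locally_integrable[OF assms]])
    ultimately show ?thesis by (simp add: tail_def)
  qed
  show ?thesis using *[of x y] *[of y x] by (cases "x \<le> y") auto
qed

lemma tail_bound:
  assumes "integrable lborel f"
  shows "\<bar>tail f y\<bar> \<le> (LINT x|lborel. \<bar>f x\<bar>)"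
proof -
  have "\<bar>tail f y\<bar> \<le> (LINT x|lborel. \<bar>indicator {y<..} x *\<^sub>R f x\<bar>)"
    unfolding tail_def set_lebesgue_integral_def by (rule integral_abs_bound)
  also have "\<dots> \<le> (LINT x|lborel. \<bar>f x\<bar>)"
    using assms by (intro integral_mono') (auto simp: indicator_def)
  finally show ?thesis .
qed

text \<open>
  The difference \<open>D\<close> of two densities has the tail integral \<open>T\<close>, which solves a transport inequality with
  coefficient \<open>a\<close>.  The weighted integral \<open>M\<close> of \<open>(T\<^sup>+)\<^sup>2/2\<close> grows at most like \<open>t\<close> (with rate \<open>1/t\<close>), but it is
  \<open>O(t\<^sup>2)\<close> at \<open>0\<close>, hence it vanishes.
\<close>

locale transport_comparison =
  fixes D H a :: "real \<times> real \<Rightarrow> real" and B :: real and N :: "real set"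
  assumes D_meas[measurable]: "D \<in> borel_measurable borel"
    and H_meas[measurable]: "H \<in> borel_measurable borel"
    and a_meas[measurable]: "a \<in> borel_measurable borel"
    and D_bd: "\<And>z. \<bar>D z\<bar> \<le> B" and H_bd: "\<And>z. \<bar>H z\<bar> \<le> B" and a_bd: "\<And>z. \<bar>a z\<bar> \<le> B"
    and D_int: "\<And>t. integrable lborel (\<lambda>x. D (x, t))"
    and N_null: "N \<in> null_sets lborel"
    and H_le: "\<And>z. H z \<le> a z * D z"
    and evol: "\<And>t. 0 < t \<Longrightarrow> t \<notin> N \<Longrightarrow>
      AE y in lborel. tail (\<lambda>x. D (x, t)) y = prim (\<lambda>\<tau>. H (y, \<tau>)) t"
    and Oleinik: "\<And>t d y. 0 < t \<Longrightarrow> t \<notin> N \<Longrightarrow> 0 < d \<Longrightarrow>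
      (prim (\<lambda>x. a (x, t)) (y + d) - prim (\<lambda>x. a (x, t)) y)
        - (prim (\<lambda>x. a (x, t)) y - prim (\<lambda>x. a (x, t)) (y - d)) \<le> 1 / t * d\<^sup>2"
begin

definition T :: "real \<Rightarrow> real \<Rightarrow> real" where
  "T y t = tail (\<lambda>x. D (x, t)) y"

definition M :: "real \<Rightarrow> real" where
  "M t = (LINT x|lborel. weight x * pos_sq (T x t))"

abbreviation \<Phi> :: real where "\<Phi> \<equiv> LINT x|lborel. weight x"

lemma B_nonneg: "0 \<le> B"
  using D_bd[of "(0, 0)"] by linarith

lemma \<Phi>_nonneg: "0 \<le> \<Phi>"
  using weight_pos by (intro integral_nonneg_AE) (auto simp: less_imp_le)

lemma continuous_T: "continuous_on UNIV (\<lambda>y. T y t)"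
proof (rule lipschitz_on_continuous_on)
  have "(\<lambda>x. D (x, t)) \<in> borel_measurable borel" by measurable
  from prim_lipschitz[OF this D_bd] show "B-lipschitz_on UNIV (\<lambda>y. T y t)"
    using B_nonneg by (auto simp: lipschitz_on_def dist_real_def T_def tail_diff[OF D_int] abs_minus_commute)
qed

lemma borel_measurable_T [measurable]: "(\<lambda>y. T y t) \<in> borel_measurable borel"
  by (rule borel_measurable_continuous_onI[OF continuous_T])

lemma T_diff_AE:
  assumes "0 < s" "0 < t" "s \<notin> N" "t \<notin> N"
  shows "AE y in lborel. T y t - T y s = prim (\<lambda>\<tau>. H (y, \<tau>)) t - prim (\<lambda>\<tau>. H (y, \<tau>)) s"
  using evol[OF assms(1,3)] evol[OF assms(2,4)] by eventually_elim (simp add: T_def)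

lemma T_lipschitz:
  assumes "0 < s" "0 < t" "s \<notin> N" "t \<notin> N"
  shows "\<bar>T y t - T y s\<bar> \<le> B * \<bar>t - s\<bar>"
proof (rule AE_le_imp_le_continuous[where f = "\<lambda>y. \<bar>T y t - T y s\<bar>" and x = y])
  show "continuous_on UNIV (\<lambda>y. \<bar>T y t - T y s\<bar>)"
    by (intro continuous_intros continuous_T)
  have "(\<lambda>\<tau>. H (y, \<tau>)) \<in> borel_measurable borel" for y by measurable
  note lip = prim_lipschitz[OF this H_bd]
  show "AE y in lborel. \<bar>T y t - T y s\<bar> \<le> B * \<bar>t - s\<bar>"
    using T_diff_AE[OF assms] by eventually_elim (use lip in simp)
qed

lemma T_bound:
  assumes "0 < t" "t \<notin> N"
  shows "\<bar>T y t\<bar> \<le> B * t"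
proof (rule AE_le_imp_le_continuous[where f = "\<lambda>y. \<bar>T y t\<bar>" and x = y])
  show "continuous_on UNIV (\<lambda>y. \<bar>T y t\<bar>)"
    by (intro continuous_intros continuous_T)
  have "(\<lambda>\<tau>. H (y, \<tau>)) \<in> borel_measurable borel" for y by measurable
  from prim_lipschitz[OF this H_bd, of _ t 0]
  show "AE y in lborel. \<bar>T y t\<bar> \<le> B * t"
    using evol[OF assms] assms by (auto simp: T_def elim!: eventually_mono)
qed

lemma integrable_M:
  assumes "0 < t" "t \<notin> N"
  shows "integrable lborel (\<lambda>x. weight x * pos_sq (T x t))"
  using pos_sq_nonneg pos_sq_bound[OF T_bound[OF assms]]
  by (intro integrable_weight_mult[where W = "(B * t)\<^sup>2 / 2"]) (auto simp: abs_le_iff intro: order_trans)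

lemma M_nonneg: "0 \<le> M t"
  unfolding M_def using weight_pos pos_sq_nonneg
  by (intro integral_nonneg_AE) (auto simp: less_imp_le)

lemma M_bound:
  assumes "0 < t" "t \<notin> N"
  shows "M t \<le> (B * t)\<^sup>2 / 2 * \<Phi>"
proof -
  have "M t \<le> (LINT x|lborel. (B * t)\<^sup>2 / 2 * weight x)"
    unfolding M_def
  proof (rule integral_mono[OF integrable_M[OF assms]])
    show "integrable lborel (\<lambda>x. (B * t)\<^sup>2 / 2 * weight x)" using integrable_weight by simp
    show "weight x * pos_sq (T x t) \<le> (B * t)\<^sup>2 / 2 * weight x" for x
      using mult_left_mono[OF pos_sq_bound[OF T_bound[OF assms]] less_imp_le[OF weight_pos[of x]]]
      by (simp add: mult.commute)
  qed
  then show ?thesis by simp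
qed

lemma integrable_weight_posT:
  assumes "0 < t" "t \<notin> N" and [measurable]: "f \<in> borel_measurable borel" and f: "\<And>x. \<bar>f x\<bar> \<le> K"
  shows "integrable lborel (\<lambda>x. weight x * (max 0 (T x t) * f x))"
proof (rule integrable_weight_mult)
  fix x
  have "\<bar>max 0 (T x t)\<bar> \<le> B * t" using T_bound[OF assms(1,2), of x] B_nonneg assms by auto
  then show "\<bar>max 0 (T x t) * f x\<bar> \<le> B * t * K"
    unfolding abs_mult using f B_nonneg assms by (intro mult_mono) auto
qed measurable

lemma weight_posT_le:
  assumes "0 < t" "t \<notin> N" "\<And>x. \<bar>f x\<bar> \<le> K"
  shows "weight x * (max 0 (T x t) * f x) \<le> weight x * (B * t * K)"
proof (intro mult_left_mono less_imp_le[OF weight_pos])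
  have "max 0 (T x t) * f x \<le> \<bar>max 0 (T x t) * f x\<bar>" by simp
  also have "\<dots> \<le> B * t * K"
    unfolding abs_mult using T_bound[OF assms(1,2), of x] assms B_nonneg by (intro mult_mono) auto
  finally show "max 0 (T x t) * f x \<le> B * t * K" .
qed

lemma M_diff_le:
  assumes "0 < s" "0 < t" "s \<notin> N" "t \<notin> N"
  shows "M t - M s \<le> (LINT x|lborel. weight x * (max 0 (T x t) * (T x t - T x s)))"
    and "integrable lborel (\<lambda>x. weight x * (max 0 (T x t) * (T x t - T x s)))"
proof -
  show int: "integrable lborel (\<lambda>x. weight x * (max 0 (T x t) * (T x t - T x s)))"
    by (rule integrable_weight_posT[OF assms(2,4) _ T_lipschitz[OF assms]]) measurable
  have "M t - M s = (LINT x|lborel. weight x * pos_sq (T x t) - weight x * pos_sq (T x s))"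
    unfolding M_def using integrable_M assms by simp
  also have "\<dots> \<le> (LINT x|lborel. weight x * (max 0 (T x t) * (T x t - T x s)))"
  proof (rule integral_mono[OF _ int])
    show "integrable lborel (\<lambda>x. weight x * pos_sq (T x t) - weight x * pos_sq (T x s))"
      using integrable_M assms by simp
    show "weight x * pos_sq (T x t) - weight x * pos_sq (T x s) \<le> weight x * (max 0 (T x t) * (T x t - T x s))" for x
      using mult_left_mono[OF pos_sq_diff_le less_imp_le[OF weight_pos]] by (simp add: right_diff_distrib)
  qed
  finally show "M t - M s \<le> (LINT x|lborel. weight x * (max 0 (T x t) * (T x t - T x s)))" .
qed

text \<open>A crude bound that ignores the sign structure. It serves \<open>M_increment\<close>,
  where replacing \<open>M \<tau>\<close> by \<open>M s\<close> may then cost a quadratic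
  error.\<close>

lemma M_lipschitz:
  assumes "0 < s" "0 < t" "s \<notin> N" "t \<notin> N" "s \<le> t" "t \<le> b"
  shows "M t - M s \<le> \<Phi> * (B\<^sup>2 * b) * (t - s)"
proof -
  have "M t - M s \<le> (LINT x|lborel. weight x * (max 0 (T x t) * (T x t - T x s)))"
    using M_diff_le assms by blast
  also have "\<dots> \<le> (LINT x|lborel. weight x * (B * t * (B * \<bar>t - s\<bar>)))"
    using integrable_weight
    by (intro integral_mono M_diff_le(2)[OF assms(1-4)] weight_posT_le[OF assms(2,4)] T_lipschitz[OF assms(1-4)]) auto
  also have "\<dots> = \<Phi> * (B\<^sup>2 * t) * (t - s)" using assms by (simp add: power2_eq_square)
  also have "\<dots> \<le> \<Phi> * (B\<^sup>2 * b) * (t - s)"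
    using assms \<Phi>_nonneg by (intro mult_right_mono mult_left_mono) auto
  finally show ?thesis .
qed

lemma transport_term_le:
  assumes "0 < t" "t \<notin> N"
  shows "(LINT x|lborel. weight x * (max 0 (T x t) * (a (x, t) * D (x, t)))) \<le> (1 / t + B) * M t"
  unfolding M_def
proof (rule weighted_transport_estimate)
  show "T y t - T x t = - (prim (\<lambda>x. D (x, t)) y - prim (\<lambda>x. D (x, t)) x)" for x y
    unfolding T_def by (rule tail_diff[OF D_int])
  show "\<bar>T x t\<bar> \<le> B * t" for x by (rule T_bound[OF assms])
qed (use assms Oleinik D_bd a_bd in auto)

text \<open>The integrated form of M' \<le> (1/t + B) M. Differentiability of M is not at hand, so
  the inequality is stated for increments with a quadratic error, the form that
  \<open>le_of_quadratic_increments\<close> accepts. The difference of T in time is the integral of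
  H, Fubini exchanges the order, and the transport estimate is applied at each intermediate time.
  The lower bound \<open>s0\<close> keeps the error constant uniform in s.\<close>

lemma M_increment:
  assumes "0 < s0" "s0 \<le> s" "s < t" "t \<le> b" "s \<notin> N" "t \<notin> N"
  shows "M t - M s \<le> (t - s) * ((1 / s + B) * M s)
    + ((1 / s0 + B) * (\<Phi> * (B\<^sup>2 * b)) + B * B * \<Phi>) * (t - s)\<^sup>2"
proof -
  have st: "0 < s" "0 < t" using assms by auto
  let ?K = "(1 / s + B) * (M s + \<Phi> * (B\<^sup>2 * b) * (t - s)) + B * B * (t - s) * \<Phi>"
  define f where "f = (\<lambda>(x, \<tau>). weight x * (max 0 (T x t) * (indicator {s<..<t} \<tau> * H (x, \<tau>))))"
  have f_meas [measurable]: "f \<in> borel_measurable borel"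
    unfolding f_def borel_prod[symmetric] by measurable
  have f_int: "integrable (lborel \<Otimes>\<^sub>M lborel) f"
  proof (rule integrable_product_bound[OF f_meas])
    show "integrable lborel (\<lambda>x. weight x * (B * t * B))" using integrable_weight by simp
    show "integrable lborel (indicator {s<..<t} :: real \<Rightarrow> real)" using assms by simp
    fix x \<tau>
    have "\<bar>f (x, \<tau>)\<bar> = weight x * (\<bar>max 0 (T x t)\<bar> * \<bar>H (x, \<tau>)\<bar>) * indicator {s<..<t} \<tau>"
      using weight_pos[of x] by (simp add: f_def abs_mult)
    also have "\<dots> \<le> weight x * (B * t * B) * indicator {s<..<t} \<tau>"
      using weight_pos[of x] T_bound[OF st(2) assms(6), of x] H_bd B_nonneg st
      by (intro mult_right_mono mult_left_mono mult_mono) (auto simp: less_imp_le)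
    finally show "\<bar>f (x, \<tau>)\<bar> \<le> weight x * (B * t * B) * indicator {s<..<t} \<tau>" .
  qed
  have H_li: "locally_integrable (\<lambda>\<tau>. H (x, \<tau>))" for x
    by (rule locally_integrable_bounded[OF _ H_bd]) measurable
  have "M t - M s \<le> (LINT x|lborel. weight x * (max 0 (T x t) * (T x t - T x s)))"
    using M_diff_le assms st by blast
  also have "\<dots> = (LINT x|lborel. (LINT \<tau>|lborel. f (x, \<tau>)))"
  proof (rule integral_cong_AE)
    show "AE x in lborel. weight x * (max 0 (T x t) * (T x t - T x s)) = (LINT \<tau>|lborel. f (x, \<tau>))"
      using T_diff_AE[OF st assms(5,6)]
    proof eventually_elim
      case (elim x)
      have "prim (\<lambda>\<tau>. H (x, \<tau>)) t - prim (\<lambda>\<tau>. H (x, \<tau>)) s = (LINT \<tau>|lborel. indicator {s<..<t} \<tau> * H (x, \<tau>))"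
        using assms by (simp add: prim_diff_set[OF H_li] set_lebesgue_integral_def)
      then show ?case using elim by (simp add: f_def)
    qed
  qed measurable
  also have "\<dots> = (LINT \<tau>|lborel. (LINT x|lborel. f (x, \<tau>)))"
    using lborel_pair.Fubini_integral[of "\<lambda>x \<tau>. f (x, \<tau>)"] f_int by simp
  also have "\<dots> \<le> (LINT \<tau>|lborel. indicator {s<..<t} \<tau> * ?K)"
  proof (rule integral_mono_AE)
    show "integrable lborel (\<lambda>\<tau>. LINT x|lborel. f (x, \<tau>))"
      using lborel_pair.integrable_snd[of "\<lambda>x \<tau>. f (x, \<tau>)"] f_int by simp
    show "integrable lborel (\<lambda>\<tau>. indicator {s<..<t} \<tau> * ?K)" using assms by simp
    show "AE \<tau> in lborel. (LINT x|lborel. f (x, \<tau>)) \<le> indicator {s<..<t} \<tau> * ?K"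
      using AE_not_in[OF N_null]
    proof eventually_elim
      case (elim \<tau>)
      show ?case
      proof (cases "\<tau> \<in> {s<..<t}")
        case True
        then have \<tau>: "0 < \<tau>" "s < \<tau>" "\<tau> < t" using st by auto
        have aD_bd: "\<bar>a (x, \<tau>) * D (x, \<tau>)\<bar> \<le> B * B" for x
          unfolding abs_mult using a_bd D_bd B_nonneg by (intro mult_mono) auto
        have i1: "integrable lborel (\<lambda>x. weight x * (max 0 (T x \<tau>) * (a (x, \<tau>) * D (x, \<tau>))))"
          by (rule integrable_weight_posT[OF \<tau>(1) elim _ aD_bd]) measurable
        have "(LINT x|lborel. f (x, \<tau>)) \<le>
          (LINT x|lborel. weight x * (max 0 (T x \<tau>) * (a (x, \<tau>) * D (x, \<tau>))) + B * B * (t - s) * weight x)"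
        proof (rule integral_mono)
          show "integrable lborel (\<lambda>x. f (x, \<tau>))"
            using True integrable_weight_posT[OF st(2) assms(6), of "\<lambda>x. H (x, \<tau>)" B] H_bd by (simp add: f_def)
          show "integrable lborel (\<lambda>x. weight x * (max 0 (T x \<tau>) * (a (x, \<tau>) * D (x, \<tau>))) + B * B * (t - s) * weight x)"
            using i1 integrable_weight by simp
          fix x
          \<comment> \<open>The positive part is moved from time t to time \<tau>, since the
            transport estimate relates quantities at one and the same time. The price is of order t
            - s, hence quadratic after integration in time.\<close>
          have "max 0 (T x t) * H (x, \<tau>) = max 0 (T x \<tau>) * H (x, \<tau>) + (max 0 (T x t) - max 0 (T x \<tau>)) * H (x, \<tau>)"
            by (simp add: algebra_simps)
          also have "\<dots> \<le> max 0 (T x \<tau>) * (a (x, \<tau>) * D (x, \<tau>)) + B * (t - s) * B"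
          proof (intro add_mono mult_left_mono H_le)
            have "\<bar>max 0 (T x t) - max 0 (T x \<tau>)\<bar> \<le> \<bar>T x t - T x \<tau>\<bar>" by (auto simp: max_def)
            also have "\<dots> \<le> B * (t - \<tau>)" using T_lipschitz[OF \<tau>(1) st(2) elim assms(6), of x] \<tau> by simp
            also have "\<dots> \<le> B * (t - s)" using \<tau> B_nonneg by (intro mult_left_mono) auto
            finally have "\<bar>(max 0 (T x t) - max 0 (T x \<tau>)) * H (x, \<tau>)\<bar> \<le> B * (t - s) * B"
              unfolding abs_mult using H_bd B_nonneg assms by (intro mult_mono) auto
            then show "(max 0 (T x t) - max 0 (T x \<tau>)) * H (x, \<tau>) \<le> B * (t - s) * B" by linarith
          qed auto
          finally have "weight x * (max 0 (T x t) * H (x, \<tau>)) \<le> 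
            weight x * (max 0 (T x \<tau>) * (a (x, \<tau>) * D (x, \<tau>)) + B * (t - s) * B)"
            using weight_pos[of x] by (intro mult_left_mono) auto
          then show "f (x, \<tau>) \<le> weight x * (max 0 (T x \<tau>) * (a (x, \<tau>) * D (x, \<tau>))) + B * B * (t - s) * weight x"
            using True by (simp add: f_def algebra_simps)
        qed
        also have "\<dots> = (LINT x|lborel. weight x * (max 0 (T x \<tau>) * (a (x, \<tau>) * D (x, \<tau>)))) + B * B * (t - s) * \<Phi>"
          using i1 integrable_weight by simp
        also have "\<dots> \<le> (1 / \<tau> + B) * M \<tau> + B * B * (t - s) * \<Phi>"
          using transport_term_le[OF \<tau>(1) elim] by simp
        also have "(1 / \<tau> + B) * M \<tau> \<le> (1 / s + B) * (M s + \<Phi> * (B\<^sup>2 * b) * (t - s))"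
        proof (rule mult_mono)
          have "M \<tau> - M s \<le> \<Phi> * (B\<^sup>2 * b) * (\<tau> - s)"
            using \<tau> assms st elim by (intro M_lipschitz) auto
          also have "\<dots> \<le> \<Phi> * (B\<^sup>2 * b) * (t - s)"
            using \<tau> assms \<Phi>_nonneg st by (intro mult_left_mono) auto
          finally show "M \<tau> \<le> M s + \<Phi> * (B\<^sup>2 * b) * (t - s)" by simp
          show "1 / \<tau> + B \<le> 1 / s + B" using \<tau> st by (simp add: frac_le)
        qed (use M_nonneg B_nonneg st in auto)
        finally show ?thesis using True by simp
      next
        case False
        then show ?thesis by (simp add: f_def)
      qed
    qed
  qed
  also have "\<dots> = (t - s) * ?K" using assms by simp
  also have "\<dots> = (t - s) * ((1 / s + B) * M s) + ((1 / s + B) * (\<Phi> * (B\<^sup>2 * b)) + B * B * \<Phi>) * (t - s)\<^sup>2"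
  proof -
    have "(t - s) * ((i + B) * (m + p * (t - s)) + B * B * (t - s) * q)
      = (t - s) * ((i + B) * m) + ((i + B) * p + B * B * q) * (t - s)\<^sup>2" for i m p q :: real
      by (simp add: algebra_simps power2_eq_square)
    then show ?thesis .
  qed
  also have "\<dots> \<le> (t - s) * ((1 / s + B) * M s) + ((1 / s0 + B) * (\<Phi> * (B\<^sup>2 * b)) + B * B * \<Phi>) * (t - s)\<^sup>2"
  proof -
    have "1 / s \<le> 1 / s0" using assms by (intro frac_le) auto
    then show ?thesis using \<Phi>_nonneg assms st
      by (intro add_left_mono mult_right_mono add_right_mono) auto
  qed
  finally show ?thesis .
qed

lemma M_eq_0:
  assumes "0 < t" "t \<notin> N"
  shows "M t = 0"
proof -
  \<comment> \<open>The integrating factor of m' = (1/t + B) m is exp(-B t)/t.\<close>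
  define e where "e s = M s * exp (- B * s) / s" for s
  have e_mono: "e t \<le> e s0" if s0: "0 < s0" "s0 < t" "s0 \<notin> N" for s0
  proof (rule le_of_quadratic_increments[OF N_null _ _ s0(2,3) assms(2)])
    let ?C = "(1 / s0 + B) * (\<Phi> * (B\<^sup>2 * t)) + B * B * \<Phi>"
    have C: "0 \<le> ?C" using s0 assms B_nonneg \<Phi>_nonneg by auto
    then show "0 \<le> ?C / s0" using s0 by simp
    fix s u assume su: "s0 \<le> s" "s < u" "u \<le> t" "s \<notin> N" "u \<notin> N"
    have pos: "0 < s" "0 < u" using su s0 by auto
    have "M u \<le> M s * (1 + (u - s) / s + B * (u - s)) + ?C * (u - s)\<^sup>2"
      using M_increment[OF s0(1) su] pos by (simp add: algebra_simps)
    also have "M s * (1 + (u - s) / s + B * (u - s)) \<le> M s * ((u / s) * exp (B * (u - s)))"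
    proof (rule mult_left_mono[OF _ M_nonneg])
      have "0 \<le> (u - s) / s * (B * (u - s))" using su pos B_nonneg by auto
      moreover have "1 + p + q \<le> (1 + p) * (1 + q)" if "0 \<le> p * q" for p q :: real
        using that by (simp add: algebra_simps)
      ultimately have "1 + (u - s) / s + B * (u - s) \<le> (1 + (u - s) / s) * (1 + B * (u - s))"
        by blast
      also have "\<dots> \<le> (u / s) * exp (B * (u - s))"
      proof (rule mult_mono)
        show "1 + (u - s) / s \<le> u / s" using pos by (simp add: diff_divide_distrib)
        show "0 \<le> 1 + B * (u - s)" using B_nonneg su by simp
      qed (use pos in auto)
      finally show "1 + (u - s) / s + B * (u - s) \<le> (u / s) * exp (B * (u - s))" .
    qed
    finally have "M u * (exp (- B * u) / u) \<le> (M s * ((u / s) * exp (B * (u - s))) + ?C * (u - s)\<^sup>2) * (exp (- B * u) / u)"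
      using pos by (intro mult_right_mono) auto
    also have "\<dots> = e s + ?C * (u - s)\<^sup>2 * (exp (- B * u) / u)"
    proof -
      have "exp (B * (u - s)) * exp (- B * u) = exp (- B * s)" by (simp flip: exp_add add: algebra_simps)
      then have "M s * ((u / s) * exp (B * (u - s))) * (exp (- B * u) / u) = e s"
        using pos by (simp add: e_def field_simps)
      then show ?thesis by (simp only: distrib_right)
    qed
    also have "?C * (u - s)\<^sup>2 * (exp (- B * u) / u) \<le> ?C * (u - s)\<^sup>2 * (1 / s0)"
    proof (intro mult_left_mono)
      show "exp (- B * u) / u \<le> 1 / s0" using pos su s0 B_nonneg by (intro frac_le) auto
      show "0 \<le> ?C * (u - s)\<^sup>2" using C by simp
    qed
    finally show "e u - e s \<le> ?C / s0 * (u - s)\<^sup>2" by (simp add: e_def)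
  qed
  have "e t \<le> 0"
  proof (rule field_le_epsilon)
    fix \<epsilon> :: real assume "\<epsilon> > 0"
    let ?c = "B\<^sup>2 / 2 * \<Phi>"
    have c: "0 \<le> ?c" using \<Phi>_nonneg by auto
    define r where "r = min t (\<epsilon> / (?c + 1))"
    have "0 < r" using assms \<open>\<epsilon> > 0\<close> c by (auto simp: r_def)
    then obtain s where s: "0 < s" "s < r" "s \<notin> N" using not_null_open_interval[OF N_null] by blast
    have "e t \<le> e s" using s by (intro e_mono) (auto simp: r_def)
    also have "\<dots> \<le> M s * 1 / s"
      unfolding e_def using s M_nonneg B_nonneg by (intro divide_right_mono mult_left_mono) auto
    also have "\<dots> \<le> (B * s)\<^sup>2 / 2 * \<Phi> / s" using s M_bound[OF s(1,3)] by (intro divide_right_mono) auto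
    also have "\<dots> = ?c * s" using s by (simp add: power2_eq_square)
    also have "\<dots> \<le> ?c * (\<epsilon> / (?c + 1))" using s c by (intro mult_left_mono) (auto simp: r_def)
    also have "\<dots> \<le> \<epsilon>" using \<open>\<epsilon> > 0\<close> c by (simp add: field_simps)
    finally show "e t \<le> 0 + \<epsilon>" by simp
  qed
  then have "M t * (exp (- B * t) / t) \<le> 0" by (simp add: e_def)
  moreover have "0 < exp (- B * t) / t" using assms by simp
  ultimately have "M t \<le> 0" by (metis mult_pos_pos not_le)
  then show ?thesis using M_nonneg[of t] by linarith
qed

lemma T_nonpos:
  assumes "0 < t" "t \<notin> N"
  shows "T y t \<le> 0"
proof (rule AE_le_imp_le_continuous[OF continuous_T])
  have "AE x in lborel. weight x * pos_sq (T x t) = 0"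
    using M_eq_0[OF assms] weight_pos pos_sq_nonneg unfolding M_def
    by (subst (asm) integral_nonneg_eq_0_iff_AE[OF integrable_M[OF assms]]) (auto simp: less_imp_le)
  then show "AE x in lborel. T x t \<le> 0"
  proof eventually_elim
    case (elim x)
    then have "max 0 (T x t) = 0" using weight_pos[of x] by (simp add: pos_sq_def)
    then show ?case by linarith
  qed
qed

end

subsection \<open>The power-law flux\<close>

definition pow_flux :: "real \<Rightarrow> real \<Rightarrow> real \<Rightarrow> real" where
  "pow_flux A \<gamma> r = r * (A - r powr \<gamma>)"

text \<open>The derivative of the flux. It is affine and decreasing in
  \<open>r powr \<gamma>\<close>, so an almost monotone power of the density is the same as a
  one-sided Lipschitz bound for this speed.\<close>

definition char_speed :: "real \<Rightarrow> real \<Rightarrow> real \<Rightarrow> real" where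
  "char_speed A \<gamma> r = A - (\<gamma> + 1) * r powr \<gamma>"

lemma flux_velocity: "flux (velocity A \<gamma>) = pow_flux A \<gamma>"
  by (simp add: fun_eq_iff flux_def velocity_def pow_flux_def)

lemma borel_measurable_pow_flux [measurable]: "pow_flux A \<gamma> \<in> borel_measurable borel"
  unfolding pow_flux_def by measurable

lemma borel_measurable_char_speed [measurable]: "char_speed A \<gamma> \<in> borel_measurable borel"
  unfolding char_speed_def by measurable

lemma deriv_mult_powr:
  fixes r :: real
  assumes "0 < r"
  shows "((\<lambda>r. r * r powr \<gamma>) has_real_derivative (\<gamma> + 1) * r powr \<gamma>) (at r)"
  using assms by (auto intro!: derivative_eq_intros simp: powr_diff algebra_simps)

lemma flux_deriv_velocity:
  assumes "\<gamma> > 0" "r \<ge> 0"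
  shows "flux_deriv (velocity A \<gamma>) r = char_speed A \<gamma> r"
proof -
  have "(pow_flux A \<gamma> has_real_derivative char_speed A \<gamma> r) (at r within {0..})"
  proof (cases "r = 0")
    case True
    have "((\<lambda>h. h powr \<gamma>) \<longlongrightarrow> 0) (at 0 within {0::real..})"
      using assms by (intro tendsto_zero_powrI[OF tendsto_ident_at tendsto_const])
        (auto simp: eventually_at_filter)
    then have "((\<lambda>h. A - h powr \<gamma>) \<longlongrightarrow> A - 0) (at 0 within {0..})"
      by (intro tendsto_diff tendsto_const)
    then have "((\<lambda>h. (pow_flux A \<gamma> h - pow_flux A \<gamma> 0) / (h - 0)) \<longlongrightarrow> A) (at 0 within {0..})"
      by (simp add: pow_flux_def) (erule Lim_transform_eventually, auto simp: eventually_at_filter)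
    then show ?thesis using True by (simp add: has_field_derivative_iff char_speed_def)
  next
    case False
    then have "r > 0" using assms by simp
    have "((\<lambda>r. A * r - r * r powr \<gamma>) has_real_derivative A * 1 - (\<gamma> + 1) * r powr \<gamma>) (at r)"
      by (intro DERIV_diff DERIV_cmult DERIV_ident deriv_mult_powr \<open>r > 0\<close>)
    moreover have "(\<lambda>r. A * r - r * r powr \<gamma>) = pow_flux A \<gamma>"
      by (simp add: fun_eq_iff pow_flux_def algebra_simps)
    ultimately have "(pow_flux A \<gamma> has_real_derivative char_speed A \<gamma> r) (at r)"
      by (simp add: char_speed_def)
    then show ?thesis by (rule has_field_derivative_at_within)
  qed
  moreover have "at r within {0..} \<noteq> bot"
  proof -
    have "r islimpt {r<..<r + 1}" by (rule islimpt_greaterThanLessThan1) simp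
    then have "r islimpt {0..}" by (rule islimpt_subset) (use assms in auto)
    then show ?thesis by (simp add: trivial_limit_within)
  qed
  ultimately show ?thesis
    unfolding flux_deriv_def flux_velocity has_real_derivative_iff_has_vector_derivative
    by (intro vector_derivative_within)
qed

lemma borel_measurable_flux_deriv:
  assumes "\<gamma> > 0"
  shows "flux_deriv (velocity A \<gamma>) \<in> borel_measurable borel"
proof -
  \<comment> \<open>At negative arguments the filter is trivial, so the derivative there is one
    fixed unspecified value, the same for all of them. Measurability follows.\<close>
  have bot: "at r within {0..} = bot" if "r < 0" for r :: real
    using that by (simp add: at_within_eq_bot_iff)
  have "flux_deriv (velocity A \<gamma>) =
    (\<lambda>r. if r < 0 then vector_derivative (pow_flux A \<gamma>) bot else char_speed A \<gamma> r)"
    using flux_deriv_velocity[OF assms] by (auto simp: fun_eq_iff flux_deriv_def flux_velocity bot)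
  then show ?thesis by simp
qed

lemma pow_flux_concave:
  assumes "\<gamma> > 0" "0 \<le> p" "0 \<le> q"
  shows "pow_flux A \<gamma> p - pow_flux A \<gamma> q \<le> char_speed A \<gamma> q * (p - q)"
proof -
  have "(\<gamma> + 1) * q powr \<gamma> * (p - q) \<le> p * p powr \<gamma> - q * q powr \<gamma>"
  proof (cases "p = 0 \<or> q = 0 \<or> p = q")
    case True
    then show ?thesis using assms by (auto simp: algebra_simps)
  next
    case False
    then have pos: "0 < p" "0 < q" using assms by auto
    show ?thesis
    proof (cases "q < p")
      case True
      have "\<exists>z>q. z < p \<and> p * p powr \<gamma> - q * q powr \<gamma> = (p - q) * ((\<gamma> + 1) * z powr \<gamma>)"
        using True pos by (intro MVT2 deriv_mult_powr) auto
      then obtain z where z: "q < z" "p * p powr \<gamma> - q * q powr \<gamma> = (p - q) * ((\<gamma> + 1) * z powr \<gamma>)"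
        by blast
      have "(p - q) * ((\<gamma> + 1) * q powr \<gamma>) \<le> (p - q) * ((\<gamma> + 1) * z powr \<gamma>)"
        using z True assms by (intro mult_left_mono powr_mono2) auto
      then show ?thesis by (simp add: z mult.commute)
    next
      case False
      have "\<exists>z>p. z < q \<and> q * q powr \<gamma> - p * p powr \<gamma> = (q - p) * ((\<gamma> + 1) * z powr \<gamma>)"
        using False \<open>\<not> (p = 0 \<or> q = 0 \<or> p = q)\<close> pos by (intro MVT2 deriv_mult_powr) auto
      then obtain z where z: "p < z" "z < q" "q * q powr \<gamma> - p * p powr \<gamma> = (q - p) * ((\<gamma> + 1) * z powr \<gamma>)"
        by blast
      have "(q - p) * ((\<gamma> + 1) * z powr \<gamma>) \<le> (q - p) * ((\<gamma> + 1) * q powr \<gamma>)"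
        using z False pos assms by (intro mult_left_mono powr_mono2) auto
      then show ?thesis using z(3) by (simp add: algebra_simps)
    qed
  qed
  then show ?thesis by (simp add: pow_flux_def char_speed_def algebra_simps)
qed

definition speed_bound :: "real \<Rightarrow> real \<Rightarrow> real \<Rightarrow> real" where
  "speed_bound A \<gamma> C = \<bar>A\<bar> + (\<gamma> + 1) * C powr \<gamma>"

lemma speed_bound_nonneg: "\<gamma> > 0 \<Longrightarrow> 0 \<le> speed_bound A \<gamma> C"
  by (simp add: speed_bound_def)

lemma char_speed_bound:
  assumes "\<gamma> > 0" "0 \<le> r" "r \<le> C"
  shows "\<bar>char_speed A \<gamma> r\<bar> \<le> speed_bound A \<gamma> C"
proof -
  have "(\<gamma> + 1) * r powr \<gamma> \<le> (\<gamma> + 1) * C powr \<gamma>"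
    using assms by (intro mult_left_mono powr_mono2) auto
  moreover have "0 \<le> (\<gamma> + 1) * r powr \<gamma>" using assms by simp
  ultimately show ?thesis by (simp add: char_speed_def speed_bound_def abs_if)
qed

lemma pow_flux_bound:
  assumes "\<gamma> > 0" "0 \<le> r" "r \<le> C"
  shows "\<bar>pow_flux A \<gamma> r\<bar> \<le> speed_bound A \<gamma> C * r"
proof -
  have "r powr \<gamma> \<le> C powr \<gamma>" using assms by (intro powr_mono2) auto
  also have "\<dots> \<le> (\<gamma> + 1) * C powr \<gamma>" using assms by (simp add: algebra_simps)
  finally have "\<bar>A - r powr \<gamma>\<bar> \<le> speed_bound A \<gamma> C"    using abs_triangle_ineq4[of A "r powr \<gamma>"] by (simp add: speed_bound_def)
  then have "r * \<bar>A - r powr \<gamma>\<bar> \<le> r * speed_bound A \<gamma> C" using assms by (intro mult_left_mono) auto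
  then show ?thesis using assms by (simp add: pow_flux_def abs_mult mult.commute)
qed

section \<open>Integrals of products over the plane\<close>

lemma plane_integral:
  fixes f :: "real \<times> real \<Rightarrow> real"
  assumes "integrable (lborel \<Otimes>\<^sub>M lborel) f"
  shows "(LINT z|lborel. f z) = (LINT t|lborel. LINT x|lborel. f (x, t))"
    "(LINT z|lborel. f z) = (LINT x|lborel. LINT t|lborel. f (x, t))"
  using lborel_pair.integral_snd[of "\<lambda>x t. f (x, t)"] lborel_pair.integral_fst'[of f] assms
  by (simp_all add: lborel_prod)

lemma tensor_integrable:
  fixes g h :: "real \<Rightarrow> real" and U :: "real \<times> real \<Rightarrow> real"
  assumes [measurable]: "U \<in> borel_measurable borel" "g \<in> borel_measurable borel" "h \<in> borel_measurable borel"
    and U: "\<And>z. \<bar>U z\<bar> \<le> K"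
    and g: "\<And>x. \<bar>g x\<bar> \<le> G" "\<And>x. x \<notin> {a..b} \<Longrightarrow> g x = 0"
    and h: "\<And>x. \<bar>h x\<bar> \<le> L" "\<And>x. x \<notin> {c..d} \<Longrightarrow> h x = 0"
  shows "integrable (lborel \<Otimes>\<^sub>M lborel) (\<lambda>z. U z * (g (fst z) * h (snd z)))"
proof (rule integrable_product_bound[where f = "\<lambda>z. U z * (g (fst z) * h (snd z))"
      and g = "\<lambda>x. K * G * indicator {a..b} x" and h = "\<lambda>x. L * indicator {c..d} x"])
  have "(\<lambda>z. g (fst z) * h (snd z)) \<in> borel_measurable (borel \<Otimes>\<^sub>M borel)" by measurable
  then show "(\<lambda>z. U z * (g (fst z) * h (snd z))) \<in> borel_measurable borel"
    using assms(1) unfolding borel_prod by (rule borel_measurable_times[rotated])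
  show "integrable lborel (\<lambda>x. K * G * indicator {a..b} x)" "integrable lborel (\<lambda>x. L * indicator {c..d} x)"
    by (auto simp: emeasure_lborel_Icc_eq)
  fix x t
  have "0 \<le> K" "0 \<le> G" using U[of 0] g(1)[of 0] by linarith+
  show "\<bar>U (x, t) * (g (fst (x, t)) * h (snd (x, t)))\<bar> \<le> K * G * indicator {a..b} x * (L * indicator {c..d} t)"
  proof (cases "x \<in> {a..b} \<and> t \<in> {c..d}")
    case True
    have "\<bar>U (x, t)\<bar> * (\<bar>g x\<bar> * \<bar>h t\<bar>) \<le> K * (G * L)"
      using U g(1) h(1) \<open>0 \<le> K\<close> \<open>0 \<le> G\<close> by (intro mult_mono) auto
    then show ?thesis using True by (simp add: abs_mult)
  next
    case False
    then have "g x * h t = 0" "indicator {a..b} x * indicator {c..d} t = (0 :: real)"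
      using g(2) h(2) by (auto simp: indicator_def)
    then show ?thesis by auto
  qed
qed

text \<open>The passage from smooth test functions to trapezoids and their discontinuous
  derivatives: pointwise limits with common bounds and common supports, so a multiple of the
  indicator of a rectangle dominates.\<close>

lemma tensor_limit:
  fixes g h :: "nat \<Rightarrow> real \<Rightarrow> real" and g' h' :: "real \<Rightarrow> real"
  assumes [measurable]: "U \<in> borel_measurable borel"
      "\<And>m. g m \<in> borel_measurable borel" "\<And>m. h m \<in> borel_measurable borel"
    and U: "\<And>z. \<bar>U z\<bar> \<le> K"
    and g: "\<And>m x. \<bar>g m x\<bar> \<le> G" "\<And>m x. x \<notin> {a..b} \<Longrightarrow> g m x = 0" "\<And>x. (\<lambda>m. g m x) \<longlonglongrightarrow> g' x"
    and h: "\<And>m x. \<bar>h m x\<bar> \<le> L" "\<And>m x. x \<notin> {c..d} \<Longrightarrow> h m x = 0" "\<And>x. (\<lambda>m. h m x) \<longlonglongrightarrow> h' x"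
  shows "(\<lambda>m. LINT z|lborel. U z * (g m (fst z) * h m (snd z)))
    \<longlonglongrightarrow> (LINT t|lborel. (LINT x|lborel. U (x, t) * g' x) * h' t)"
proof -
  have g'_meas[measurable]: "g' \<in> borel_measurable borel"
    by (rule borel_measurable_LIMSEQ_real[of _ g]) (use g in auto)
  have h'_meas[measurable]: "h' \<in> borel_measurable borel"
    by (rule borel_measurable_LIMSEQ_real[of _ h]) (use h in auto)
  have g': "\<bar>g' x\<bar> \<le> G" "x \<notin> {a..b} \<Longrightarrow> g' x = 0" for x
  proof -
    show "\<bar>g' x\<bar> \<le> G" by (rule LIMSEQ_le_const2[OF tendsto_rabs[OF g(3)]]) (use g(1) in auto)
    show "x \<notin> {a..b} \<Longrightarrow> g' x = 0" using LIMSEQ_unique[OF g(3)[of x]] g(2) by simp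
  qed
  have h': "\<bar>h' x\<bar> \<le> L" "x \<notin> {c..d} \<Longrightarrow> h' x = 0" for x
  proof -
    show "\<bar>h' x\<bar> \<le> L" by (rule LIMSEQ_le_const2[OF tendsto_rabs[OF h(3)]]) (use h(1) in auto)
    show "x \<notin> {c..d} \<Longrightarrow> h' x = 0" using LIMSEQ_unique[OF h(3)[of x]] h(2) by simp
  qed
  have KGL: "0 \<le> K" "0 \<le> G" "0 \<le> L" using U[of 0] g(1)[of 0 0] h(1)[of 0 0] by linarith+
  have int: "integrable (lborel \<Otimes>\<^sub>M lborel) (\<lambda>z. U z * (g m (fst z) * h m (snd z)))" for m
    by (rule tensor_integrable[OF _ _ _ U g(1,2) h(1,2)]) auto
  have int': "integrable (lborel \<Otimes>\<^sub>M lborel) (\<lambda>z. U z * (g' (fst z) * h' (snd z)))"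
    by (rule tensor_integrable[OF _ _ _ U g' h']) auto
  have one: "integrable (lborel \<Otimes>\<^sub>M lborel) (\<lambda>z::real\<times>real. K * G * L * (indicator {a..b} (fst z) * indicator {c..d} (snd z)))"
    by (rule tensor_integrable[where K = "K * G * L" and G = 1 and L = 1 and a = a and b = b and c = c and d = d])
       (use KGL in \<open>auto simp: indicator_def\<close>)
  have "(\<lambda>m. LINT z|(lborel \<Otimes>\<^sub>M lborel). U z * (g m (fst z) * h m (snd z)))
    \<longlonglongrightarrow> (LINT z|(lborel \<Otimes>\<^sub>M lborel). U z * (g' (fst z) * h' (snd z)))"
  proof (rule integral_dominated_convergence[OF _ _ one])
    show "AE z in lborel \<Otimes>\<^sub>M lborel. (\<lambda>m. U z * (g m (fst z) * h m (snd z))) \<longlonglongrightarrow> U z * (g' (fst z) * h' (snd z))"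
      by (intro AE_I2 tendsto_intros g h)
    fix m
    show "AE z in lborel \<Otimes>\<^sub>M lborel. norm (U z * (g m (fst z) * h m (snd z)))
       \<le> K * G * L * (indicator {a..b} (fst z) * indicator {c..d} (snd z))"
    proof (rule AE_I2)
      fix z :: "real \<times> real"
      show "norm (U z * (g m (fst z) * h m (snd z)))
         \<le> K * G * L * (indicator {a..b} (fst z) * indicator {c..d} (snd z))"
      proof (cases "fst z \<in> {a..b} \<and> snd z \<in> {c..d}")
        case True
        have "\<bar>U z\<bar> * (\<bar>g m (fst z)\<bar> * \<bar>h m (snd z)\<bar>) \<le> K * (G * L)"
          using U g(1) h(1) KGL by (intro mult_mono) auto
        then show ?thesis using True by (simp add: abs_mult)
      next
        case False
        then have 0: "U z * (g m (fst z) * h m (snd z)) = 0" using g(2) h(2) by auto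
        show ?thesis unfolding 0 using KGL by simp
      qed
    qed
  qed (use int int' in auto)
  moreover have "(LINT z|lborel. U z * (g' (fst z) * h' (snd z)))
    = (LINT t|lborel. (LINT x|lborel. U (x, t) * g' x) * h' t)"
    unfolding plane_integral(1)[OF int'] by (simp add: mult.assoc[symmetric])
  ultimately show ?thesis by (simp add: lborel_prod)
qed

text \<open>\<open>ramp d (x - a)\<close> is the length of the part of (a, a + d) lying to the left
  of x; exchanging the integrals turns it into a mean of tails.\<close>

lemma integral_ramp:
  assumes f: "integrable lborel f" and "0 \<le> d"
  shows "(LINT x|lborel. f x * ramp d (x - a)) = (LINT y:{a<..<a + d}|lborel. tail f y)"
proof -
  have [measurable]: "f \<in> borel_measurable borel" using f by auto
  let ?F = "\<lambda>z. f (fst z) * (indicator {a<..<a + d} (snd z) * indicator {z. snd z < fst z} z)"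
  have int: "integrable (lborel \<Otimes>\<^sub>M lborel) ?F"
  proof (rule integrable_product_bound[where f = ?F and g = "\<lambda>x. \<bar>f x\<bar>" and h = "indicator {a<..<a + d}"])
    have "open {z::real \<times> real. snd z < fst z}" by (intro open_Collect_less continuous_intros)
    from borel_open[OF this] have [measurable]: "{z::real \<times> real. snd z < fst z} \<in> sets (borel \<Otimes>\<^sub>M borel)"
      unfolding borel_prod .
    show "?F \<in> borel_measurable borel"
      unfolding borel_prod[symmetric] by measurable
    show "integrable lborel (\<lambda>x. \<bar>f x\<bar>)" using f by simp
    show "integrable lborel (indicator {a<..<a + d} :: real \<Rightarrow> real)" using \<open>0 \<le> d\<close> by simp
  qed (auto simp: indicator_def)
  have meas: "(LINT y|lborel. indicator {a<..<a + d} y * indicator {z. snd z < fst z} (x, y)) = ramp d (x - a)" for x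
  proof -
    have "(LINT y|lborel. indicator {a<..<a + d} y * indicator {z. snd z < fst z} (x, y) :: real)
      = (LINT y|lborel. indicator ({a<..<a + d} \<inter> {..<x}) y)"
      by (intro Bochner_Integration.integral_cong) (auto simp: indicator_def)
    also have "\<dots> = measure lborel ({a<..<a + d} \<inter> {..<x})" by simp
    also have "{a<..<a + d} \<inter> {..<x} = {a<..<min (a + d) x}" by auto
    also have "measure lborel {a<..<min (a + d) x} = ramp d (x - a)"
      using \<open>0 \<le> d\<close> by (cases "a \<le> min (a + d) x") (auto simp: ramp_def measure_def)
    finally show ?thesis .
  qed
  have "(LINT x|lborel. f x * ramp d (x - a)) = (LINT x|lborel. LINT y|lborel. ?F (x, y))"
    by (simp add: meas)
  also have "\<dots> = (LINT y|lborel. LINT x|lborel. ?F (x, y))"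
    using plane_integral[OF int] by simp
  also have "\<dots> = (LINT y:{a<..<a + d}|lborel. tail f y)"
    unfolding set_lebesgue_integral_def tail_def
  proof (intro Bochner_Integration.integral_cong refl)
    fix y
    have "(LINT x|lborel. ?F (x, y)) = (LINT x|lborel. indicator {a<..<a + d} y * (indicator {y<..} x *\<^sub>R f x))"
      by (intro Bochner_Integration.integral_cong) (auto simp: indicator_def)
    then show "(LINT x|lborel. ?F (x, y)) = indicator {a<..<a + d} y *\<^sub>R (LINT x|lborel. indicator {y<..} x *\<^sub>R f x)"
      by simp
  qed
  finally show ?thesis .
qed

lemma integral_trap:
  assumes "0 \<le> d" "a \<le> c"
  shows "(LINT x|lborel. trap d a c x) = d * (c - a)"
proof -
  \<comment> \<open>The indicator of the support serves as the density in
    \<open>integral_ramp\<close>; its tail is affine there, and the two ramps differ by a shift of c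
    - a.\<close>
  let ?f = "indicator {a..c + d} :: real \<Rightarrow> real"
  have f: "integrable lborel ?f" using assms by simp
  have tl: "tail ?f y = c + d - y" if "a \<le> y" "y \<le> c + d" for y
  proof -
    have "tail ?f y = (LINT x|lborel. indicator {y<..c + d} x)"
      unfolding tail_def set_lebesgue_integral_def using that
      by (intro Bochner_Integration.integral_cong) (auto simp: indicator_def)
    then show ?thesis using that by simp
  qed
  have li: "locally_integrable (\<lambda>y. tail ?f y)"
  proof (rule locally_integrable_bounded[OF _ tail_bound[OF f]])
    have "1-lipschitz_on UNIV (tail ?f)"
      using prim_lipschitz[of ?f 1] by (auto simp: lipschitz_on_def dist_real_def tail_diff[OF f] indicator_def abs_minus_commute)
    then show "tail ?f \<in> borel_measurable borel"
      by (intro borel_measurable_continuous_onI lipschitz_on_continuous_on)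
  qed
  have bd: "integrable lborel (\<lambda>x. ?f x * ramp d (x - b))" for b
  proof (rule Bochner_Integration.integrable_bound)
    show "integrable lborel (\<lambda>x. ?f x * d)" using f by simp
    show "(\<lambda>x. ?f x * ramp d (x - b)) \<in> borel_measurable lborel" unfolding ramp_def by measurable
  qed (use assms in \<open>auto simp: ramp_def indicator_def\<close>)
  have "(LINT x|lborel. trap d a c x) = (LINT x|lborel. ?f x * ramp d (x - a) - ?f x * ramp d (x - c))"
    using assms trap_eq_0[of a c d]
    by (intro Bochner_Integration.integral_cong) (auto simp: indicator_def trap_def)
  also have "\<dots> = (LINT y:{a<..<a + d}|lborel. tail ?f y) - (LINT y:{c<..<c + d}|lborel. tail ?f y)"
    using bd by (simp add: integral_ramp[OF f assms(1)])
  also have "(LINT y:{c<..<c + d}|lborel. tail ?f y) = (LINT y:{a<..<a + d}|lborel. tail ?f y - (c - a))"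
  proof -
    have "(LINT y:{c<..<c + d}|lborel. tail ?f y)
      = (LINT y|lborel. indicator {c<..<c + d} ((c - a) + 1 * y) *\<^sub>R tail ?f ((c - a) + 1 * y))"
      unfolding set_lebesgue_integral_def
      using lborel_integral_real_affine[of 1 "\<lambda>y. indicator {c<..<c + d} y *\<^sub>R tail ?f y" "c - a"] by simp
    also have "\<dots> = (LINT y|lborel. indicator {a<..<a + d} y *\<^sub>R (tail ?f y - (c - a)))"
      using assms by (intro Bochner_Integration.integral_cong) (auto simp: indicator_def tl)
    finally show ?thesis by (simp add: set_lebesgue_integral_def)
  qed
  also have "(LINT y:{a<..<a + d}|lborel. tail ?f y) - \<dots> = (LINT y:{a<..<a + d}|lborel. tail ?f y - (tail ?f y - (c - a)))"
    using locally_integrable_subset[OF li, of "{a<..<a + d}" a "a + d"] assms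
    by (intro set_integral_diff(2)[symmetric] set_integral_diff(1)) (auto simp: subset_eq set_integrable_def)
  also have "\<dots> = d * (c - a)" using assms by (simp add: set_lebesgue_integral_def)
  finally show ?thesis .
qed

subsection \<open>Uniqueness of classical entropy solutions\<close>

text \<open>The exceptional times depend on the points of evaluation, so only countably many pairs
  can be treated at once. Continuity of the primitive recovers the others, first in y and then in
  d.\<close>

lemma second_difference_of_rationals:
  fixes P :: "real \<Rightarrow> real"
  assumes P: "continuous_on UNIV P"
    and rat: "\<And>y d. y \<in> \<rat> \<Longrightarrow> d \<in> \<rat> \<Longrightarrow> 0 < d \<Longrightarrow> (P (y + d) - P y) - (P y - P (y - d)) \<le> l * d\<^sup>2"
    and "0 < d"
  shows "(P (y + d) - P y) - (P y - P (y - d)) \<le> l * d\<^sup>2"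
proof -
  have comp: "continuous_on UNIV (\<lambda>x. P (f x))" if "continuous_on UNIV f" for f :: "real \<Rightarrow> real"
    using continuous_on_compose2[OF P that] by auto
  have 1: "(P (y + d) - P y) - (P y - P (y - d)) \<le> l * d\<^sup>2" if d: "d \<in> \<rat>" "0 < d" for y d
  proof -
    have "closed {y. (P (y + d) - P y) - (P y - P (y - d)) \<le> l * d\<^sup>2}"
      by (intro closed_Collect_le continuous_intros comp)
    moreover have "\<rat> \<subseteq> {y. (P (y + d) - P y) - (P y - P (y - d)) \<le> l * d\<^sup>2}"
      using rat d by auto
    ultimately have "closure \<rat> \<subseteq> {y. (P (y + d) - P y) - (P y - P (y - d)) \<le> l * d\<^sup>2}"
      by (rule closure_minimal[rotated])
    then show ?thesis by (auto simp: Rats_closure_real)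
  qed
  \<comment> \<open>The absolute value makes the condition meaningful for every real d, so that the
    density of the rationals in the whole line applies.\<close>
  let ?S = "{d. (P (y + \<bar>d\<bar>) - P y) - (P y - P (y - \<bar>d\<bar>)) \<le> l * d\<^sup>2}"
  have "closed ?S"
    by (intro closed_Collect_le continuous_intros comp)
  moreover have "\<rat> \<subseteq> ?S"
  proof
    fix d :: real assume "d \<in> \<rat>"
    then have "\<bar>d\<bar> \<in> \<rat>" by (simp add: abs_if)
    then show "d \<in> ?S" using 1[of "\<bar>d\<bar>" y] by (cases "d = 0") auto
  qed
  ultimately have "closure \<rat> \<subseteq> ?S" by (rule closure_minimal[rotated])
  then have "d \<in> ?S" unfolding Rats_closure_real by blast
  then show ?thesis using \<open>0 < d\<close> by simp
qed

text \<open>A representative for which the bounds hold at every point and at every time, so that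
  each time section can be integrated. A single C bounds the values and the mass.\<close>

locale clean_solution =
  fixes A \<gamma> C :: real and g :: "real \<Rightarrow> real" and r :: "real \<times> real \<Rightarrow> real"
  assumes \<gamma>_pos: "\<gamma> > 0" and C_nonneg: "0 \<le> C"
    and r_meas[measurable]: "r \<in> borel_measurable borel"
    and r_nonneg: "\<And>z. 0 \<le> r z" and r_le: "\<And>z. r z \<le> C"
    and r_int: "\<And>t. integrable lborel (\<lambda>x. r (x, t))"
    and r_mass: "\<And>t. (LINT x|lborel. r (x, t)) \<le> C"
    and weak: "\<And>\<phi>. test_function \<phi> \<Longrightarrow>
      (LINT z|lborel. r z * partial_t \<phi> z + pow_flux A \<gamma> (r z) * partial_x \<phi> z) = 0"
    and trace: "weak_star_trace r g"
    and entropy: "\<And>\<phi>. test_function \<phi> \<Longrightarrow> (\<And>z. 0 \<le> \<phi> z) \<Longrightarrow>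
      - (LINT z:UNIV \<times> {0<..}|lborel. 1 / snd z * \<phi> z)
        \<le> (LINT z:UNIV \<times> {0<..}|lborel. char_speed A \<gamma> (r z) * partial_x \<phi> z)"
begin

abbreviation K :: real where "K \<equiv> speed_bound A \<gamma> C"

lemma K_nonneg: "0 \<le> K" using \<gamma>_pos by (rule speed_bound_nonneg)

lemma flux_le: "\<bar>pow_flux A \<gamma> (r z)\<bar> \<le> K * r z"
  using pow_flux_bound[OF \<gamma>_pos r_nonneg r_le] .

lemma flux_bd: "\<bar>pow_flux A \<gamma> (r z)\<bar> \<le> K * C"
  using flux_le[of z] mult_left_mono[OF r_le K_nonneg] by (meson order_trans)

lemma speed_bd: "\<bar>char_speed A \<gamma> (r z)\<bar> \<le> K"
  using char_speed_bound[OF \<gamma>_pos r_nonneg r_le] .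

lemma r_bd: "\<bar>r z\<bar> \<le> C" using r_nonneg[of z] r_le[of z] by simp

text \<open>With \<open>flow\<close> and \<open>slope\<close> below: the weak formulations tested in
  space alone. In time, \<open>mass\<close> has the distributional derivative \<open>flow\<close>,
  and the entropy condition becomes a lower bound for \<open>t * slope d a c t\<close> by minus the
  integral of the trapezoid.\<close>

definition mass :: "real \<Rightarrow> real \<Rightarrow> real \<Rightarrow> real \<Rightarrow> real" where
  "mass d a c t = (LINT x|lborel. r (x, t) * trap d a c x)"

definition flow :: "real \<Rightarrow> real \<Rightarrow> real \<Rightarrow> real \<Rightarrow> real" where
  "flow d a c t = (LINT x|lborel. pow_flux A \<gamma> (r (x, t)) * trap' d a c x)"

definition slope :: "real \<Rightarrow> real \<Rightarrow> real \<Rightarrow> real \<Rightarrow> real" where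
  "slope d a c t = (LINT x|lborel. char_speed A \<gamma> (r (x, t)) * trap' d a c x)"

lemma borel_measurable_mass [measurable]: "mass d a c \<in> borel_measurable borel"
  unfolding mass_def by measurable

lemma borel_measurable_flow [measurable]: "flow d a c \<in> borel_measurable borel"
  unfolding flow_def by measurable

lemma borel_measurable_slope [measurable]: "slope d a c \<in> borel_measurable borel"
  unfolding slope_def by measurable

lemma mass_bound:
  assumes "a \<le> c" "0 \<le> d" shows "\<bar>mass d a c t\<bar> \<le> C * d"
proof -
  have "\<bar>mass d a c t\<bar> \<le> (LINT x|lborel. \<bar>r (x, t) * trap d a c x\<bar>)"
    unfolding mass_def by (rule integral_abs_bound)
  also have "\<dots> \<le> (LINT x|lborel. r (x, t) * d)"
    using r_int trap_bounds[OF assms] r_nonneg assms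
    by (intro integral_mono') (auto simp: abs_mult intro!: mult_left_mono)
  also have "\<dots> \<le> C * d" using r_mass[of t] assms by (simp add: mult_right_mono)
  finally show ?thesis .
qed

lemma integral_trap'_bound:
  assumes "0 \<le> d" "0 \<le> B" "locally_integrable p" "\<And>x. \<bar>p x\<bar> \<le> B" "p \<in> borel_measurable borel"
  shows "\<bar>LINT x|lborel. p x * trap' d a c x\<bar> \<le> 2 * B * d"
  using prim_lipschitz[OF assms(5,4), of "a + d" a] prim_lipschitz[OF assms(5,4), of "c + d" c] assms
  by (simp add: integral_trap')

lemma flow_bound:
  assumes "0 \<le> d" shows "\<bar>flow d a c t\<bar> \<le> 2 * (K * C) * d"
proof -
  have [measurable]: "(\<lambda>x. pow_flux A \<gamma> (r (x, t))) \<in> borel_measurable borel" by measurable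
  show ?thesis unfolding flow_def
    using assms K_nonneg C_nonneg flux_bd
    by (intro integral_trap'_bound locally_integrable_bounded[where B = "K * C"]) auto
qed

lemma slope_bound:
  assumes "0 \<le> d" shows "\<bar>slope d a c t\<bar> \<le> 2 * K * d"
proof -
  have [measurable]: "(\<lambda>x. char_speed A \<gamma> (r (x, t))) \<in> borel_measurable borel" by measurable
  show ?thesis unfolding slope_def
    using assms K_nonneg speed_bd
    by (intro integral_trap'_bound locally_integrable_bounded[where B = K]) auto
qed

lemma borel_measurable_Ck: "(\<And>k. Ck k f) \<Longrightarrow> f \<in> borel_measurable borel"
  by (rule borel_measurable_continuous_onI) (rule Ck_continuous)

lemma trapezoid_identity:
  assumes "a \<le> c" "0 < d" "0 < d'" "0 < s" "s < s'"
  shows "(LINT t|lborel. mass d a c t * trap' d' s s' t) + (LINT t|lborel. flow d a c t * trap d' s s' t) = 0"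
proof -
  define \<phi> where "\<phi> m = (\<lambda>(x, t). smooth_trap m d a c x * smooth_trap m d' s s' t)" for m
  have test: "test_function (\<phi> m)" for m
    unfolding \<phi>_def using assms smooth_trap_eq_0
    by (intro test_function_tensor[where a = a and b = "c + d" and c = s and d = "s' + d'"] Ck_smooth_trap) auto
  have [measurable]: "smooth_trap m d a c \<in> borel_measurable borel" "smooth_trap' m d a c \<in> borel_measurable borel" for m d a c
    by (auto intro: borel_measurable_Ck Ck_smooth_trap Ck_smooth_trap')
  have b: "\<bar>smooth_trap m d a c x\<bar> \<le> d" "\<bar>smooth_trap m d' s s' x\<bar> \<le> d'" for m x
    using smooth_trap_bounds[of a c d m x] smooth_trap_bounds[of s s' d' m x] assms by auto
  have z: "x \<notin> {a..c + d} \<Longrightarrow> smooth_trap m d a c x = 0" "x \<notin> {a..c + d} \<Longrightarrow> smooth_trap' m d a c x = 0"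
     "x \<notin> {s..s' + d'} \<Longrightarrow> smooth_trap m d' s s' x = 0" "x \<notin> {s..s' + d'} \<Longrightarrow> smooth_trap' m d' s s' x = 0" for m x
    using assms smooth_trap_eq_0 smooth_trap'_eq_0 by auto
  have "(\<lambda>m. LINT z|lborel. r z * (smooth_trap m d a c (fst z) * smooth_trap' m d' s s' (snd z)))
    \<longlonglongrightarrow> (LINT t|lborel. (LINT x|lborel. r (x, t) * trap d a c x) * trap' d' s s' t)"
    by (rule tensor_limit[OF _ _ _ r_bd b(1) z(1) smooth_trap_tendsto[OF assms(2)] smooth_trap'_bound z(4) smooth_trap'_tendsto]) auto
  moreover have "(\<lambda>m. LINT z|lborel. pow_flux A \<gamma> (r z) * (smooth_trap' m d a c (fst z) * smooth_trap m d' s s' (snd z)))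
    \<longlonglongrightarrow> (LINT t|lborel. (LINT x|lborel. pow_flux A \<gamma> (r (x, t)) * trap' d a c x) * trap d' s s' t)"
    by (rule tensor_limit[OF _ _ _ flux_bd smooth_trap'_bound z(2) smooth_trap'_tendsto b(2) z(3) smooth_trap_tendsto[OF assms(3)]]) auto
  ultimately have "(\<lambda>m. (LINT z|lborel. r z * (smooth_trap m d a c (fst z) * smooth_trap' m d' s s' (snd z)))
      + (LINT z|lborel. pow_flux A \<gamma> (r z) * (smooth_trap' m d a c (fst z) * smooth_trap m d' s s' (snd z))))
    \<longlonglongrightarrow> (LINT t|lborel. mass d a c t * trap' d' s s' t) + (LINT t|lborel. flow d a c t * trap d' s s' t)"
    unfolding mass_def flow_def by (rule tendsto_add)
  moreover have "(LINT z|lborel. r z * (smooth_trap m d a c (fst z) * smooth_trap' m d' s s' (snd z)))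
      + (LINT z|lborel. pow_flux A \<gamma> (r z) * (smooth_trap' m d a c (fst z) * smooth_trap m d' s s' (snd z))) = 0" for m
  proof -
    have 1: "integrable (lborel \<Otimes>\<^sub>M lborel) (\<lambda>z. r z * (smooth_trap m d a c (fst z) * smooth_trap' m d' s s' (snd z)))"
      by (rule tensor_integrable[OF _ _ _ r_bd b(1) z(1) smooth_trap'_bound z(4)]) auto
    have 2: "integrable (lborel \<Otimes>\<^sub>M lborel) (\<lambda>z. pow_flux A \<gamma> (r z) * (smooth_trap' m d a c (fst z) * smooth_trap m d' s s' (snd z)))"
      by (rule tensor_integrable[OF _ _ _ flux_bd smooth_trap'_bound z(2) b(2) z(3)]) auto
    have "(LINT z|lborel. r z * partial_t (\<phi> m) z + pow_flux A \<gamma> (r z) * partial_x (\<phi> m) z) = 0"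
      by (rule weak[OF test])
    then have "(LINT z|lborel. r z * (smooth_trap m d a c (fst z) * smooth_trap' m d' s s' (snd z))
      + pow_flux A \<gamma> (r z) * (smooth_trap' m d a c (fst z) * smooth_trap m d' s s' (snd z))) = 0"
      unfolding \<phi>_def partial_tensor[OF deriv_smooth_trap deriv_smooth_trap] by (simp add: split_beta')
    then show ?thesis using 1 2 by (simp add: lborel_prod)
  qed
  ultimately show ?thesis by (simp add: LIMSEQ_const_iff)
qed

lemma mass_evolution:
  assumes "a \<le> c" "0 < d"
  shows "\<exists>N\<in>null_sets lborel. \<forall>t>0. t \<notin> N \<longrightarrow>
    mass d a c t - (LINT x|lborel. trap d a c x * g x) = prim (flow d a c) t"
proof -
  define B where "B = max (C * d) (2 * (K * C) * d)"
  have mB: "\<bar>mass d a c t\<bar> \<le> B" and fB: "\<bar>flow d a c t\<bar> \<le> B" for t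
    using mass_bound[of a c d t] flow_bound[of d a c t] assms by (auto simp: B_def)
  obtain N1 where N1: "N1 \<in> null_sets lborel" and incr: "\<And>s s'. 0 < s \<Longrightarrow> s < s' \<Longrightarrow> s \<notin> N1 \<Longrightarrow> s' \<notin> N1 \<Longrightarrow>
      mass d a c s' - mass d a c s = prim (flow d a c) s' - prim (flow d a c) s"
    using AE_primitive_of_trapezoids[OF borel_measurable_mass mB borel_measurable_flow fB trapezoid_identity[OF assms]]
    by blast
  have cont: "continuous_on UNIV (trap d a c)"
    unfolding trap_def ramp_def by (intro continuous_intros)
  have "{x. trap d a c x \<noteq> 0} \<subseteq> {a..c + d}" using trap_eq_0[of a c d] assms by force
  then have "closure {x. trap d a c x \<noteq> 0} \<subseteq> {a..c + d}" by (intro closure_minimal) auto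
  then have "compact (closure {x. trap d a c x \<noteq> 0})"
    by (metis bounded_closed_interval bounded_subset closed_closure compact_eq_bounded_closed)
  then obtain N2 where N2: "N2 \<in> null_sets lborel" and lim:
      "((\<lambda>t. LINT x|lborel. trap d a c x * r (x, t)) \<longlongrightarrow> (LINT x|lborel. trap d a c x * g x)) (at 0 within ({0<..} - N2))"
    using trace cont unfolding weak_star_trace_def by blast
  let ?N = "N1 \<union> N2"
  have N: "?N \<in> null_sets lborel" using N1 N2 by (rule null_sets.Un)
  show ?thesis
  proof (intro bexI[OF _ N] allI impI)
    fix t :: real assume t: "0 < t" "t \<notin> ?N"
    \<comment> \<open>Times tending to 0 that avoid both exceptional sets: along them the evolution
      identity and the initial trace hold together, which extends the identity down to time
      0.\<close>
    have "\<exists>s. 0 < s \<and> s < min t (1 / real (Suc k)) \<and> s \<notin> ?N" for k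
      using not_null_open_interval[OF N, of 0 "min t (1 / real (Suc k))"] t by auto
    then obtain s where s: "\<And>k. 0 < s k" "\<And>k. s k < t" "\<And>k. s k < 1 / real (Suc k)" "\<And>k. s k \<notin> ?N"
      by (metis min_less_iff_conj)
    have s0: "s \<longlonglongrightarrow> 0"
      by (rule tendsto_sandwich[OF _ _ tendsto_const LIMSEQ_Suc[OF lim_1_over_n]])
         (use less_imp_le[OF s(1)] less_imp_le[OF s(3)] in \<open>auto intro: always_eventually\<close>)
    have "filterlim s (at 0 within ({0<..} - N2)) sequentially"
      unfolding filterlim_at using s0 s by (auto intro!: always_eventually simp: less_imp_neq[THEN not_sym])
    from filterlim_compose[OF lim this]
    have l1: "(\<lambda>k. mass d a c (s k)) \<longlonglongrightarrow> (LINT x|lborel. trap d a c x * g x)"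
      by (simp add: mass_def mult.commute)
    have "B-lipschitz_on UNIV (prim (flow d a c))"
      using prim_lipschitz[OF borel_measurable_flow fB] fB[of 0]
      by (auto simp: lipschitz_on_def dist_real_def abs_minus_commute)
    then have "isCont (prim (flow d a c)) 0"
      using lipschitz_on_continuous_on continuous_on_eq_continuous_at by blast
    from isCont_tendsto_compose[OF this s0]
    have "(\<lambda>k. mass d a c t - (prim (flow d a c) t - prim (flow d a c) (s k))) \<longlonglongrightarrow>
        mass d a c t - (prim (flow d a c) t - 0)"
      by (intro tendsto_diff tendsto_const) simp
    moreover have "mass d a c t - (prim (flow d a c) t - prim (flow d a c) (s k)) = mass d a c (s k)" for k
      using incr[of "s k" t] s[of k] t by auto
    ultimately have "(\<lambda>k. mass d a c (s k)) \<longlonglongrightarrow> mass d a c t - prim (flow d a c) t" by simp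
    from LIMSEQ_unique[OF l1 this]
    show "mass d a c t - (LINT x|lborel. trap d a c x * g x) = prim (flow d a c) t" by simp
  qed
qed

lemma slope_ge:
  assumes "a \<le> c" "0 < d"
  shows "AE t in lborel. 0 < t \<longrightarrow> 0 \<le> t * slope d a c t + d * (c - a)"
proof (rule AE_nonneg_of_integrals)
  show li: "locally_integrable (\<lambda>t. t * slope d a c t + d * (c - a))"
    unfolding locally_integrable_def set_integrable_def
  proof (intro allI integrableI_bounded_set_indicator)
    fix p q :: real
    show "AE t in lborel. t \<in> {p..q} \<longrightarrow> norm (t * slope d a c t + d * (c - a))
        \<le> (\<bar>p\<bar> + \<bar>q\<bar>) * (2 * K * d) + d * (c - a)"
    proof (intro AE_I2 impI)
      fix t assume "t \<in> {p..q}"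
      then have "\<bar>t\<bar> * \<bar>slope d a c t\<bar> \<le> (\<bar>p\<bar> + \<bar>q\<bar>) * (2 * K * d)"
        using slope_bound[of d a c t] assms by (intro mult_mono) auto
      moreover have "0 \<le> d * (c - a)" using assms by simp
      ultimately show "norm (t * slope d a c t + d * (c - a)) \<le> (\<bar>p\<bar> + \<bar>q\<bar>) * (2 * K * d) + d * (c - a)"
        using abs_triangle_ineq[of "t * slope d a c t" "d * (c - a)"] assms by (simp add: abs_mult)
    qed
  qed (auto simp: emeasure_lborel_Icc_eq)
  fix s s' :: real assume s: "0 < s" "s < s'"
  \<comment> \<open>The factor t cancels the weight 1/t of the entropy condition, leaving a bump
    that tends to the indicator of (s, s').\<close>
  define h where "h m t = t * bump m s s' t" for m t
  define \<phi> where "\<phi> m = (\<lambda>(x, t). smooth_trap m d a c x * h m t)" for m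
  have h_Ck: "Ck k (h m)" for k m
    unfolding h_def[abs_def] by (intro Ck_mult Ck_id Ck_bump)
  have h_0: "t \<notin> {s..s'} \<Longrightarrow> h m t = 0" and b_0: "t \<notin> {s..s'} \<Longrightarrow> bump m s s' t = 0" for m t
    by (auto simp: h_def bump_eq_0)
  have h_bd: "\<bar>h m t\<bar> \<le> s'" for m t
  proof (cases "t \<in> {s..s'}")
    case True
    then have "\<bar>t\<bar> * \<bar>bump m s s' t\<bar> \<le> s' * 1"
      using bump_bounds[of m s s' t] s by (intro mult_mono) auto
    then show ?thesis by (simp add: h_def abs_mult)
  qed (use h_0 s in auto)
  have bump_bd: "\<bar>bump m s s' t\<bar> \<le> 1" for m t using bump_bounds[of m s s' t] by auto
  have h_lim: "(\<lambda>m. h m t) \<longlonglongrightarrow> t * indicator {s<..<s'} t" for t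
    unfolding h_def by (intro tendsto_intros bump_tendsto)
  have test: "test_function (\<phi> m)" for m
    unfolding \<phi>_def using assms s smooth_trap_eq_0 h_0
    by (intro test_function_tensor[where a = a and b = "c + d" and c = s and d = s'] Ck_smooth_trap h_Ck) auto
  have \<phi>_nonneg: "0 \<le> \<phi> m z" for m z
    using smooth_trap_bounds(1)[of a c d m "fst z"] bump_bounds(1)[of m s s' "snd z"] assms b_0[of "snd z" m] s
    by (cases "snd z \<in> {s..s'}") (auto simp: \<phi>_def h_def split_beta' intro!: mult_nonneg_nonneg)
  have dh: "(h m has_real_derivative deriv (h m) t) (at t)" for m t
    using Ck_SucD(1)[OF h_Ck] .
  have [measurable]: "smooth_trap m d a c \<in> borel_measurable borel" "smooth_trap' m d a c \<in> borel_measurable borel"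
    "h m \<in> borel_measurable borel" "bump m s s' \<in> borel_measurable borel" for m
    by (auto intro: borel_measurable_Ck Ck_smooth_trap Ck_smooth_trap' h_Ck Ck_bump)
  have b: "\<bar>smooth_trap m d a c x\<bar> \<le> d" for m x
    using smooth_trap_bounds[of a c d m x] assms by auto
  have z: "x \<notin> {a..c + d} \<Longrightarrow> smooth_trap m d a c x = 0" "x \<notin> {a..c + d} \<Longrightarrow> smooth_trap' m d a c x = 0" for m x
    using assms smooth_trap_eq_0 smooth_trap'_eq_0 by auto
  have "(\<lambda>m. LINT z|lborel. char_speed A \<gamma> (r z) * (smooth_trap' m d a c (fst z) * h m (snd z)))
    \<longlonglongrightarrow> (LINT t|lborel. (LINT x|lborel. char_speed A \<gamma> (r (x, t)) * trap' d a c x) * (t * indicator {s<..<s'} t))"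
    by (rule tensor_limit[OF _ _ _ speed_bd smooth_trap'_bound z(2) smooth_trap'_tendsto h_bd h_0 h_lim]) auto
  then have L1: "(\<lambda>m. LINT z|lborel. char_speed A \<gamma> (r z) * (smooth_trap' m d a c (fst z) * h m (snd z)))
    \<longlonglongrightarrow> (LINT t:{s<..<s'}|lborel. t * slope d a c t)"
    by (simp add: slope_def set_lebesgue_integral_def mult_ac)
  have "(\<lambda>m. LINT z|lborel. 1 * (smooth_trap m d a c (fst z) * bump m s s' (snd z)))
    \<longlonglongrightarrow> (LINT t|lborel. (LINT x|lborel. 1 * trap d a c x) * indicator {s<..<s'} t)"
    by (rule tensor_limit[where U = "\<lambda>_. 1" and K = 1, OF _ _ _ _ b z(1) smooth_trap_tendsto[OF assms(2)] bump_bd b_0 bump_tendsto]) auto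
  then have L2: "(\<lambda>m. LINT z|lborel. smooth_trap m d a c (fst z) * bump m s s' (snd z))
    \<longlonglongrightarrow> (LINT t:{s<..<s'}|lborel. d * (c - a))"
    using assms by (simp add: integral_trap set_lebesgue_integral_def mult_ac)
  have "- (LINT z|lborel. smooth_trap m d a c (fst z) * bump m s s' (snd z))
     \<le> (LINT z|lborel. char_speed A \<gamma> (r z) * (smooth_trap' m d a c (fst z) * h m (snd z)))" for m
  proof -
    have "indicator (UNIV \<times> {0<..}) z *\<^sub>R (1 / snd z * \<phi> m z) = smooth_trap m d a c (fst z) * bump m s s' (snd z)" for z
      using b_0[of "snd z" m] s
      by (cases "snd z \<in> {s..s'}") (auto simp: \<phi>_def h_def split_beta' indicator_def mem_Times_iff)
    then have 1: "(LINT z:UNIV \<times> {0<..}|lborel. 1 / snd z * \<phi> m z)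
       = (LINT z|lborel. smooth_trap m d a c (fst z) * bump m s s' (snd z))"
      by (simp only: set_lebesgue_integral_def)
    have "indicator (UNIV \<times> {0<..}) z *\<^sub>R (char_speed A \<gamma> (r z) * partial_x (\<phi> m) z)
      = char_speed A \<gamma> (r z) * (smooth_trap' m d a c (fst z) * h m (snd z))" for z
    proof -
      have "partial_x (\<phi> m) z = smooth_trap' m d a c (fst z) * h m (snd z)"
        unfolding \<phi>_def partial_tensor(1)[OF deriv_smooth_trap dh] by (simp add: split_beta')
      then show ?thesis using h_0[of "snd z" m] s
        by (cases "snd z \<in> {s..s'}") (auto simp: indicator_def mem_Times_iff)
    qed
    then have 2: "(LINT z:UNIV \<times> {0<..}|lborel. char_speed A \<gamma> (r z) * partial_x (\<phi> m) z)
       = (LINT z|lborel. char_speed A \<gamma> (r z) * (smooth_trap' m d a c (fst z) * h m (snd z)))"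
      by (simp only: set_lebesgue_integral_def)
    show ?thesis using entropy[OF test[of m] \<phi>_nonneg] unfolding 1 2 .
  qed
  then have "- (LINT t:{s<..<s'}|lborel. d * (c - a)) \<le> (LINT t:{s<..<s'}|lborel. t * slope d a c t)"
    by (intro LIMSEQ_le[OF tendsto_minus[OF L2] L1]) auto
  moreover have "(LINT t:{s<..<s'}|lborel. t * slope d a c t + d * (c - a))
     = (LINT t:{s<..<s'}|lborel. t * slope d a c t) + (LINT t:{s<..<s'}|lborel. d * (c - a))"
  proof (rule set_integral_add(2))
    show i: "set_integrable lborel {s<..<s'} (\<lambda>t. d * (c - a))" using s by (simp add: set_integrable_def)
    have "set_integrable lborel {s<..<s'} (\<lambda>t. t * slope d a c t + d * (c - a))"
      by (rule locally_integrable_subset[OF li, of _ s s']) auto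
    from set_integral_diff(1)[OF this i]
    show "set_integrable lborel {s<..<s'} (\<lambda>t. t * slope d a c t)" by simp
  qed
  ultimately show "0 \<le> (LINT t:{s<..<s'}|lborel. t * slope d a c t + d * (c - a))" by simp
qed

lemma Oleinik_AE:
  "\<exists>N\<in>null_sets lborel. \<forall>t>0. t \<notin> N \<longrightarrow> (\<forall>d>0. \<forall>y.
    (prim (\<lambda>x. char_speed A \<gamma> (r (x, t))) (y + d) - prim (\<lambda>x. char_speed A \<gamma> (r (x, t))) y)
      - (prim (\<lambda>x. char_speed A \<gamma> (r (x, t))) y - prim (\<lambda>x. char_speed A \<gamma> (r (x, t))) (y - d)) \<le> 1 / t * d\<^sup>2)"
proof -
  \<comment> \<open>With feet y - d and y the trapezoid is the tent over [y - d, y + d], of integral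
    d^2, and \<open>slope\<close> is minus the second difference of the primitive of the
    speed.\<close>
  have "AE t in lborel. \<forall>y\<in>\<rat>. \<forall>d\<in>\<rat> \<inter> {0<..}. 0 < t \<longrightarrow> 0 \<le> t * slope d (y - d) y t + d * (y - (y - d))"
  proof (intro AE_ball_countable' countable_rat countable_Int1)
    fix y d :: real assume "d \<in> \<rat> \<inter> {0<..}"
    then show "AE t in lborel. 0 < t \<longrightarrow> 0 \<le> t * slope d (y - d) y t + d * (y - (y - d))"
      by (intro slope_ge) auto
  qed
  then obtain N where N: "N \<in> null_sets lborel" and slope: "\<And>t y d. t \<notin> N \<Longrightarrow> y \<in> \<rat> \<Longrightarrow> d \<in> \<rat> \<Longrightarrow> 0 < d \<Longrightarrow> 0 < t \<Longrightarrow>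
      0 \<le> t * slope d (y - d) y t + d * (y - (y - d))"
    unfolding eventually_ae_filter by auto
  show ?thesis
  proof (intro bexI[OF _ N] allI impI)
    fix t d y :: real assume t: "0 < t" "t \<notin> N" and d: "0 < d"
    let ?a = "\<lambda>x. char_speed A \<gamma> (r (x, t))"
    have a: "?a \<in> borel_measurable borel" by measurable
    have lip: "K-lipschitz_on UNIV (prim ?a)"
      using prim_lipschitz[OF a speed_bd] K_nonneg
      by (auto simp: lipschitz_on_def dist_real_def abs_minus_commute)
    show "(prim ?a (y + d) - prim ?a y) - (prim ?a y - prim ?a (y - d)) \<le> 1 / t * d\<^sup>2"
    proof (rule second_difference_of_rationals[OF lipschitz_on_continuous_on[OF lip] _ d])
      fix y d :: real assume yd: "y \<in> \<rat>" "d \<in> \<rat>" "0 < d"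
      have "(prim ?a (y + d) - prim ?a y) - (prim ?a y - prim ?a (y - d)) = - slope d (y - d) y t"
        using integral_trap'[OF locally_integrable_bounded[OF a speed_bd], of d "y - d" y] yd
        by (simp add: slope_def)
      also have "\<dots> \<le> 1 / t * d\<^sup>2"
        using slope[OF t(2) yd t(1)] t by (simp add: field_simps power2_eq_square)
      finally show "(prim ?a (y + d) - prim ?a y) - (prim ?a y - prim ?a (y - d)) \<le> 1 / t * d\<^sup>2" .
    qed
  qed
qed

end

section \<open>Null sets in the plane and their time sections\<close>

lemma AE_lborel_null_set:
  assumes "AE x in lborel. P x"
  shows "\<exists>N\<in>null_sets lborel. \<forall>x. x \<notin> N \<longrightarrow> P x"
  using assms unfolding eventually_ae_filter by auto

lemma AE_plane:
  fixes P :: "real \<times> real \<Rightarrow> bool"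
  assumes "{z. P z} \<in> sets borel" "AE t in lborel. AE x in lborel. P (x, t)"
  shows "AE z in lborel. P z"
proof -
  have m: "{z \<in> space (lborel \<Otimes>\<^sub>M lborel). P z} \<in> sets (lborel \<Otimes>\<^sub>M lborel)"
    using assms(1) unfolding lborel_prod by simp
  have m': "{z \<in> space (lborel \<Otimes>\<^sub>M lborel). P (fst z, snd z)} \<in> sets (lborel \<Otimes>\<^sub>M lborel)"
    using m by simp
  have "AE x in lborel. AE t in lborel. P (x, t)"
    using assms(2) lborel_pair.AE_commute[of "\<lambda>x t. P (x, t)", OF m'] by blast
  from lborel_pair.AE_pair_measure[OF m this] show ?thesis unfolding lborel_prod .
qed

lemma AE_snd_neq_0: "AE z::real \<times> real in lborel. snd z \<noteq> 0"
proof (rule AE_plane)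
  have "open {z::real \<times> real. snd z \<noteq> 0}" by (intro open_Collect_neq continuous_intros)
  then show "{z::real \<times> real. snd z \<noteq> 0} \<in> sets borel" by simp
  show "AE t in lborel. AE x in lborel. snd (x::real, t::real) \<noteq> 0"
    using AE_lborel_singleton[of "0::real"] by eventually_elim simp
qed

lemma AE_plane_section:
  fixes P :: "real \<times> real \<Rightarrow> bool"
  assumes "AE z in lborel. P z"
  shows "AE t in lborel. AE x in lborel. P (x, t)"
proof -
  obtain N where N: "N \<in> null_sets lborel" "\<And>z. z \<notin> N \<Longrightarrow> P z"
    using assms unfolding eventually_ae_filter by auto
  have "AE z in lborel \<Otimes>\<^sub>M lborel. z \<notin> N" using AE_not_in[OF N(1)] unfolding lborel_prod .
  from lborel_pair.AE_pair[OF this] have "AE x in lborel. AE t in lborel. (x, t) \<notin> N" .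
  moreover have "{z \<in> space (lborel \<Otimes>\<^sub>M lborel). (fst z, snd z) \<notin> N} \<in> sets (lborel \<Otimes>\<^sub>M lborel)"
  proof -
    have "- N \<in> sets (lborel \<Otimes>\<^sub>M lborel)"
      using N(1) borel_comp[of N] unfolding lborel_prod by (auto simp: null_sets_def)
    moreover have "{z \<in> space (lborel \<Otimes>\<^sub>M lborel). (fst z, snd z) \<notin> N} = - N"
      by (auto simp: space_pair_measure)
    ultimately show ?thesis by simp
  qed
  ultimately have "AE t in lborel. AE x in lborel. (x, t) \<notin> N"
    using lborel_pair.AE_commute[of "\<lambda>x t. (x, t) \<notin> N"] by blast
  then show ?thesis by eventually_elim (auto elim!: eventually_mono intro: N(2))
qed

lemma integrable_time_slab:
  fixes F :: "real \<times> real \<Rightarrow> real"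
  assumes F: "F \<in> borel_measurable borel"
    and int: "\<And>\<tau>. integrable lborel (\<lambda>x. F (x, \<tau>))" and bd: "\<And>\<tau>. (LINT x|lborel. \<bar>F (x, \<tau>)\<bar>) \<le> L"
  shows "integrable (lborel \<Otimes>\<^sub>M lborel) (\<lambda>z. indicator {0<..<t} (snd z) * F z)"
proof -
  note [measurable] = F
  let ?f = "\<lambda>z. indicator {0<..<t} (snd z) * F z"
  have "integrable (lborel \<Otimes>\<^sub>M lborel) (\<lambda>(\<tau>, x). ?f (x, \<tau>))"
  proof (rule lborel_pair.Fubini_integrable)
    show "(\<lambda>(\<tau>, x). ?f (x, \<tau>)) \<in> borel_measurable (lborel \<Otimes>\<^sub>M lborel)" by measurable
    show "AE \<tau> in lborel. integrable lborel (\<lambda>x. case (\<tau>, x) of (\<tau>, x) \<Rightarrow> ?f (x, \<tau>))"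
      using int by simp
    show "integrable lborel (\<lambda>\<tau>. LINT x|lborel. norm (case (\<tau>, x) of (\<tau>, x) \<Rightarrow> ?f (x, \<tau>)))"
    proof (rule Bochner_Integration.integrable_bound)
      show "integrable lborel (\<lambda>\<tau>. indicator {0<..<t} \<tau> * L)" 
        by (cases "0 < t") auto
      show "AE \<tau> in lborel. norm (LINT x|lborel. norm (case (\<tau>, x) of (\<tau>, x) \<Rightarrow> ?f (x, \<tau>)))
          \<le> norm (indicator {0<..<t} \<tau> * L)"
        using bd by (intro AE_I2) (auto simp: indicator_def intro: order_trans[OF _ abs_ge_self])
    qed measurable
  qed
  from lborel_pair.integrable_product_swap[OF this] show ?thesis by (simp add: split_beta')
qed

section \<open>Comparison of two solutions with the same datum\<close>

locale clean_pair = s1: clean_solution A \<gamma> C g r1 + s2: clean_solution A \<gamma> C g r2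
  for A \<gamma> C g r1 r2
begin

definition D :: "real \<times> real \<Rightarrow> real" where "D z = r1 z - r2 z"
definition H :: "real \<times> real \<Rightarrow> real" where "H z = pow_flux A \<gamma> (r1 z) - pow_flux A \<gamma> (r2 z)"
text \<open>The sum of the bounds for \<open>D\<close>, \<open>H\<close> and the characteristic
  speed, one constant for all three.\<close>

definition B :: real where "B = C + 2 * (s1.K * C) + s1.K"

lemma D_meas[measurable]: "D \<in> borel_measurable borel"
  unfolding D_def by measurable

lemma H_meas[measurable]: "H \<in> borel_measurable borel"
  unfolding H_def by measurable

lemma KC: "0 \<le> s1.K * C" using s1.K_nonneg s1.C_nonneg by simp

lemma D_int: "integrable lborel (\<lambda>x. D (x, t))"
  unfolding D_def using s1.r_int s2.r_int by simp

lemma D_bd: "\<bar>D z\<bar> \<le> B"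
  using s1.r_nonneg[of z] s1.r_le[of z] s2.r_nonneg[of z] s2.r_le[of z] KC s1.K_nonneg
  unfolding D_def B_def by linarith

lemma H_bd: "\<bar>H z\<bar> \<le> B"
  using s1.flux_bd[of z] s2.flux_bd[of z] s1.K_nonneg s1.C_nonneg unfolding H_def B_def by linarith

lemma H_int: "integrable lborel (\<lambda>x. H (x, t))"
  and H_mass: "(LINT x|lborel. \<bar>H (x, t)\<bar>) \<le> 2 * (s1.K * C)"
proof -
  have le: "\<bar>H z\<bar> \<le> s1.K * (r1 z + r2 z)" for z
    using s1.flux_le[of z] s2.flux_le[of z] by (simp add: H_def distrib_left abs_if split: if_splits)
  have i: "integrable lborel (\<lambda>x. s1.K * (r1 (x, t) + r2 (x, t)))"
    using s1.r_int s2.r_int by simp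
  show int: "integrable lborel (\<lambda>x. H (x, t))"
    by (rule Bochner_Integration.integrable_bound[OF i])
       (use le order_trans[OF le abs_ge_self] in auto)
  have "(LINT x|lborel. \<bar>H (x, t)\<bar>) \<le> (LINT x|lborel. s1.K * (r1 (x, t) + r2 (x, t)))"
    using int i le by (intro integral_mono) auto
  also have "\<dots> = s1.K * ((LINT x|lborel. r1 (x, t)) + (LINT x|lborel. r2 (x, t)))"
    using s1.r_int s2.r_int by simp
  also have "\<dots> \<le> s1.K * (C + C)"
    using s1.r_mass[of t] s2.r_mass[of t] s1.K_nonneg by (intro mult_left_mono add_mono) auto
  finally show "(LINT x|lborel. \<bar>H (x, t)\<bar>) \<le> 2 * (s1.K * C)" by simp
qed

lemma D_trap:
  assumes "a \<le> c" "0 < d"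
  shows "s1.mass d a c t - s2.mass d a c t = (LINT x|lborel. D (x, t) * trap d a c x)"
proof -
  have "integrable lborel (\<lambda>x. r (x, t) * trap d a c x)" if r: "integrable lborel (\<lambda>x. r (x, t))" for r :: "real \<times> real \<Rightarrow> real"
  proof (rule Bochner_Integration.integrable_bound)
    show "integrable lborel (\<lambda>x. r (x, t) * d)" using r by simp
    show "(\<lambda>x. r (x, t) * trap d a c x) \<in> borel_measurable lborel" using r by measurable
    show "AE x in lborel. norm (r (x, t) * trap d a c x) \<le> norm (r (x, t) * d)"
      using trap_bounds[of a c d] assms by (intro AE_I2) (auto simp: abs_mult intro!: mult_left_mono)
  qed
  from this[OF s1.r_int] this[OF s2.r_int] show ?thesis
    by (simp add: s1.mass_def s2.mass_def D_def left_diff_distrib)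
qed

lemma H_trap':
  assumes "0 < d" "0 < t"
  shows "prim (s1.flow d a c) t - prim (s2.flow d a c) t
    = (LINT z|lborel. indicator {0<..<t} (snd z) * H z * trap' d a c (fst z))"
    and "integrable (lborel \<Otimes>\<^sub>M lborel) (\<lambda>z. indicator {0<..<t} (snd z) * H z * trap' d a c (fst z))"
proof -
  let ?H = "\<lambda>z. indicator {0<..<t} (snd z) * H z"
  have slab: "integrable (lborel \<Otimes>\<^sub>M lborel) ?H"
    by (rule integrable_time_slab[OF H_meas H_int H_mass])
  show int: "integrable (lborel \<Otimes>\<^sub>M lborel) (\<lambda>z. ?H z * trap' d a c (fst z))"
  proof (rule Bochner_Integration.integrable_bound[OF slab])
    have "\<bar>trap' d a c x\<bar> \<le> 1" for x by (auto simp: trap'_def indicator_def)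
    then show "AE z in lborel \<Otimes>\<^sub>M lborel. norm (?H z * trap' d a c (fst z)) \<le> norm (?H z)"
      by (intro AE_I2) (simp add: abs_mult mult_left_le)
    show "(\<lambda>z. ?H z * trap' d a c (fst z)) \<in> borel_measurable (lborel \<Otimes>\<^sub>M lborel)"
      using borel_measurable_integrable[OF slab] by measurable
  qed
  have l1: "locally_integrable (s1.flow d a c)"
    using assms by (intro locally_integrable_bounded[OF s1.borel_measurable_flow s1.flow_bound]) simp
  have l2: "locally_integrable (s2.flow d a c)"
    using assms by (intro locally_integrable_bounded[OF s2.borel_measurable_flow s2.flow_bound]) simp
  have i1: "set_integrable lborel {0<..<t} (s1.flow d a c)" by (rule locally_integrable_subset[OF l1, of _ 0 t]) auto
  have i2: "set_integrable lborel {0<..<t} (s2.flow d a c)" by (rule locally_integrable_subset[OF l2, of _ 0 t]) auto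
  have flow_diff: "s1.flow d a c \<tau> - s2.flow d a c \<tau> = (LINT x|lborel. H (x, \<tau>) * trap' d a c x)" for \<tau>
  proof -
    have li: "integrable lborel (\<lambda>x. p x * trap' d a c x)" if "locally_integrable p" for p
    proof -
      have "set_integrable lborel {a<..<a + d} p" "set_integrable lborel {c<..<c + d} p"
        using locally_integrable_subset[OF that, of "{a<..<a + d}" a "a + d"]
          locally_integrable_subset[OF that, of "{c<..<c + d}" c "c + d"] by (auto simp: subset_eq)
      then have "integrable lborel (\<lambda>x. indicator {a<..<a + d} x *\<^sub>R p x - indicator {c<..<c + d} x *\<^sub>R p x)"
        unfolding set_integrable_def by (rule Bochner_Integration.integrable_diff)
      then show ?thesis by (simp add: trap'_def algebra_simps)
    qed
    have "locally_integrable (\<lambda>x. pow_flux A \<gamma> (r1 (x, \<tau>)))"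
      by (rule locally_integrable_bounded[OF _ s1.flux_bd]) measurable
    moreover have "locally_integrable (\<lambda>x. pow_flux A \<gamma> (r2 (x, \<tau>)))"
      by (rule locally_integrable_bounded[OF _ s2.flux_bd]) measurable
    ultimately show ?thesis
      using li by (simp add: s1.flow_def s2.flow_def H_def left_diff_distrib)
  qed
  have "prim (s1.flow d a c) t - prim (s2.flow d a c) t
      = (LINT \<tau>:{0<..<t}|lborel. s1.flow d a c \<tau>) - (LINT \<tau>:{0<..<t}|lborel. s2.flow d a c \<tau>)"
    using prim_diff_set[OF l1, of 0 t] prim_diff_set[OF l2, of 0 t] assms by simp
  also have "\<dots> = (LINT \<tau>:{0<..<t}|lborel. s1.flow d a c \<tau> - s2.flow d a c \<tau>)"
    using i1 i2 by (rule set_integral_diff(2)[symmetric])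
  also have "\<dots> = (LINT \<tau>|lborel. LINT x|lborel. indicator {0<..<t} \<tau> * H (x, \<tau>) * trap' d a c x)"
    by (simp add: flow_diff set_lebesgue_integral_def mult.assoc)
  also have "\<dots> = (LINT z|lborel. ?H z * trap' d a c (fst z))"
    using plane_integral(1)[OF int] by simp
  finally show "prim (s1.flow d a c) t - prim (s2.flow d a c) t = (LINT z|lborel. ?H z * trap' d a c (fst z))" .
qed

lemma continuous_tail: "integrable lborel f \<Longrightarrow> (\<And>x. \<bar>f x\<bar> \<le> L) \<Longrightarrow> continuous_on UNIV (tail f)"
proof (rule lipschitz_on_continuous_on)
  assume f: "integrable lborel f" "\<And>x. \<bar>f x\<bar> \<le> L"
  have "f \<in> borel_measurable borel" using f(1) by auto
  from prim_lipschitz[OF this f(2)] f(2)[of 0] show "L-lipschitz_on UNIV (tail f)"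
    by (auto simp: lipschitz_on_def dist_real_def tail_diff[OF f(1)] abs_minus_commute)
qed

text \<open>In the difference of the two mass identities the common datum cancels. Sending the right
  foot of the trapezoid to infinity leaves a ramp, that is a mean of tails over (a, a + d). Both
  sides of the claim then have equal integrals over all intervals with rational a and d, hence agree
  almost everywhere.\<close>

lemma evolution_AE:
  "\<exists>N\<in>null_sets lborel. \<forall>t>0. t \<notin> N \<longrightarrow> (AE y in lborel. tail (\<lambda>x. D (x, t)) y = prim (\<lambda>\<tau>. H (y, \<tau>)) t)"
proof -
  have "AE t in lborel. 0 < t \<longrightarrow> s1.mass d a c t - s2.mass d a c t = prim (s1.flow d a c) t - prim (s2.flow d a c) t"
    if ac: "a \<le> c" and d: "0 < d" for a c d
  proof -
    obtain N1 N2 where N12: "N1 \<in> null_sets lborel" "N2 \<in> null_sets lborel"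
      and e: "\<And>t. 0 < t \<Longrightarrow> t \<notin> N1 \<Longrightarrow> s1.mass d a c t - (LINT x|lborel. trap d a c x * g x) = prim (s1.flow d a c) t"
      "\<And>t. 0 < t \<Longrightarrow> t \<notin> N2 \<Longrightarrow> s2.mass d a c t - (LINT x|lborel. trap d a c x * g x) = prim (s2.flow d a c) t"
      using s1.mass_evolution[OF ac d] s2.mass_evolution[OF ac d] by blast
    from AE_not_in[OF N12(1)] AE_not_in[OF N12(2)] show ?thesis
    proof eventually_elim
      case (elim t)
      then show ?case using e[of t] by auto
    qed
  qed
  then have "AE t in lborel. \<forall>a\<in>\<rat>. \<forall>c\<in>\<rat> \<inter> {a..}. \<forall>d\<in>\<rat> \<inter> {0<..}. 0 < t \<longrightarrow>
      s1.mass d a c t - s2.mass d a c t = prim (s1.flow d a c) t - prim (s2.flow d a c) t"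
    by (intro AE_ball_countable' countable_rat countable_Int1) simp
  from AE_lborel_null_set[OF this]
  obtain N where N: "N \<in> null_sets lborel" and good: "\<And>t. t \<notin> N \<Longrightarrow> \<forall>a\<in>\<rat>. \<forall>c\<in>\<rat> \<inter> {a..}. \<forall>d\<in>\<rat> \<inter> {0<..}. 0 < t \<longrightarrow>
      s1.mass d a c t - s2.mass d a c t = prim (s1.flow d a c) t - prim (s2.flow d a c) t"
    by blast
  have evol: "\<And>t a c d. t \<notin> N \<Longrightarrow> a \<in> \<rat> \<Longrightarrow> c \<in> \<rat> \<Longrightarrow> a \<le> c \<Longrightarrow>
      d \<in> \<rat> \<Longrightarrow> 0 < d \<Longrightarrow> 0 < t \<Longrightarrow> s1.mass d a c t - s2.mass d a c t = prim (s1.flow d a c) t - prim (s2.flow d a c) t"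
    using good by simp
  show ?thesis
  proof (intro bexI[OF _ N] allI impI)
    fix t :: real assume t: "0 < t" "t \<notin> N"
    let ?f = "\<lambda>x. D (x, t)" and ?H = "\<lambda>z. indicator {0<..<t} (snd z) * H z"
    have slab: "integrable (lborel \<Otimes>\<^sub>M lborel) ?H"
      by (rule integrable_time_slab[OF H_meas H_int H_mass])
    have Hl: "locally_integrable (\<lambda>\<tau>. H (y, \<tau>))" for y
      by (rule locally_integrable_bounded[OF _ H_bd]) measurable
    have prim_H: "prim (\<lambda>\<tau>. H (y, \<tau>)) t = (LINT \<tau>|lborel. ?H (y, \<tau>))" for y
      using prim_diff_set[OF Hl, of 0 t] t by (simp add: set_lebesgue_integral_def)
    define k where "k y = tail ?f y - prim (\<lambda>\<tau>. H (y, \<tau>)) t" for y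
    have tail_meas: "tail ?f \<in> borel_measurable borel"
      by (intro borel_measurable_continuous_onI continuous_tail[OF D_int D_bd])
    have prim_meas: "(\<lambda>y. prim (\<lambda>\<tau>. H (y, \<tau>)) t) \<in> borel_measurable borel"
      unfolding prim_H by measurable
    have k_meas[measurable]: "k \<in> borel_measurable borel"
      unfolding k_def using tail_meas prim_meas by measurable
    have tail_bd: "\<bar>tail ?f y\<bar> \<le> (LINT x|lborel. \<bar>D (x, t)\<bar>)" for y by (rule tail_bound[OF D_int])
    have prim_bd: "\<bar>prim (\<lambda>\<tau>. H (y, \<tau>)) t\<bar> \<le> B * t" for y
    proof -
      have "(\<lambda>\<tau>. H (y, \<tau>)) \<in> borel_measurable borel" by measurable
      from prim_lipschitz[OF this H_bd, of t 0] show ?thesis using t by simp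
    qed
    have k_bd: "\<bar>k y\<bar> \<le> (LINT x|lborel. \<bar>D (x, t)\<bar>) + B * t" for y
      using tail_bd[of y] prim_bd[of y] unfolding k_def by linarith
    have k_int: "(LINT y:{a<..<a + d}|lborel. k y) = 0" if a: "a \<in> \<rat>" and d: "d \<in> \<rat>" "0 < d" for a d
    proof -
      let ?I = "indicator {a<..<a + d} :: real \<Rightarrow> real"
      \<comment> \<open>The right foot runs through the integers j: each point x is eventually to
        the left of it, so the descending part of the trapezoid disappears. Domination by
        \<open>D\<close> comes from its integrability in space.\<close>
      have *: "(\<lambda>j. LINT x|lborel. D (x, t) * trap d a (real j) x) \<longlonglongrightarrow> (LINT x|lborel. D (x, t) * ramp d (x - a))"
      proof (rule integral_dominated_convergence[where w = "\<lambda>x. \<bar>D (x, t)\<bar> * d"])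
        show "AE x in lborel. (\<lambda>j. D (x, t) * trap d a (real j) x) \<longlonglongrightarrow> D (x, t) * ramp d (x - a)"
        proof (intro AE_I2 tendsto_mult tendsto_const)
          fix x
          have "eventually (\<lambda>j. ramp d (x - a) = trap d a (real j) x) sequentially"
            using eventually_ge_at_top[of "nat \<lceil>x\<rceil>"]
          proof eventually_elim
            case (elim j)
            then have "x \<le> real j" by linarith
            then show ?case using d by (simp add: trap_def ramp_def)
          qed
          then show "(\<lambda>j. trap d a (real j) x) \<longlonglongrightarrow> ramp d (x - a)"
            by (rule Lim_transform_eventually[OF tendsto_const])
        qed
        have tb: "\<bar>trap d a c x\<bar> \<le> d" for c x
          using d by (auto simp: trap_def ramp_def)
        then show "AE x in lborel. norm (D (x, t) * trap d a (real j) x) \<le> \<bar>D (x, t)\<bar> * d" for j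
          by (intro AE_I2) (auto simp: abs_mult intro!: mult_left_mono)
        show "(\<lambda>x. D (x, t) * ramp d (x - a)) \<in> borel_measurable lborel" unfolding ramp_def by measurable
      qed (use D_int in auto)
      have **: "(\<lambda>j. LINT z|(lborel \<Otimes>\<^sub>M lborel). ?H z * trap' d a (real j) (fst z))
        \<longlonglongrightarrow> (LINT z|(lborel \<Otimes>\<^sub>M lborel). ?H z * ?I (fst z))"
      proof (rule integral_dominated_convergence[where w = "\<lambda>z. \<bar>?H z\<bar>"])
        show "AE z in lborel \<Otimes>\<^sub>M lborel. (\<lambda>j. ?H z * trap' d a (real j) (fst z)) \<longlonglongrightarrow> ?H z * ?I (fst z)"
        proof (intro AE_I2 tendsto_mult tendsto_const)
          fix z :: "real \<times> real"
          have "eventually (\<lambda>j. ?I (fst z) = trap' d a (real j) (fst z)) sequentially"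
            using eventually_ge_at_top[of "nat \<lceil>fst z\<rceil>"]
          proof eventually_elim
            case (elim j)
            then have "fst z \<le> real j" by linarith
            then show ?case by (simp add: trap'_def indicator_def)
          qed
          then show "(\<lambda>j. trap' d a (real j) (fst z)) \<longlonglongrightarrow> ?I (fst z)"
            by (rule Lim_transform_eventually[OF tendsto_const])
        qed
        have "\<bar>trap' d a c x\<bar> \<le> 1" for c x by (auto simp: trap'_def indicator_def)
        then show "AE z in lborel \<Otimes>\<^sub>M lborel. norm (?H z * trap' d a (real j) (fst z)) \<le> \<bar>?H z\<bar>" for j
          by (intro AE_I2) (simp add: abs_mult mult_left_le)
        show "integrable (lborel \<Otimes>\<^sub>M lborel) (\<lambda>z. \<bar>?H z\<bar>)" using slab by simp
        show "(\<lambda>z. ?H z * trap' d a (real j) (fst z)) \<in> borel_measurable (lborel \<Otimes>\<^sub>M lborel)" for j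
          using borel_measurable_integrable[OF slab] by measurable
        show "(\<lambda>z. ?H z * ?I (fst z)) \<in> borel_measurable (lborel \<Otimes>\<^sub>M lborel)"
          using borel_measurable_integrable[OF slab] by measurable
      qed
      have int: "integrable (lborel \<Otimes>\<^sub>M lborel) (\<lambda>z. ?H z * ?I (fst z))"
      proof (rule Bochner_Integration.integrable_bound[OF slab])
        show "(\<lambda>z. ?H z * ?I (fst z)) \<in> borel_measurable (lborel \<Otimes>\<^sub>M lborel)"
          using borel_measurable_integrable[OF slab] by measurable
      qed (auto simp: indicator_def)
      have "eventually (\<lambda>j. (LINT x|lborel. D (x, t) * trap d a (real j) x)
          = (LINT z|(lborel \<Otimes>\<^sub>M lborel). ?H z * trap' d a (real j) (fst z))) sequentially"
        using eventually_ge_at_top[of "nat \<lceil>a\<rceil>"]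
      proof eventually_elim
        case (elim j)
        then have "a \<le> real j" by linarith
        then show ?case
          using evol[OF t(2) a _ _ d(1,2) t(1), of "real j"] D_trap[of a "real j" d t] H_trap'(1)[OF d(2) t(1), of a "real j"] d
          by (simp add: lborel_prod)
      qed
      from Lim_transform_eventually[OF * this] **
      have "(LINT x|lborel. D (x, t) * ramp d (x - a)) = (LINT z|(lborel \<Otimes>\<^sub>M lborel). ?H z * ?I (fst z))"
        by (rule LIMSEQ_unique)
      also have "\<dots> = (LINT y|lborel. LINT \<tau>|lborel. ?H (y, \<tau>) * ?I y)"
        using plane_integral(2)[OF int] by (simp add: lborel_prod)
      also have "\<dots> = (LINT y:{a<..<a + d}|lborel. prim (\<lambda>\<tau>. H (y, \<tau>)) t)"
        unfolding set_lebesgue_integral_def prim_H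
        by (intro Bochner_Integration.integral_cong refl) (simp add: indicator_def)
      finally have "(LINT y:{a<..<a + d}|lborel. tail ?f y) = (LINT y:{a<..<a + d}|lborel. prim (\<lambda>\<tau>. H (y, \<tau>)) t)"
        using d by (simp add: integral_ramp[OF D_int])
      moreover have "set_integrable lborel {a<..<a + d} (tail ?f)"
        by (rule locally_integrable_subset[OF locally_integrable_bounded[OF tail_meas tail_bd], of _ a "a + d"]) auto
      moreover have "set_integrable lborel {a<..<a + d} (\<lambda>y. prim (\<lambda>\<tau>. H (y, \<tau>)) t)"
        by (rule locally_integrable_subset[OF locally_integrable_bounded[OF prim_meas prim_bd], of _ a "a + d"]) auto
      ultimately show ?thesis unfolding k_def by (simp add: set_integral_diff(2))
    qed
    have kl: "locally_integrable k" by (rule locally_integrable_bounded[OF k_meas k_bd])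
    have "prim k x = 0" if "x \<in> \<rat>" for x
    proof -
      consider "x = 0" | "0 < x" | "x < 0" by linarith
      then show ?thesis
      proof cases
        case 2
        then show ?thesis using k_int[of 0 x] prim_diff_set[OF kl, of 0 x] that by simp
      next
        case 3
        then show ?thesis using k_int[of x "- x"] prim_diff_set[OF kl, of x 0] that by simp
      qed simp
    qed
    from AE_eq_0_of_prim_const[OF k_meas k_bd this]
    show "AE y in lborel. tail (\<lambda>x. D (x, t)) y = prim (\<lambda>\<tau>. H (y, \<tau>)) t"
      by (auto simp: k_def elim!: eventually_mono)
  qed
qed

text \<open>Concavity compares the fluxes with the tangent at \<open>r2\<close>; the transport
  coefficient is therefore the characteristic speed of \<open>r2\<close>, and it is the Oleinik
  bound of \<open>r2\<close> that is used. The opposite inequality arises by exchanging the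
  solutions.\<close>

lemma tail_le_0:
  "\<exists>N\<in>null_sets lborel. \<forall>t>0. t \<notin> N \<longrightarrow> (\<forall>y. tail (\<lambda>x. D (x, t)) y \<le> 0)"
proof -
  from evolution_AE obtain N1 where N1: "N1 \<in> null_sets lborel"
    and 1: "\<And>t. 0 < t \<Longrightarrow> t \<notin> N1 \<Longrightarrow> AE y in lborel. tail (\<lambda>x. D (x, t)) y = prim (\<lambda>\<tau>. H (y, \<tau>)) t"
    by (elim bexE) simp
  from s2.Oleinik_AE obtain N2 where N2: "N2 \<in> null_sets lborel"
    and 2: "\<And>t d y. 0 < t \<Longrightarrow> t \<notin> N2 \<Longrightarrow> 0 < d \<Longrightarrow>
      (prim (\<lambda>x. char_speed A \<gamma> (r2 (x, t))) (y + d) - prim (\<lambda>x. char_speed A \<gamma> (r2 (x, t))) y)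
      - (prim (\<lambda>x. char_speed A \<gamma> (r2 (x, t))) y - prim (\<lambda>x. char_speed A \<gamma> (r2 (x, t))) (y - d)) \<le> 1 / t * d\<^sup>2"
    by (elim bexE) simp
  interpret transport_comparison D H "\<lambda>z. char_speed A \<gamma> (r2 z)" B "N1 \<union> N2"
  proof
    show "N1 \<union> N2 \<in> null_sets lborel" using N1 N2 by (rule null_sets.Un)
    show "\<bar>char_speed A \<gamma> (r2 z)\<bar> \<le> B" for z
      using s2.speed_bd[of z] KC s1.C_nonneg unfolding B_def by linarith
    show "H z \<le> char_speed A \<gamma> (r2 z) * D z" for z
      unfolding H_def D_def by (rule pow_flux_concave[OF s1.\<gamma>_pos s1.r_nonneg s2.r_nonneg])
  qed (use D_bd H_bd D_int 1 2 in auto)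
  show ?thesis
    using T_nonpos N_null by (intro bexI[of _ "N1 \<union> N2"]) (auto simp: T_def)
qed

end

lemma clean_solution_unique:
  assumes "clean_solution A \<gamma> C g r1" "clean_solution A \<gamma> C g r2"
  shows "AE z in lborel. 0 < snd z \<longrightarrow> r1 z = r2 z"
proof -
  interpret p: clean_pair A \<gamma> C g r1 r2
    using assms by (intro clean_pair.intro)
  interpret q: clean_pair A \<gamma> C g r2 r1
    using assms by (intro clean_pair.intro)
  from p.tail_le_0 obtain N1 where N1: "N1 \<in> null_sets lborel"
    and 1: "\<And>t y. 0 < t \<Longrightarrow> t \<notin> N1 \<Longrightarrow> tail (\<lambda>x. p.D (x, t)) y \<le> 0"
    by (elim bexE) simp
  from q.tail_le_0 obtain N2 where N2: "N2 \<in> null_sets lborel"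
    and 2: "\<And>t y. 0 < t \<Longrightarrow> t \<notin> N2 \<Longrightarrow> tail (\<lambda>x. q.D (x, t)) y \<le> 0"
    by (elim bexE) simp
  note N = N1 N2
  have D0: "AE x in lborel. p.D (x, t) = 0" if t: "0 < t" "t \<notin> N1 \<union> N2" for t
  proof -
    have "tail (\<lambda>x. q.D (x, t)) y = - tail (\<lambda>x. p.D (x, t)) y" for y
      unfolding tail_def p.D_def q.D_def
      by (subst set_integral_uminus[symmetric])
         (use integrable_mult_indicator[OF _ p.D_int] in \<open>auto simp: set_integrable_def p.D_def\<close>)
    then have "tail (\<lambda>x. p.D (x, t)) y = 0" for y
      using 1[of t y] 2[of t y] t by auto
    then have "prim (\<lambda>x. p.D (x, t)) y = 0" for y
      using tail_diff[OF p.D_int, of t y 0] by simp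
    moreover have "(\<lambda>x. p.D (x, t)) \<in> borel_measurable borel" by measurable
    ultimately show ?thesis using p.D_bd by (intro AE_eq_0_of_prim_const[where c = 0 and B = p.B]) auto
  qed
  have "AE t in lborel. AE x in lborel. 0 < snd (x, t) \<longrightarrow> r1 (x, t) = r2 (x, t)"
    using AE_not_in[OF null_sets.Un[OF N]]
  proof eventually_elim
    case (elim t)
    then show ?case using D0[of t] by (cases "0 < t") (auto simp: p.D_def)
  qed
  moreover have "{z. 0 < snd z \<longrightarrow> r1 z = r2 z} \<in> sets borel"
  proof -
    have "{z. 0 < snd z \<longrightarrow> r1 z = r2 z} = - (UNIV \<times> {0<..}) \<union> {z. r1 z = r2 z}"
      by (auto simp: mem_Times_iff)
    moreover have "UNIV \<times> {0<..} \<in> sets (borel :: (real \<times> real) measure)"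
      by (intro borel_open open_Times) auto
    moreover have "{z. r1 z = r2 z} \<in> sets borel"
      using borel_measurable_eq[OF p.s1.r_meas p.s2.r_meas] by simp
    ultimately show ?thesis by (metis borel_comp sets.Un)
  qed
  ultimately show ?thesis
    using AE_plane[where P = "\<lambda>z. 0 < snd z \<longrightarrow> r1 z = r2 z"] by blast
qed

section \<open>From classical solutions to clean representatives\<close>

lemma clean_solution_mono:
  assumes "clean_solution A \<gamma> C g r" "C \<le> C'"
  shows "clean_solution A \<gamma> C' g r"
proof -
  interpret clean_solution A \<gamma> C g r by fact
  show ?thesis
    using \<gamma>_pos C_nonneg r_meas r_nonneg order_trans[OF r_le assms(2)] r_int order_trans[OF r_mass assms(2)]
      weak trace entropy assms(2)
    by (intro clean_solution.intro) auto
qed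

lemma test_function_continuous:
  assumes "test_function \<phi>"
  shows "continuous_on UNIV \<phi>" "continuous_on UNIV (partial_x \<phi>)" "continuous_on UNIV (partial_t \<phi>)"
proof -
  have "C_k 1 \<phi>" using assms by (simp add: test_function_def)
  then show "continuous_on UNIV \<phi>" "continuous_on UNIV (partial_x \<phi>)" "continuous_on UNIV (partial_t \<phi>)"
    by simp_all
qed

lemma half_plane_sets [measurable]:
  "(UNIV \<times> {a<..} :: (real \<times> real) set) \<in> sets borel"
  "(UNIV \<times> {a..} :: (real \<times> real) set) \<in> sets borel"
proof -
  have "open (UNIV \<times> {a<..} :: (real \<times> real) set)" by (intro open_Times) auto
  then show "(UNIV \<times> {a<..} :: (real \<times> real) set) \<in> sets borel" by (rule borel_open)
  have "closed (UNIV \<times> {a..} :: (real \<times> real) set)" by (intro closed_Times) auto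
  then show "(UNIV \<times> {a..} :: (real \<times> real) set) \<in> sets borel" by (rule borel_closed)
qed

lemma clean_of_classical:
  assumes \<gamma>: "\<gamma> > 0" and sol: "classical_entropy_solution (velocity A \<gamma>) g \<rho>"
  shows "\<exists>C r. clean_solution A \<gamma> C g r \<and> (AE z in lborel. z \<in> UNIV \<times> {0..} \<longrightarrow> \<rho> z = r z)"
proof -
  define S where "S = (UNIV \<times> {0..} :: (real \<times> real) set)"
  define S' where "S' = (UNIV \<times> {0<..} :: (real \<times> real) set)"
  have S_meas[measurable]: "S \<in> sets borel" "S' \<in> sets borel" by (simp_all add: S_def S'_def)
  have in_S: "z \<in> S \<longleftrightarrow> 0 \<le> snd z" "z \<in> S' \<longleftrightarrow> 0 < snd z" for z
    by (auto simp: S_def S'_def mem_Times_iff)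
  define \<rho>1 where "\<rho>1 z = indicator S z * \<rho> z" for z
  have \<rho>1_meas[measurable]: "\<rho>1 \<in> borel_measurable borel"
    using sol by (simp add: classical_entropy_solution_def Linfty_L1_Linfty_def set_borel_measurable_def \<rho>1_def[abs_def] S_def)
  obtain C0 where C0: "AE t in lborel. 0 \<le> t \<longrightarrow> integrable lborel (\<lambda>x. \<rho> (x, t)) \<and>
      (LINT x|lborel. \<bar>\<rho> (x, t)\<bar>) \<le> C0 \<and> (AE x in lborel. \<bar>\<rho> (x, t)\<bar> \<le> C0)"
    using sol unfolding classical_entropy_solution_def Linfty_L1_Linfty_def by blast
  have nonneg: "AE z in lborel. z \<in> S \<longrightarrow> 0 \<le> \<rho> z"
    using sol unfolding classical_entropy_solution_def S_def by blast
  define C where "C = max C0 0"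
  \<comment> \<open>Truncation to [0,C] alters only a null set and makes the bounds hold everywhere.
    Nonnegativity also makes \<open>flux_deriv_velocity\<close> applicable at every point.\<close>
  define r1 where "r1 z = max 0 (min C (\<rho>1 z))" for z
  have r1_meas[measurable]: "r1 \<in> borel_measurable borel" unfolding r1_def by measurable
  have "AE t in lborel. 0 \<le> t \<longrightarrow> integrable lborel (\<lambda>x. \<rho> (x, t)) \<and>
      (LINT x|lborel. \<bar>\<rho> (x, t)\<bar>) \<le> C \<and> (AE x in lborel. \<rho> (x, t) = r1 (x, t))"
    using C0 AE_plane_section[OF nonneg]
  proof eventually_elim
    case (elim t)
    show ?case
    proof (intro impI conjI)
      assume t: "0 \<le> t"
      then show "integrable lborel (\<lambda>x. \<rho> (x, t))" "(LINT x|lborel. \<bar>\<rho> (x, t)\<bar>) \<le> C"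
        using elim(1) by (auto simp: C_def)
      have "AE x in lborel. \<bar>\<rho> (x, t)\<bar> \<le> C0" using elim(1) t by simp
      then show "AE x in lborel. \<rho> (x, t) = r1 (x, t)"
        using elim(2) by eventually_elim (use t in \<open>auto simp: r1_def \<rho>1_def in_S C_def\<close>)
    qed
  qed
  from AE_lborel_null_set[OF this] obtain E where E: "E \<in> null_sets lborel"
    and good: "\<And>t. t \<notin> E \<Longrightarrow> 0 \<le> t \<Longrightarrow> integrable lborel (\<lambda>x. \<rho> (x, t))"
      "\<And>t. t \<notin> E \<Longrightarrow> 0 \<le> t \<Longrightarrow> (LINT x|lborel. \<bar>\<rho> (x, t)\<bar>) \<le> C"
      "\<And>t. t \<notin> E \<Longrightarrow> 0 \<le> t \<Longrightarrow> AE x in lborel. \<rho> (x, t) = r1 (x, t)"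
    by (elim bexE) simp
  have E_meas[measurable]: "E \<in> sets borel" using E by (auto simp: null_sets_def)
  define G where "G = (UNIV \<times> ({0<..} - E) :: (real \<times> real) set)"
  have G_meas[measurable]: "G \<in> sets borel"
    unfolding G_def borel_prod[symmetric] by (intro pair_measureI) auto
  have in_G: "z \<in> G \<longleftrightarrow> 0 < snd z \<and> snd z \<notin> E" for z by (auto simp: G_def mem_Times_iff)
  \<comment> \<open>Sections at exceptional times and at times that are not positive are replaced by
    0; integrability and the mass bound then hold at every time.\<close>
  define r where "r z = indicator G z * r1 z" for z
  have r_meas[measurable]: "r \<in> borel_measurable borel" unfolding r_def by measurable
  have r_bd: "0 \<le> r z" "r z \<le> C" for z by (auto simp: r_def r1_def C_def indicator_def)
  have r_sec: "AE x in lborel. \<rho> (x, t) = r (x, t)" if "0 < t" "t \<notin> E" for t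
    using good(3)[of t] that by (simp add: r_def in_G)
  have r_0: "r (x, t) = 0" if "\<not> (0 < t \<and> t \<notin> E)" for x t
    using that by (simp add: r_def in_G indicator_def)
  have r_int: "integrable lborel (\<lambda>x. r (x, t)) \<and> (LINT x|lborel. r (x, t)) \<le> C" for t
  proof (cases "0 < t \<and> t \<notin> E")
    case True
    have m: "(\<lambda>x. r (x, t)) \<in> borel_measurable lborel" by measurable
    have i: "integrable lborel (\<lambda>x. \<rho> (x, t))" using good(1) True by simp
    have "integrable lborel (\<lambda>x. r (x, t))"
      by (rule integrable_cong_AE_imp[OF i m]) (use r_sec True in \<open>auto simp: eq_commute\<close>)
    moreover have "(LINT x|lborel. r (x, t)) = (LINT x|lborel. \<bar>\<rho> (x, t)\<bar>)"
    proof (rule integral_cong_AE[OF m])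
      show "(\<lambda>x. \<bar>\<rho> (x, t)\<bar>) \<in> borel_measurable lborel" using i by measurable
      show "AE x in lborel. r (x, t) = \<bar>\<rho> (x, t)\<bar>"
        using r_sec[of t] True by (auto elim!: eventually_mono simp: abs_of_nonneg[OF r_bd(1)])
    qed
    ultimately show ?thesis using good(2)[of t] True by simp
  next
    case False
    then show ?thesis by (simp add: r_0 C_def)
  qed
  have eq: "AE z in lborel. z \<in> S \<longrightarrow> \<rho> z = r z"
  proof -
    have "AE z in lborel. z \<in> S \<longrightarrow> \<rho>1 z = r z"
    proof (rule AE_plane)
      have "{z. z \<in> S \<longrightarrow> \<rho>1 z = r z} = - S \<union> {z. \<rho>1 z = r z}" by auto
      moreover have "{z. \<rho>1 z = r z} \<in> sets borel"
        using borel_measurable_eq[OF \<rho>1_meas r_meas] by simp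
      ultimately show "{z. z \<in> S \<longrightarrow> \<rho>1 z = r z} \<in> sets borel" using borel_comp[OF S_meas(1)] by auto
      have "AE t in lborel. t \<notin> E \<and> t \<noteq> (0::real)"
        using AE_not_in[OF E] AE_lborel_singleton[of 0] by eventually_elim simp
      then show "AE t in lborel. AE x in lborel. (x, t) \<in> S \<longrightarrow> \<rho>1 (x, t) = r (x, t)"
      proof eventually_elim
        case (elim t)
        show ?case
        proof (cases "0 < t")
          case True
          then show ?thesis using r_sec[of t] elim by (auto elim!: eventually_mono simp: \<rho>1_def in_S)
        next
          case False
          then show ?thesis using elim by (auto simp: in_S)
        qed
      qed
    qed
    then show ?thesis by eventually_elim (auto simp: \<rho>1_def)
  qed
  have "clean_solution A \<gamma> C g r"
  proof
    show "\<gamma> > 0" by fact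
    show "0 \<le> C" by (simp add: C_def)
    show "r \<in> borel_measurable borel" by measurable
    show "0 \<le> r z" "r z \<le> C" for z by (rule r_bd)+
    show "integrable lborel (\<lambda>x. r (x, t))" "(LINT x|lborel. r (x, t)) \<le> C" for t using r_int by auto
  next
    fix \<phi> :: "real \<times> real \<Rightarrow> real" assume \<phi>: "test_function \<phi>"
    have [measurable]: "partial_x \<phi> \<in> borel_measurable borel" "partial_t \<phi> \<in> borel_measurable borel"
      using test_function_continuous[OF \<phi>] by (auto intro: borel_measurable_continuous_onI)
    have "(LINT z:S'|lborel. \<rho> z * partial_t \<phi> z + flux (velocity A \<gamma>) (\<rho> z) * partial_x \<phi> z) =
      (LINT z|lborel. r z * partial_t \<phi> z + pow_flux A \<gamma> (r z) * partial_x \<phi> z)"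
      unfolding set_lebesgue_integral_def flux_velocity
    proof (rule integral_cong_AE)
      have "(\<lambda>z. indicator S' z *\<^sub>R (\<rho> z * partial_t \<phi> z + pow_flux A \<gamma> (\<rho> z) * partial_x \<phi> z))
        = (\<lambda>z. indicator S' z *\<^sub>R (\<rho>1 z * partial_t \<phi> z + pow_flux A \<gamma> (\<rho>1 z) * partial_x \<phi> z))"
        by (auto simp: fun_eq_iff indicator_def \<rho>1_def in_S)
      then show "(\<lambda>z. indicator S' z *\<^sub>R (\<rho> z * partial_t \<phi> z + pow_flux A \<gamma> (\<rho> z) * partial_x \<phi> z)) \<in> borel_measurable lborel"
        by simp
      show "AE z in lborel. indicator S' z *\<^sub>R (\<rho> z * partial_t \<phi> z + pow_flux A \<gamma> (\<rho> z) * partial_x \<phi> z)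
        = r z * partial_t \<phi> z + pow_flux A \<gamma> (r z) * partial_x \<phi> z"
        using eq
      proof eventually_elim
        case (elim z)
        show ?case
        proof (cases "0 < snd z")
          case True
          then show ?thesis using elim by (simp add: in_S)
        next
          case False
          then have "r z = 0" using r_0[of "snd z" "fst z"] by simp
          then show ?thesis using False by (simp add: in_S pow_flux_def)
        qed
      qed
    qed measurable
    moreover have "(LINT z:S'|lborel. \<rho> z * partial_t \<phi> z + flux (velocity A \<gamma>) (\<rho> z) * partial_x \<phi> z) = 0"
      using sol \<phi> unfolding classical_entropy_solution_def S'_def by blast
    ultimately show "(LINT z|lborel. r z * partial_t \<phi> z + pow_flux A \<gamma> (r z) * partial_x \<phi> z) = 0" by simp
  next
    fix \<phi> :: "real \<times> real \<Rightarrow> real" assume \<phi>: "test_function \<phi>" and pos: "\<And>z. 0 \<le> \<phi> z"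
    have [measurable]: "partial_x \<phi> \<in> borel_measurable borel"
      using test_function_continuous[OF \<phi>] by (auto intro: borel_measurable_continuous_onI)
    note [measurable] = borel_measurable_flux_deriv[OF \<gamma>]
    have "(LINT z:S'|lborel. flux_deriv (velocity A \<gamma>) (\<rho> z) * partial_x \<phi> z) =
      (LINT z:S'|lborel. char_speed A \<gamma> (r z) * partial_x \<phi> z)"
      unfolding set_lebesgue_integral_def
    proof (rule integral_cong_AE)
      have "(\<lambda>z. indicator S' z *\<^sub>R (flux_deriv (velocity A \<gamma>) (\<rho> z) * partial_x \<phi> z))
        = (\<lambda>z. indicator S' z *\<^sub>R (flux_deriv (velocity A \<gamma>) (\<rho>1 z) * partial_x \<phi> z))"
        by (auto simp: fun_eq_iff indicator_def \<rho>1_def in_S)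
      then show "(\<lambda>z. indicator S' z *\<^sub>R (flux_deriv (velocity A \<gamma>) (\<rho> z) * partial_x \<phi> z)) \<in> borel_measurable lborel"
        by simp
      show "AE z in lborel. indicator S' z *\<^sub>R (flux_deriv (velocity A \<gamma>) (\<rho> z) * partial_x \<phi> z)
        = indicator S' z *\<^sub>R (char_speed A \<gamma> (r z) * partial_x \<phi> z)"
        using eq by eventually_elim (auto simp: indicator_def in_S flux_deriv_velocity[OF \<gamma> r_bd(1)])
    qed measurable
    moreover have "- (LINT z:S'|lborel. 1 / snd z * \<phi> z)
        \<le> (LINT z:S'|lborel. flux_deriv (velocity A \<gamma>) (\<rho> z) * partial_x \<phi> z)"
      using sol \<phi> pos unfolding classical_entropy_solution_def S'_def by blast
    ultimately show "- (LINT z:UNIV \<times> {0<..}|lborel. 1 / snd z * \<phi> z)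
        \<le> (LINT z:UNIV \<times> {0<..}|lborel. char_speed A \<gamma> (r z) * partial_x \<phi> z)"
      unfolding S'_def by simp
  next
    obtain N where N: "N \<in> null_sets lborel" and lim: "\<And>\<psi>. continuous_on UNIV \<psi> \<Longrightarrow> compact (closure {x. \<psi> x \<noteq> 0}) \<Longrightarrow>
        ((\<lambda>t. LINT x|lborel. \<psi> x * \<rho> (x, t)) \<longlongrightarrow> (LINT x|lborel. \<psi> x * g x)) (at 0 within ({0<..} - N))"
      using sol unfolding classical_entropy_solution_def weak_star_trace_def by blast
    have NE: "N \<union> E \<in> null_sets lborel" using N E by (rule null_sets.Un)
    show "weak_star_trace r g"
      unfolding weak_star_trace_def
    proof (intro bexI[OF _ NE] allI impI, elim conjE)
      fix \<psi> :: "real \<Rightarrow> real" assume \<psi>: "continuous_on UNIV \<psi>" "compact (closure {x. \<psi> x \<noteq> 0})"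
      have [measurable]: "\<psi> \<in> borel_measurable borel" by (rule borel_measurable_continuous_onI[OF \<psi>(1)])
      have "((\<lambda>t. LINT x|lborel. \<psi> x * \<rho> (x, t)) \<longlongrightarrow> (LINT x|lborel. \<psi> x * g x)) (at 0 within ({0<..} - (N \<union> E)))"
        by (rule tendsto_within_subset[OF lim[OF \<psi>]]) auto
      moreover have "\<forall>\<^sub>F t in at 0 within ({0<..} - (N \<union> E)).
          (LINT x|lborel. \<psi> x * \<rho> (x, t)) = (LINT x|lborel. \<psi> x * r (x, t))"
        unfolding eventually_at_filter
      proof (intro always_eventually allI impI)
        fix t :: real assume t: "t \<in> {0<..} - (N \<union> E)"
        have [measurable]: "(\<lambda>x. \<rho> (x, t)) \<in> borel_measurable borel" using good(1)[of t] t by auto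
        show "(LINT x|lborel. \<psi> x * \<rho> (x, t)) = (LINT x|lborel. \<psi> x * r (x, t))"
          by (rule integral_cong_AE) (use r_sec[of t] t in auto)
      qed
      ultimately show "((\<lambda>t. LINT x|lborel. \<psi> x * r (x, t)) \<longlongrightarrow> (LINT x|lborel. \<psi> x * g x)) (at 0 within ({0<..} - (N \<union> E)))"
        by (rule Lim_transform_eventually)
    qed
  qed
  with eq show ?thesis unfolding S_def by blast
qed

theorem classical_entropy_solution_unique:
  assumes "\<gamma> > 0" "classical_entropy_solution (velocity A \<gamma>) g \<rho>" "classical_entropy_solution (velocity A \<gamma>) g \<rho>'"
  shows "AE z in lborel. z \<in> UNIV \<times> {0..} \<longrightarrow> \<rho>' z = \<rho> z"
proof -
  obtain C r where 1: "clean_solution A \<gamma> C g r" "AE z in lborel. z \<in> UNIV \<times> {0..} \<longrightarrow> \<rho> z = r z"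
    using clean_of_classical[OF assms(1,2)] by blast
  obtain C' r' where 2: "clean_solution A \<gamma> C' g r'" "AE z in lborel. z \<in> UNIV \<times> {0..} \<longrightarrow> \<rho>' z = r' z"
    using clean_of_classical[OF assms(1,3)] by blast
  have u: "AE z in lborel. 0 < snd z \<longrightarrow> r z = r' z"
    by (rule clean_solution_unique[OF clean_solution_mono[OF 1(1)] clean_solution_mono[OF 2(1)], of "max C C'"]) auto
  show ?thesis using 1(2) 2(2) u AE_snd_neq_0 by eventually_elim (auto simp: less_le)
qed

subsection \<open>Supports of test functions\<close>

lemma C_k_partials:
  assumes "C_k (Suc k) \<phi>"
  shows "((\<lambda>y. \<phi> (y, t)) has_real_derivative partial_x \<phi> (y, t)) (at y)"
    "((\<lambda>s. \<phi> (y, s)) has_real_derivative partial_t \<phi> (y, t)) (at t)"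
    "C_k k (partial_x \<phi>)" "C_k k (partial_t \<phi>)"
  using assms by (auto simp: partial_x_def partial_t_def DERIV_deriv_iff_real_differentiable)

lemma C_k_continuous: "C_k k \<phi> \<Longrightarrow> continuous_on UNIV \<phi>"
  by (cases k) auto

text \<open>Vanishing outside a box passes to both partial derivatives, and for continuous functions
  it yields global bounds, whence Lipschitz constants. A positive lower time \<tau> keeps the
  support away from the initial line.\<close>

definition supp_box :: "(real \<times> real \<Rightarrow> real) \<Rightarrow> real \<Rightarrow> real \<Rightarrow> real \<Rightarrow> bool" where
  "supp_box \<phi> L \<tau> T \<longleftrightarrow> (\<forall>y t. L < \<bar>y\<bar> \<or> t < \<tau> \<or> T < t \<longrightarrow> \<phi> (y, t) = 0)"

lemma test_function_supp_box:
  assumes "test_function \<phi>"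
  shows "\<exists>L \<tau> T. 0 < L \<and> 0 < \<tau> \<and> \<tau> < T \<and> supp_box \<phi> L \<tau> T"
proof -
  let ?K = "closure {z. \<phi> z \<noteq> 0}"
  have K: "compact ?K" "?K \<subseteq> UNIV \<times> {0<..}" using assms by (auto simp: test_function_def)
  obtain B where B: "\<And>z. z \<in> ?K \<Longrightarrow> norm z \<le> B"
    using compact_imp_bounded[OF K(1)] by (auto simp: bounded_iff)
  have "\<exists>\<tau>>0. \<forall>z\<in>?K. \<tau> \<le> snd z"
  proof (cases "?K = {}")
    case False
    have "continuous_on ?K (snd :: real \<times> real \<Rightarrow> real)" by (intro continuous_intros)
    from continuous_attains_inf[OF K(1) False this]
    obtain z where z: "z \<in> ?K" "\<forall>w\<in>?K. snd z \<le> snd w" by blast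
    moreover have "0 < snd z" using z(1) K(2) by auto
    ultimately show ?thesis by blast
  next
    case True
    then show ?thesis by (intro exI[of _ 1]) (simp only: True ball_empty, simp)
  qed
  then obtain \<tau> where \<tau>: "\<tau> > 0" "\<And>z. z \<in> ?K \<Longrightarrow> \<tau> \<le> snd z" by blast
  have "supp_box \<phi> (max B 1) \<tau> (max B \<tau> + 1)"
    unfolding supp_box_def
  proof (intro allI impI)
    fix y t assume out: "max B 1 < \<bar>y\<bar> \<or> t < \<tau> \<or> max B \<tau> + 1 < t"
    show "\<phi> (y, t) = 0"
    proof (rule ccontr)
      assume "\<phi> (y, t) \<noteq> 0"
      then have k: "(y, t) \<in> ?K" using closure_subset[of "{z. \<phi> z \<noteq> 0}"] by auto
      have "\<bar>y\<bar> \<le> B" "\<bar>t\<bar> \<le> B"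
        using B[OF k] norm_fst_le[of y t] norm_snd_le[of t y] by auto
      then show False using out \<tau>(2)[OF k] by auto
    qed
  qed
  then show ?thesis using \<tau> by (intro exI[of _ "max B 1"] exI[of _ \<tau>] exI[of _ "max B \<tau> + 1"]) auto
qed

lemma deriv_eq_0_locally:
  fixes f :: "real \<Rightarrow> real"
  assumes "open S" "x \<in> S" "\<And>y. y \<in> S \<Longrightarrow> f y = 0"
  shows "deriv f x = 0"
proof -
  have "eventually (\<lambda>y. f y = (\<lambda>_. 0) y) (nhds x)"
    using eventually_nhds_in_open[OF assms(1,2)] by eventually_elim (simp add: assms(3))
  from deriv_cong_ev[OF this refl] show ?thesis by simp
qed

lemma supp_box_partial:
  assumes "supp_box \<phi> L \<tau> T"
  shows "supp_box (partial_x \<phi>) L \<tau> T" "supp_box (partial_t \<phi>) L \<tau> T"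
proof -
  have z: "\<phi> (y, t) = 0" if "L < \<bar>y\<bar> \<or> t < \<tau> \<or> T < t" for y t
    using assms that by (auto simp: supp_box_def)
  have o: "open {y::real. L < \<bar>y\<bar>}" by (intro open_Collect_less continuous_intros)
  show "supp_box (partial_x \<phi>) L \<tau> T"
    unfolding supp_box_def partial_x_def prod.case
  proof (intro allI impI)
    fix y t assume yt: "L < \<bar>y\<bar> \<or> t < \<tau> \<or> T < t"
    show "deriv (\<lambda>y. \<phi> (y, t)) y = 0"
    proof (cases "L < \<bar>y\<bar>")
      case True
      then show ?thesis by (intro deriv_eq_0_locally[OF o]) (auto intro: z)
    next
      case False
      then show ?thesis using yt by (intro deriv_eq_0_locally[OF open_UNIV]) (auto intro: z)
    qed
  qed
  show "supp_box (partial_t \<phi>) L \<tau> T"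
    unfolding supp_box_def partial_t_def prod.case
  proof (intro allI impI)
    fix y t assume yt: "L < \<bar>y\<bar> \<or> t < \<tau> \<or> T < t"
    then consider "L < \<bar>y\<bar>" | "t < \<tau>" | "T < t" by blast
    then show "deriv (\<lambda>s. \<phi> (y, s)) t = 0"
    proof cases
      case 1
      then show ?thesis by (intro deriv_eq_0_locally[OF open_UNIV]) (auto intro: z)
    next
      case 2
      then show ?thesis by (intro deriv_eq_0_locally[OF open_lessThan[of \<tau>]]) (auto intro: z)
    next
      case 3
      then show ?thesis by (intro deriv_eq_0_locally[OF open_greaterThan[of T]]) (auto intro: z)
    qed
  qed
qed

lemma supp_box_bounded:
  assumes "supp_box \<phi> L \<tau> T" "continuous_on UNIV \<phi>"
  shows "\<exists>B\<ge>0. \<forall>z. \<bar>\<phi> z\<bar> \<le> B"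
proof -
  have "compact (\<phi> ` cbox (- L, \<tau>) (L, T))"
    by (intro compact_continuous_image continuous_on_subset[OF assms(2)]) auto
  then obtain B where B: "\<And>z. z \<in> cbox (- L, \<tau>) (L, T) \<Longrightarrow> \<bar>\<phi> z\<bar> \<le> B"
    using compact_imp_bounded by (force simp: bounded_iff)
  have "\<bar>\<phi> z\<bar> \<le> max B 0" for z
  proof (cases "z \<in> cbox (- L, \<tau>) (L, T)")
    case True
    then show ?thesis using B[OF True] by simp
  next
    case False
    then have "L < \<bar>fst z\<bar> \<or> snd z < \<tau> \<or> T < snd z"
      by (cases z) (auto simp: cbox_Pair_eq)
    then have "\<phi> (fst z, snd z) = 0" using assms(1) unfolding supp_box_def by blast
    then show ?thesis by simp
  qed
  then show ?thesis by (intro exI[of _ "max B 0"]) auto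
qed

lemma supp_box_lipschitz:
  assumes "supp_box \<phi> L \<tau> T" "C_k 1 \<phi>"
  shows "\<exists>B\<ge>0. \<forall>y y' t. \<bar>\<phi> (y', t) - \<phi> (y, t)\<bar> \<le> B * \<bar>y' - y\<bar>"
proof -
  have c: "C_k (Suc 0) \<phi>" using assms(2) by simp
  obtain B where B: "B \<ge> 0" "\<And>z. \<bar>partial_x \<phi> z\<bar> \<le> B"
    using supp_box_bounded[OF supp_box_partial(1)[OF assms(1)] C_k_continuous[OF C_k_partials(3)[OF c]]] by blast
  have "\<bar>\<phi> (y', t) - \<phi> (y, t)\<bar> \<le> B * \<bar>y' - y\<bar>" for y y' t
    using field_differentiable_bound[of UNIV "\<lambda>y. \<phi> (y, t)" "\<lambda>y. partial_x \<phi> (y, t)" B y' y]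
      C_k_partials(1)[OF c] B by simp
  then show ?thesis using B(1) by blast
qed

text \<open>\<open>C_k\<close> speaks of iterated partial derivatives. Total differentiability,
  which a curve requires, follows from the continuity of the partial derivative in time.\<close>

lemma C1_chain:
  assumes "C_k 1 \<phi>" and X: "(X has_real_derivative X') (at t within S)"
  shows "((\<lambda>t. \<phi> (X t, t)) has_real_derivative
    partial_t \<phi> (X t, t) + X' * partial_x \<phi> (X t, t)) (at t within S)"
proof -
  have c: "C_k (Suc 0) \<phi>" using assms(1) by simp
  have ct: "continuous_on UNIV (partial_t \<phi>)"
    using C_k_continuous[OF C_k_partials(4)[OF c]] .
  have "((\<lambda>(y, s). \<phi> (y, s)) has_derivative
     (\<lambda>(ty, ts). (\<lambda>h. h * partial_x \<phi> (X t, t)) ty + blinfun_apply (blinfun_scaleR_left (partial_t \<phi> (X t, t))) ts))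
     (at (X t, t) within UNIV \<times> UNIV)"
  proof (rule has_derivative_partialsI[where fy = "\<lambda>y s. blinfun_scaleR_left (partial_t \<phi> (y, s))"])
    show "((\<lambda>y. \<phi> (y, t)) has_derivative (\<lambda>h. h * partial_x \<phi> (X t, t))) (at (X t))"
      using C_k_partials(1)[OF c] by (simp add: has_field_derivative_def mult.commute[of _ "partial_x \<phi> (X t, t)"])
    show "((\<lambda>s. \<phi> (y, s)) has_derivative blinfun_apply (blinfun_scaleR_left (partial_t \<phi> (y, s)))) (at s)" for y s
    proof -
      have "(*) (partial_t \<phi> (y, s)) = blinfun_apply (blinfun_scaleR_left (partial_t \<phi> (y, s)))"
        by (simp add: fun_eq_iff)
      then show ?thesis using C_k_partials(2)[OF c, of y s] by (simp add: has_field_derivative_def)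
    qed
    have "isCont (\<lambda>z. blinfun_scaleR_left (partial_t \<phi> z)) (X t, t)"
      using ct by (intro bounded_linear.isCont[OF bounded_linear_blinfun_scaleR_left])
         (simp add: continuous_on_eq_continuous_at)
    then show "continuous (at (X t, t) within UNIV \<times> UNIV) (\<lambda>(y, s). blinfun_scaleR_left (partial_t \<phi> (y, s)))"
      by (simp add: split_beta')
  qed auto
  then have d: "(\<phi> has_derivative (\<lambda>h. fst h * partial_x \<phi> (X t, t) + snd h * partial_t \<phi> (X t, t))) (at (X t, t))"
    by (simp add: split_beta')
  have "((\<lambda>s. (X s, s)) has_derivative (\<lambda>h. (h * X', h))) (at t within S)"
    using X by (intro has_derivative_Pair) (auto simp: has_field_derivative_def mult.commute[of _ X'])
  from has_derivative_compose[OF this, of \<phi>, OF d]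
  have "((\<lambda>s. \<phi> (X s, s)) has_derivative
    (\<lambda>h. h * X' * partial_x \<phi> (X t, t) + h * partial_t \<phi> (X t, t))) (at t within S)" by simp
  moreover have "(\<lambda>h. h * X' * partial_x \<phi> (X t, t) + h * partial_t \<phi> (X t, t))
    = (*) (partial_t \<phi> (X t, t) + X' * partial_x \<phi> (X t, t))"
    by (simp add: fun_eq_iff algebra_simps)
  ultimately show ?thesis by (simp only: has_field_derivative_def)
qed

subsection \<open>Initial positions of the particles\<close>

text \<open>A Lindelof argument: each point off the support has a neighbourhood on which g vanishes
  almost everywhere, and this may be taken from the countably many intervals with rational
  ends.\<close>

lemma AE_outside_ess_support: "AE y in lborel. y \<notin> ess_support g \<longrightarrow> g y = 0"
proof -
  let ?Q = "\<lambda>p q. AE y in lborel. y \<in> {p<..<q} \<longrightarrow> g y = 0"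
  have "AE y in lborel. \<forall>p\<in>\<rat>. \<forall>q\<in>\<rat>. ?Q p q \<longrightarrow> y \<in> {p<..<q} \<longrightarrow> g y = 0"
  proof (intro AE_ball_countable' countable_rat)
    fix p q :: real
    show "AE y in lborel. ?Q p q \<longrightarrow> y \<in> {p<..<q} \<longrightarrow> g y = 0"
      by (cases "?Q p q") auto
  qed
  then show ?thesis
  proof eventually_elim
    case (elim y)
    show ?case
    proof
      assume "y \<notin> ess_support g"
      then obtain U where U: "open U" "y \<in> U" "AE z in lborel. z \<in> U \<longrightarrow> g z = 0"
        by (auto simp: ess_support_def)
      obtain e where e: "e > 0" "ball y e \<subseteq> U"
        using U(1,2) unfolding open_contains_ball by blast
      obtain p where p: "p \<in> \<rat>" "y - e < p" "p < y" using Rats_dense_in_real[of "y - e" y] e by auto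
      obtain q where q: "q \<in> \<rat>" "y < q" "q < y + e" using Rats_dense_in_real[of y "y + e"] e by auto
      have "{p<..<q} \<subseteq> ball y e" using p q by (auto simp: dist_real_def)
      then have "{p<..<q} \<subseteq> U" using e by blast
      then have "?Q p q" using U(3) by (auto elim!: eventually_mono)
      then show "g y = 0" using elim p q by auto
    qed
  qed
qed

locale initial_datum =
  fixes g :: "real \<Rightarrow> real" and C :: real
  assumes g_int: "integrable lborel g" and C_pos: "C > 0"
    and g_bd: "AE y in lborel. \<bar>g y\<bar> \<le> C" and g_nonneg: "AE y in lborel. g y \<ge> 0"
    and g_supp: "compact (ess_support g)" and g_mass: "(LINT y|lborel. \<bar>g y\<bar>) = 1"
begin

lemma supp_nonempty: "ess_support g \<noteq> {}"
proof
  assume "ess_support g = {}"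
  then have "AE y in lborel. \<bar>g y\<bar> = 0" using AE_outside_ess_support[of g] by simp
  then have "(LINT y|lborel. \<bar>g y\<bar>) = 0" by (rule integral_eq_zero_AE)
  then show False using g_mass by simp
qed

lemma hull_bounds:
  assumes "y \<in> ess_support g" shows "x_min g \<le> y" "y \<le> x_max g"
proof -
  have b: "bounded (convex hull (ess_support g))"
    using compact_convex_hull[OF g_supp] by (rule compact_imp_bounded)
  have y: "y \<in> convex hull (ess_support g)" using assms by (rule hull_inc)
  show "x_min g \<le> y" unfolding x_min_def
    using y b by (intro cInf_lower bounded_imp_bdd_below)
  show "y \<le> x_max g" unfolding x_max_def
    using y b by (intro cSup_upper bounded_imp_bdd_above)
qed

lemma min_le_max: "x_min g \<le> x_max g"
proof -
  obtain y where "y \<in> ess_support g" using supp_nonempty by blast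
  then show ?thesis using hull_bounds[of y] by linarith
qed

lemma AE_outside: "AE y in lborel. y \<notin> {x_min g..x_max g} \<longrightarrow> g y = 0"
  using AE_outside_ess_support[of g] hull_bounds by (auto elim!: eventually_mono)

lemma locally_integrable_g: "locally_integrable g"
  by (rule integrable_imp_locally_integrable[OF g_int])

text \<open>The cumulative distribution function of the datum.\<close>

definition F :: "real \<Rightarrow> real" where
  "F x = prim g x - prim g (x_min g)"

lemma F_diff: "F y - F x = (LBINT s=ereal x..ereal y. g s)"
  using prim_diff[OF locally_integrable_g, of y x] by (simp add: F_def)

lemma F_diff_set: "x \<le> y \<Longrightarrow> F y - F x = (LINT s:{x..y}|lborel. g s)"
  using prim_diff_Icc[OF locally_integrable_g, of x y] by (simp add: F_def)

lemma F_mono: "x \<le> y \<Longrightarrow> F x \<le> F y"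
proof -
  assume "x \<le> y"
  have "0 \<le> (LINT s:{x..y}|lborel. g s)"
    unfolding set_lebesgue_integral_def
    using g_nonneg by (intro integral_nonneg_AE) (auto elim!: eventually_mono)
  then show ?thesis using F_diff_set[OF \<open>x \<le> y\<close>] by simp
qed

lemma F_lipschitz:
  assumes "x \<le> y" shows "F y - F x \<le> C * (y - x)"
proof -
  have "(LINT s:{x..y}|lborel. g s) \<le> (LINT s:{x..y}|lborel. C)"
    unfolding set_lebesgue_integral_def
  proof (rule integral_mono_AE)
    show "integrable lborel (\<lambda>s. indicator {x..y} s *\<^sub>R g s)"
      using locally_integrable_g by (simp add: locally_integrable_def set_integrable_def)
    show "AE s in lborel. indicator {x..y} s *\<^sub>R g s \<le> indicator {x..y} s *\<^sub>R C"
      using g_bd by eventually_elim (auto simp: indicator_def)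
  qed (auto simp: emeasure_lborel_Icc_eq)
  also have "\<dots> = C * (y - x)" using assms by (simp add: set_lebesgue_integral_def)
  finally show ?thesis using F_diff_set[OF assms] by simp
qed

lemma F_continuous: "continuous_on UNIV F"
proof (rule lipschitz_on_continuous_on)
  have "\<bar>F y - F x\<bar> \<le> C * \<bar>y - x\<bar>" for x y
    using F_lipschitz[of x y] F_lipschitz[of y x] F_mono[of x y] F_mono[of y x] by (cases "x \<le> y") auto
  then show "C-lipschitz_on UNIV F"
    using C_pos by (auto simp: lipschitz_on_def dist_real_def abs_minus_commute)
qed

lemma g_total: "(LINT s|lborel. g s) = 1"
proof -
  have "(LINT s|lborel. g s) = (LINT s|lborel. \<bar>g s\<bar>)"
    using g_nonneg borel_measurable_integrable[OF g_int]
    by (intro integral_cong_AE) (auto elim!: eventually_mono)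
  then show ?thesis using g_mass by simp
qed

lemma F_left: "x \<le> x_min g \<Longrightarrow> F x = 0"
proof -
  assume x: "x \<le> x_min g"
  have "(LINT s|lborel. indicator {x..x_min g} s *\<^sub>R g s) = 0"
  proof (rule integral_eq_zero_AE)
    show "AE s in lborel. indicator {x..x_min g} s *\<^sub>R g s = 0"
      using AE_outside AE_lborel_singleton[of "x_min g"]
      by eventually_elim (auto simp: indicator_def)
  qed
  then show ?thesis using F_diff_set[OF x] by (simp add: set_lebesgue_integral_def F_def)
qed

lemma F_right: "x_max g \<le> x \<Longrightarrow> F x = 1"
proof -
  assume x: "x_max g \<le> x"
  have le: "x_min g \<le> x" using x min_le_max by simp
  have "(LINT s|lborel. indicator {x_min g..x} s *\<^sub>R g s) = (LINT s|lborel. g s)"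
  proof (rule integral_cong_AE)
    show "AE s in lborel. indicator {x_min g..x} s *\<^sub>R g s = g s"
      using AE_outside by eventually_elim (use x in \<open>auto simp: indicator_def\<close>)
  qed (use borel_measurable_integrable[OF g_int] in auto)
  then show ?thesis using F_diff_set[OF le] g_total by (simp add: set_lebesgue_integral_def F_def)
qed

lemma F_less_imp: "F x < F y \<Longrightarrow> x < y"
  using F_mono[of y x] by linarith

lemma F_Sup:
  assumes c: "0 < c" "c < 1"
  shows "F (Sup {x. F x < c}) = c"
proof -
  let ?S = "{x. F x < c}"
  have ne: "x_min g \<in> ?S" using F_left[of "x_min g"] c by simp
  have bdd: "bdd_above ?S"
  proof (rule bdd_aboveI)
    fix x assume "x \<in> ?S"
    then show "x \<le> x_max g" using F_right[of x] c by (cases "x \<le> x_max g") auto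
  qed
  have cont: "isCont F (Sup ?S)" using F_continuous by (simp add: continuous_on_eq_continuous_at)
  have "\<not> F (Sup ?S) < c"
  proof
    assume "F (Sup ?S) < c"
    then have "eventually (\<lambda>y. F y < c) (at (Sup ?S))"
      using cont unfolding isCont_def by (intro order_tendstoD(2)) auto
    then obtain d where d: "d > 0" "\<And>y. y \<noteq> Sup ?S \<Longrightarrow> dist y (Sup ?S) < d \<Longrightarrow> F y < c"
      unfolding eventually_at by auto
    have "F (Sup ?S + d / 2) < c" using d by (intro d(2)) (auto simp: dist_real_def)
    then have "Sup ?S + d / 2 \<le> Sup ?S" using bdd by (intro cSup_upper) auto
    then show False using d by simp
  qed
  moreover have "\<not> c < F (Sup ?S)"
  proof
    assume "c < F (Sup ?S)"
    then have "eventually (\<lambda>y. c < F y) (at (Sup ?S))"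
      using cont unfolding isCont_def by (intro order_tendstoD(1)) auto
    then obtain d where d: "d > 0" "\<And>y. y \<noteq> Sup ?S \<Longrightarrow> dist y (Sup ?S) < d \<Longrightarrow> c < F y"
      unfolding eventually_at by auto
    have lt: "Sup ?S - d / 2 < Sup ?S" using d by simp
    have big: "c < F (Sup ?S - d / 2)" using d by (intro d(2)) (auto simp: dist_real_def)
    obtain x where "x \<in> ?S" "Sup ?S - d / 2 < x"
      using less_cSup_iff[of ?S, THEN iffD1, OF _ bdd lt] ne by auto
    then show False using F_mono[of "Sup ?S - d / 2" x] big by auto
  qed
  ultimately show ?thesis by linarith
qed

lemma F_init_pos:
  assumes "n \<ge> 1" "i \<le> n"
  shows "F (init_pos g n i) = real i / real n"
proof -
  have q: "F (quantile_pos g n i) = real i / real n" if "i < n" for i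
    using that
  proof (induction i)
    case 0
    then show ?case by (simp add: F_left)
  next
    case (Suc i)
    \<comment> \<open>The oriented integral from the previous quantile is F x - i/n. Thus the
      recursion takes the supremum of a sublevel set of F, where F attains the level by
      continuity.\<close>
    have "(LBINT s=ereal (quantile_pos g n i)..ereal x. g s) < 1 / real n \<longleftrightarrow> F x < real (Suc i) / real n" for x
      using Suc assms by (simp add: F_diff[symmetric] field_simps)
    then have "quantile_pos g n (Suc i) = Sup {x. F x < real (Suc i) / real n}" by simp
    moreover have "real (Suc i) / real n < 1" using Suc by simp
    ultimately show ?case using F_Sup[of "real (Suc i) / real n"] Suc by simp
  qed
  show ?thesis
  proof (cases "i = n")
    case True
    then show ?thesis using assms by (simp add: init_pos_def F_right)
  next
    case False
    then show ?thesis using assms q[of i] by (simp add: init_pos_def)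
  qed
qed

text \<open>Consecutive particles enclose mass 1/n, and the density is at most C.\<close>

lemma init_gap:
  assumes "n \<ge> 1" "i < n"
  shows "1 / (real n * C) \<le> init_pos g n (Suc i) - init_pos g n i"
proof -
  have d: "F (init_pos g n (Suc i)) - F (init_pos g n i) = 1 / real n"
    using assms by (simp add: F_init_pos diff_divide_distrib[symmetric])
  moreover have "0 < 1 / real n" using assms by simp
  ultimately have "F (init_pos g n i) < F (init_pos g n (Suc i))" by linarith
  from less_imp_le[OF F_less_imp[OF this]]
  have "1 / real n \<le> C * (init_pos g n (Suc i) - init_pos g n i)"
    using F_lipschitz d by metis
  then have "1 / real n / C \<le> init_pos g n (Suc i) - init_pos g n i"
    using C_pos pos_divide_le_eq[of C "1 / real n"] by (metis mult.commute)
  then show ?thesis by (simp add: mult.commute)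
qed

end

subsection \<open>Convergence of almost monotone functions from convergence of their primitives\<close>

lemma limsup_bounded:
  fixes z :: "nat \<Rightarrow> real"
  assumes "\<And>m. \<bar>z m\<bar> \<le> K"
  shows "ereal (real_of_ereal (limsup (\<lambda>m. ereal (z m)))) = limsup (\<lambda>m. ereal (z m))"
    and "ereal (real_of_ereal (liminf (\<lambda>m. ereal (z m)))) = liminf (\<lambda>m. ereal (z m))"
proof -
  have up: "limsup (\<lambda>m. ereal (z m)) \<le> ereal K"
    using assms by (intro Limsup_bounded) (auto simp: abs_le_iff)
  have lo: "ereal (- K) \<le> liminf (\<lambda>m. ereal (z m))"
    using assms by (intro Liminf_bounded) (auto simp: abs_le_iff minus_le_iff)
  have le: "liminf (\<lambda>m. ereal (z m)) \<le> limsup (\<lambda>m. ereal (z m))"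
    by (rule Liminf_le_Limsup) simp
  have "limsup (\<lambda>m. ereal (z m)) \<noteq> \<infinity>" "limsup (\<lambda>m. ereal (z m)) \<noteq> -\<infinity>"
    "liminf (\<lambda>m. ereal (z m)) \<noteq> \<infinity>" "liminf (\<lambda>m. ereal (z m)) \<noteq> -\<infinity>"
    using up lo le by (auto simp: ereal_infty_less_eq2)
  then show "ereal (real_of_ereal (limsup (\<lambda>m. ereal (z m)))) = limsup (\<lambda>m. ereal (z m))" "ereal (real_of_ereal (liminf (\<lambda>m. ereal (z m)))) = liminf (\<lambda>m. ereal (z m))"
    unfolding ereal_real by auto
qed

text \<open>
  \<open>Z m x y\<close> is the \<open>\<gamma>\<close>-th power of a difference quotient of the primitive of the density, \<open>z m\<close> the \<open>\<gamma>\<close>-th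
  power of the density.  Up to a linear term the upper limit of \<open>z\<close> is monotone, and it coincides with the
  lower limit at its points of continuity.
\<close>

lemma countable_nonconvergence:
  fixes z :: "nat \<Rightarrow> real \<Rightarrow> real" and Z :: "nat \<Rightarrow> real \<Rightarrow> real \<Rightarrow> real"
  assumes bd: "\<And>m x. \<bar>z m x\<bar> \<le> K" and "\<epsilon> \<longlonglongrightarrow> 0" and "0 \<le> l"
    and quasi: "\<And>m x y. x < y \<Longrightarrow> z m x \<le> z m y + l * (y - x) + \<epsilon> m"
    and lower: "\<And>m x y. x < y \<Longrightarrow> z m x \<le> Z m x y + l * (y - x) + \<epsilon> m"
    and upper: "\<And>m x y. x < y \<Longrightarrow> Z m x y \<le> z m y + l * (y - x) + \<epsilon> m"
    and conv: "\<And>x y. x < y \<Longrightarrow> convergent (\<lambda>m. Z m x y)"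
  shows "countable {x. \<not> convergent (\<lambda>m. z m x)}"
proof -
  define P where "P x = real_of_ereal (limsup (\<lambda>m. ereal (z m x)))" for x
  define Q where "Q x = real_of_ereal (liminf (\<lambda>m. ereal (z m x)))" for x
  have P: "ereal (P x) = limsup (\<lambda>m. ereal (z m x))" and Q: "ereal (Q x) = liminf (\<lambda>m. ereal (z m x))" for x
    unfolding P_def Q_def using limsup_bounded[of "\<lambda>m. z m x" K] bd by auto
  have P_le: "P x \<le> c" if "\<And>m. z m x \<le> c' m" "c' \<longlonglongrightarrow> c" for x c c'
  proof -
    have "limsup (\<lambda>m. ereal (z m x)) \<le> limsup (\<lambda>m. ereal (c' m))"
      using that(1) by (intro Limsup_mono) auto
    also have "\<dots> = ereal c" using that(2) by (intro lim_imp_Limsup) auto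
    finally show ?thesis by (simp flip: P)
  qed
  have Q_ge: "c \<le> Q x" if "\<And>m. c' m \<le> z m x" "c' \<longlonglongrightarrow> c" for x c c'
  proof -
    have "ereal c = liminf (\<lambda>m. ereal (c' m))" using that(2) by (intro lim_imp_Liminf[symmetric]) auto
    also have "\<dots> \<le> liminf (\<lambda>m. ereal (z m x))"
      using that(1) by (intro Liminf_mono) auto
    finally show ?thesis by (simp flip: Q)
  qed
  \<comment> \<open>\<open>Z m x y\<close> lies between \<open>z m x\<close> and
    \<open>z m y\<close> up to small terms. Since it converges, the upper limit at x is controlled
    by the lower limit at y, although the two may be attained along different subsequences.\<close>
  have PQ: "P x \<le> Q y + 2 * l * (y - x)" if xy: "x < y" for x y
  proof -
    obtain q where q: "(\<lambda>m. Z m x y) \<longlonglongrightarrow> q" using conv[OF xy] by (auto simp: convergent_def)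
    have "P x \<le> q + l * (y - x) + 0"
      by (rule P_le[OF lower[OF xy]]) (intro tendsto_intros q assms(2))
    moreover have "q - l * (y - x) - 0 \<le> Q y"
    proof (rule Q_ge)
      show "Z m x y - l * (y - x) - \<epsilon> m \<le> z m y" for m using upper[OF xy, of m] by simp
    qed (intro tendsto_intros q assms(2))
    ultimately show ?thesis by simp
  qed
  have P_quasi: "P x \<le> P y + l * (y - x)" if "x < y" for x y
  proof -
    have "limsup (\<lambda>m. ereal (z m x)) \<le> limsup (\<lambda>m. ereal (z m y) + ereal (l * (y - x) + \<epsilon> m))"
      using quasi[OF that] by (intro Limsup_mono) (auto simp: add.assoc)
    also have "\<dots> \<le> limsup (\<lambda>m. ereal (z m y)) + limsup (\<lambda>m. ereal (l * (y - x) + \<epsilon> m))"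
      by (rule ereal_limsup_add_mono)
    also have "limsup (\<lambda>m. ereal (l * (y - x) + \<epsilon> m)) = ereal (l * (y - x) + 0)"
      by (intro lim_imp_Limsup tendsto_ereal tendsto_add tendsto_const assms(2)) simp
    finally show ?thesis by (simp flip: P)
  qed
  have "mono (\<lambda>x. P x + l * x)"
  proof (rule monoI)
    fix x y :: real assume "x \<le> y"
    then show "P x + l * x \<le> P y + l * y"
      using P_quasi[of x y] by (cases "x = y") (auto simp: algebra_simps)
  qed
  then have "countable {x. \<not> isCont (\<lambda>x. P x + l * x) x}" by (rule mono_ctble_discont)
  \<comment> \<open>At a point of continuity of P, letting x increase to y in \<open>PQ\<close>
    makes the upper limit at most the lower one.\<close>
  moreover have "convergent (\<lambda>m. z m y)" if "isCont (\<lambda>x. P x + l * x) y" for y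
  proof -
    have "isCont (\<lambda>x. (P x + l * x) - l * x) y"
      by (rule continuous_diff[OF that]) (intro continuous_intros)
    then have "((\<lambda>x. P x) \<longlongrightarrow> P y) (at_left y)"
      by (simp add: isCont_def filterlim_at_split)
    moreover have "((\<lambda>x. Q y + 2 * l * (y - x)) \<longlongrightarrow> Q y + 2 * l * (y - y)) (at_left y)"
      by (intro tendsto_intros)
    moreover have "eventually (\<lambda>x. P x \<le> Q y + 2 * l * (y - x)) (at_left y)"
      using PQ by (auto simp: eventually_at_filter)
    ultimately have "P y \<le> Q y + 2 * l * (y - y)"
      by (intro tendsto_le[of "at_left y"]) (auto simp: trivial_limit_at_left_real)
    then have "limsup (\<lambda>m. ereal (z m y)) \<le> liminf (\<lambda>m. ereal (z m y))"
      by (simp flip: P Q)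
    then have "limsup (\<lambda>m. ereal (z m y)) = ereal (P y)" "liminf (\<lambda>m. ereal (z m y)) = ereal (P y)"
      using Liminf_le_Limsup[of sequentially "\<lambda>m. ereal (z m y)"] by (auto simp: P intro: antisym)
    then have "(\<lambda>m. ereal (z m y)) \<longlonglongrightarrow> ereal (P y)" by (intro Liminf_eq_Limsup) auto
    then show ?thesis by (auto simp: convergent_def)
  qed
  then have "{x. \<not> convergent (\<lambda>m. z m x)} \<subseteq> {x. \<not> isCont (\<lambda>x. P x + l * x) x}" by auto
  ultimately show ?thesis by (meson countable_subset)
qed

subsection \<open>The discrete density and its distribution function\<close>

lemma integral_indicator_ramp:
  assumes "a \<le> b" "p \<le> q"
  shows "(LINT y:{a<..<b}|lborel. indicator {p..<q} y) = ramp (q - p) (b - p) - ramp (q - p) (a - p)"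
proof -
  have "(LINT y:{a<..<b}|lborel. indicator {p..<q} y :: real) = (LINT y|lborel. indicator ({a<..<b} \<inter> {p..<q}) y)"
    unfolding set_lebesgue_integral_def
    by (intro Bochner_Integration.integral_cong) (auto simp: indicator_def)
  also have "\<dots> = measure lborel ({a<..<b} \<inter> {p..<q})" by simp
  also have "\<dots> = ramp (q - p) (b - p) - ramp (q - p) (a - p)"
  proof (cases "a < p")
    case True
    then have "{a<..<b} \<inter> {p..<q} = {p..<min b q}" by auto
    then show ?thesis using assms True
      by (cases "p \<le> min b q") (auto simp: ramp_def measure_def)
  next
    case False
    then have "{a<..<b} \<inter> {p..<q} = {a<..<min b q}" by auto
    then show ?thesis using assms False
      by (cases "a \<le> min b q") (auto simp: ramp_def measure_def)
  qed
  finally show ?thesis .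
qed

context ftl_scheme
begin

abbreviation dens :: "real \<Rightarrow> real \<Rightarrow> real" where
  "dens y t \<equiv> ftl_density n x (y, t)"

lemma dens_eq: "dens y t = (\<Sum>i<n. R i t * indicator {x i t..<x (Suc i) t} y)"
  by (simp add: ftl_density_def)

lemma x_less_Suc: "i < n \<Longrightarrow> t \<ge> 0 \<Longrightarrow> x i t < x (Suc i) t"
  using gap_pos[of i t] by (simp add: gap_def)

lemma x_mono:
  assumes "t \<ge> 0" "i \<le> j" "j \<le> n" shows "x i t \<le> x j t"
  using assms(2,3)
proof (induction j rule: dec_induct)
  case (step j)
  then show ?case using x_less_Suc[of j t] assms(1) by simp
qed simp

lemma dens_cell:
  assumes "t \<ge> 0" "i < n" "x i t \<le> y" "y < x (Suc i) t"
  shows "dens y t = R i t"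
proof -
  have "indicator {x j t..<x (Suc j) t} y = (0::real)" if "j < n" "j \<noteq> i" for j
  proof (cases "j < i")
    case True
    then have "x (Suc j) t \<le> x i t" using assms by (intro x_mono) auto
    then show ?thesis using assms by (simp add: indicator_def)
  next
    case False
    then have "x (Suc i) t \<le> x j t" using assms that by (intro x_mono) auto
    then show ?thesis using assms by (simp add: indicator_def)
  qed
  then have "dens y t = (\<Sum>j<n. if j = i then R i t else 0)"
    unfolding dens_eq using assms by (intro sum.cong) auto
  then show ?thesis using assms by simp
qed

lemma dens_outside:
  assumes "t \<ge> 0" "y < x 0 t \<or> x n t \<le> y"
  shows "dens y t = 0"
  unfolding dens_eq
proof (rule sum.neutral, rule ballI)
  fix i assume "i \<in> {..<n}"
  then have "x 0 t \<le> x i t" "x (Suc i) t \<le> x n t" using assms by (auto intro: x_mono)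
  then show "R i t * indicator {x i t..<x (Suc i) t} y = 0" using assms by (auto simp: indicator_def)
qed

lemma cell_exists:
  assumes "x 0 t \<le> y" "y < x n t"
  shows "\<exists>i<n. x i t \<le> y \<and> y < x (Suc i) t"
proof -
  define k where "k = (LEAST k. y < x k t)"
  have k: "y < x k t" unfolding k_def using assms(2) by (rule LeastI)
  have "k \<le> n" unfolding k_def using assms(2) by (rule Least_le)
  have "k \<noteq> 0" using k assms(1) by (intro notI) simp
  then obtain i where i: "k = Suc i" using not0_implies_Suc by blast
  have "\<not> y < x i t" using not_less_Least[of i "\<lambda>k. y < x k t"] i unfolding k_def by simp
  then show ?thesis using k i \<open>k \<le> n\<close> by (intro exI[of _ i]) auto
qed

lemma dens_cases:
  assumes "t \<ge> 0"
  obtains "dens y t = 0" "y < x 0 t \<or> x n t \<le> y"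
  | i where "i < n" "x i t \<le> y" "y < x (Suc i) t" "dens y t = R i t"
  using assms dens_outside[of t y] cell_exists[of t y] dens_cell[of t _ y] by (meson not_less)

lemma dens_bounds:
  assumes "t \<ge> 0" shows "0 \<le> dens y t" "dens y t \<le> C"
  using assms R_pos[of _ t] R_le[of _ t] C_pos by (cases rule: dens_cases[OF assms, of y]; force intro: less_imp_le)+

definition speed_max :: real where
  "speed_max = \<bar>A\<bar> + C powr \<gamma>"

lemma speed_max_nonneg: "0 \<le> speed_max" by (simp add: speed_max_def)

lemma velocity_bound:
  assumes "i < n" "t \<ge> 0" shows "\<bar>velocity A \<gamma> (R i t)\<bar> \<le> speed_max"
proof -
  have "R i t powr \<gamma> \<le> C powr \<gamma>"
    using R_pos[OF assms] R_le[OF assms] \<gamma>_pos by (intro powr_mono2) auto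
  then show ?thesis using powr_ge_zero[of "R i t" \<gamma>] unfolding velocity_def speed_max_def by linarith
qed

lemma x_lipschitz:
  assumes "i \<le> n" "s \<ge> 0" "t \<ge> 0"
  shows "\<bar>x i t - x i s\<bar> \<le> speed_max * \<bar>t - s\<bar>"
proof (cases "i < n")
  case True
  show ?thesis
    using field_differentiable_bound[of "{0..}" "x i" "\<lambda>t. velocity A \<gamma> (R i t)" speed_max t s]
      ode[OF True] velocity_bound[OF True] assms by auto
next
  case False
  have "\<bar>A\<bar> \<le> speed_max" by (simp add: speed_max_def)
  then show ?thesis
    using field_differentiable_bound[of "{0..}" "x n" "\<lambda>t. A" speed_max t s] ode_last assms False by auto
qed

lemma z_diff:
  assumes "t > 0" "i \<le> j" "j \<le> n"
  shows "(1 + \<gamma>) * t * (z i t - z j t) \<le> x j t - x i t"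
  using assms(2,3)
proof (induction j rule: dec_induct)
  case (step j)
  have "(1 + \<gamma>) * t * (z j t - z (Suc j) t) \<le> x (Suc j) t - x j t"
    using discrete_Oleinik[of t j] assms step by (auto simp: gap_def)
  moreover have "(1 + \<gamma>) * t * (z i t - z j t) \<le> x j t - x i t" using step by simp
  ultimately show ?case by (simp add: algebra_simps)
qed simp

text \<open>The error of comparing points instead of particles, split at cell length 1/sqrt n. A
  shorter cell costs its length divided by (1+\<gamma>) t; a longer one has density below 1/sqrt n,
  so its whole \<gamma>-th power is small.\<close>

definition Oleinik_error :: "real \<Rightarrow> real" where
  "Oleinik_error t = (1 / sqrt (real n)) / ((1 + \<gamma>) * t) + (1 / sqrt (real n)) powr \<gamma>"

lemma dens_powr_quasi_mono:
  assumes t: "t > 0" and "y < y'"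
  shows "dens y t powr \<gamma> \<le> dens y' t powr \<gamma> + 1 / ((1 + \<gamma>) * t) * (y' - y) + Oleinik_error t"
proof -
  let ?c = "1 / ((1 + \<gamma>) * t)" and ?d = "1 / sqrt (real n)"
  have c: "0 < (1 + \<gamma>) * t" using t \<gamma>_pos by simp
  have d: "0 < ?d" using n_pos by simp
  have pos: "0 \<le> ?c * (y' - y)" "0 \<le> ?d / ((1 + \<gamma>) * t)" using c d assms by auto
  have t0: "t \<ge> 0" using t by simp
  show ?thesis
  proof (cases rule: dens_cases[OF t0, of y])
    case 1
    then show ?thesis using pos by (simp add: Oleinik_error_def)
  next
    case (2 i)
    have zi: "dens y t powr \<gamma> = z i t" using 2 by (simp add: z_def)
    \<comment> \<open>To the right of the leader the index n is taken: the density 0 there agrees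
      with \<open>z n\<close>.\<close>
    have ex: "\<exists>j. i \<le> j \<and> j \<le> n \<and> x j t \<le> y' \<and> dens y' t powr \<gamma> = z j t"
    proof (cases rule: dens_cases[OF t0, of y'])
      case 1
      have "x 0 t \<le> x i t" using 2 t by (intro x_mono) auto
      then have "x n t \<le> y'" using 1 2 assms by auto
      then show ?thesis using 1 2 by (intro exI[of _ n]) (auto simp: z_def)
    next
      case (2 j)
      have "\<not> j < i"
      proof
        assume "j < i"
        then have "x (Suc j) t \<le> x i t" using \<open>i < n\<close> t by (intro x_mono) auto
        then show False using 2 \<open>x i t \<le> y\<close> \<open>y < y'\<close> by linarith
      qed
      then show ?thesis using 2 by (intro exI[of _ j]) (auto simp: z_def)
    qed
    then obtain j where j: "i \<le> j" "j \<le> n" "x j t \<le> y'" "dens y' t powr \<gamma> = z j t" by blast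
    show ?thesis
    proof (cases "gap i t \<le> ?d")
      case True
      have "(1 + \<gamma>) * t * (z i t - z j t) \<le> x j t - x i t" using t j by (intro z_diff)
      also have "\<dots> \<le> (y' - y) + ?d" using True j 2 by (simp add: gap_def)
      finally have "z i t - z j t \<le> ((y' - y) + ?d) / ((1 + \<gamma>) * t)"
        using c by (simp add: pos_le_divide_eq mult.commute)
      moreover have "((y' - y) + ?d) / ((1 + \<gamma>) * t) = ?c * (y' - y) + ?d / ((1 + \<gamma>) * t)"
        by (simp add: add_divide_distrib)
      ultimately show ?thesis unfolding zi j(4) Oleinik_error_def
        using powr_ge_zero[of ?d \<gamma>] by linarith
    next
      case False
      then have g: "?d < gap i t" by simp
      have "1 / real n = ?d * ?d" using n_pos by simp
      then have "R i t = ?d * ?d / gap i t"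
        by (simp add: R_eq) 
      also have "\<dots> \<le> ?d * ?d / ?d" by (intro frac_le less_imp_le[OF g] d) auto
      also have "\<dots> = ?d" by (rule nonzero_mult_div_cancel_right) (use d in linarith)
      finally have "R i t \<le> ?d" .
      then have "z i t \<le> ?d powr \<gamma>"
        using 2 R_pos[of i t] t \<gamma>_pos by (auto simp: z_def intro!: powr_mono2)
      then show ?thesis unfolding zi j(4) Oleinik_error_def using pos z_nonneg[of j t] by linarith
    qed
  qed
qed

text \<open>The distribution function in closed form: the ramp is the length of the part of the i-th
  cell to the left of y, and a full cell contributes 1/n.\<close>

definition mass :: "real \<Rightarrow> real \<Rightarrow> real" where
  "mass t y = (\<Sum>i<n. R i t * ramp (gap i t) (y - x i t))"

lemma dens_measurable_section: "(\<lambda>y. dens y t) \<in> borel_measurable borel"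
  unfolding dens_eq by measurable

lemma dens_abs: "t \<ge> 0 \<Longrightarrow> \<bar>dens y t\<bar> \<le> C"
  using dens_bounds[of t y] by simp

lemma dens_locally_integrable: "t \<ge> 0 \<Longrightarrow> locally_integrable (\<lambda>y. dens y t)"
  by (rule locally_integrable_bounded[OF dens_measurable_section dens_abs])

lemma integral_dens:
  assumes "t \<ge> 0" "a \<le> b"
  shows "(LINT y:{a<..<b}|lborel. dens y t) = mass t b - mass t a"
proof -
  have "(LINT y:{a<..<b}|lborel. dens y t)
     = (\<Sum>i<n. R i t * (LINT y:{a<..<b}|lborel. indicator {x i t..<x (Suc i) t} y))"
  proof -
    have "integrable lborel (\<lambda>y. indicator {a<..<b} y * indicator {x i t..<x (Suc i) t} y :: real)" for i
    proof (rule Bochner_Integration.integrable_bound)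
      show "integrable lborel (indicator {a<..<b} :: real \<Rightarrow> real)" using assms by simp
    qed (auto simp: indicator_def)
    moreover have "indicator {a<..<b} y *\<^sub>R dens y t =
        (\<Sum>i<n. R i t * (indicator {a<..<b} y * indicator {x i t..<x (Suc i) t} y))" for y
      by (simp only: dens_eq real_scaleR_def sum_distrib_left mult.left_commute)
    ultimately show ?thesis by (simp add: set_lebesgue_integral_def)
  qed
  also have "\<dots> = (\<Sum>i<n. R i t * (ramp (gap i t) (b - x i t) - ramp (gap i t) (a - x i t)))"
  proof (rule sum.cong)
    fix i assume "i \<in> {..<n}"
    then have "x i t \<le> x (Suc i) t" using x_less_Suc[of i t] assms by simp
    from integral_indicator_ramp[OF assms(2) this]
    show "R i t * (LINT y:{a<..<b}|lborel. indicator {x i t..<x (Suc i) t} y)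
      = R i t * (ramp (gap i t) (b - x i t) - ramp (gap i t) (a - x i t))" by (simp add: gap_def)
  qed simp
  finally show ?thesis by (simp add: mass_def right_diff_distrib sum_subtractf)
qed

lemma mass_diff_ge:
  assumes "t \<ge> 0" "a \<le> b" "\<And>y. a < y \<Longrightarrow> y < b \<Longrightarrow> c \<le> dens y t"
  shows "c * (b - a) \<le> mass t b - mass t a"
proof -
  have "(LINT y:{a<..<b}|lborel. c) \<le> (LINT y:{a<..<b}|lborel. dens y t)"
    using assms locally_integrable_subset[OF dens_locally_integrable[OF assms(1)], of "{a<..<b}" a b]
    by (intro set_integral_mono) (auto simp: set_integrable_def subset_eq)
  moreover have "(LINT y:{a<..<b}|lborel. c) = c * (b - a)"
    using assms(2) by (simp add: set_lebesgue_integral_def)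
  ultimately show ?thesis using integral_dens[OF assms(1,2)] by linarith
qed

lemma mass_diff_le:
  assumes "t \<ge> 0" "a \<le> b" "\<And>y. a < y \<Longrightarrow> y < b \<Longrightarrow> dens y t \<le> c"
  shows "mass t b - mass t a \<le> c * (b - a)"
proof -
  have "(LINT y:{a<..<b}|lborel. dens y t) \<le> (LINT y:{a<..<b}|lborel. c)"
    using assms locally_integrable_subset[OF dens_locally_integrable[OF assms(1)], of "{a<..<b}" a b]
    by (intro set_integral_mono) (auto simp: set_integrable_def subset_eq)
  moreover have "(LINT y:{a<..<b}|lborel. c) = c * (b - a)"
    using assms(2) by (simp add: set_lebesgue_integral_def)
  ultimately show ?thesis using integral_dens[OF assms(1,2)] by linarith
qed

lemma mass_term:
  assumes "i < n" "t \<ge> 0"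
  shows "0 \<le> R i t * ramp (gap i t) (y - x i t)" "R i t * ramp (gap i t) (y - x i t) \<le> 1 / real n"
    "y \<le> x i t \<Longrightarrow> R i t * ramp (gap i t) (y - x i t) = 0"
    "x (Suc i) t \<le> y \<Longrightarrow> R i t * ramp (gap i t) (y - x i t) = 1 / real n"
proof -
  have g: "0 < gap i t" "0 < R i t" using gap_pos R_pos assms by auto
  have e: "R i t * gap i t = 1 / real n" using g by (simp add: R_eq)
  have r: "0 \<le> ramp (gap i t) (y - x i t)" "ramp (gap i t) (y - x i t) \<le> gap i t"
    using g by (auto simp: ramp_def)
  show "0 \<le> R i t * ramp (gap i t) (y - x i t)" using g r by simp
  show "R i t * ramp (gap i t) (y - x i t) \<le> 1 / real n"
    using mult_left_mono[OF r(2), of "R i t"] g e by simp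
  show "y \<le> x i t \<Longrightarrow> R i t * ramp (gap i t) (y - x i t) = 0" using g by (simp add: ramp_def)
  assume "x (Suc i) t \<le> y"
  then have "ramp (gap i t) (y - x i t) = gap i t" using g by (simp add: ramp_def gap_def)
  then show "R i t * ramp (gap i t) (y - x i t) = 1 / real n" using e by simp
qed

lemma mass_le_count:
  assumes "t \<ge> 0" shows "mass t y \<le> real (card {i. i < n \<and> x i t < y}) / real n"
proof -
  have "mass t y \<le> (\<Sum>i<n. if x i t < y then 1 / real n else 0)"
    unfolding mass_def
  proof (rule sum_mono)
    fix i assume "i \<in> {..<n}"
    then show "R i t * ramp (gap i t) (y - x i t) \<le> (if x i t < y then 1 / real n else 0)"
      using mass_term(2,3)[of i t y] assms by (cases "x i t < y") (auto simp del: mult_eq_0_iff)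
  qed
  also have "\<dots> = (\<Sum>i\<in>{i. i < n \<and> x i t < y}. 1 / real n)"
    by (subst sum.inter_filter[symmetric]) (auto simp: lessThan_def)
  finally show ?thesis by simp
qed

lemma mass_ge_count:
  assumes "t \<ge> 0" shows "real (card {i. i < n \<and> x (Suc i) t \<le> y}) / real n \<le> mass t y"
proof -
  have "real (card {i. i < n \<and> x (Suc i) t \<le> y}) / real n = (\<Sum>i\<in>{i. i < n \<and> x (Suc i) t \<le> y}. 1 / real n)"
    by simp
  also have "\<dots> = (\<Sum>i<n. if x (Suc i) t \<le> y then 1 / real n else 0)"
    by (subst sum.inter_filter[symmetric]) (auto simp: lessThan_def)
  also have "\<dots> \<le> mass t y"
    unfolding mass_def using mass_term(1,4) assms by (intro sum_mono) auto
  finally show ?thesis .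
qed

lemma mass_bounds:
  assumes "t \<ge> 0" shows "0 \<le> mass t y" "mass t y \<le> 1"
proof -
  show "0 \<le> mass t y" unfolding mass_def using mass_term(1) assms by (intro sum_nonneg) auto
  have "mass t y \<le> (\<Sum>i<n. 1 / real n)" unfolding mass_def using mass_term(2) assms by (intro sum_mono) auto
  also have "\<dots> = 1" using n_pos by simp
  finally show "mass t y \<le> 1" .
qed

lemma mass_right: "t \<ge> 0 \<Longrightarrow> x n t \<le> y \<Longrightarrow> mass t y = 1"
proof -
  assume t: "t \<ge> 0" and y: "x n t \<le> y"
  have "x (Suc i) t \<le> y" if "i < n" for i using x_mono[of t "Suc i" n] t y that by simp
  then have "mass t y = (\<Sum>i<n. 1 / real n)" unfolding mass_def using mass_term(4) t by (intro sum.cong) auto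
  then show ?thesis using n_pos by simp
qed

lemma mass_left: "t \<ge> 0 \<Longrightarrow> y \<le> x 0 t \<Longrightarrow> mass t y = 0"
proof -
  assume t: "t \<ge> 0" and y: "y \<le> x 0 t"
  have "y \<le> x i t" if "i < n" for i using x_mono[of t 0 i] t y that by simp
  then show ?thesis unfolding mass_def using mass_term(3) t by (intro sum.neutral) auto
qed

lemma mass_mono: "t \<ge> 0 \<Longrightarrow> a \<le> b \<Longrightarrow> mass t a \<le> mass t b"
  using mass_diff_ge[of t a b 0] dens_bounds by simp

lemma mass_space_lipschitz:
  assumes "t \<ge> 0" shows "\<bar>mass t b - mass t a\<bar> \<le> C * \<bar>b - a\<bar>"
  using mass_diff_le[OF assms, of a b C] mass_diff_le[OF assms, of b a C] dens_bounds[OF assms]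
    mass_mono[OF assms, of a b] mass_mono[OF assms, of b a] by (cases "a \<le> b") auto

text \<open>Mass is compared by counting. A particle to the left of y at time t is to the left of
  the shifted point at time s. Counting cells that begin before y on one side and cells that end
  before the shifted point on the other moves the index by one, which accounts for the error of one
  cell.\<close>

lemma mass_time_shift:
  assumes "s \<ge> 0" "t \<ge> 0"
  shows "mass t y \<le> mass s (y + speed_max * \<bar>t - s\<bar>) + 1 / real n"
proof -
  let ?y = "y + speed_max * \<bar>t - s\<bar>"
  let ?T = "{i. i < n \<and> x (Suc i) s \<le> ?y}"
  have "{i. i < n \<and> x i t < y} \<subseteq> insert 0 (Suc ` ?T)"
  proof
    fix i assume i: "i \<in> {i. i < n \<and> x i t < y}"
    show "i \<in> insert 0 (Suc ` ?T)"
    proof (cases i)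
      case (Suc j)
      have "x i s - x i t \<le> speed_max * \<bar>t - s\<bar>"
        using x_lipschitz[of i t s] i assms by (simp add: abs_minus_commute[of s t] abs_le_iff)
      moreover have "x i t < y" using i by simp
      ultimately have "x i s \<le> ?y" by linarith
      then show ?thesis using Suc i by auto
    qed simp
  qed
  then have "card {i. i < n \<and> x i t < y} \<le> card (insert 0 (Suc ` ?T))" by (intro card_mono) auto
  also have "\<dots> \<le> Suc (card (Suc ` ?T))" by (rule card_insert_le_m1) auto
  also have "card (Suc ` ?T) = card ?T" by (rule card_image) auto
  finally have "real (card {i. i < n \<and> x i t < y}) / real n \<le> real (Suc (card ?T)) / real n"
    by (intro divide_right_mono) auto
  also have "\<dots> = real (card ?T) / real n + 1 / real n" by (simp add: add_divide_distrib)
  finally show ?thesis using mass_le_count[OF assms(2), of y] mass_ge_count[OF assms(1), of ?y] by linarith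
qed

lemma mass_time_lipschitz:
  assumes "s \<ge> 0" "t \<ge> 0"
  shows "\<bar>mass t y - mass s y\<bar> \<le> C * speed_max * \<bar>t - s\<bar> + 1 / real n"
proof -
  have *: "mass t y - mass s y \<le> C * speed_max * \<bar>t - s\<bar> + 1 / real n" if "s \<ge> 0" "t \<ge> 0" for s t
    using mass_time_shift[OF that, of y] mass_space_lipschitz[OF that(1), of "y + speed_max * \<bar>t - s\<bar>" y]
      speed_max_nonneg by (simp add: abs_mult mult.assoc)
  show ?thesis using *[OF assms] *[OF assms(2,1)] by (simp add: abs_minus_commute abs_le_iff)
qed

text \<open>Both functions are nondecreasing and equal i/n at the i-th particle, so they differ by
  at most one cell.\<close>

lemma mass_initial:
  assumes F: "mono F" "\<And>i. i \<le> n \<Longrightarrow> F (x i 0) = real i / real n" and F_bd: "0 \<le> F y" "F y \<le> 1"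
  shows "\<bar>mass 0 y - F y\<bar> \<le> 1 / real n"
proof -
  have n: "real n > 0" using n_pos by simp
  have "{i. i < n \<and> x i 0 < y} \<subseteq> {..nat \<lfloor>real n * F y\<rfloor>}"
  proof
    fix i assume i: "i \<in> {i. i < n \<and> x i 0 < y}"
    then have "F (x i 0) \<le> F y" by (intro monoD[OF F(1)]) auto
    then have "real i \<le> real n * F y" using F(2)[of i] i n by (simp add: divide_le_eq mult.commute)
    then have "i \<le> nat \<lfloor>real n * F y\<rfloor>" by (simp add: le_nat_floor)
    then show "i \<in> {..nat \<lfloor>real n * F y\<rfloor>}" by simp
  qed
  then have "card {i. i < n \<and> x i 0 < y} \<le> card {..nat \<lfloor>real n * F y\<rfloor>}" by (intro card_mono) auto
  then have "real (card {i. i < n \<and> x i 0 < y}) \<le> real (Suc (nat \<lfloor>real n * F y\<rfloor>))" by simp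
  also have "\<dots> \<le> real n * F y + 1" using F_bd n by simp
  finally have "real (card {i. i < n \<and> x i 0 < y}) / real n \<le> F y + 1 / real n"
    using n by (simp add: field_simps)
  then have 1: "mass 0 y \<le> F y + 1 / real n" using mass_le_count[of 0 y] by simp
  have "{i. real i + 1 < real n * F y} \<subseteq> {i. i < n \<and> x (Suc i) 0 \<le> y}"
  proof
    fix i assume "i \<in> {i. real i + 1 < real n * F y}"
    then have i: "real (Suc i) < real n * F y" by simp
    also have "\<dots> \<le> real n" using F_bd n by (simp add: mult_left_le)
    finally have "Suc i < n" by simp
    then have "F (x (Suc i) 0) < F y" using F(2)[of "Suc i"] i n by (simp add: divide_less_eq mult.commute)
    then have "x (Suc i) 0 \<le> y" using monoD[OF F(1), of y "x (Suc i) 0"] by (meson not_le linear)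
    then show "i \<in> {i. i < n \<and> x (Suc i) 0 \<le> y}" using \<open>Suc i < n\<close> by simp
  qed
  moreover have "real n * F y - 1 \<le> real (card {i. real i + 1 < real n * F y})"
  proof -
    have "{i. real i + 1 < real n * F y} = {..<nat \<lceil>real n * F y - 1\<rceil>}"
      by (auto simp: less_ceiling_iff) (linarith | simp add: less_ceiling_iff zless_nat_eq_int_zless)+
    then show ?thesis by simp linarith
  qed
  ultimately have "real n * F y - 1 \<le> real (card {i. i < n \<and> x (Suc i) 0 \<le> y})"
    using card_mono[of "{i. i < n \<and> x (Suc i) 0 \<le> y}" "{i. real i + 1 < real n * F y}"] by simp
  then have "(real n * F y - 1) / real n \<le> real (card {i. i < n \<and> x (Suc i) 0 \<le> y}) / real n"
    using n by (intro divide_right_mono) auto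
  then have "F y - 1 / real n \<le> real (card {i. i < n \<and> x (Suc i) 0 \<le> y}) / real n"
    using n by (simp add: diff_divide_distrib)
  then have "F y - 1 / real n \<le> mass 0 y" using mass_ge_count[of 0 y] by simp
  then show ?thesis using 1 by linarith
qed

lemma continuous_x: "i \<le> n \<Longrightarrow> continuous_on {0..} (x i)"
  using ode[of i] ode_last by (cases "i < n") (auto intro!: DERIV_continuous_on)

lemma dens_measurable: "(\<lambda>z. indicator (UNIV \<times> {0..}) z * ftl_density n x z) \<in> borel_measurable borel"
proof -
  \<comment> \<open>The trajectories are continuous for nonnegative times only; freezing them before
    time 0 yields continuous functions on the line.\<close>
  define X where "X i t = x i (max 0 t)" for i t
  have X: "X i \<in> borel_measurable borel" if "i \<le> n" for i
  proof (rule borel_measurable_continuous_onI)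
    show "continuous_on UNIV (X i)" unfolding X_def
      by (rule continuous_on_compose2[OF continuous_x[OF that]]) (auto intro: continuous_intros)
  qed
  have "(\<lambda>z. indicator (UNIV \<times> {0..}) z * ftl_density n x z) =
    (\<lambda>z. indicator (UNIV \<times> {0..}) z * (\<Sum>i<n. (1 / real n) / (X (Suc i) (snd z) - X i (snd z)) *
      (if X i (snd z) \<le> fst z \<and> fst z < X (Suc i) (snd z) then 1 else 0)))"
    by (auto simp: fun_eq_iff ftl_density_def X_def discrete_density_def indicator_def max_def intro!: sum.cong)
  also have "\<dots> \<in> borel_measurable borel"
  proof (intro borel_measurable_times borel_measurable_sum borel_measurable_indicator half_plane_sets)
    fix i assume "i \<in> {..<n}"
    then have [measurable]: "X i \<in> borel_measurable borel" "X (Suc i) \<in> borel_measurable borel"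
      using X by auto
    have "(\<lambda>z::real \<times> real. (1 / real n) / (X (Suc i) (snd z) - X i (snd z))) \<in> borel_measurable (borel \<Otimes>\<^sub>M borel)"
      by measurable
    then show "(\<lambda>z::real \<times> real. (1 / real n) / (X (Suc i) (snd z) - X i (snd z))) \<in> borel_measurable borel"
      unfolding borel_prod .
    have "(\<lambda>z. if X i (snd z) \<le> fst z \<and> fst z < X (Suc i) (snd z) then 1 else 0 :: real)
      \<in> borel_measurable (borel \<Otimes>\<^sub>M borel)" by measurable
    then show "(\<lambda>z. if X i (snd z) \<le> fst z \<and> fst z < X (Suc i) (snd z) then 1 else 0 :: real) \<in> borel_measurable borel"
      unfolding borel_prod .
  qed
  finally show ?thesis .
qed

end

section \<open>Consistency of the scheme with the weak formulation\<close>

context ftl_scheme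
begin

text \<open>Cut off at negative times, where the equations say nothing about the particles; this
  gives a bounded Borel function on the whole plane.\<close>

definition dens0 :: "real \<times> real \<Rightarrow> real" where
  "dens0 p = indicator (UNIV \<times> {0..}) p * ftl_density n x p"

lemma dens0_eq: "0 \<le> t \<Longrightarrow> dens0 (y, t) = dens y t"
  by (simp add: dens0_def)

lemma dens0_measurable [measurable]: "dens0 \<in> borel_measurable borel"
  using dens_measurable by (simp add: dens0_def[abs_def])

lemma dens0_bounds: "0 \<le> dens0 p" "dens0 p \<le> C"
  using dens_bounds[of "snd p" "fst p"] C_pos by (cases p; auto simp: dens0_def indicator_def)+

lemma sum_gap: "(\<Sum>i<n. gap i t) = x n t - x 0 t"
  unfolding gap_def by (rule sum_lessThan_telescope)

lemma continuous_R:
  assumes "i < n" shows "continuous_on {0..} (\<lambda>t. R i t)"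
  unfolding discrete_density_def
proof (intro continuous_on_divide continuous_on_const continuous_on_diff continuous_x)
  have "x (Suc i) t - x i t \<noteq> 0" if "t \<ge> 0" for t using x_less_Suc[OF assms that] by simp
  then show "\<forall>t\<in>{0..}. x (Suc i) t - x i t \<noteq> 0" by simp
qed (use assms in auto)

text \<open>At y = x_i(t) this is the time derivative of \<phi> along the i-th particle; at other
  points of the i-th cell, multiplied by \<open>R i t\<close>, it is the integrand of the weak
  formulation.\<close>

definition rate :: "(real \<times> real \<Rightarrow> real) \<Rightarrow> nat \<Rightarrow> real \<Rightarrow> real \<Rightarrow> real" where
  "rate \<phi> i t y = partial_t \<phi> (y, t) + velocity A \<gamma> (R i t) * partial_x \<phi> (y, t)"

text \<open>The integrand is the time derivative of the mean of \<phi> over the particles 0, ..., n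
  - 1, and this mean vanishes at the times 0 and T + 1, both outside the support.\<close>

lemma rate_integral_eq_0:
  assumes \<phi>: "test_function \<phi>" and box: "supp_box \<phi> L \<tau> T" and "0 < \<tau>" "0 \<le> T"
  shows "(LINT t:{0..T+1}|lborel. \<Sum>i<n. 1 / real n * rate \<phi> i t (x i t)) = 0"
    and "set_integrable lborel {0..T+1} (\<lambda>t. \<Sum>i<n. 1 / real n * rate \<phi> i t (x i t))"
proof -
  let ?S = "\<lambda>t. \<Sum>i<n. 1 / real n * \<phi> (x i t, t)"
  let ?G = "\<lambda>t. \<Sum>i<n. 1 / real n * rate \<phi> i t (x i t)"
  have C1: "C_k 1 \<phi>" using \<phi> by (simp add: test_function_def)
  have d: "(?S has_real_derivative ?G t) (at t within {0..})" if "t \<ge> 0" for t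
    unfolding rate_def
    by (intro DERIV_sum DERIV_cmult C1_chain[OF C1] ode) (use that in auto)
  have cx: "continuous_on {0..} (\<lambda>t. (x i t, t))" if "i < n" for i
    using that by (intro continuous_intros continuous_x) auto
  have cont_i: "continuous_on {0..} (\<lambda>t. rate \<phi> i t (x i t))" if i: "i < n" for i
  proof -
    have 1: "continuous_on {0..} (\<lambda>t. partial_t \<phi> (x i t, t))"
      by (rule continuous_on_compose2[OF test_function_continuous(3)[OF \<phi>] cx[OF i]]) auto
    have 2: "continuous_on {0..} (\<lambda>t. partial_x \<phi> (x i t, t))"
      by (rule continuous_on_compose2[OF test_function_continuous(2)[OF \<phi>] cx[OF i]]) auto
    have 3: "continuous_on {0..} (\<lambda>t. R i t powr \<gamma>)"
      using R_pos[OF i] \<gamma>_pos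
      by (intro continuous_on_powr' continuous_R[OF i] continuous_on_const) (auto intro: less_imp_le)
    show ?thesis
      unfolding rate_def velocity_def
      by (intro continuous_on_add continuous_on_mult continuous_on_diff continuous_on_const 1 2 3)
  qed
  have cont: "continuous_on {0..} ?G"
    by (intro continuous_on_sum continuous_on_mult continuous_on_const cont_i) auto
  show int: "set_integrable lborel {0..T+1} ?G"
    by (rule borel_integrable_atLeastAtMost'[OF continuous_on_subset[OF cont]]) auto
  have "(?G has_integral ?S (T + 1) - ?S 0) {0..T+1}"
  proof (rule fundamental_theorem_of_calculus)
    fix t assume "t \<in> {0..T+1}"
    then have "(?S has_real_derivative ?G t) (at t within {0..T+1})"
      by (intro DERIV_subset[OF d]) auto
    then show "(?S has_vector_derivative ?G t) (at t within {0..T+1})"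
      by (simp only: has_real_derivative_iff_has_vector_derivative)
  qed (use \<open>0 \<le> T\<close> in simp)
  moreover have "\<phi> (y, T + 1) = 0" "\<phi> (y, 0) = 0" for y
    using box \<open>0 < \<tau>\<close> by (auto simp: supp_box_def)
  ultimately have "(?G has_integral 0) {0..T+1}" by simp
  then show "(LINT t:{0..T+1}|lborel. ?G t) = 0"
    using set_borel_integral_eq_integral(2)[OF int] by (simp add: integral_unique)
qed

text \<open>On each cell \<open>rate\<close> is replaced by its value at the left end. The cell has
  mass 1/n, so the error is at most the Lipschitz constant times the gap divided by n, and the gaps
  sum to the length of the occupied interval.\<close>

lemma section_integral:
  assumes \<phi>: "test_function \<phi>" and t: "0 \<le> t"
    and lip: "\<And>y y'. \<bar>partial_t \<phi> (y', t) - partial_t \<phi> (y, t)\<bar> \<le> Bt * \<bar>y' - y\<bar>"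
      "\<And>y y'. \<bar>partial_x \<phi> (y', t) - partial_x \<phi> (y, t)\<bar> \<le> Bx * \<bar>y' - y\<bar>" "0 \<le> Bt" "0 \<le> Bx"
  shows "\<bar>(LINT y|lborel. dens0 (y, t) * partial_t \<phi> (y, t) + pow_flux A \<gamma> (dens0 (y, t)) * partial_x \<phi> (y, t))
      - (\<Sum>i<n. 1 / real n * rate \<phi> i t (x i t))\<bar> \<le> (Bt + speed_max * Bx) * (x n t - x 0 t) / real n"
proof -
  have [measurable]: "partial_x \<phi> \<in> borel_measurable borel" "partial_t \<phi> \<in> borel_measurable borel"
    using test_function_continuous[OF \<phi>] by (auto intro: borel_measurable_continuous_onI)
  let ?c = "\<lambda>i. {x i t..<x (Suc i) t}"
  have cont: "continuous_on UNIV (rate \<phi> i t)" for i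
    unfolding rate_def[abs_def]
    by (intro continuous_intros continuous_on_compose2[OF test_function_continuous(2)[OF \<phi>]]
        continuous_on_compose2[OF test_function_continuous(3)[OF \<phi>]]) auto
  have int: "set_integrable lborel (?c i) (rate \<phi> i t)" for i
    by (rule set_integrable_subset[OF borel_integrable_atLeastAtMost'[OF continuous_on_subset[OF cont]], of "x i t" "x (Suc i) t"]) auto
  have "dens0 (y, t) * partial_t \<phi> (y, t) + pow_flux A \<gamma> (dens0 (y, t)) * partial_x \<phi> (y, t)
    = (\<Sum>i<n. R i t * (indicator (?c i) y *\<^sub>R rate \<phi> i t y))" for y
  proof (cases rule: dens_cases[OF t, of y])
    case 1
    have "indicator (?c i) y = (0::real)" if "i < n" for i
      using 1(2) x_mono[OF t, of 0 i] x_mono[OF t, of "Suc i" n] that by (auto simp: indicator_def)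
    then have "(\<Sum>i<n. R i t * (indicator (?c i) y *\<^sub>R rate \<phi> i t y)) = 0" by (intro sum.neutral) auto
    then show ?thesis using 1 t by (simp add: dens0_eq pow_flux_def)
  next
    case (2 i)
    have "indicator (?c j) y = (0::real)" if "j < n" "j \<noteq> i" for j
    proof (cases "j < i")
      case True
      then have "x (Suc j) t \<le> x i t" using 2 t by (intro x_mono) auto
      then show ?thesis using 2 by (simp add: indicator_def)
    next
      case False
      then have "x (Suc i) t \<le> x j t" using 2 t that by (intro x_mono) auto
      then show ?thesis using 2 by (simp add: indicator_def)
    qed
    then have "(\<Sum>j<n. R j t * (indicator (?c j) y *\<^sub>R rate \<phi> j t y)) = (\<Sum>j<n. if j = i then R i t * rate \<phi> i t y else 0)"
      using 2 by (intro sum.cong) auto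
    also have "\<dots> = R i t * rate \<phi> i t y" using 2 by simp
    finally show ?thesis
      using 2 t by (simp add: dens0_eq pow_flux_def rate_def velocity_def algebra_simps)
  qed
  then have "(LINT y|lborel. dens0 (y, t) * partial_t \<phi> (y, t) + pow_flux A \<gamma> (dens0 (y, t)) * partial_x \<phi> (y, t))
    = (\<Sum>i<n. R i t * (LINT y:?c i|lborel. rate \<phi> i t y))"
    using int by (simp add: set_lebesgue_integral_def set_integrable_def)
  then have "\<bar>(LINT y|lborel. dens0 (y, t) * partial_t \<phi> (y, t) + pow_flux A \<gamma> (dens0 (y, t)) * partial_x \<phi> (y, t))
      - (\<Sum>i<n. 1 / real n * rate \<phi> i t (x i t))\<bar>
    = \<bar>\<Sum>i<n. R i t * (LINT y:?c i|lborel. rate \<phi> i t y) - 1 / real n * rate \<phi> i t (x i t)\<bar>"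
    by (simp add: sum_subtractf)
  also have "\<dots> \<le> (\<Sum>i<n. \<bar>R i t * (LINT y:?c i|lborel. rate \<phi> i t y) - 1 / real n * rate \<phi> i t (x i t)\<bar>)"
    by (rule sum_abs)
  also have "\<dots> \<le> (\<Sum>i<n. (Bt + speed_max * Bx) / real n * gap i t)"
  proof (rule sum_mono)
    fix i assume "i \<in> {..<n}"
    then have i: "i < n" by simp
    note g = gap_pos[OF i t] and r = R_pos[OF i t]
    have Rg: "R i t * gap i t = 1 / real n" using g by (simp add: R_eq)
    have ci: "set_integrable lborel (?c i) (\<lambda>y. k)" for k :: real
      using x_less_Suc[OF i t] by (simp add: set_integrable_def)
    have mc: "(LINT y:?c i|lborel. k) = gap i t * k" for k :: real
      using g by (simp add: set_lebesgue_integral_def gap_def)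
    have "R i t * (LINT y:?c i|lborel. rate \<phi> i t y) - 1 / real n * rate \<phi> i t (x i t)
       = R i t * ((LINT y:?c i|lborel. rate \<phi> i t y) - gap i t * rate \<phi> i t (x i t))"
      by (simp add: right_diff_distrib Rg[symmetric])
    also have "\<dots> = R i t * (LINT y:?c i|lborel. rate \<phi> i t y - rate \<phi> i t (x i t))"
      using set_integral_diff(2)[OF int[of i] ci[of "rate \<phi> i t (x i t)"]] by (simp add: mc)
    finally have eq: "\<bar>R i t * (LINT y:?c i|lborel. rate \<phi> i t y) - 1 / real n * rate \<phi> i t (x i t)\<bar>
       = R i t * \<bar>LINT y:?c i|lborel. rate \<phi> i t y - rate \<phi> i t (x i t)\<bar>"
      using r by (simp add: abs_mult)
    have "\<bar>LINT y:?c i|lborel. rate \<phi> i t y - rate \<phi> i t (x i t)\<bar>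
        \<le> (LINT y:?c i|lborel. \<bar>rate \<phi> i t y - rate \<phi> i t (x i t)\<bar>)"
      using set_integral_norm_bound[OF set_integral_diff(1)[OF int[of i] ci]] by simp
    also have "\<dots> \<le> (LINT y:?c i|lborel. (Bt + speed_max * Bx) * gap i t)"
    proof (rule set_integral_mono)
      show "set_integrable lborel (?c i) (\<lambda>y. \<bar>rate \<phi> i t y - rate \<phi> i t (x i t)\<bar>)"
        using set_integrable_abs[OF set_integral_diff(1)[OF int[of i] ci]] .
      show "set_integrable lborel (?c i) (\<lambda>y. (Bt + speed_max * Bx) * gap i t)"
        by (rule ci)
      fix y assume y: "y \<in> ?c i"
      let ?v = "velocity A \<gamma> (R i t)" and ?dx = "partial_x \<phi> (y, t) - partial_x \<phi> (x i t, t)"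
      have "\<bar>?v\<bar> * \<bar>?dx\<bar> \<le> speed_max * (Bx * \<bar>y - x i t\<bar>)"
        using velocity_bound[OF i t] lip(2) speed_max_nonneg by (intro mult_mono) auto
      moreover have "\<bar>rate \<phi> i t y - rate \<phi> i t (x i t)\<bar>
          \<le> \<bar>partial_t \<phi> (y, t) - partial_t \<phi> (x i t, t)\<bar> + \<bar>?v * ?dx\<bar>"
        unfolding rate_def by (rule order_trans[OF _ abs_triangle_ineq]) (simp add: algebra_simps)
      ultimately have "\<bar>rate \<phi> i t y - rate \<phi> i t (x i t)\<bar> \<le> Bt * \<bar>y - x i t\<bar> + speed_max * (Bx * \<bar>y - x i t\<bar>)"
        using lip(1)[of y "x i t"] unfolding abs_mult by linarith
      also have "\<dots> = (Bt + speed_max * Bx) * \<bar>y - x i t\<bar>" by (simp add: algebra_simps)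
      also have "\<dots> \<le> (Bt + speed_max * Bx) * gap i t"
        using y lip(3,4) speed_max_nonneg by (intro mult_left_mono) (auto simp: gap_def)
      finally show "\<bar>rate \<phi> i t y - rate \<phi> i t (x i t)\<bar> \<le> (Bt + speed_max * Bx) * gap i t" .
    qed
    also have "\<dots> = gap i t * ((Bt + speed_max * Bx) * gap i t)" by (rule mc)
    finally have "R i t * \<bar>LINT y:?c i|lborel. rate \<phi> i t y - rate \<phi> i t (x i t)\<bar>
        \<le> R i t * (gap i t * ((Bt + speed_max * Bx) * gap i t))"
      using r by (intro mult_left_mono) auto
    also have "\<dots> = (Bt + speed_max * Bx) / real n * gap i t"
      unfolding mult.assoc[symmetric] Rg by simp
    finally show "\<bar>R i t * (LINT y:?c i|lborel. rate \<phi> i t y) - 1 / real n * rate \<phi> i t (x i t)\<bar>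
        \<le> (Bt + speed_max * Bx) / real n * gap i t" unfolding eq .
  qed
  also have "\<dots> = (Bt + speed_max * Bx) * (x n t - x 0 t) / real n"
    by (subst sum_distrib_left[symmetric]) (simp add: sum_gap)
  finally show ?thesis .
qed

lemma length_bound:
  assumes "0 \<le> t" "t \<le> b"
  shows "x n t - x 0 t \<le> x n 0 - x 0 0 + 2 * speed_max * b"
proof -
  have "speed_max * t \<le> speed_max * b" using assms speed_max_nonneg by (intro mult_left_mono)
  then show ?thesis using x_lipschitz[of n 0 t] x_lipschitz[of 0 0 t] assms by (simp add: abs_le_iff)
qed

lemma flux_dens0_bound: "\<bar>pow_flux A \<gamma> (dens0 p)\<bar> \<le> speed_bound A \<gamma> C * C"
  using pow_flux_bound[OF \<gamma>_pos dens0_bounds] mult_left_mono[OF dens0_bounds(2) speed_bound_nonneg[OF \<gamma>_pos]]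
  by (rule order_trans)

text \<open>Subtracting the vanishing time integral of the particle sum leaves the errors of the
  sections. They stay of order 1/n because the occupied interval grows at most linearly in
  time.\<close>

lemma weak_residual:
  assumes \<phi>: "test_function \<phi>" and box: "supp_box \<phi> L \<tau> T" and T: "0 < \<tau>" "0 \<le> T"
    and lip: "\<And>y y' t. \<bar>partial_t \<phi> (y', t) - partial_t \<phi> (y, t)\<bar> \<le> Bt * \<bar>y' - y\<bar>"
      "\<And>y y' t. \<bar>partial_x \<phi> (y', t) - partial_x \<phi> (y, t)\<bar> \<le> Bx * \<bar>y' - y\<bar>" "0 \<le> Bt" "0 \<le> Bx"
  shows "\<bar>LINT p|lborel. dens0 p * partial_t \<phi> p + pow_flux A \<gamma> (dens0 p) * partial_x \<phi> p\<bar>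
    \<le> (Bt + speed_max * Bx) * (x n 0 - x 0 0 + 2 * speed_max * (T + 1)) / real n * (T + 1)"
proof -
  let ?f = "\<lambda>p. dens0 p * partial_t \<phi> p + pow_flux A \<gamma> (dens0 p) * partial_x \<phi> p"
  let ?I = "\<lambda>t. LINT y|lborel. ?f (y, t)"
  let ?G = "\<lambda>t. \<Sum>i<n. 1 / real n * rate \<phi> i t (x i t)"
  let ?b = "(Bt + speed_max * Bx) * (x n 0 - x 0 0 + 2 * speed_max * (T + 1)) / real n"
  have [measurable]: "partial_x \<phi> \<in> borel_measurable borel" "partial_t \<phi> \<in> borel_measurable borel"
    using test_function_continuous[OF \<phi>] by (auto intro: borel_measurable_continuous_onI)
  note bx = supp_box_partial[OF box]
  obtain Mx where Mx: "Mx \<ge> 0" "\<And>p. \<bar>partial_x \<phi> p\<bar> \<le> Mx"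
    using supp_box_bounded[OF bx(1) test_function_continuous(2)[OF \<phi>]] by blast
  obtain Mt where Mt: "Mt \<ge> 0" "\<And>p. \<bar>partial_t \<phi> p\<bar> \<le> Mt"
    using supp_box_bounded[OF bx(2) test_function_continuous(3)[OF \<phi>]] by blast
  define W where "W = C * Mt + speed_bound A \<gamma> C * C * Mx"
  have f_0: "?f (y, t) = 0" if "y \<notin> {- L..L} \<or> t \<notin> {\<tau>..T}" for y t
  proof -
    have "L < \<bar>y\<bar> \<or> t < \<tau> \<or> T < t" using that by auto
    then have "partial_x \<phi> (y, t) = 0" "partial_t \<phi> (y, t) = 0" using bx unfolding supp_box_def by blast+
    then show ?thesis by simp
  qed
  have f_bd: "\<bar>?f p\<bar> \<le> W" for p
  proof -
    have "\<bar>dens0 p\<bar> * \<bar>partial_t \<phi> p\<bar> \<le> C * Mt"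
      using dens0_bounds[of p] Mt C_pos by (intro mult_mono) auto
    moreover have "\<bar>pow_flux A \<gamma> (dens0 p)\<bar> * \<bar>partial_x \<phi> p\<bar> \<le> speed_bound A \<gamma> C * C * Mx"
      using flux_dens0_bound[of p] Mx C_pos speed_bound_nonneg[OF \<gamma>_pos] by (intro mult_mono) auto
    ultimately show ?thesis unfolding W_def
      by (intro order_trans[OF abs_triangle_ineq]) (simp add: abs_mult)
  qed
  have W: "0 \<le> W" using f_bd[of 0] by (meson abs_ge_zero order_trans)
  have f_int: "integrable (lborel \<Otimes>\<^sub>M lborel) ?f"
  proof (rule integrable_product_bound[where f = ?f and g = "\<lambda>y. W * indicator {- L..L} y" and h = "indicator {\<tau>..T}"])
    fix y t
    show "\<bar>?f (y, t)\<bar> \<le> W * indicator {- L..L} y * indicator {\<tau>..T} t"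
      using f_0[of y t] f_bd[of "(y, t)"] W by (cases "y \<notin> {- L..L} \<or> t \<notin> {\<tau>..T}") auto
  qed (auto simp: emeasure_lborel_Icc_eq)
  have I_meas: "integrable lborel ?I"
    using lborel_pair.integrable_snd[of "\<lambda>y t. ?f (y, t)"] f_int by (simp add: split_beta')
  have I_0: "?I t = 0" if "t \<notin> {0..T+1}" for t
  proof -
    have "t \<notin> {\<tau>..T}" using that T by auto
    then have 0: "(\<lambda>y. ?f (y, t)) = (\<lambda>y. 0)" using f_0 by blast
    show ?thesis unfolding 0 by simp
  qed
  have IG: "\<bar>?I t - ?G t\<bar> \<le> ?b" if "t \<in> {0..T+1}" for t
  proof -
    have "\<bar>?I t - ?G t\<bar> \<le> (Bt + speed_max * Bx) * (x n t - x 0 t) / real n"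
      using that lip by (intro section_integral[OF \<phi>]) auto
    also have "\<dots> \<le> ?b"
      using that length_bound[of t "T + 1"] lip(3,4) speed_max_nonneg
      by (intro divide_right_mono mult_left_mono) auto
    finally show ?thesis .
  qed
  note G = rate_integral_eq_0[OF \<phi> box T]
  have I_set: "set_integrable lborel {0..T+1} ?I"
    unfolding set_integrable_def by (rule integrable_mult_indicator[OF _ I_meas]) simp
  have "(LINT p|lborel. ?f p) = (LINT t|lborel. ?I t)" using plane_integral(1)[OF f_int] by simp
  also have "\<dots> = (LINT t:{0..T+1}|lborel. ?I t)"
    unfolding set_lebesgue_integral_def
    by (intro Bochner_Integration.integral_cong) (use I_0 in \<open>auto simp: indicator_def\<close>)
  also have "\<dots> = (LINT t:{0..T+1}|lborel. ?I t - ?G t)"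
    using set_integral_diff(2)[OF I_set G(2)] G(1) by simp
  finally have "\<bar>LINT p|lborel. ?f p\<bar> = \<bar>LINT t:{0..T+1}|lborel. ?I t - ?G t\<bar>" by simp
  also have "\<dots> \<le> (LINT t:{0..T+1}|lborel. \<bar>?I t - ?G t\<bar>)"
    using set_integral_norm_bound[OF set_integral_diff(1)[OF I_set G(2)]] by simp
  also have "\<dots> \<le> (LINT t:{0..T+1}|lborel. ?b)"
    using set_integrable_abs[OF set_integral_diff(1)[OF I_set G(2)]] IG
    by (intro set_integral_mono) (auto simp: set_integrable_def emeasure_lborel_Icc_eq)
  also have "\<dots> = ?b * (T + 1)" using T by (simp add: set_lebesgue_integral_def)
  finally show ?thesis .
qed

end

subsection \<open>The Oleinik estimate in the limit\<close>

context ftl_scheme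
begin

text \<open>The mean density over (y, y') raised to the power \<gamma>: the \<open>Z\<close> of
  \<open>countable_nonconvergence\<close>, convergent because it depends only on distribution
  functions.\<close>

definition mass_quotient :: "real \<Rightarrow> real \<Rightarrow> real \<Rightarrow> real" where
  "mass_quotient t y y' = ((mass t y' - mass t y) / (y' - y)) powr \<gamma>"

text \<open>Almost monotonicity bounds the density below by a constant on the whole interval, and
  means preserve such a bound. The detour through the power 1/\<gamma> is needed since the mean is
  taken of the density and not of its power.\<close>

lemma mass_quotient_lower:
  assumes t: "t > 0" and y: "y < y'"
  shows "dens y t powr \<gamma> \<le> mass_quotient t y y' + 1 / ((1 + \<gamma>) * t) * (y' - y) + Oleinik_error t"
proof -
  let ?c = "1 / ((1 + \<gamma>) * t)"
  have c: "0 \<le> ?c" using t \<gamma>_pos by simp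
  define w where "w = dens y t powr \<gamma> - ?c * (y' - y) - Oleinik_error t"
  have "w \<le> mass_quotient t y y'"
  proof (cases "w \<le> 0")
    case True
    then show ?thesis unfolding mass_quotient_def by (rule order_trans) simp
  next
    case False
    have "w powr (1 / \<gamma>) \<le> dens s t" if s: "y < s" "s < y'" for s
    proof -
      have "?c * (s - y) \<le> ?c * (y' - y)" using c s by (intro mult_left_mono) auto
      then have "w \<le> dens s t powr \<gamma>"
        using dens_powr_quasi_mono[OF t s(1)] unfolding w_def by linarith
      then have "w powr (1 / \<gamma>) \<le> (dens s t powr \<gamma>) powr (1 / \<gamma>)"
        using False \<gamma>_pos by (intro powr_mono2) auto
      also have "\<dots> = dens s t" using \<gamma>_pos dens_bounds[of t s] t by (simp add: powr_powr)
      finally show ?thesis .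
    qed
    then have "w powr (1 / \<gamma>) * (y' - y) \<le> mass t y' - mass t y"
      using t y by (intro mass_diff_ge) auto
    then have "w powr (1 / \<gamma>) \<le> (mass t y' - mass t y) / (y' - y)"
      using y by (simp add: pos_le_divide_eq)
    then have "(w powr (1 / \<gamma>)) powr \<gamma> \<le> mass_quotient t y y'"
      unfolding mass_quotient_def using \<gamma>_pos by (intro powr_mono2) auto
    then show ?thesis using False \<gamma>_pos by (simp add: powr_powr)
  qed
  then show ?thesis unfolding w_def by linarith
qed

lemma mass_quotient_upper:
  assumes t: "t > 0" and y: "y < y'"
  shows "mass_quotient t y y' \<le> dens y' t powr \<gamma> + 1 / ((1 + \<gamma>) * t) * (y' - y) + Oleinik_error t"
proof -
  let ?c = "1 / ((1 + \<gamma>) * t)"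
  have c: "0 \<le> ?c" using t \<gamma>_pos by simp
  define w where "w = dens y' t powr \<gamma> + ?c * (y' - y) + Oleinik_error t"
  have "0 \<le> Oleinik_error t" unfolding Oleinik_error_def using t \<gamma>_pos by auto
  moreover have "0 \<le> ?c * (y' - y)" using c y by (intro mult_nonneg_nonneg) auto
  moreover have "0 \<le> dens y' t powr \<gamma>" by simp
  ultimately have w: "0 \<le> w" unfolding w_def by linarith
  have "dens s t \<le> w powr (1 / \<gamma>)" if s: "y < s" "s < y'" for s
  proof -
    have "?c * (y' - s) \<le> ?c * (y' - y)" using c s by (intro mult_left_mono) auto
    then have "dens s t powr \<gamma> \<le> w"
      using dens_powr_quasi_mono[OF t s(2)] unfolding w_def by linarith
    then have "(dens s t powr \<gamma>) powr (1 / \<gamma>) \<le> w powr (1 / \<gamma>)"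
      using \<gamma>_pos by (intro powr_mono2) auto
    then show ?thesis using \<gamma>_pos dens_bounds[of t s] t by (simp add: powr_powr)
  qed
  then have "mass t y' - mass t y \<le> w powr (1 / \<gamma>) * (y' - y)"
    using t y by (intro mass_diff_le) auto
  then have "(mass t y' - mass t y) / (y' - y) \<le> w powr (1 / \<gamma>)"
    using y by (simp add: pos_divide_le_eq)
  moreover have "0 \<le> (mass t y' - mass t y) / (y' - y)"
    using mass_mono[of t y y'] t y by simp
  ultimately have "mass_quotient t y y' \<le> (w powr (1 / \<gamma>)) powr \<gamma>"
    unfolding mass_quotient_def using \<gamma>_pos by (intro powr_mono2) auto
  then show ?thesis using w \<gamma>_pos unfolding w_def[symmetric] by (simp add: powr_powr)
qed

end

text \<open>Discrete integration by parts: the derivative of \<psi> is replaced by backward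
  quotients, and a shift moves the difference onto a. There the bound l holds outside S and one
  translate of S, both countable and hence null.\<close>

lemma weak_one_sided_lipschitz:
  fixes a \<psi> \<psi>' :: "real \<Rightarrow> real"
  assumes a[measurable]: "a \<in> borel_measurable borel" and a_bd: "\<And>y. \<bar>a y\<bar> \<le> K"
    and S: "countable S" and a_le: "\<And>y y'. y < y' \<Longrightarrow> y \<notin> S \<Longrightarrow> y' \<notin> S \<Longrightarrow> a y' - a y \<le> l * (y' - y)"
    and \<psi>: "\<And>y. (\<psi> has_real_derivative \<psi>' y) (at y)" "\<And>y. 0 \<le> \<psi> y" "\<And>y. L < \<bar>y\<bar> \<Longrightarrow> \<psi> y = 0"
    and lip: "\<And>y y'. \<bar>\<psi> y' - \<psi> y\<bar> \<le> B * \<bar>y' - y\<bar>"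
  shows "- (l * (LINT y|lborel. \<psi> y)) \<le> (LINT y|lborel. a y * \<psi>' y)"
proof -
  let ?h = "\<lambda>k. 1 / real (Suc k)"
  have cont: "continuous_on UNIV \<psi>"
    using \<psi>(1) DERIV_isCont continuous_at_imp_continuous_on by blast
  have [measurable]: "\<psi> \<in> borel_measurable borel" by (rule borel_measurable_continuous_onI[OF cont])
  have K: "0 \<le> K" using a_bd[of 0] by simp
  have B: "0 \<le> B" using lip[of 1 0] abs_ge_zero[of "\<psi> 1 - \<psi> 0"] by simp
  have "\<bar>\<psi> y\<bar> \<le> B * (2 * \<bar>L\<bar> + 1)" for y
  proof (cases "L < \<bar>y\<bar>")
    case False
    have "\<psi> (\<bar>L\<bar> + 1) = 0" by (rule \<psi>(3)) auto
    then have "\<bar>\<psi> y\<bar> \<le> B * \<bar>y - (\<bar>L\<bar> + 1)\<bar>" using lip[of y "\<bar>L\<bar> + 1"] by simp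
    also have "\<dots> \<le> B * (2 * \<bar>L\<bar> + 1)" using False B by (intro mult_left_mono) auto
    finally show ?thesis .
  qed (use \<psi>(3)[of y] B in simp)
  then have \<psi>_int: "integrable lborel \<psi>"
    using \<psi>(3) by (intro integrableI_bounded_set[where A = "{- L..L}" and B = "B * (2 * \<bar>L\<bar> + 1)"])
      (auto simp: emeasure_lborel_Icc_eq intro!: AE_I2)
  have a\<psi>_int: "integrable lborel (\<lambda>y. a (y + c) * \<psi> y)" for c
  proof (rule Bochner_Integration.integrable_bound)
    show "integrable lborel (\<lambda>y. K * \<psi> y)" using \<psi>_int by simp
    show "AE y in lborel. norm (a (y + c) * \<psi> y) \<le> norm (K * \<psi> y)"
      using a_bd K by (intro AE_I2) (auto simp: abs_mult intro!: mult_right_mono)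
  qed measurable
  have key: "- (l * (LINT y|lborel. \<psi> y)) \<le> (LINT y|lborel. a y * (real (Suc k) * (\<psi> y - \<psi> (y - ?h k))))" for k
  proof -
    have i: "integrable lborel (\<lambda>y. a y * \<psi> (y - ?h k))"
      using lborel_integrable_real_affine[OF a\<psi>_int[of "?h k"], of 1 "- ?h k"] by (simp add: add.commute)
    have shift: "(LINT y|lborel. a y * \<psi> (y - ?h k)) = (LINT y|lborel. a (y + ?h k) * \<psi> y)"
      using lborel_integral_real_affine[of 1 "\<lambda>y. a (y + ?h k) * \<psi> y" "- ?h k"] by (simp add: add.commute)
    have "(LINT y|lborel. a y * (real (Suc k) * (\<psi> y - \<psi> (y - ?h k))))
      = (LINT y|lborel. real (Suc k) * (a y * \<psi> y - a y * \<psi> (y - ?h k)))"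
      by (intro Bochner_Integration.integral_cong) (simp_all add: algebra_simps)
    also have "\<dots> = real (Suc k) * ((LINT y|lborel. a y * \<psi> y) - (LINT y|lborel. a y * \<psi> (y - ?h k)))"
      using i a\<psi>_int[of 0] by simp
    also have "\<dots> = real (Suc k) * ((LINT y|lborel. a y * \<psi> y) - (LINT y|lborel. a (y + ?h k) * \<psi> y))"
      unfolding shift ..
    also have "\<dots> = (LINT y|lborel. real (Suc k) * (a y * \<psi> y - a (y + ?h k) * \<psi> y))"
      using a\<psi>_int[of 0] a\<psi>_int[of "?h k"] by simp
    finally have eq: "(LINT y|lborel. a y * (real (Suc k) * (\<psi> y - \<psi> (y - ?h k))))
      = (LINT y|lborel. real (Suc k) * (a y * \<psi> y - a (y + ?h k) * \<psi> y))" .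
    have "(LINT y|lborel. - l * \<psi> y) \<le> (LINT y|lborel. real (Suc k) * (a y * \<psi> y - a (y + ?h k) * \<psi> y))"
    proof (rule integral_mono_AE)
      show "integrable lborel (\<lambda>y. - l * \<psi> y)" using \<psi>_int by simp
      show "integrable lborel (\<lambda>y. real (Suc k) * (a y * \<psi> y - a (y + ?h k) * \<psi> y))"
        using a\<psi>_int[of 0] a\<psi>_int[of "?h k"] by simp
      have "countable (S \<union> (\<lambda>y. y - ?h k) ` S)" using S by simp
      then have "S \<union> (\<lambda>y. y - ?h k) ` S \<in> null_sets lborel" by (rule countable_imp_null_set_lborel)
      then show "AE y in lborel. - l * \<psi> y \<le> real (Suc k) * (a y * \<psi> y - a (y + ?h k) * \<psi> y)"
      proof (rule AE_not_in[THEN eventually_mono])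
        fix y assume y: "y \<notin> S \<union> (\<lambda>y. y - ?h k) ` S"
        have "y + ?h k \<notin> S"
        proof
          assume "y + ?h k \<in> S"
          then have "(y + ?h k) - ?h k \<in> (\<lambda>y. y - ?h k) ` S" by (rule imageI)
          then show False using y by simp
        qed
        then have "a (y + ?h k) - a y \<le> l * ?h k" using a_le[of y "y + ?h k"] y by simp
        then have "real (Suc k) * (a (y + ?h k) - a y) \<le> real (Suc k) * (l * ?h k)"
          by (intro mult_left_mono) auto
        then have "real (Suc k) * (a (y + ?h k) - a y) \<le> l" by simp
        then have "(real (Suc k) * (a (y + ?h k) - a y)) * \<psi> y \<le> l * \<psi> y"
          by (rule mult_right_mono) (rule \<psi>(2))
        then show "- l * \<psi> y \<le> real (Suc k) * (a y * \<psi> y - a (y + ?h k) * \<psi> y)"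
          by (simp add: algebra_simps)
      qed
    qed
    then show ?thesis unfolding eq by simp
  qed
  have "(\<lambda>k. LINT y|lborel. a y * (real (Suc k) * (\<psi> y - \<psi> (y - ?h k)))) \<longlonglongrightarrow> (LINT y|lborel. a y * \<psi>' y)"
  proof (rule integral_dominated_convergence[where w = "\<lambda>y. K * B * indicator {- L - 1..L + 1} y"])
    have lim: "(\<lambda>k. real (Suc k) * (\<psi> y - \<psi> (y - ?h k))) \<longlonglongrightarrow> \<psi>' y" for y
    proof -
      have "((\<lambda>h. (\<psi> (y + h) - \<psi> y) / h) \<longlongrightarrow> \<psi>' y) (at 0)"
        using \<psi>(1) by (simp add: DERIV_def)
      moreover have "filterlim (\<lambda>k. - ?h k) (at 0) sequentially"
        using tendsto_minus[OF LIMSEQ_Suc[OF lim_1_over_n]] by (simp add: filterlim_at)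
      ultimately have "(\<lambda>k. (\<psi> (y + - ?h k) - \<psi> y) / - ?h k) \<longlonglongrightarrow> \<psi>' y"
        by (rule filterlim_compose)
      moreover have "(\<psi> (y + - ?h k) - \<psi> y) / - ?h k = real (Suc k) * (\<psi> y - \<psi> (y - ?h k))" for k
        by (simp add: algebra_simps)
      ultimately show ?thesis by simp
    qed
    then show "AE y in lborel. (\<lambda>k. a y * (real (Suc k) * (\<psi> y - \<psi> (y - ?h k)))) \<longlonglongrightarrow> a y * \<psi>' y"
      by (intro AE_I2 tendsto_mult tendsto_const)
    have [measurable]: "\<psi>' \<in> borel_measurable borel"
      by (rule borel_measurable_LIMSEQ_real[OF lim]) measurable
    show "(\<lambda>y. a y * \<psi>' y) \<in> borel_measurable lborel" by measurable
    show "AE y in lborel. norm (a y * (real (Suc k) * (\<psi> y - \<psi> (y - ?h k)))) \<le> K * B * indicator {- L - 1..L + 1} y" for k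
    proof (rule AE_I2)
      fix y
      show "norm (a y * (real (Suc k) * (\<psi> y - \<psi> (y - ?h k)))) \<le> K * B * indicator {- L - 1..L + 1} y"
      proof (cases "y \<in> {- L - 1..L + 1}")
        case True
        have "\<bar>real (Suc k) * (\<psi> y - \<psi> (y - ?h k))\<bar> = real (Suc k) * \<bar>\<psi> y - \<psi> (y - ?h k)\<bar>"
          by (simp add: abs_mult)
        also have "\<dots> \<le> real (Suc k) * (B * ?h k)" using lip[of y "y - ?h k"] by (intro mult_left_mono) auto
        also have "\<dots> = B" by simp
        finally have "\<bar>a y\<bar> * \<bar>real (Suc k) * (\<psi> y - \<psi> (y - ?h k))\<bar> \<le> K * B"
          using a_bd K by (intro mult_mono) auto
        then show ?thesis using True by (simp add: abs_mult)
      next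
        case False
        have "?h k \<le> 1" "0 < ?h k" by auto
        then have "L < \<bar>y\<bar>" "L < \<bar>y - ?h k\<bar>" using False unfolding atLeastAtMost_iff by linarith+
        then show ?thesis using False \<psi>(3) by simp
      qed
    qed
  qed (auto simp: emeasure_lborel_Icc_eq)
  then show ?thesis by (rule LIMSEQ_le_const) (use key in blast)
qed

subsection \<open>Compactness\<close>

lemma convergent_of_approximable:
  fixes a :: "nat \<Rightarrow> real"
  assumes "\<And>e. e > 0 \<Longrightarrow> \<exists>b. convergent b \<and> (\<forall>\<^sub>F j in sequentially. \<bar>a j - b j\<bar> \<le> e)"
  shows "convergent a"
proof (rule Cauchy_convergent, rule metric_CauchyI)
  fix e :: real assume "e > 0"
  then obtain b where b: "convergent b" "\<forall>\<^sub>F j in sequentially. \<bar>a j - b j\<bar> \<le> e / 4"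
    using assms[of "e / 4"] by auto
  obtain M1 where M1: "\<And>j. j \<ge> M1 \<Longrightarrow> \<bar>a j - b j\<bar> \<le> e / 4"
    using b(2) unfolding eventually_sequentially by auto
  obtain M2 where M2: "\<And>i j. i \<ge> M2 \<Longrightarrow> j \<ge> M2 \<Longrightarrow> dist (b i) (b j) < e / 4"
    using metric_CauchyD[OF convergent_Cauchy[OF b(1)], of "e / 4"] \<open>e > 0\<close> by auto
  have "dist (a i) (a j) < e" if "i \<ge> max M1 M2" "j \<ge> max M1 M2" for i j
  proof -
    have "\<bar>a i - b i\<bar> \<le> e / 4" "\<bar>a j - b j\<bar> \<le> e / 4" "\<bar>b i - b j\<bar> < e / 4"
      using M1[of i] M1[of j] M2[of i j] that unfolding dist_real_def by auto
    then show ?thesis unfolding dist_real_def by linarith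
  qed
  then show "\<exists>M. \<forall>i\<ge>M. \<forall>j\<ge>M. dist (a i) (a j) < e" by blast
qed

locale ftl_family = initial_datum +
  fixes A \<gamma> :: real and x :: "nat \<Rightarrow> nat \<Rightarrow> real \<Rightarrow> real"
  assumes \<gamma>_pos: "\<gamma> > 0"
    and sol: "\<And>n. n \<ge> 1 \<Longrightarrow> ftl_solution (velocity A \<gamma>) g n (x n)"
begin

lemma scheme: "n \<ge> 1 \<Longrightarrow> ftl_scheme A \<gamma> C n (x n)"
proof
  assume n: "n \<ge> 1"
  show "\<gamma> > 0" "n > 0" "C > 0" using n \<gamma>_pos C_pos by auto
  note s = sol[OF n, unfolded ftl_solution_def]
  show "(x n i has_real_derivative velocity A \<gamma> (discrete_density n (x n) i t)) (at t within {0..})"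
    if "i < n" "t \<ge> 0" for i t using s that by blast
  show "(x n n has_real_derivative A) (at t within {0..})" if "t \<ge> 0" for t
    using s that by (simp add: velocity_def)
  show "1 / (real n * C) \<le> x n (Suc i) 0 - x n i 0" if "i < n" for i
    using s that init_gap[OF n that] by auto
qed

lemma initial_positions: "n \<ge> 1 \<Longrightarrow> i \<le> n \<Longrightarrow> x n i 0 = init_pos g n i"
  using sol unfolding ftl_solution_def by blast

text \<open>A diagonal subsequence converges at rational points. The functions are equicontinuous in
  time only up to an error 1/n, so the extension to all points is an approximation argument along
  the subsequence, in which that error becomes negligible.\<close>

lemma convergent_mass_subsequence:
  "\<exists>r. strict_mono r \<and> r 0 \<ge> 1 \<and>
    (\<forall>t\<ge>0. \<forall>y. convergent (\<lambda>j. ftl_scheme.mass (r j) (x (r j)) t y))"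
proof -
  define M where "M n = ftl_scheme.mass n (x n)" for n
  define V where "V = ftl_scheme.speed_max A \<gamma> C"
  note sp = ftl_scheme.mass_space_lipschitz[OF scheme, folded M_def]
  note ti = ftl_scheme.mass_time_lipschitz[OF scheme, folded M_def V_def]
  have V: "0 \<le> V" unfolding V_def ftl_scheme.speed_max_def[OF scheme[OF order_refl]] by simp
  define S where "S = (\<rat> \<inter> {0::real..}) \<times> (\<rat> :: real set)"
  have "countable S" unfolding S_def by (intro countable_SIGMA countable_Int1 countable_rat)
  moreover have "norm (M (Suc k) (fst p) (snd p)) \<le> 1" if "p \<in> S" for k and p :: "real \<times> real"
    using ftl_scheme.mass_bounds[OF scheme[of "Suc k"], of "fst p" "snd p"] that unfolding M_def S_def by auto
  ultimately obtain k where k: "strict_mono k"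
    and conv: "\<And>p. p \<in> S \<Longrightarrow> \<exists>l. (\<lambda>j. M (Suc (k j)) (fst p) (snd p)) \<longlonglongrightarrow> l"
    by (rule function_convergent_subsequence[where f = "\<lambda>k p. M (Suc k) (fst p) (snd p)"]) auto
  \<comment> \<open>The shift by one excludes n = 0, for which no scheme is given.\<close>
  define r where "r j = Suc (k j)" for j
  have r1: "r j \<ge> 1" for j unfolding r_def by simp
  have rj: "real j + 1 \<le> real (r j)" for j using seq_suble[OF k, of j] unfolding r_def by simp
  have "convergent (\<lambda>j. M (r j) t y)" if t: "0 \<le> t" for t y
  proof (rule convergent_of_approximable)
    fix e :: real assume e: "e > 0"
    define d where "d = e / (3 * (C * V + C + 1))"
    have CV: "0 < C * V + C + 1" using C_pos V by (intro add_nonneg_pos add_nonneg_nonneg mult_nonneg_nonneg) auto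
    then have d: "0 < d" unfolding d_def using e by simp
    have "(C * V + C + 1) * d = e / 3" unfolding d_def using CV by (simp add: field_simps)
    then have d3: "C * V * d + C * d + d = e / 3" by (simp add: algebra_simps)
    have p1: "0 \<le> C * V * d" "0 \<le> C * d" using C_pos V d by auto
    obtain t' where t': "t' \<in> \<rat>" "t < t'" "t' < t + d" using Rats_dense_in_real[of t "t + d"] d by auto
    obtain y' where y': "y' \<in> \<rat>" "y < y'" "y' < y + d" using Rats_dense_in_real[of y "y + d"] d by auto
    have "(t', y') \<in> S" using t t' y' unfolding S_def by auto
    then have cb: "convergent (\<lambda>j. M (r j) t' y')" using conv[of "(t', y')"] unfolding r_def convergent_def by simp
    have "\<forall>\<^sub>F j in sequentially. 1 / (real j + 1) < e / 3"
      using LIMSEQ_inverse_real_of_nat[THEN order_tendstoD(2), of "e / 3"] e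
      by (simp add: inverse_eq_divide add.commute)
    then have "\<forall>\<^sub>F j in sequentially. \<bar>M (r j) t y - M (r j) t' y'\<bar> \<le> e"
    proof eventually_elim
      case (elim j)
      have "1 / real (r j) \<le> 1 / (real j + 1)" using rj[of j] by (intro divide_left_mono) auto
      moreover have "C * V * \<bar>t - t'\<bar> \<le> C * V * d" using t' C_pos V by (intro mult_left_mono) auto
      moreover have "C * \<bar>y' - y\<bar> \<le> C * d" using y' C_pos by (intro mult_left_mono) auto
      moreover have "\<bar>M (r j) t y - M (r j) t' y\<bar> \<le> C * V * \<bar>t - t'\<bar> + 1 / real (r j)"
        using ti[OF r1[of j], of t' t y] t t' by auto
      moreover have "\<bar>M (r j) t' y' - M (r j) t' y\<bar> \<le> C * \<bar>y' - y\<bar>"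
        using sp[OF r1[of j], of t' y' y] t t' by auto
      ultimately show ?case using elim d3 p1 d by linarith
    qed
    then show "\<exists>b. convergent b \<and> (\<forall>\<^sub>F j in sequentially. \<bar>M (r j) t y - b j\<bar> \<le> e)" using cb by blast
  qed
  moreover have "strict_mono r" using k unfolding r_def strict_mono_def by simp
  ultimately show ?thesis using r1[of 0] unfolding M_def by blast
qed

end

section \<open>The limit density\<close>

locale ftl_limit = ftl_family +
  fixes r :: "nat \<Rightarrow> nat"
  assumes r_mono: "strict_mono r" and r_0: "r 0 \<ge> 1"
    and mass_convergent: "\<And>t y. t \<ge> 0 \<Longrightarrow> convergent (\<lambda>j. ftl_scheme.mass (r j) (x (r j)) t y)"
begin

lemma r_ge: "r j \<ge> 1"
  using r_0 strict_mono_mono[OF r_mono] unfolding mono_def by (meson le0 order_trans)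

lemmas sch = scheme[OF r_ge]

definition M :: "nat \<Rightarrow> real \<Rightarrow> real \<Rightarrow> real" where
  "M j = ftl_scheme.mass (r j) (x (r j))"

definition u :: "nat \<Rightarrow> real \<times> real \<Rightarrow> real" where
  "u j = ftl_scheme.dens0 (r j) (x (r j))"

definition V :: real where
  "V = ftl_scheme.speed_max A \<gamma> C"

text \<open>The default 0 off the convergence set, and at times that are not positive, keeps the
  bounds and the propagation of the support valid at every point.\<close>

definition \<rho> :: "real \<times> real \<Rightarrow> real" where
  "\<rho> p = (if 0 < snd p \<and> convergent (\<lambda>j. u j p) then lim (\<lambda>j. u j p) else 0)"

lemma inverse_r_tendsto: "(\<lambda>j. 1 / real (r j)) \<longlonglongrightarrow> 0"
  using LIMSEQ_subseq_LIMSEQ[OF lim_1_over_n r_mono] by (simp add: o_def)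

lemma u_measurable [measurable]: "u j \<in> borel_measurable borel"
  unfolding u_def by (rule ftl_scheme.dens0_measurable[OF sch])

lemma u_bounds: "0 \<le> u j p" "u j p \<le> C"
  unfolding u_def using ftl_scheme.dens0_bounds[OF sch] by auto

lemma u_eq: "0 \<le> snd p \<Longrightarrow> u j p = ftl_density (r j) (x (r j)) p"
  unfolding u_def ftl_scheme.dens0_def[OF sch] by (simp add: indicator_def mem_Times_iff)

lemma particle_range:
  assumes "i \<le> r j" "0 \<le> t"
  shows "x_min g - V * t \<le> x (r j) 0 t" "x (r j) (r j) t \<le> x_max g + V * t"
  using ftl_scheme.x_lipschitz[OF sch, of 0 j 0 t] ftl_scheme.x_lipschitz[OF sch, of "r j" j 0 t]
    initial_positions[OF r_ge, of 0 j] initial_positions[OF r_ge, of "r j" j] assms r_ge[of j]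
  unfolding V_def by (auto simp: init_pos_def)

lemma u_outside:
  assumes "0 \<le> t" "y \<notin> {x_min g - V * t..x_max g + V * t}" shows "u j (y, t) = 0"
  using ftl_scheme.dens_outside[OF sch assms(1), of y j] particle_range[of 0 j t] assms u_eq[of "(y, t)" j] by force

lemma dens_eq_u: "0 \<le> t \<Longrightarrow> ftl_density (r j) (x (r j)) (y, t) = u j (y, t)"
  using u_eq[of "(y, t)" j] by simp

lemma quasi_mono:
  assumes "t > 0" "y < y'"
  shows "u j (y, t) powr \<gamma> \<le> u j (y', t) powr \<gamma> + 1 / ((1 + \<gamma>) * t) * (y' - y) + ftl_scheme.Oleinik_error \<gamma> (r j) t"
  using ftl_scheme.dens_powr_quasi_mono[OF sch assms, of j] assms by (simp add: dens_eq_u)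

lemma Oleinik_error_tendsto: "t > 0 \<Longrightarrow> (\<lambda>j. ftl_scheme.Oleinik_error \<gamma> (r j) t) \<longlonglongrightarrow> 0"
proof -
  have "(\<lambda>j. sqrt (1 / real (r j))) \<longlonglongrightarrow> sqrt 0" by (intro tendsto_real_sqrt inverse_r_tendsto)
  then have s: "(\<lambda>j. 1 / sqrt (real (r j))) \<longlonglongrightarrow> 0" by (simp add: real_sqrt_divide)
  have "(\<lambda>j. (1 / sqrt (real (r j))) / ((1 + \<gamma>) * t) + (1 / sqrt (real (r j))) powr \<gamma>) \<longlonglongrightarrow> 0 / ((1 + \<gamma>) * t) + 0 powr \<gamma>"
    if "t > 0"
    using s \<gamma>_pos that by (intro tendsto_add tendsto_divide tendsto_const tendsto_powr2) auto
  then show "t > 0 \<Longrightarrow> ?thesis" unfolding ftl_scheme.Oleinik_error_def[OF sch] by simp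
qed

text \<open>The same subsequence serves all positive times, since the distribution functions
  converge at each of them. Exceptional sets that are null at every time then form a null set in the
  plane.\<close>

lemma countable_nonconvergent_u:
  assumes t: "t > 0"
  shows "countable {y. \<not> convergent (\<lambda>j. u j (y, t))}"
proof -
  have pw: "u j p powr \<gamma> \<le> C powr \<gamma>" for j p using u_bounds \<gamma>_pos by (intro powr_mono2) auto
  have "countable {y. \<not> convergent (\<lambda>j. u j (y, t) powr \<gamma>)}"
  proof (rule countable_nonconvergence[where K = "C powr \<gamma>" and l = "1 / ((1 + \<gamma>) * t)"
        and \<epsilon> = "\<lambda>j. ftl_scheme.Oleinik_error \<gamma> (r j) t"
        and Z = "\<lambda>j y y'. ftl_scheme.mass_quotient \<gamma> (r j) (x (r j)) t y y'"])
    show "\<bar>u j (y, t) powr \<gamma>\<bar> \<le> C powr \<gamma>" for j y using pw by simp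
    show "0 \<le> 1 / ((1 + \<gamma>) * t)" using t \<gamma>_pos by simp
    show "(\<lambda>j. ftl_scheme.Oleinik_error \<gamma> (r j) t) \<longlonglongrightarrow> 0" by (rule Oleinik_error_tendsto[OF t])
  next
    fix y y' :: real assume y: "y < y'"
    show "u j (y, t) powr \<gamma> \<le> u j (y', t) powr \<gamma> + 1 / ((1 + \<gamma>) * t) * (y' - y) + ftl_scheme.Oleinik_error \<gamma> (r j) t" for j
      by (rule quasi_mono[OF t y])
    show "u j (y, t) powr \<gamma> \<le> ftl_scheme.mass_quotient \<gamma> (r j) (x (r j)) t y y' + 1 / ((1 + \<gamma>) * t) * (y' - y) + ftl_scheme.Oleinik_error \<gamma> (r j) t" for j
      using ftl_scheme.mass_quotient_lower[OF sch t y, of j] t by (simp add: dens_eq_u)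
    show "ftl_scheme.mass_quotient \<gamma> (r j) (x (r j)) t y y' \<le> u j (y', t) powr \<gamma> + 1 / ((1 + \<gamma>) * t) * (y' - y) + ftl_scheme.Oleinik_error \<gamma> (r j) t" for j
      using ftl_scheme.mass_quotient_upper[OF sch t y, of j] t by (simp add: dens_eq_u)
    have "(\<lambda>j. M j t y) \<longlonglongrightarrow> lim (\<lambda>j. M j t y)" "(\<lambda>j. M j t y') \<longlonglongrightarrow> lim (\<lambda>j. M j t y')"
      using mass_convergent[of t] t unfolding M_def by (auto simp: convergent_LIMSEQ_iff[symmetric])
    then have "(\<lambda>j. (M j t y' - M j t y) / (y' - y)) \<longlonglongrightarrow> (lim (\<lambda>j. M j t y') - lim (\<lambda>j. M j t y)) / (y' - y)"
      using y by (intro tendsto_divide tendsto_diff tendsto_const) auto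
    moreover have "\<forall>\<^sub>F j in sequentially. 0 \<le> (M j t y' - M j t y) / (y' - y)"
      using ftl_scheme.mass_mono[OF sch, of t y y'] t y unfolding M_def by (intro always_eventually allI divide_nonneg_pos) auto
    ultimately have "(\<lambda>j. ((M j t y' - M j t y) / (y' - y)) powr \<gamma>) \<longlonglongrightarrow>
      ((lim (\<lambda>j. M j t y') - lim (\<lambda>j. M j t y)) / (y' - y)) powr \<gamma>"
      using \<gamma>_pos by (intro tendsto_powr2 tendsto_const)
    then show "convergent (\<lambda>j. ftl_scheme.mass_quotient \<gamma> (r j) (x (r j)) t y y')"
      unfolding ftl_scheme.mass_quotient_def[OF sch] M_def convergent_def by blast
  qed
  moreover have "convergent (\<lambda>j. u j (y, t))" if c: "convergent (\<lambda>j. u j (y, t) powr \<gamma>)" for y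
  proof -
    obtain l where l: "(\<lambda>j. u j (y, t) powr \<gamma>) \<longlonglongrightarrow> l" using c unfolding convergent_def ..
    then have "(\<lambda>j. (u j (y, t) powr \<gamma>) powr (1 / \<gamma>)) \<longlonglongrightarrow> l powr (1 / \<gamma>)"
      using \<gamma>_pos by (intro tendsto_powr2 tendsto_const) auto
    moreover have "(u j (y, t) powr \<gamma>) powr (1 / \<gamma>) = u j (y, t)" for j
      using u_bounds \<gamma>_pos by (simp add: powr_powr)
    ultimately show ?thesis unfolding convergent_def by auto
  qed
  ultimately show ?thesis by (elim countable_subset[rotated]) auto
qed

lemma tendsto_\<rho>: "0 < snd p \<Longrightarrow> convergent (\<lambda>j. u j p) \<Longrightarrow> (\<lambda>j. u j p) \<longlonglongrightarrow> \<rho> p"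
  unfolding \<rho>_def by (simp add: convergent_LIMSEQ_iff)

lemma AE_section_tendsto: "0 < t \<Longrightarrow> AE y in lborel. (\<lambda>j. u j (y, t)) \<longlonglongrightarrow> \<rho> (y, t)"
  using AE_not_in[OF countable_imp_null_set_lborel[OF countable_nonconvergent_u[of t]]]
  by (auto elim!: eventually_mono intro!: tendsto_\<rho>)

lemma \<rho>_bounds: "0 \<le> \<rho> p" "\<rho> p \<le> C"
proof -
  have "0 \<le> \<rho> p \<and> \<rho> p \<le> C"
  proof (cases "0 < snd p \<and> convergent (\<lambda>j. u j p)")
    case True
    then show ?thesis
      using LIMSEQ_le_const[OF tendsto_\<rho>[of p], of 0] LIMSEQ_le_const2[OF tendsto_\<rho>[of p], of C] u_bounds by auto
  qed (use C_pos in \<open>auto simp: \<rho>_def\<close>)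
  then show "0 \<le> \<rho> p" "\<rho> p \<le> C" by auto
qed

lemma \<rho>_outside:
  assumes "y \<notin> {x_min g - V * t..x_max g + V * t}" shows "\<rho> (y, t) = 0"
proof (cases "0 < t \<and> convergent (\<lambda>j. u j (y, t))")
  case True
  then have "(\<lambda>j. u j (y, t)) \<longlonglongrightarrow> \<rho> (y, t)" by (intro tendsto_\<rho>) auto
  moreover have "(\<lambda>j. u j (y, t)) = (\<lambda>j. 0)" using u_outside[OF _ assms] True by auto
  ultimately show ?thesis by (simp add: LIMSEQ_const_iff)
qed (auto simp: \<rho>_def)

lemma convergent_set: "{p. convergent (\<lambda>j. u j p)} \<in> sets borel"
proof -
  have "{p. Cauchy (\<lambda>j. u j p)} = {p \<in> space borel. Cauchy (\<lambda>j. u j p)}" by simp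
  also have "\<dots> \<in> sets borel" by (rule sets_Collect_Cauchy) measurable
  finally show ?thesis by (simp add: Cauchy_convergent_iff)
qed

lemma \<rho>_measurable [measurable]: "\<rho> \<in> borel_measurable borel"
proof -
  have [measurable]: "{p. convergent (\<lambda>j. u j p)} \<in> sets borel" by (rule convergent_set)
  have [measurable]: "(\<lambda>p. lim (\<lambda>j. u j p)) \<in> borel_measurable borel"
    by (rule borel_measurable_lim_metric) measurable
  have "\<rho> = (\<lambda>p. indicator (UNIV \<times> {0<..}) p * indicator {p. convergent (\<lambda>j. u j p)} p * lim (\<lambda>j. u j p))"
    unfolding \<rho>_def by (auto simp: indicator_def mem_Times_iff fun_eq_iff)
  also have "\<dots> \<in> borel_measurable borel" by measurable
  finally show ?thesis .
qed

lemma AE_tendsto: "AE p in lborel. 0 < snd p \<longrightarrow> (\<lambda>j. u j p) \<longlonglongrightarrow> \<rho> p"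
proof (rule AE_plane)
  have "{p. 0 < snd p \<longrightarrow> (\<lambda>j. u j p) \<longlonglongrightarrow> \<rho> p} = {p. convergent (\<lambda>j. u j p)} \<union> - (UNIV \<times> {0<..})"
    using tendsto_\<rho> by (auto simp: mem_Times_iff convergent_def)
  also have "\<dots> \<in> sets borel" using convergent_set half_plane_sets(1)[of 0] by (intro sets.Un sets.compl_sets) (auto simp: Compl_eq_Diff_UNIV)
  finally show "{p. 0 < snd p \<longrightarrow> (\<lambda>j. u j p) \<longlonglongrightarrow> \<rho> p} \<in> sets borel" .
  show "AE t in lborel. AE y in lborel. 0 < snd (y, t) \<longrightarrow> (\<lambda>j. u j (y, t)) \<longlonglongrightarrow> \<rho> (y, t)"
  proof (rule AE_I2)
    show "AE y in lborel. 0 < snd (y, t) \<longrightarrow> (\<lambda>j. u j (y, t)) \<longlonglongrightarrow> \<rho> (y, t)" for t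
      using AE_section_tendsto[of t] by (cases "0 < t") auto
  qed
qed

section \<open>Sections of the limit at fixed times\<close>

lemma section_measurable [measurable]:
  "(\<lambda>y. u j (y, t)) \<in> borel_measurable borel" "(\<lambda>y. \<rho> (y, t)) \<in> borel_measurable borel"
  using measurable_compose[OF _ u_measurable[of j], of "\<lambda>y. (y, t)" borel]
    measurable_compose[OF _ \<rho>_measurable, of "\<lambda>y. (y, t)" borel] by (auto simp: borel_prod[symmetric])

lemma section_dominated:
  assumes "0 < t" and h[measurable]: "h \<in> borel_measurable borel" and h_bd: "\<And>y. \<bar>h y\<bar> \<le> 1"
  shows "(\<lambda>j. LINT y|lborel. h y * u j (y, t)) \<longlonglongrightarrow> (LINT y|lborel. h y * \<rho> (y, t))"
    and "integrable lborel (\<lambda>y. h y * \<rho> (y, t))" "integrable lborel (\<lambda>y. h y * u j (y, t))"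
proof -
  let ?w = "\<lambda>y. C * indicator {x_min g - V * t..x_max g + V * t} y"
  have w: "integrable lborel ?w" by (auto simp: emeasure_lborel_Icc_eq)
  have lim: "AE y in lborel. (\<lambda>j. h y * u j (y, t)) \<longlonglongrightarrow> h y * \<rho> (y, t)"
    using AE_section_tendsto[OF assms(1)] by eventually_elim (intro tendsto_mult tendsto_const)
  have bd: "norm (h y * u j (y, t)) \<le> ?w y" for y j
  proof (cases "y \<in> {x_min g - V * t..x_max g + V * t}")
    case True
    then show ?thesis using mult_mono[OF h_bd u_bounds(2)] u_bounds(1) by (simp add: abs_mult)
  qed (use u_outside[of t y j] assms(1) in simp)
  show "(\<lambda>j. LINT y|lborel. h y * u j (y, t)) \<longlonglongrightarrow> (LINT y|lborel. h y * \<rho> (y, t))"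
    by (rule integral_dominated_convergence[OF _ _ w lim]) (use bd in auto)
  show "integrable lborel (\<lambda>y. h y * \<rho> (y, t))"
    by (rule integrable_dominated_convergence[OF _ _ w lim]) (use bd in auto)
  show "integrable lborel (\<lambda>y. h y * u j (y, t))"
    by (rule integrable_dominated_convergence2[OF _ _ w, of _ "\<lambda>_ y. h y * u j (y, t)"]) (use bd in auto)
qed

lemma integral_u_atMost:
  assumes t: "0 < t"
  shows "(LINT y|lborel. indicator {..b} y * u j (y, t)) = M j t b"
proof -
  define a where "a = min b (x (r j) 0 t) - 1"
  have a: "a \<le> b" "a \<le> x (r j) 0 t" unfolding a_def by auto
  have "(LINT y|lborel. indicator {..b} y * u j (y, t)) = (LINT y|lborel. indicator {a<..<b} y * u j (y, t))"
  proof (rule integral_cong_AE)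
    show "AE y in lborel. indicator {..b} y * u j (y, t) = indicator {a<..<b} y * u j (y, t)"
      using AE_lborel_singleton[of b]
    proof eventually_elim
      case (elim y)
      show ?case
      proof (cases "y \<le> a")
        case True
        then have "u j (y, t) = 0"
          using ftl_scheme.dens_outside[OF sch, of t y j] t a by (cases "y < x (r j) 0 t") (auto simp: dens_eq_u a_def)
        then show ?thesis by simp
      qed (use elim in \<open>auto simp: indicator_def\<close>)
    qed
  qed measurable
  also have "\<dots> = (LINT y:{a<..<b}|lborel. ftl_density (r j) (x (r j)) (y, t))"
    using t by (simp add: set_lebesgue_integral_def dens_eq_u)
  also have "\<dots> = M j t b"
    using ftl_scheme.integral_dens[OF sch, of t a b j] ftl_scheme.mass_left[OF sch, of t a j] t a unfolding M_def by simp
  finally show ?thesis .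
qed

lemma M_tendsto: "0 < t \<Longrightarrow> (\<lambda>j. M j t b) \<longlonglongrightarrow> (LINT y|lborel. indicator {..b} y * \<rho> (y, t))"
  using section_dominated(1)[of t "indicator {..b}"] by (simp add: integral_u_atMost)

lemma section_integrable: "0 < t \<Longrightarrow> integrable lborel (\<lambda>y. \<rho> (y, t))"
  using section_dominated(2)[of t "\<lambda>_. 1"] by simp

text \<open>No mass escapes to infinity: at time t all particles lie in an interval that does not
  depend on their number.\<close>

lemma section_mass:
  assumes t: "0 < t" shows "(LINT y|lborel. \<rho> (y, t)) = 1"
proof -
  let ?b = "x_max g + V * t"
  have "(\<lambda>j. M j t ?b) = (\<lambda>j. 1)"
    using ftl_scheme.mass_right[OF sch, of t _ ?b] particle_range(2)[of 0 _ t] t unfolding M_def by auto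
  then have "(LINT y|lborel. indicator {..?b} y * \<rho> (y, t)) = 1"
    using M_tendsto[OF t, of ?b] by (simp add: LIMSEQ_const_iff)
  moreover have "indicator {..?b} y * \<rho> (y, t) = \<rho> (y, t)" for y
    using \<rho>_outside[of y t] by (cases "y \<le> ?b") auto
  ultimately show ?thesis by simp
qed

text \<open>The 1/n errors of the initial sampling and of the bound in time disappear in the limit.
  What remains is a rate linear in t, which gives the initial trace without any regularity of the
  datum.\<close>

lemma distribution_initial:
  assumes t: "0 < t"
  shows "\<bar>(LINT y|lborel. indicator {..b} y * \<rho> (y, t)) - F b\<bar> \<le> C * V * t"
proof -
  have F: "0 \<le> F b" "F b \<le> 1"
    using F_mono[of "x_min g" b] F_left[of b] F_left[of "x_min g"] F_mono[of b "x_max g"] F_right[of b] F_right[of "x_max g"]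
    by (cases "b \<le> x_min g"; cases "b \<le> x_max g"; simp)+
  have "\<bar>M j t b - F b\<bar> \<le> C * V * t + 2 * (1 / real (r j))" for j
  proof -
    have "\<bar>M j 0 b - F b\<bar> \<le> 1 / real (r j)"
      unfolding M_def
    proof (rule ftl_scheme.mass_initial[OF sch])
      show "mono F" using F_mono by (auto intro: monoI)
      show "F (x (r j) i 0) = real i / real (r j)" if "i \<le> r j" for i
        using initial_positions[OF r_ge that] F_init_pos[OF r_ge that] by simp
    qed (use F in auto)
    moreover have "\<bar>M j t b - M j 0 b\<bar> \<le> C * V * t + 1 / real (r j)"
      using ftl_scheme.mass_time_lipschitz[OF sch, of 0 t j b] t unfolding M_def V_def by simp
    ultimately show ?thesis by linarith
  qed
  moreover have "(\<lambda>j. \<bar>M j t b - F b\<bar>) \<longlonglongrightarrow> \<bar>(LINT y|lborel. indicator {..b} y * \<rho> (y, t)) - F b\<bar>"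
    by (intro tendsto_rabs tendsto_diff tendsto_const M_tendsto[OF t])
  moreover have "(\<lambda>j. C * V * t + 2 * (1 / real (r j))) \<longlonglongrightarrow> C * V * t + 2 * 0"
    by (intro tendsto_add tendsto_mult tendsto_const inverse_r_tendsto)
  ultimately show ?thesis by (intro LIMSEQ_le[where Y = "\<lambda>j. C * V * t + 2 * (1 / real (r j))"]) auto
qed

end

subsection \<open>The limit is a classical entropy solution\<close>

lemma supp_box_integrable:
  fixes f :: "real \<times> real \<Rightarrow> real"
  assumes [measurable]: "f \<in> borel_measurable borel" and "supp_box f L \<tau> T" and bd: "\<And>p. \<bar>f p\<bar> \<le> K"
  shows "integrable lborel f" "integrable (lborel \<Otimes>\<^sub>M lborel) f" "integrable lborel (\<lambda>y. f (y, t))"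
proof -
  have z: "f (y, t) = 0" if "L < \<bar>y\<bar> \<or> t < \<tau> \<or> T < t" for y t
    using assms(2) that unfolding supp_box_def by blast
  have out: "f p = 0" if "p \<notin> cbox (- L, \<tau>) (L, T)" for p
    using that by (cases p) (auto simp: cbox_Pair_eq intro!: z)
  show i: "integrable lborel f"
    using out bd by (intro integrableI_bounded_set[where A = "cbox (- L, \<tau>) (L, T)" and B = K])
      (use emeasure_bounded_finite[OF bounded_cbox, of "(- L, \<tau>)" "(L, T)"] in auto)
  then show "integrable (lborel \<Otimes>\<^sub>M lborel) f" unfolding lborel_prod .
  have [measurable]: "(\<lambda>y. f (y, t)) \<in> borel_measurable borel"
    using measurable_compose[OF _ assms(1), of "\<lambda>y. (y, t)" borel] by (auto simp: borel_prod[symmetric])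
  show "integrable lborel (\<lambda>y. f (y, t))"
    using bd by (intro integrableI_bounded_set[where A = "{- L..L}" and B = K])
      (auto simp: emeasure_lborel_Icc_eq intro!: AE_I2 z)
qed

lemma tendsto_pow_flux:
  assumes "\<gamma> > 0" "a \<longlonglongrightarrow> l" "\<And>j::nat. 0 \<le> a j"
  shows "(\<lambda>j. pow_flux A \<gamma> (a j)) \<longlonglongrightarrow> pow_flux A \<gamma> l"
proof -
  have "(\<lambda>j. a j powr \<gamma>) \<longlonglongrightarrow> l powr \<gamma>"
    using assms by (intro tendsto_powr2 tendsto_const always_eventually) auto
  then show ?thesis unfolding pow_flux_def by (intro tendsto_mult tendsto_diff tendsto_const assms)
qed

text \<open>Turns densities of mass 1 into probability measures on the line, so that convergence of
  distribution functions can be read as weak convergence of measures.\<close>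

lemma density_distribution:
  fixes h :: "real \<Rightarrow> real"
  assumes h: "integrable lborel h" "AE y in lborel. 0 \<le> h y" "(LINT y|lborel. h y) = 1"
  defines "\<mu> \<equiv> density lborel (\<lambda>y. ennreal (h y))"
  shows "real_distribution \<mu>" "cdf \<mu> b = (LINT y|lborel. indicator {..b} y * h y)"
    and "\<psi> \<in> borel_measurable borel \<Longrightarrow> (LINT y|\<mu>. \<psi> y) = (LINT y|lborel. \<psi> y * h y)"
proof -
  have [measurable]: "h \<in> borel_measurable borel" using borel_measurable_integrable[OF h(1)] by simp
  have e: "emeasure \<mu> (space \<mu>) = 1"
    unfolding \<mu>_def using nn_integral_eq_integral[OF h(1,2)] h(3) by (simp add: emeasure_density)
  show d: "real_distribution \<mu>"
    by (intro real_distribution.intro prob_spaceI e real_distribution_axioms.intro) (auto simp: \<mu>_def)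
  show i: "(LINT y|\<mu>. \<psi> y) = (LINT y|lborel. \<psi> y * h y)" if "\<psi> \<in> borel_measurable borel" for \<psi> :: "real \<Rightarrow> real"
    unfolding \<mu>_def using that h by (subst integral_density) (auto simp: mult.commute)
  have "cdf \<mu> b = (LINT y|\<mu>. indicator {..b} y)"
    unfolding cdf_def by (simp add: \<mu>_def)
  also have "\<dots> = (LINT y|lborel. indicator {..b} y * h y)" by (rule i) simp
  finally show "cdf \<mu> b = (LINT y|lborel. indicator {..b} y * h y)" .
qed

context ftl_limit
begin

lemma Linfty_L1_Linfty_limit: "Linfty_L1_Linfty \<rho>"
  unfolding Linfty_L1_Linfty_def
proof (intro conjI exI[of _ "max C 1"] AE_I2 impI)
  show "set_borel_measurable lborel (UNIV \<times> {0..}) \<rho>" unfolding set_borel_measurable_def by measurable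
  fix t :: real
  have z: "\<rho> (y, t) = 0" if "\<not> 0 < t" for y using that unfolding \<rho>_def by simp
  show "integrable lborel (\<lambda>x. \<rho> (x, t))" using section_integrable[of t] z by (cases "0 < t") auto
  show "(LINT x|lborel. \<bar>\<rho> (x, t)\<bar>) \<le> max C 1" using section_mass[of t] \<rho>_bounds z by (cases "0 < t") auto
  show "\<bar>\<rho> (x, t)\<bar> \<le> max C 1" for x using \<rho>_bounds[of "(x, t)"] by auto
qed

lemma weak_solution:
  assumes \<phi>: "test_function \<phi>"
  shows "(LINT z:UNIV \<times> {0<..}|lborel. \<rho> z * partial_t \<phi> z + flux (velocity A \<gamma>) (\<rho> z) * partial_x \<phi> z) = 0"
proof -
  obtain L \<tau> T where box: "0 < L" "0 < \<tau>" "\<tau> < T" "supp_box \<phi> L \<tau> T"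
    using test_function_supp_box[OF \<phi>] by blast
  note bx = supp_box_partial[OF box(4)] and cont = test_function_continuous[OF \<phi>]
  have [measurable]: "partial_x \<phi> \<in> borel_measurable borel" "partial_t \<phi> \<in> borel_measurable borel"
    using cont by (auto intro: borel_measurable_continuous_onI)
  obtain Mx where Mx: "Mx \<ge> 0" "\<And>p. \<bar>partial_x \<phi> p\<bar> \<le> Mx" using supp_box_bounded[OF bx(1) cont(2)] by blast
  obtain Mt where Mt: "Mt \<ge> 0" "\<And>p. \<bar>partial_t \<phi> p\<bar> \<le> Mt" using supp_box_bounded[OF bx(2) cont(3)] by blast
  \<comment> \<open>Two orders of smoothness: \<open>weak_residual\<close> asks for Lipschitz
    constants of the first partial derivatives.\<close>
  have C2: "C_k (Suc 1) \<phi>" using \<phi> unfolding test_function_def by blast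
  obtain Bx where Bx: "Bx \<ge> 0" "\<And>y y' t. \<bar>partial_x \<phi> (y', t) - partial_x \<phi> (y, t)\<bar> \<le> Bx * \<bar>y' - y\<bar>"
    using supp_box_lipschitz[OF bx(1) C_k_partials(3)[OF C2]] by blast
  obtain Bt where Bt: "Bt \<ge> 0" "\<And>y y' t. \<bar>partial_t \<phi> (y', t) - partial_t \<phi> (y, t)\<bar> \<le> Bt * \<bar>y' - y\<bar>"
    using supp_box_lipschitz[OF bx(2) C_k_partials(4)[OF C2]] by blast
  define f where "f w p = w p * partial_t \<phi> p + pow_flux A \<gamma> (w p) * partial_x \<phi> p" for w :: "real \<times> real \<Rightarrow> real" and p
  define K where "K = C * Mt + speed_bound A \<gamma> C * C * Mx"
  have f_out: "f w (y, t) = 0" if "L < \<bar>y\<bar> \<or> t < \<tau> \<or> T < t" for w y t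
  proof -
    have "partial_x \<phi> (y, t) = 0" "partial_t \<phi> (y, t) = 0" using bx that unfolding supp_box_def by blast+
    then show ?thesis unfolding f_def by simp
  qed
  have f_bd: "\<bar>f w p\<bar> \<le> K" if w: "0 \<le> w p" "w p \<le> C" for w p
  proof -
    have "\<bar>pow_flux A \<gamma> (w p)\<bar> \<le> speed_bound A \<gamma> C * C"
      using pow_flux_bound[OF \<gamma>_pos w, of A] mult_left_mono[OF w(2) speed_bound_nonneg[OF \<gamma>_pos, of A C]] by simp
    then have "\<bar>pow_flux A \<gamma> (w p) * partial_x \<phi> p\<bar> \<le> speed_bound A \<gamma> C * C * Mx"
      unfolding abs_mult using Mx speed_bound_nonneg[OF \<gamma>_pos, of A C] C_pos by (intro mult_mono) auto
    moreover have "\<bar>w p * partial_t \<phi> p\<bar> \<le> C * Mt"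
      unfolding abs_mult using Mt w C_pos by (intro mult_mono) auto
    ultimately show ?thesis unfolding f_def K_def by linarith
  qed
  have [measurable]: "f w \<in> borel_measurable borel" if "w \<in> borel_measurable borel" for w
    unfolding f_def using that by measurable
  let ?B = "cbox (- L, \<tau>) (L, T)"
  have "(\<lambda>j. LINT p|lborel. f (u j) p) \<longlonglongrightarrow> (LINT p|lborel. f \<rho> p)"
  proof (rule integral_dominated_convergence[where w = "\<lambda>p. K * indicator ?B p"])
    show "AE p in lborel. (\<lambda>j. f (u j) p) \<longlonglongrightarrow> f \<rho> p"
      using AE_tendsto
    proof eventually_elim
      case (elim p)
      show ?case
      proof (cases "0 < snd p")
        case True
        then show ?thesis unfolding f_def
          using elim u_bounds by (intro tendsto_intros tendsto_pow_flux[OF \<gamma>_pos]) auto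
      next
        case False
        then have "f w p = 0" for w using f_out[of "fst p" "snd p" w] box by simp
        then show ?thesis by simp
      qed
    qed
    show "AE p in lborel. norm (f (u j) p) \<le> K * indicator ?B p" for j
    proof (rule AE_I2)
      fix p
      show "norm (f (u j) p) \<le> K * indicator ?B p"
      proof (cases "p \<in> ?B")
        case True
        then show ?thesis using f_bd[of "u j" p] u_bounds by simp
      next
        case False
        then have "L < \<bar>fst p\<bar> \<or> snd p < \<tau> \<or> T < snd p"
          by (cases p) (auto simp: cbox_Pair_eq)
        then have "f (u j) p = 0" using f_out[of "fst p" "snd p" "u j"] by simp
        then show ?thesis using False by simp
      qed
    qed
    show "integrable lborel (\<lambda>p. K * indicator ?B p)"
      using emeasure_bounded_finite[OF bounded_cbox, of "(- L, \<tau>)" "(L, T)"] by auto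
  qed auto
  moreover have "(\<lambda>j. LINT p|lborel. f (u j) p) \<longlonglongrightarrow> 0"
  proof (rule Lim_null_comparison)
    let ?k = "(Bt + V * Bx) * (x_max g - x_min g + 2 * V * (T + 1)) * (T + 1)"
    show "\<forall>\<^sub>F j in sequentially. norm (LINT p|lborel. f (u j) p) \<le> ?k * (1 / real (r j))"
    proof (intro always_eventually allI)
      fix j
      have "x (r j) (r j) 0 - x (r j) 0 0 = x_max g - x_min g"
        using initial_positions[OF r_ge, of 0 j] initial_positions[OF r_ge, of "r j" j] r_ge[of j] by (simp add: init_pos_def)
      then show "norm (LINT p|lborel. f (u j) p) \<le> ?k * (1 / real (r j))"
        using ftl_scheme.weak_residual[OF sch \<phi> box(4) box(2) _ Bt(2) Bx(2) Bt(1) Bx(1), of j] box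
        unfolding f_def u_def V_def by (simp add: mult_ac)
    qed
    show "(\<lambda>j. ?k * (1 / real (r j))) \<longlonglongrightarrow> 0"
      using tendsto_mult[OF tendsto_const[of ?k] inverse_r_tendsto] by simp
  qed
  ultimately have "(LINT p|lborel. f \<rho> p) = 0" by (rule LIMSEQ_unique)
  moreover have "indicator (UNIV \<times> {0<..}) p *\<^sub>R f \<rho> p = f \<rho> p" for p
    using f_out[of "fst p" "snd p" \<rho>] box by (cases "0 < snd p") (auto simp: indicator_def mem_Times_iff)
  ultimately show ?thesis
    unfolding set_lebesgue_integral_def flux_velocity f_def by (simp only:)
qed

text \<open>By \<open>distribution_initial\<close> the distribution functions converge at every
  point as t tends to 0, hence the measures converge weakly. Along every sequence of positive times
  this applies to the bounded continuous \<psi>; the exceptional set of times is empty.\<close>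

lemma weak_star_trace_limit: "weak_star_trace \<rho> g"
  unfolding weak_star_trace_def
proof (rule bexI[of _ "{}"], intro allI impI)
  fix \<psi> :: "real \<Rightarrow> real"
  assume \<psi>: "continuous_on UNIV \<psi> \<and> compact (closure {x. \<psi> x \<noteq> 0})"
  have [measurable]: "\<psi> \<in> borel_measurable borel" using \<psi> by (intro borel_measurable_continuous_onI) auto
  obtain B where B: "\<And>y. \<bar>\<psi> y\<bar> \<le> B"
  proof -
    have "continuous_on (closure {x. \<psi> x \<noteq> 0}) \<psi>" using \<psi> continuous_on_subset by blast
    then have "compact (\<psi> ` closure {x. \<psi> x \<noteq> 0})" using \<psi> by (intro compact_continuous_image) auto
    from compact_imp_bounded[OF this] obtain B where B: "\<forall>z\<in>\<psi> ` closure {x. \<psi> x \<noteq> 0}. norm z \<le> B"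
      unfolding bounded_iff by blast
    have "\<bar>\<psi> y\<bar> \<le> max B 0" for y
    proof (cases "\<psi> y = 0")
      case False
      then have "y \<in> closure {x. \<psi> x \<noteq> 0}" using closure_subset[of "{x. \<psi> x \<noteq> 0}"] by blast
      then have "norm (\<psi> y) \<le> B" using B by blast
      then show ?thesis by simp
    qed simp
    then show thesis by (rule that)
  qed
  show "((\<lambda>t. LINT x|lborel. \<psi> x * \<rho> (x, t)) \<longlongrightarrow> (LINT x|lborel. \<psi> x * g x)) (at 0 within {0<..} - {})"
    unfolding tendsto_at_iff_sequentially
  proof (intro allI impI)
    fix X :: "nat \<Rightarrow> real"
    assume X: "\<forall>i. X i \<in> ({0<..} - {}) - {0}" and X0: "X \<longlonglongrightarrow> 0"
    have Xp: "0 < X i" for i using X by auto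
    define \<mu> where "\<mu> i = density lborel (\<lambda>y. ennreal (\<rho> (y, X i)))" for i
    define \<mu>0 where "\<mu>0 = density lborel (\<lambda>y. ennreal (g y))"
    have nn: "AE y in lborel. 0 \<le> \<rho> (y, X i)" for i using \<rho>_bounds by simp
    note d = density_distribution[OF section_integrable[OF Xp] nn section_mass[OF Xp], folded \<mu>_def]
    note d0 = density_distribution[OF g_int g_nonneg g_total, folded \<mu>0_def]
    have F_eq: "(LINT y|lborel. indicator {..b} y * g y) = F b" for b
    proof -
      define a where "a = min b (x_min g)"
      have "(LINT y|lborel. indicator {..b} y * g y) = (LINT y|lborel. indicator {a..b} y *\<^sub>R g y)"
        using borel_measurable_integrable[OF g_int]
      proof (intro integral_cong_AE)
        show "AE y in lborel. indicator {..b} y * g y = indicator {a..b} y *\<^sub>R g y"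
          using AE_outside by eventually_elim (auto simp: indicator_def a_def)
      qed auto
      also have "\<dots> = F b - F a"
        using F_diff_set[of a b] unfolding set_lebesgue_integral_def a_def by simp
      finally show ?thesis using F_left[of a] unfolding a_def by simp
    qed
    have "weak_conv_m \<mu> \<mu>0"
      unfolding weak_conv_m_def weak_conv_def
    proof (intro allI impI)
      fix b
      have "(\<lambda>i. cdf (\<mu> i) b - F b) \<longlonglongrightarrow> 0"
      proof (rule Lim_null_comparison)
        show "\<forall>\<^sub>F i in sequentially. norm (cdf (\<mu> i) b - F b) \<le> C * V * X i"
          using distribution_initial[OF Xp] unfolding d(2) by simp
        show "(\<lambda>i. C * V * X i) \<longlonglongrightarrow> 0"
          using tendsto_mult[OF tendsto_const[of "C * V"] X0] by simp
      qed
      then show "(\<lambda>i. cdf (\<mu> i) b) \<longlonglongrightarrow> cdf \<mu>0 b"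
        unfolding d0(2) F_eq by (simp add: LIM_zero_iff)
    qed
    then have "(\<lambda>i. LINT y|\<mu> i. \<psi> y) \<longlonglongrightarrow> (LINT y|\<mu>0. \<psi> y)"
      using \<psi> B by (intro weak_conv_imp_integral_bdd_continuous_conv[OF d(1) d0(1)])
        (auto simp: continuous_on_eq_continuous_at)
    then show "((\<lambda>t. LINT x|lborel. \<psi> x * \<rho> (x, t)) \<circ> X) \<longlonglongrightarrow> (LINT x|lborel. \<psi> x * g x)"
      by (simp add: d(3) d0(3) o_def)
  qed
qed simp

text \<open>The factor 1+\<gamma> of the characteristic speed cancels the one in the discrete
  estimate, which leaves exactly 1/t.\<close>

lemma one_sided_lipschitz_limit:
  assumes t: "0 < t" and y: "y < y'"
    and conv: "convergent (\<lambda>j. u j (y, t))" "convergent (\<lambda>j. u j (y', t))"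
  shows "char_speed A \<gamma> (\<rho> (y', t)) - char_speed A \<gamma> (\<rho> (y, t)) \<le> 1 / t * (y' - y)"
proof -
  let ?c = "1 / ((1 + \<gamma>) * t)"
  have l: "(\<lambda>j. u j (y, t) powr \<gamma>) \<longlonglongrightarrow> \<rho> (y, t) powr \<gamma>" "(\<lambda>j. u j (y', t) powr \<gamma>) \<longlonglongrightarrow> \<rho> (y', t) powr \<gamma>"
    using tendsto_\<rho>[of "(y, t)"] tendsto_\<rho>[of "(y', t)"] conv t \<gamma>_pos u_bounds
    by (intro tendsto_powr2 tendsto_const; force)+
  have "\<rho> (y, t) powr \<gamma> \<le> \<rho> (y', t) powr \<gamma> + ?c * (y' - y) + 0"
    using quasi_mono[OF t y]
    by (intro LIMSEQ_le[OF l(1) tendsto_add[OF tendsto_add[OF l(2) tendsto_const] Oleinik_error_tendsto[OF t]]]) auto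
  then have "(1 + \<gamma>) * (\<rho> (y, t) powr \<gamma> - \<rho> (y', t) powr \<gamma>) \<le> (1 + \<gamma>) * (?c * (y' - y))"
    using \<gamma>_pos by (intro mult_left_mono) auto
  also have "\<dots> = (1 + \<gamma>) * ?c * (y' - y)" by (simp only: mult.assoc)
  also have "(1 + \<gamma>) * ?c = 1 / t" using \<gamma>_pos by simp
  finally show ?thesis unfolding char_speed_def by (simp add: algebra_simps)
qed

text \<open>The inequality already holds on each time section, where the speed is one-sided
  Lipschitz off a countable set; integrating over time gives the distributional form. Division by
  the time is harmless because the support of \<phi> stays away from time 0.\<close>

lemma entropy_limit:
  assumes \<phi>: "test_function \<phi>" and nonneg: "\<And>z. 0 \<le> \<phi> z"
  shows "- (LINT z:UNIV \<times> {0<..}|lborel. 1 / snd z * \<phi> z)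
    \<le> (LINT z:UNIV \<times> {0<..}|lborel. flux_deriv (velocity A \<gamma>) (\<rho> z) * partial_x \<phi> z)"
proof -
  obtain L \<tau> T where box: "0 < L" "0 < \<tau>" "\<tau> < T" "supp_box \<phi> L \<tau> T"
    using test_function_supp_box[OF \<phi>] by blast
  note bx = supp_box_partial(1)[OF box(4)] and cont = test_function_continuous[OF \<phi>]
  have [measurable]: "partial_x \<phi> \<in> borel_measurable borel" "\<phi> \<in> borel_measurable borel"
    using cont by (auto intro: borel_measurable_continuous_onI)
  obtain Mx where Mx: "Mx \<ge> 0" "\<And>p. \<bar>partial_x \<phi> p\<bar> \<le> Mx" using supp_box_bounded[OF bx cont(2)] by blast
  obtain M0 where M0: "M0 \<ge> 0" "\<And>p. \<bar>\<phi> p\<bar> \<le> M0" using supp_box_bounded[OF box(4) cont(1)] by blast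
  have C1: "C_k 1 \<phi>" using \<phi> unfolding test_function_def by blast
  obtain B where B: "\<And>y y' t. \<bar>\<phi> (y', t) - \<phi> (y, t)\<bar> \<le> B * \<bar>y' - y\<bar>"
    using supp_box_lipschitz[OF box(4) C1] by blast
  define a where "a p = char_speed A \<gamma> (\<rho> p)" for p
  have [measurable]: "a \<in> borel_measurable borel" unfolding a_def by measurable
  have a_bd: "\<bar>a p\<bar> \<le> speed_bound A \<gamma> C" for p
    unfolding a_def using char_speed_bound[OF \<gamma>_pos \<rho>_bounds] .
  let ?P = "\<lambda>p. a p * partial_x \<phi> p" and ?Q = "\<lambda>p. 1 / snd p * \<phi> p"
  have P_box: "supp_box ?P L \<tau> T" using bx unfolding supp_box_def by simp
  have Q_box: "supp_box ?Q L \<tau> T" using box(4) unfolding supp_box_def by simp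
  have P_bd: "\<bar>?P p\<bar> \<le> speed_bound A \<gamma> C * Mx" for p
    unfolding abs_mult using a_bd Mx speed_bound_nonneg[OF \<gamma>_pos, of A C] by (intro mult_mono) auto
  have Q_bd: "\<bar>?Q p\<bar> \<le> 1 / \<tau> * M0" for p
  proof (cases "\<tau> \<le> snd p")
    case True
    then have "\<bar>1 / snd p\<bar> \<le> 1 / \<tau>" using box by (simp add: frac_le)
    then show ?thesis unfolding abs_mult using M0 box by (intro mult_mono) auto
  next
    case False
    then have "\<phi> (fst p, snd p) = 0" using box(4) unfolding supp_box_def by (meson not_le)
    then show ?thesis using M0 box by simp
  qed
  have [measurable]: "(\<lambda>p::real \<times> real. snd p) \<in> borel_measurable borel"
    by (intro borel_measurable_continuous_onI continuous_intros)
  have [measurable]: "?P \<in> borel_measurable borel" "?Q \<in> borel_measurable borel" by measurable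
  note Pi = supp_box_integrable[OF _ P_box P_bd] and Qi = supp_box_integrable[OF _ Q_box Q_bd]
  have "0 \<le> (LINT t|lborel. LINT y|lborel. ?P (y, t) + ?Q (y, t))"
  proof (rule integral_nonneg_AE, rule AE_I2)
    fix t :: real
    show "0 \<le> (LINT y|lborel. ?P (y, t) + ?Q (y, t))"
    proof (cases "0 < t")
      case True
      have "- (1 / t * (LINT y|lborel. \<phi> (y, t))) \<le> (LINT y|lborel. a (y, t) * partial_x \<phi> (y, t))"
      proof (rule weak_one_sided_lipschitz)
        show "(\<lambda>y. a (y, t)) \<in> borel_measurable borel" unfolding a_def by measurable
        show "countable {y. \<not> convergent (\<lambda>j. u j (y, t))}" by (rule countable_nonconvergent_u[OF True])
        show "a (y', t) - a (y, t) \<le> 1 / t * (y' - y)"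
          if "y < y'" "y \<notin> {y. \<not> convergent (\<lambda>j. u j (y, t))}" "y' \<notin> {y. \<not> convergent (\<lambda>j. u j (y, t))}" for y y'
          unfolding a_def using that by (intro one_sided_lipschitz_limit[OF True]) auto
        show "((\<lambda>y. \<phi> (y, t)) has_real_derivative partial_x \<phi> (y, t)) (at y)" for y
          using C_k_partials(1)[of 0 \<phi>] C1 by simp
        show "L < \<bar>y\<bar> \<Longrightarrow> \<phi> (y, t) = 0" for y using box(4) unfolding supp_box_def by blast
      qed (use a_bd nonneg B in auto)
      moreover have "(LINT y|lborel. ?P (y, t) + ?Q (y, t))
          = (LINT y|lborel. a (y, t) * partial_x \<phi> (y, t)) + 1 / t * (LINT y|lborel. \<phi> (y, t))"
        using Pi(3)[of t] Qi(3)[of t] by simp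
      ultimately show ?thesis by linarith
    next
      case False
      then have "?P (y, t) + ?Q (y, t) = 0" for y using P_box Q_box box unfolding supp_box_def by simp
      then show ?thesis by simp
    qed
  qed
  also have "\<dots> = (LINT p|lborel. ?P p + ?Q p)"
    using Pi(2) Qi(2) by (intro plane_integral(1)[symmetric] Bochner_Integration.integrable_add) auto
  also have "\<dots> = (LINT p|lborel. ?P p) + (LINT p|lborel. ?Q p)"
    using Pi(1) Qi(1) by (intro Bochner_Integration.integral_add) auto
  finally have "- (LINT p|lborel. ?Q p) \<le> (LINT p|lborel. ?P p)" by simp
  moreover have "indicator (UNIV \<times> {0<..}) p *\<^sub>R ?Q p = ?Q p" for p
    using Q_box box unfolding supp_box_def by (cases p; cases "0 < snd p") (auto simp: indicator_def)
  moreover have "indicator (UNIV \<times> {0<..}) p *\<^sub>R (flux_deriv (velocity A \<gamma>) (\<rho> p) * partial_x \<phi> p) = ?P p" for p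
    using P_box box flux_deriv_velocity[OF \<gamma>_pos \<rho>_bounds(1)[of p]] unfolding supp_box_def a_def
    by (cases p; cases "0 < snd p") (auto simp: indicator_def)
  ultimately show ?thesis unfolding set_lebesgue_integral_def by (simp only:)
qed

lemma classical_entropy_solution_limit: "classical_entropy_solution (velocity A \<gamma>) g \<rho>"
  unfolding classical_entropy_solution_def
  by (intro conjI allI impI Linfty_L1_Linfty_limit weak_solution weak_star_trace_limit entropy_limit)
    (use \<rho>_bounds in auto)

section \<open>Convergence on the closed half-plane\<close>

lemma converges_ae_limit: "converges_ae (\<lambda>k. ftl_density (r k) (x (r k))) \<rho>"
  unfolding converges_ae_def using AE_tendsto AE_snd_neq_0
proof eventually_elim
  case (elim p)
  then show ?case by (auto simp: mem_Times_iff u_eq)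
qed

text \<open>Dominated convergence with the uniform bound C on K. The set K may meet the initial
  line, where nothing is known about convergence, but that line is null.\<close>

lemma converges_L1_loc_limit: "converges_L1_loc (\<lambda>k. ftl_density (r k) (x (r k))) \<rho>"
  unfolding converges_L1_loc_def
proof (intro allI impI)
  fix K :: "(real \<times> real) set"
  assume K: "compact K \<and> K \<subseteq> UNIV \<times> {0..}"
  have K_meas [measurable]: "K \<in> sets borel" using K by (simp add: borel_compact)
  have K_fin: "emeasure lborel K < \<infinity>" using K by (intro emeasure_bounded_finite compact_imp_bounded) auto
  have eq: "indicator K p *\<^sub>R ftl_density (r k) (x (r k)) p = indicator K p *\<^sub>R u k p" for k p
    using K u_eq[of p k] by (cases "p \<in> K") (auto simp: mem_Times_iff)
  have int: "integrable lborel (\<lambda>p. indicator K p *\<^sub>R h p)"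
    if "h \<in> borel_measurable borel" "\<And>p. 0 \<le> h p" "\<And>p. h p \<le> C" for h :: "real \<times> real \<Rightarrow> real"
    using that K_fin C_pos by (intro integrableI_bounded_set[where A = K and B = C]) (auto simp: indicator_def)
  have w: "integrable lborel (\<lambda>p. C * indicator K p)" using K_fin by auto
  have "(\<lambda>k. LINT p|lborel. indicator K p * \<bar>u k p - \<rho> p\<bar>) \<longlonglongrightarrow> (LINT p|(lborel :: (real \<times> real) measure). 0)"
  proof (rule integral_dominated_convergence[OF _ _ w])
    show "AE p in lborel. (\<lambda>k. indicator K p * \<bar>u k p - \<rho> p\<bar>) \<longlonglongrightarrow> 0"
      using AE_tendsto AE_snd_neq_0
    proof eventually_elim
      case (elim p)
      show ?case
      proof (cases "p \<in> K")
        case True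
        then have "0 < snd p" using K elim by (force simp: mem_Times_iff)
        then have "(\<lambda>k. \<bar>u k p - \<rho> p\<bar>) \<longlonglongrightarrow> \<bar>\<rho> p - \<rho> p\<bar>" using elim by (intro tendsto_intros) auto
        then show ?thesis using True by simp
      qed simp
    qed
    show "AE p in lborel. norm (indicator K p * \<bar>u k p - \<rho> p\<bar>) \<le> C * indicator K p" for k
    proof (rule AE_I2)
      fix p
      have "\<bar>u k p - \<rho> p\<bar> \<le> C" using u_bounds[of k p] \<rho>_bounds[of p] by linarith
      then show "norm (indicator K p * \<bar>u k p - \<rho> p\<bar>) \<le> C * indicator K p" by (simp add: indicator_def)
    qed
  qed auto
  moreover have "(LINT z:K|lborel. \<bar>ftl_density (r k) (x (r k)) z - \<rho> z\<bar>) = (LINT p|lborel. indicator K p * \<bar>u k p - \<rho> p\<bar>)" for k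
    unfolding set_lebesgue_integral_def
  proof (rule Bochner_Integration.integral_cong)
    show "indicator K p *\<^sub>R \<bar>ftl_density (r k) (x (r k)) p - \<rho> p\<bar> = indicator K p * \<bar>u k p - \<rho> p\<bar>" for p
      using K u_eq[of p k] by (cases "p \<in> K") (auto simp: mem_Times_iff)
  qed simp
  ultimately show "(\<forall>k. set_integrable lborel K (ftl_density (r k) (x (r k)))) \<and> set_integrable lborel K \<rho> \<and>
      (\<lambda>k. LINT z:K|lborel. \<bar>ftl_density (r k) (x (r k)) z - \<rho> z\<bar>) \<longlonglongrightarrow> 0"
    unfolding set_integrable_def eq
    using int[OF u_measurable u_bounds] int[OF \<rho>_measurable \<rho>_bounds] by simp
qed

end

theorem theorem2p4:
  fixes rho0 :: "real \<Rightarrow> real" and A \<gamma> :: real and x :: "nat \<Rightarrow> nat \<Rightarrow> real \<Rightarrow> real"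
  assumes "integrable lborel rho0"
    and "\<exists>C. AE y in lborel. \<bar>rho0 y\<bar> \<le> C"
    and "AE y in lborel. rho0 y \<ge> 0"
    and "compact (ess_support rho0)"
    and "(LINT y|lborel. \<bar>rho0 y\<bar>) = 1"
    and "A > 0" and "\<gamma> > 0"
    and "\<And>n. n \<ge> 1 \<Longrightarrow> ftl_solution (velocity A \<gamma>) rho0 n (x n)"
  shows "\<exists>\<rho>. classical_entropy_solution (velocity A \<gamma>) rho0 \<rho> \<and>
      (\<forall>\<rho>'. classical_entropy_solution (velocity A \<gamma>) rho0 \<rho>' \<longrightarrow>
         (AE z in lborel. z \<in> UNIV \<times> {0..} \<longrightarrow> \<rho>' z = \<rho> z)) \<and>
      (\<exists>r. strict_mono r \<and> r 0 \<ge> 1 \<and>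
         converges_ae (\<lambda>k. ftl_density (r k) (x (r k))) \<rho> \<and>
         converges_L1_loc (\<lambda>k. ftl_density (r k) (x (r k))) \<rho>)"
proof -
  obtain C where "AE y in lborel. \<bar>rho0 y\<bar> \<le> C" using assms(2) ..
  \<comment> \<open>The scheme divides by the density bound, so the bound is made positive.\<close>
  then have C: "AE y in lborel. \<bar>rho0 y\<bar> \<le> max C 1" by eventually_elim simp
  interpret ftl_family rho0 "max C 1" A \<gamma> x
    by unfold_locales (fact assms C | simp)+
  obtain r where r: "strict_mono r" "r 0 \<ge> 1"
      "\<And>t y. t \<ge> 0 \<Longrightarrow> convergent (\<lambda>j. ftl_scheme.mass (r j) (x (r j)) t y)"
    using convergent_mass_subsequence by blast
  interpret ftl_limit rho0 "max C 1" A \<gamma> x r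
    by unfold_locales (fact r)+
  show ?thesis
  proof (intro exI[of _ \<rho>] exI[of _ r] conjI allI impI)
    show "AE z in lborel. z \<in> UNIV \<times> {0..} \<longrightarrow> \<rho>' z = \<rho> z"
      if "classical_entropy_solution (velocity A \<gamma>) rho0 \<rho>'" for \<rho>'
      by (rule classical_entropy_solution_unique[OF \<open>\<gamma> > 0\<close> classical_entropy_solution_limit that])
  qed (fact classical_entropy_solution_limit r(1,2) converges_ae_limit converges_L1_loc_limit)+
qed

end
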